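(* Let $E$ be a Banach lattice with ideal center $Z(E)$, let $i:Z(E)\to L(E)$ be the natural embedding, and let $i^{*}:Z(E)''\to L(E')$ be its Arens extension. Then $E$ has a topologically full center if and only if $i^{*}(Z(E)'')=Z(E')$. When this holds, $Z(E')$ can be identified, both as an algebra and as a Banach lattice, with a band in $Z(E)''$.
   Context: Scalars may be real or complex; the result is asserted in either case. $L(E)$ denotes the algebra of bounded linear operators on $E$, and $E'$ is the Banach dual of $E$ (a Banach lattice). Ideal center: $Z(E)$ is the set of all $T\in L(E)$ for which there is $M>0$ with $|T(x)|\le Mx$ for every $x\in E_+$; $Z(E')$ is defined in the same way for the Banach lattice $E'$. With the operator norm, operator composition and operator order, $Z(E)$ is isomorphic, as a Banach algebra and as a Banach lattice, to $C(K)$ for some compact Hausdorff space $K$. $E$ has a topologically full center if, for each $x\in E_+$, the norm closure of $Z(E)x=\{Tx:T\in Z(E)\}$ is an order ideal in $E$ (equivalently, it is the closed ideal generated by $x$). Arens extension: for $x\in E$, $x'\in E'$ define $\mu_{xx'}\in Z(E)'$ by $\mu_{xx'}(T)=x'(Tx)$ for $T\in Z(E)$. For $a\in Z(E)''$ (the Banach bidual of $Z(E)$) and $x'\in E'$ define $i^{*}(a)(x')\in E'$ by $\big(i^{*}(a)(x')\big)(x)=a(\mu_{xx'})$ for $x\in E$. The bidual $Z(E)''$ carries its bidual Banach lattice structure and the Arens product; with these it is isomorphic to $C(S)$ for a hyperstonian compact space $S$, and $i^{*}$ is a bounded unital algebra homomorphism. *)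

theory Defs
  imports "HOL-Analysis.Analysis" "HOL-Library.Lattice_Algebras" "HOL-Library.Function_Algebras"
begin

section \<open>Normed ordered spaces over the real or the complex field\<close>

text \<open>
  Duals, algebras of operators and ideal centers over the field \<^typ>\<open>real\<close> or \<^typ>\<open>complex\<close> are
  treated uniformly as spaces with an explicit carrier. Addition is that of the underlying type
  (for functions, the pointwise one); the other operations are part of the structure. The order
  is given by its positive cone.
\<close>

record ('k, 'v) ospace =
  vecs :: "'v set"
  smul :: "'k \<Rightarrow> 'v \<Rightarrow> 'v"
  vnorm :: "'v \<Rightarrow> real"
  cone :: "'v set"

definition le :: "('k, 'v::ab_group_add) ospace \<Rightarrow> 'v \<Rightarrow> 'v \<Rightarrow> bool" where
  "le V x y \<longleftrightarrow> y - x \<in> cone V"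

definition is_lub :: "('k, 'v::ab_group_add) ospace \<Rightarrow> 'v set \<Rightarrow> 'v \<Rightarrow> bool" where
  "is_lub V A s \<longleftrightarrow> s \<in> vecs V \<and> (\<forall>a\<in>A. le V a s) \<and>
     (\<forall>w\<in>vecs V. (\<forall>a\<in>A. le V a w) \<longrightarrow> le V s w)"

definition real_vecs :: "('k, 'v::ab_group_add) ospace \<Rightarrow> 'v set" where
  "real_vecs V = {x - y |x y. x \<in> cone V \<and> y \<in> cone V}"

text \<open>
  The scalars whose square lies in \<open>\<real>\<^sub>\<le>\<^sub>0\<close> are the purely imaginary ones; over the real field
  only 0 is of this kind, and every real vector is then its own real part.
\<close>

definition is_Re :: "('k::real_normed_field, 'v::ab_group_add) ospace \<Rightarrow> 'v \<Rightarrow> 'v \<Rightarrow> bool" where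
  "is_Re V z x \<longleftrightarrow> x \<in> real_vecs V \<and>
     (\<exists>c. \<exists>y\<in>real_vecs V. c\<^sup>2 \<in> \<real>\<^sub>\<le>\<^sub>0 \<and> z = x + smul V c y)"

text \<open>
  The modulus is \<open>|z| = sup {Re (u z) | |u| = 1}\<close>, which is \<open>sup {z, -z}\<close> over the real field.
\<close>

definition modulus :: "('k::real_normed_field, 'v::ab_group_add) ospace \<Rightarrow> 'v \<Rightarrow> 'v" where
  "modulus V z = (THE m. is_lub V {x. \<exists>u. norm u = 1 \<and> is_Re V (smul V u z) x} m)"

definition norm_closure :: "('k, 'v::ab_group_add) ospace \<Rightarrow> 'v set \<Rightarrow> 'v set" where
  "norm_closure V A = {y \<in> vecs V. \<forall>e>0. \<exists>z\<in>A. vnorm V (y - z) < e}"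

definition is_subspace :: "('k, 'v::ab_group_add) ospace \<Rightarrow> 'v set \<Rightarrow> bool" where
  "is_subspace V I \<longleftrightarrow> I \<subseteq> vecs V \<and> 0 \<in> I \<and> (\<forall>x\<in>I. \<forall>y\<in>I. x + y \<in> I) \<and>
     (\<forall>c. \<forall>x\<in>I. smul V c x \<in> I)"

definition order_ideal :: "('k::real_normed_field, 'v::ab_group_add) ospace \<Rightarrow> 'v set \<Rightarrow> bool" where
  "order_ideal V I \<longleftrightarrow> is_subspace V I \<and>
     (\<forall>x\<in>vecs V. \<forall>y\<in>I. le V (modulus V x) (modulus V y) \<longrightarrow> x \<in> I)"

definition band :: "('k::real_normed_field, 'v::ab_group_add) ospace \<Rightarrow> 'v set \<Rightarrow> bool" where
  "band V B \<longleftrightarrow> order_ideal V B \<and>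
     (\<forall>A s. A \<subseteq> B \<inter> real_vecs V \<longrightarrow> is_lub V A s \<longrightarrow> s \<in> B)"


section \<open>Bounded operators and duals\<close>

text \<open>Operators are extended by 0 outside the carrier of their domain.\<close>

definition linear_map ::
    "('k, 'v::ab_group_add) ospace \<Rightarrow> ('k, 'w::ab_group_add) ospace \<Rightarrow> ('v \<Rightarrow> 'w) \<Rightarrow> bool" where
  "linear_map V W T \<longleftrightarrow> (\<forall>x\<in>vecs V. T x \<in> vecs W) \<and>
     (\<forall>x\<in>vecs V. \<forall>y\<in>vecs V. T (x + y) = T x + T y) \<and>
     (\<forall>c. \<forall>x\<in>vecs V. T (smul V c x) = smul W c (T x))"

definition bounded_maps ::
    "('k, 'v::ab_group_add) ospace \<Rightarrow> ('k, 'w::ab_group_add) ospace \<Rightarrow> ('v \<Rightarrow> 'w) set" where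
  "bounded_maps V W = {T. linear_map V W T \<and> (\<forall>x. x \<notin> vecs V \<longrightarrow> T x = 0) \<and>
     (\<exists>C. \<forall>x\<in>vecs V. vnorm W (T x) \<le> C * vnorm V x)}"

definition operators ::
    "('k, 'v::ab_group_add) ospace \<Rightarrow> ('k, 'w::ab_group_add) ospace \<Rightarrow> ('k, 'v \<Rightarrow> 'w) ospace" where
  "operators V W =
    \<lparr>vecs = bounded_maps V W,
     smul = (\<lambda>c T x. smul W c (T x)),
     vnorm = (\<lambda>T. Sup {vnorm W (T x) |x. x \<in> vecs V \<and> vnorm V x \<le> 1}),
     cone = {T \<in> bounded_maps V W. \<forall>x\<in>cone V. T x \<in> cone W}\<rparr>"

definition scalars :: "('k::real_normed_field, 'k) ospace" where
  "scalars = \<lparr>vecs = UNIV, smul = (*), vnorm = norm, cone = \<real>\<^sub>\<ge>\<^sub>0\<rparr>"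

definition dual :: "('k::real_normed_field, 'v::ab_group_add) ospace \<Rightarrow> ('k, 'v \<Rightarrow> 'k) ospace" where
  "dual V = operators V scalars"


section \<open>The ideal center and its bidual\<close>

definition center :: "('k::real_normed_field, 'v::ab_group_add) ospace \<Rightarrow> ('k, 'v \<Rightarrow> 'v) ospace" where
  "center V = (let Z = {T \<in> bounded_maps V V.
        \<exists>M>0. \<forall>x\<in>cone V. le V (modulus V (T x)) (smul V (of_real M) x)}
     in (operators V V)\<lparr>vecs := Z, cone := Z \<inter> cone (operators V V)\<rparr>)"

definition topologically_full_center ::
    "('k::real_normed_field, 'v::ab_group_add) ospace \<Rightarrow> bool" where
  "topologically_full_center V \<longleftrightarrow>
     (\<forall>x\<in>cone V. order_ideal V (norm_closure V {T x |T. T \<in> vecs (center V)}))"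

abbreviation center_bidual ::
    "('k::real_normed_field, 'v::ab_group_add) ospace \<Rightarrow> ('k, (('v \<Rightarrow> 'v) \<Rightarrow> 'k) \<Rightarrow> 'k) ospace" where
  "center_bidual V \<equiv> dual (dual (center V))"

definition restrict0 :: "'v set \<Rightarrow> ('v \<Rightarrow> 'w::zero) \<Rightarrow> 'v \<Rightarrow> 'w" where
  "restrict0 A f = (\<lambda>x. if x \<in> A then f x else 0)"

text \<open>\<open>mu_functional V x f\<close> is the functional \<open>T \<mapsto> f (T x)\<close> on the center.\<close>

definition mu_functional ::
    "('k::real_normed_field, 'v::ab_group_add) ospace \<Rightarrow> 'v \<Rightarrow> ('v \<Rightarrow> 'k) \<Rightarrow> ('v \<Rightarrow> 'v) \<Rightarrow> 'k" where
  "mu_functional V x f = restrict0 (vecs (center V)) (\<lambda>T. f (T x))"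

definition arens_extension ::
    "('k::real_normed_field, 'v::ab_group_add) ospace \<Rightarrow> ((('v \<Rightarrow> 'v) \<Rightarrow> 'k) \<Rightarrow> 'k) \<Rightarrow>
     ('v \<Rightarrow> 'k) \<Rightarrow> ('v \<Rightarrow> 'k)" where
  "arens_extension V a =
     restrict0 (vecs (dual V)) (\<lambda>f. restrict0 (vecs V) (\<lambda>x. a (mu_functional V x f)))"

text \<open>
  For an algebra \<open>A\<close> of operators: \<open>(a b)(\<phi>) = a (S \<mapsto> b (T \<mapsto> \<phi> (S \<circ> T)))\<close>.
\<close>

definition arens_product ::
    "('k::real_normed_field, 'v::ab_group_add \<Rightarrow> 'v) ospace \<Rightarrow> ((('v \<Rightarrow> 'v) \<Rightarrow> 'k) \<Rightarrow> 'k) \<Rightarrow>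
     ((('v \<Rightarrow> 'v) \<Rightarrow> 'k) \<Rightarrow> 'k) \<Rightarrow> (('v \<Rightarrow> 'v) \<Rightarrow> 'k) \<Rightarrow> 'k" where
  "arens_product A a b = restrict0 (vecs (dual A)) (\<lambda>\<phi>.
     a (restrict0 (vecs A) (\<lambda>S. b (restrict0 (vecs A) (\<lambda>T. \<phi> (S \<circ> T))))))"

text \<open>
  \<open>\<Phi>\<close> identifies \<open>V\<close> with the subspace \<open>B\<close> of \<open>W\<close>, isometrically and as an ordered algebra;
  the last two arguments are the products of \<open>V\<close> and \<open>W\<close>.
\<close>

definition banach_lattice_algebra_iso ::
    "('k, 'v::ab_group_add) ospace \<Rightarrow> ('k, 'w::ab_group_add) ospace \<Rightarrow> 'w set \<Rightarrow>
     ('v \<Rightarrow> 'v \<Rightarrow> 'v) \<Rightarrow> ('w \<Rightarrow> 'w \<Rightarrow> 'w) \<Rightarrow> ('v \<Rightarrow> 'w) \<Rightarrow> bool" where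
  "banach_lattice_algebra_iso V W B multV multW \<Phi> \<longleftrightarrow>
     bij_betw \<Phi> (vecs V) B \<and> linear_map V W \<Phi> \<and>
     (\<forall>S\<in>vecs V. \<forall>T\<in>vecs V. \<Phi> (multV S T) = multW (\<Phi> S) (\<Phi> T)) \<and>
     (\<forall>S\<in>vecs V. \<forall>T\<in>vecs V. le W (\<Phi> S) (\<Phi> T) \<longleftrightarrow> le V S T) \<and>
     (\<forall>S\<in>vecs V. vnorm W (\<Phi> S) = vnorm V S)"


section \<open>Real and complex Banach lattices\<close>

class banach_lattice = banach + ordered_real_vector + lattice_ab_group_add_abs +
  assumes norm_mono_abs: "\<bar>x\<bar> \<le> \<bar>y\<bar> \<Longrightarrow> norm x \<le> norm y"

definition real_lattice :: "(real, 'a::banach_lattice) ospace" where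
  "real_lattice = \<lparr>vecs = UNIV, smul = (*\<^sub>R), vnorm = norm, cone = {x. 0 \<le> x}\<rparr>"

text \<open>
  A complex Banach lattice is the complexification \<open>E + i E\<close> of a real one \<open>E\<close>, with \<open>x + i y\<close>
  represented by the pair \<open>(x, y)\<close> and normed by \<open>\<parallel>|x + i y|\<parallel>\<close>. The norm of the product type is
  not used.
\<close>

definition pair_modulus :: "'a::banach_lattice \<Rightarrow> 'a \<Rightarrow> 'a" where
  "pair_modulus x y = (THE m. \<forall>w. m \<le> w \<longleftrightarrow> (\<forall>t::real. cos t *\<^sub>R x + sin t *\<^sub>R y \<le> w))"

definition complex_lattice :: "(complex, 'a::banach_lattice \<times> 'a) ospace" where
  "complex_lattice =
    \<lparr>vecs = UNIV,
     smul = (\<lambda>c (x, y). (Re c *\<^sub>R x - Im c *\<^sub>R y, Im c *\<^sub>R x + Re c *\<^sub>R y)),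
     vnorm = (\<lambda>(x, y). norm (pair_modulus x y)),
     cone = {(x, 0) |x. 0 \<le> x}\<rparr>"


section \<open>Agreement with the library notions\<close>

instance real :: banach_lattice
  by standard simp

lemma real_lattice_simps [simp]:
  "vecs real_lattice = UNIV" "smul real_lattice = (*\<^sub>R)" "vnorm real_lattice = norm"
  "cone real_lattice = {x. 0 \<le> x}"
  by (simp_all add: real_lattice_def)

lemma bounded_maps_real:
  "bounded_maps real_lattice (real_lattice :: (real, 'a::banach_lattice) ospace) = {T. bounded_linear T}"
  unfolding bounded_maps_def linear_map_def real_lattice_def
  apply (auto simp: bounded_linear_def bounded_linear_axioms_def linear_iff mult.commute)
  done

lemma op_norm_real:
  fixes T :: "'a::banach_lattice \<Rightarrow> 'a"
  assumes "bounded_linear T"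
  shows "vnorm (operators real_lattice real_lattice) T = onorm T"
proof -
  let ?S = "{norm (T x) |x. norm x \<le> 1}"
  have "Sup ?S = onorm T"
  proof (rule antisym)
    have le: "y \<le> onorm T" if y: "y \<in> ?S" for y
    proof -
      obtain x where x: "y = norm (T x)" "norm x \<le> 1" using y by auto
      have "norm (T x) \<le> onorm T * norm x" using onorm[OF assms] .
      also have "\<dots> \<le> onorm T * 1"
        using x onorm_pos_le[OF assms] by (intro mult_left_mono) auto
      finally show ?thesis using x by simp
    qed
    then have bdd: "bdd_above ?S" by (rule bdd_aboveI)
    show "Sup ?S \<le> onorm T"
      by (rule cSup_least[OF _ le]) (auto intro!: exI[of _ 0])
    show "onorm T \<le> Sup ?S"
    proof (rule onorm_bound)
      show "0 \<le> Sup ?S"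
        by (rule cSup_upper2[OF _ _ bdd, of "norm (T 0)"]) (auto intro!: exI[of _ 0])
      fix x show "norm (T x) \<le> Sup ?S * norm x"
      proof (cases "x = 0")
        case True then show ?thesis using assms by (simp add: linear_simps)
      next
        case False
        have "norm (T (x /\<^sub>R norm x)) \<le> Sup ?S"
          by (rule cSup_upper[OF _ bdd]) (use False in \<open>auto intro!: exI[of _ "x /\<^sub>R norm x"]\<close>)
        then show ?thesis using assms False by (simp add: linear_simps field_simps)
      qed
    qed
  qed
  then show ?thesis by (simp add: operators_def real_lattice_def)
qed

lemma real_vecs_real [simp]: "real_vecs real_lattice = (UNIV :: 'a::banach_lattice set)"
proof -
  have "z \<in> real_vecs real_lattice" for z :: 'a
    unfolding real_vecs_def real_lattice_simps
    by (rule CollectI, rule exI[of _ "sup z 0"], rule exI[of _ "sup z 0 - z"]) simp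
  then show ?thesis by auto
qed

lemma modulus_real: "modulus real_lattice z = \<bar>z :: 'a::banach_lattice\<bar>"
proof -
  have c: "(c::real)\<^sup>2 \<in> \<real>\<^sub>\<le>\<^sub>0 \<longleftrightarrow> c = 0" for c
  proof -
    have "c\<^sup>2 \<in> \<real>\<^sub>\<le>\<^sub>0 \<longleftrightarrow> c\<^sup>2 \<le> 0" using nonpos_Reals_of_real_iff[of "c\<^sup>2", where ?'a = real] by simp
    then show ?thesis by simp
  qed
  have R: "is_Re real_lattice z x \<longleftrightarrow> z = x" for z x :: 'a
    by (simp add: is_Re_def c)
  have u: "norm u = 1 \<longleftrightarrow> u = 1 \<or> u = - 1" for u :: real
    unfolding real_norm_def by linarith
  have S: "{x. \<exists>u. norm u = 1 \<and> is_Re real_lattice (smul real_lattice u z) x} = {z, - z}"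
    unfolding R u real_lattice_simps
  proof (intro set_eqI iffI)
    fix x assume "x \<in> {z, - z}"
    then have "1 *\<^sub>R z = x \<or> (- 1) *\<^sub>R z = x" by auto
    then show "x \<in> {x. \<exists>u. (u = 1 \<or> u = - 1) \<and> u *\<^sub>R z = x}" by blast
  qed auto
  show ?thesis
    unfolding modulus_def S
  proof (rule the_equality)
    show *: "is_lub real_lattice {z, - z} \<bar>z\<bar>"
      unfolding is_lub_def le_def real_lattice_simps mem_Collect_eq diff_ge_0_iff_ge
      using abs_ge_self[of z] abs_ge_minus_self[of z] abs_leI[of z] by blast
    fix m assume "is_lub real_lattice {z, - z} m"
    with * have "m \<le> \<bar>z\<bar>" "\<bar>z\<bar> \<le> m" by (simp_all add: is_lub_def le_def)
    then show "m = \<bar>z\<bar>" by (rule order_antisym)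
  qed
qed

lemma nonneg_limit:
  fixes X :: "nat \<Rightarrow> 'a::banach_lattice"
  assumes "X \<longlonglongrightarrow> m" "\<And>n. 0 \<le> X n"
  shows "0 \<le> m"
proof -
  define p where "p = sup (- m) 0"
  have p: "0 \<le> p" "- m \<le> p" by (auto simp: p_def)
  have "norm p \<le> norm (X n - m)" for n
  proof (rule norm_mono_abs)
    have "p \<le> \<bar>X n - m\<bar>" unfolding p_def
      using assms(2)[of n] abs_ge_self[of "X n - m"]
      by (auto intro: order_trans[OF _ abs_ge_self[of "X n - m"]])
    then show "\<bar>p\<bar> \<le> \<bar>X n - m\<bar>" using p by simp
  qed
  moreover have "(\<lambda>n. norm (X n - m)) \<longlonglongrightarrow> 0"
    using assms(1) tendsto_norm_zero LIM_zero by blast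
  ultimately have "norm p \<le> 0"
    by (intro LIMSEQ_le_const) auto
  then show ?thesis using p by simp
qed

lemma trig_lipschitz: "\<bar>cos s - cos t\<bar> \<le> \<bar>s - t\<bar>" "\<bar>sin s - sin t\<bar> \<le> \<bar>s - (t::real)\<bar>"
proof -
  have a: "\<bar>sin ((s-t)/2)\<bar> \<le> \<bar>s-t\<bar>/2" using abs_sin_le_one abs_sin_x_le_abs_x[of "(s-t)/2"] by simp
  have b: "\<bar>sin ((t-s)/2)\<bar> \<le> \<bar>s-t\<bar>/2" using abs_sin_x_le_abs_x[of "(t-s)/2"] by simp
  have "\<bar>cos s - cos t\<bar> = 2 * (\<bar>sin ((s+t)/2)\<bar> * \<bar>sin ((t-s)/2)\<bar>)"
    by (simp add: cos_diff_cos abs_mult)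
  also have "\<dots> \<le> 2 * (1 * (\<bar>s-t\<bar>/2))" by (intro mult_left_mono mult_mono b) auto
  finally show "\<bar>cos s - cos t\<bar> \<le> \<bar>s - t\<bar>" by simp
  have "\<bar>sin s - sin t\<bar> = 2 * (\<bar>sin ((s-t)/2)\<bar> * \<bar>cos ((s+t)/2)\<bar>)"
    by (simp add: sin_diff_sin abs_mult)
  also have "\<dots> \<le> 2 * ((\<bar>s-t\<bar>/2) * 1)" by (intro mult_left_mono mult_mono a) auto
  finally show "\<bar>sin s - sin t\<bar> \<le> \<bar>s - t\<bar>" by simp
qed

lemma pair_modulus_ex:
  fixes x y :: "'a::banach_lattice"
  shows "\<exists>m. \<forall>w. m \<le> w \<longleftrightarrow> (\<forall>t::real. cos t *\<^sub>R x + sin t *\<^sub>R y \<le> w)"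
proof -
  define f where "f t = cos t *\<^sub>R x + sin t *\<^sub>R y" for t :: real
  define u where "u = \<bar>x\<bar> + \<bar>y\<bar>"
  have u0: "0 \<le> u" by (simp add: u_def)
  have sc: "a *\<^sub>R z \<le> b *\<^sub>R \<bar>z\<bar>" if "\<bar>a\<bar> \<le> b" for a b :: real and z :: 'a
  proof -
    have "a *\<^sub>R z \<le> \<bar>a\<bar> *\<^sub>R \<bar>z\<bar>"
    proof (cases "0 \<le> a")
      case True then show ?thesis by (auto intro: scaleR_left_mono abs_ge_self)
    next
      case False
      then have "(-a) *\<^sub>R (-z) \<le> (-a) *\<^sub>R \<bar>z\<bar>" by (intro scaleR_left_mono) (auto simp: abs_ge_minus_self)
      with False show ?thesis by simp
    qed
    also have "\<dots> \<le> b *\<^sub>R \<bar>z\<bar>" using that by (intro scaleR_right_mono) auto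
    finally show ?thesis .
  qed
  have lip: "f s \<le> f t + d *\<^sub>R u" if "\<bar>s - t\<bar> \<le> d" for s t d
  proof -
    have "f s - f t = (cos s - cos t) *\<^sub>R x + (sin s - sin t) *\<^sub>R y"
      by (simp add: f_def algebra_simps)
    also have "\<dots> \<le> d *\<^sub>R \<bar>x\<bar> + d *\<^sub>R \<bar>y\<bar>"
      using trig_lipschitz[of s t] that by (intro add_mono sc) linarith+
    finally show ?thesis by (simp add: u_def algebra_simps)
  qed
  define h where "h n = 2 * pi / real (Suc n)" for n
  have h0: "h n > 0" for n by (simp add: h_def)
  define G where "G n = f ` (\<lambda>j. real j * h n) ` {..Suc n}" for n
  have G: "finite (G n)" "G n \<noteq> {}" for n by (auto simp: G_def)
  define S where "S n = Sup_fin (G n)" for n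
  have S_le: "S n \<le> w" if "\<And>t. f t \<le> w" for n w
    unfolding S_def using G that by (intro Sup_fin.boundedI) (auto simp: G_def)
  have f_le: "f t \<le> S n + h n *\<^sub>R u" for t n
  proof -
    define t' where "t' = t - 2 * pi * of_int \<lfloor>t / (2*pi)\<rfloor>"
    have t': "0 \<le> t'" "t' < 2 * pi"
      unfolding t'_def using floor_divide_lower[of "2*pi" t] floor_divide_upper[of "2*pi" t]
      by (auto simp: algebra_simps)
    have ft: "f t = f t'"
      unfolding f_def t'_def 
      by (simp only: cos_diff sin_diff cos_int_2pin sin_int_2pin) simp
    define j where "j = nat \<lfloor>t' / h n\<rfloor>"
    have j: "real j * h n \<le> t'" "t' < (real j + 1) * h n"
    proof -
      have "real j = of_int \<lfloor>t' / h n\<rfloor>" using t' h0[of n] by (simp add: j_def)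
      then show "real j * h n \<le> t'" "t' < (real j + 1) * h n"
        using floor_divide_lower[OF h0[of n], of t'] floor_divide_upper[OF h0[of n], of t'] by auto
    qed
    have "real j * h n < 2 * pi" using j t' by linarith
    then have "(2 * pi) * real j < (2 * pi) * real (Suc n)" by (simp add: h_def field_simps)
    then have "real j < real (Suc n)" by (rule mult_left_less_imp_less) simp
    then have "j \<le> Suc n" by simp
    then have "f (real j * h n) \<in> G n" by (auto simp: G_def)
    then have "f (real j * h n) \<le> S n" unfolding S_def using G by (intro Sup_fin.coboundedI)
    moreover have "f t' \<le> f (real j * h n) + h n *\<^sub>R u"
      using j by (intro lip) (auto simp: algebra_simps)
    ultimately show ?thesis unfolding ft by (meson add_right_mono order_trans)
  qed
  have SS: "S k \<le> S n + h n *\<^sub>R u" for k n using f_le by (rule S_le)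
  have nS: "norm (S k - S n) \<le> (h n + h k) * norm u" for k n
  proof -
    have "S k - S n \<le> (h n + h k) *\<^sub>R u"
      using SS[of k n] scaleR_right_mono[of "h n" "h n + h k" u] h0[of k] u0
      by (smt (verit) diff_le_eq add.commute order_trans add_left_mono)
    moreover have "- (S k - S n) \<le> (h n + h k) *\<^sub>R u"
      using SS[of n k] scaleR_right_mono[of "h k" "h n + h k" u] h0[of n] u0
      by (smt (verit) diff_le_eq minus_diff_eq add.commute order_trans add_left_mono)
    ultimately have "\<bar>S k - S n\<bar> \<le> (h n + h k) *\<^sub>R u" by (rule abs_leI)
    also have "\<dots> \<le> \<bar>(h n + h k) *\<^sub>R u\<bar>" by (rule abs_ge_self)
    finally have "norm (S k - S n) \<le> norm ((h n + h k) *\<^sub>R u)" by (rule norm_mono_abs)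
    then show ?thesis using h0[of n] h0[of k] by simp
  qed
  have h_lim: "h \<longlonglongrightarrow> 0"
    unfolding h_def using tendsto_mult[OF tendsto_const[of "2*pi"] LIMSEQ_inverse_real_of_nat]
    by (simp add: divide_inverse)
  have "Cauchy S"
  proof (rule CauchyI)
    fix e :: real assume e: "0 < e"
    define d where "d = e / (2 * (norm u + 1))"
    have d: "d > 0" using e by (simp add: d_def add_nonneg_pos)
    have "\<forall>\<^sub>F n in sequentially. h n < d" using order_tendstoD(2)[OF h_lim d] .
    then obtain M where M: "\<And>n. n \<ge> M \<Longrightarrow> h n < d" by (auto simp: eventually_sequentially)
    show "\<exists>M. \<forall>m\<ge>M. \<forall>n\<ge>M. norm (S m - S n) < e"
    proof (intro exI allI impI)
      fix m n assume mn: "m \<ge> M" "n \<ge> M"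
      have "norm (S m - S n) \<le> (h n + h m) * norm u" by (rule nS)
      also have "\<dots> \<le> (2 * d) * norm u"
        using M[OF mn(1)] M[OF mn(2)] by (intro mult_right_mono) auto
      also have "\<dots> < (2 * d) * (norm u + 1)" using d by simp
      also have "\<dots> = e"
      proof -
        have "norm u + 1 > 0" by (simp add: add_nonneg_pos)
        then show ?thesis by (simp add: d_def field_simps)
      qed
      finally show "norm (S m - S n) < e" .
    qed
  qed
  then obtain m where m: "S \<longlonglongrightarrow> m" using Cauchy_convergent_iff convergent_def by blast
  have "f t \<le> m" for t
  proof -
    have "(\<lambda>n. S n + h n *\<^sub>R u - f t) \<longlonglongrightarrow> m + 0 *\<^sub>R u - f t"
      by (intro tendsto_intros m h_lim)
    then have "0 \<le> m + 0 *\<^sub>R u - f t" by (rule nonneg_limit) (use f_le in simp)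
    then show ?thesis by simp
  qed
  moreover have "m \<le> w" if "\<And>t. f t \<le> w" for w
  proof -
    have "(\<lambda>n. w - S n) \<longlonglongrightarrow> w - m" by (intro tendsto_intros m)
    then have "0 \<le> w - m" by (rule nonneg_limit) (use S_le[OF that] in simp)
    then show ?thesis by simp
  qed
  ultimately show ?thesis unfolding f_def by (meson order_trans)
qed

lemma le_pair_modulus_iff:
  "pair_modulus x y \<le> w \<longleftrightarrow> (\<forall>t::real. cos t *\<^sub>R x + sin t *\<^sub>R y \<le> w)"
proof -
  have "\<exists>!m. \<forall>w. m \<le> w \<longleftrightarrow> (\<forall>t::real. cos t *\<^sub>R x + sin t *\<^sub>R y \<le> w)"
    using pair_modulus_ex[of x y] by (metis order_antisym order_refl)
  from theI'[OF this] show ?thesis unfolding pair_modulus_def by blast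
qed

lemma complex_lattice_simps:
  "vecs complex_lattice = UNIV"
  "smul complex_lattice c (x, y) = (Re c *\<^sub>R x - Im c *\<^sub>R y, Im c *\<^sub>R x + Re c *\<^sub>R y)"
  "vnorm complex_lattice (x, y) = norm (pair_modulus x y)"
  "cone complex_lattice = {(x, 0) |x. 0 \<le> x}"
  by (simp_all add: complex_lattice_def)

lemma real_vecs_complex: "real_vecs complex_lattice = {(x, 0) |x. True}"
proof -
  have "\<exists>a b. x = a - b \<and> 0 \<le> a \<and> 0 \<le> b" for x :: 'a
    by (rule exI[of _ "sup x 0"], rule exI[of _ "sup x 0 - x"]) simp
  then show ?thesis unfolding real_vecs_def complex_lattice_def by auto
qed

lemma modulus_complex: "modulus complex_lattice (x, y) = (pair_modulus x y, 0)"
proof -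
  have c: "c\<^sup>2 \<in> \<real>\<^sub>\<le>\<^sub>0 \<longleftrightarrow> Re c = 0" for c :: complex
    by (auto simp: complex_nonpos_Reals_iff power2_eq_square)
       (smt (verit) zero_le_square mult_eq_0_iff)+
  have R: "is_Re complex_lattice (a, b) z \<longleftrightarrow> z = (a, 0)" for a b :: 'a and z
  proof
    assume "is_Re complex_lattice (a, b) z"
    then show "z = (a, 0)"
      unfolding is_Re_def real_vecs_complex by (auto simp: c complex_lattice_def)
  next
    assume "z = (a, 0)"
    then show "is_Re complex_lattice (a, b) z"
      unfolding is_Re_def real_vecs_complex
      by (auto simp: c complex_lattice_def intro!: exI[of _ \<i>] exI[of _ b])
  qed
  have S: "{z. \<exists>u. norm u = 1 \<and> is_Re complex_lattice (smul complex_lattice u (x, y)) z} =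
      {(cos t *\<^sub>R x + sin t *\<^sub>R y, 0) |t. True}" (is "?A = ?B")
  proof (intro set_eqI iffI)
    fix z assume "z \<in> ?A"
    then obtain u where u: "norm u = 1" "z = (Re u *\<^sub>R x - Im u *\<^sub>R y, 0)"
      by (auto simp: complex_lattice_def R[unfolded complex_lattice_def])
    have "(Re u)\<^sup>2 + (- Im u)\<^sup>2 = 1" using u(1) by (simp add: cmod_def)
    then obtain t where "Re u = cos t" "- Im u = sin t" using sincos_total_2pi by metis
    then show "z \<in> ?B" using u(2) by (auto intro!: exI[of _ t]) (metis scaleR_minus_left diff_conv_add_uminus)
  next
    fix z assume "z \<in> ?B"
    then obtain t where "z = (cos t *\<^sub>R x + sin t *\<^sub>R y, 0)" by auto
    then show "z \<in> ?A"
      by (auto simp: complex_lattice_def R[unfolded complex_lattice_def] intro!: exI[of _ "cis (-t)"])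
  qed
  have L: "le complex_lattice (a, b) (a', b') \<longleftrightarrow> a \<le> a' \<and> b = b'" for a b a' b' :: 'a
    by (auto simp: le_def complex_lattice_def)
  have P: "cos t *\<^sub>R x + sin t *\<^sub>R y \<le> pair_modulus x y" for t
    using le_pair_modulus_iff[of x y "pair_modulus x y"] by simp
  show ?thesis unfolding modulus_def S
  proof (rule the_equality)
    show "is_lub complex_lattice ?B (pair_modulus x y, 0)"
      unfolding is_lub_def using P by (auto simp: L le_pair_modulus_iff complex_lattice_simps)
    fix m assume m: "is_lub complex_lattice ?B m"
    obtain a b where ab: "m = (a, b)" by force
    have "b = 0" "\<And>t. cos t *\<^sub>R x + sin t *\<^sub>R y \<le> a"
      using m unfolding is_lub_def ab by (auto simp: L)
    moreover have "le complex_lattice m (pair_modulus x y, 0)"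
    proof -
      have "\<forall>a\<in>?B. le complex_lattice a (pair_modulus x y, 0)" using P by (auto simp: L)
      moreover have "(pair_modulus x y, 0) \<in> vecs complex_lattice" by (simp add: complex_lattice_simps)
      ultimately show ?thesis using m unfolding is_lub_def by blast
    qed
    ultimately have "pair_modulus x y \<le> a" "a \<le> pair_modulus x y" "b = 0"
      unfolding ab L le_pair_modulus_iff[of x y a] by blast+
    then show "m = (pair_modulus x y, 0)" unfolding ab by (simp add: order_antisym)
  qed
qed

end

theory Submission
  imports Defs
begin

text \<open>
  Over both fields everything reduces to normed Riesz spaces. Let \<open>mu x f\<close> be the functional
  \<open>T \<mapsto> f (T x)\<close> on \<open>Z(E)\<close>. If the center is topologically full, then \<open>x \<approx> T u\<close> turns every sum of
  such functionals into one functional \<open>mu u g\<close>, up to a small error, and \<open>g\<^sup>+ (u)\<close> is nearly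
  attained as \<open>g (T u)\<close> with \<open>0 \<le> T \<le> 1\<close>. Hence for \<open>0 \<le> S \<in> Z(E')\<close> the assignment
  \<open>mu x f \<mapsto> (S f) (x)\<close> is dominated by a multiple of \<open>\<phi> \<mapsto> \<phi>\<^sup>+ (1)\<close>, and the Mazur--Orlicz theorem
  extends it to a positive \<open>a \<in> Z(E)''\<close> with \<open>i\<^sup>* (a) = S\<close>. Conversely, if \<open>f\<close> vanishes on \<open>Z(E) x\<close>, then
  \<open>mu x f = 0\<close>, so \<open>(S f) (x) = 0\<close> for all \<open>S\<close> in the image of \<open>i\<^sup>*\<close>; if the band projection onto the
  band of \<open>f\<^sup>+\<close> is in the image, then \<open>|f| (x) = 0\<close>, and the Hahn--Banach theorem shows that \<open>Z(E) x\<close> is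
  dense in the ideal generated by \<open>x\<close>.

  A functional between 0 and \<open>mu x f\<close> is of the form \<open>mu x g\<close>, so the kernel of \<open>i\<^sup>*\<close> is closed
  under suprema. If \<open>q\<close> is its largest element in \<open>[0, 1]\<close>, then the idempotent \<open>e = 1 - q\<close>
  annihilates the kernel, and \<open>i\<^sup>*\<close> maps the band \<open>e Z(E)''\<close> isomorphically onto \<open>Z(E')\<close>. The inverse
  is isometric because operator norms on centers are order unit norms, and because a complex functional
  \<open>\<phi>\<close> on \<open>Z(E)\<close> is, up to a small error in the norm, a finite combination \<open>\<Sum> u \<phi>\<^sub>u\<close> of positive
  functionals with \<open>|u| = 1\<close> and \<open>\<Sum> \<phi>\<^sub>u (1) \<le> \<parallel>\<phi>\<parallel>\<close>.
\<close>


section \<open>Minimal sublinear functionals\<close>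

text \<open>The points of a representing compact space enter only as normalized lattice
  homomorphisms on a principal ideal, obtained as minimal sublinear functionals; at each of them an
  identity between central operators becomes an identity between numbers. One class of spaces
  contains \<open>E\<close>, its center and all duals, so a single order theory serves every level
  up to \<open>Z(E)''\<close>.

  The majorant \<open>\<phi> \<mapsto> \<phi>\<^sup>+ (1)\<close> is forced: it is the support
  function of the order interval from 0 to 1 in \<open>Z(E)''\<close>, so domination by
  \<open>M\<close> times it says exactly that \<open>0 \<le> a \<le> M\<close>.

  Rotating scalars cause the remaining difficulty. A complex functional on \<open>Z(E)\<close> has
  no sign, and its norm meets the order only through real parts of \<open>u (s + i t)\<close>.
  Finitely many directions \<open>u\<close> keep the Mazur-Orlicz argument inside a finite power of
  \<open>Z(E)\<close>, where an extension splits into one positive functional per direction. The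
  price is a factor \<open>1 + e\<close> in the norm, which disappears in the limit.\<close>

locale real_carrier =
  fixes X :: "'v::ab_group_add set" and sc :: "real \<Rightarrow> 'v \<Rightarrow> 'v"
  assumes zero_in: "0 \<in> X"
    and add_in: "x \<in> X \<Longrightarrow> y \<in> X \<Longrightarrow> x + y \<in> X"
    and sc_in: "x \<in> X \<Longrightarrow> sc r x \<in> X"
    and sc_add_left: "x \<in> X \<Longrightarrow> sc (r + s) x = sc r x + sc s x"
    and sc_add_right: "x \<in> X \<Longrightarrow> y \<in> X \<Longrightarrow> sc r (x + y) = sc r x + sc r y"
    and sc_sc: "x \<in> X \<Longrightarrow> sc r (sc s x) = sc (r * s) x"
    and sc_one: "x \<in> X \<Longrightarrow> sc 1 x = x"
begin

lemma sc_zero: "x \<in> X \<Longrightarrow> sc 0 x = 0"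
  using sc_add_left[of x 0 0] by simp

lemma sc_minus_one: "x \<in> X \<Longrightarrow> sc (- 1) x = - x"
  using sc_add_left[of x 1 "- 1"] by (simp add: sc_zero sc_one eq_neg_iff_add_eq_0 add.commute)

lemma minus_in: "x \<in> X \<Longrightarrow> - x \<in> X"
  using sc_in[of x "- 1"] by (simp add: sc_minus_one)

definition sublinear :: "('v \<Rightarrow> real) \<Rightarrow> bool" where
  "sublinear p \<longleftrightarrow> (\<forall>x\<in>X. \<forall>y\<in>X. p (x + y) \<le> p x + p y) \<and> (\<forall>r>0. \<forall>x\<in>X. p (sc r x) \<le> r * p x)"

lemma sublinear_add: "sublinear p \<Longrightarrow> x \<in> X \<Longrightarrow> y \<in> X \<Longrightarrow> p (x + y) \<le> p x + p y"
  by (simp add: sublinear_def)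

text \<open>The definition asks for one inequality only; scaling back by \<open>inverse r\<close>
  gives the other.\<close>

lemma sublinear_sc:
  assumes "sublinear p" "x \<in> X" "r > 0"
  shows "p (sc r x) = r * p x"
proof -
  have "p (sc (inverse r) (sc r x)) \<le> inverse r * p (sc r x)"
    using assms sc_in by (simp add: sublinear_def)
  then have "p x \<le> inverse r * p (sc r x)" using assms by (simp add: sc_sc sc_one)
  then have "r * p x \<le> p (sc r x)" using assms by (simp add: field_simps)
  moreover have "p (sc r x) \<le> r * p x" using assms by (simp add: sublinear_def)
  ultimately show ?thesis by simp
qed

lemma sublinear_zero: assumes "sublinear p" shows "p 0 = 0"
  using sublinear_sc[OF assms zero_in, of 2] sc_add_right[OF zero_in zero_in, of 2] by simp

lemma sublinear_neg_le: assumes "sublinear p" "x \<in> X" shows "- p (- x) \<le> p x"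
  using sublinear_add[OF assms(1), of x "- x"] assms minus_in sublinear_zero by fastforce

definition linear_on :: "('v \<Rightarrow> real) \<Rightarrow> bool" where
  "linear_on h \<longleftrightarrow> (\<forall>x\<in>X. \<forall>y\<in>X. h (x + y) = h x + h y) \<and> (\<forall>r. \<forall>x\<in>X. h (sc r x) = r * h x)"

text \<open>Sublinearity gives \<open>- p (- x) \<le> p x\<close>, so the hypothesis makes
  \<open>p\<close> odd, and subadditivity at \<open>- x\<close> and \<open>- y\<close> becomes
  superadditivity at \<open>x\<close> and \<open>y\<close>.\<close>

lemma sublinear_imp_linear:
  assumes p: "sublinear p" and neg: "\<And>x. x \<in> X \<Longrightarrow> p (- x) \<le> - p x"
  shows "linear_on p"
proof -
  have n: "p (- x) = - p x" if "x \<in> X" for x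
    using neg[OF that] sublinear_neg_le[OF p that] by linarith
  have "p (x + y) = p x + p y" if "x \<in> X" "y \<in> X" for x y
  proof -
    have "p (- x + - y) \<le> p (- x) + p (- y)" using that minus_in by (intro sublinear_add p)
    then have "- p (x + y) \<le> - p x - p y"
      using that n[of "x + y"] add_in by (simp add: n add.commute)
    with sublinear_add[OF p that] show ?thesis by linarith
  qed
  moreover have "p (sc r x) = r * p x" if x: "x \<in> X" for r x
  proof (cases r "0 :: real" rule: linorder_cases)
    case greater then show ?thesis using x by (simp add: sublinear_sc p)
  next
    case equal then show ?thesis using x by (simp add: sc_zero sublinear_zero p)
  next
    case less
    have "sc r x = - sc (- r) x"
      using sc_sc[OF x, of "- 1" "- r"] sc_minus_one[OF sc_in[OF x]] by simp
    then show ?thesis using x less n[OF sc_in[OF x]] sublinear_sc[OF p x, of "- r"] by simp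
  qed
  ultimately show ?thesis by (simp add: linear_on_def)
qed

text \<open>
  \<open>J\<close> plays the role of a binary supremum; with \<open>L = False\<close> the condition on \<open>J\<close> is void, and the
  theorem below is the Hahn--Banach theorem.
\<close>

definition sup_preserving :: "bool \<Rightarrow> ('v \<Rightarrow> 'v \<Rightarrow> 'v) \<Rightarrow> ('v \<Rightarrow> real) \<Rightarrow> bool" where
  "sup_preserving L J p \<longleftrightarrow> (L \<longrightarrow> (\<forall>x\<in>X. \<forall>y\<in>X. p (J x y) = max (p x) (p y)))"

text \<open>The infimum is a limit for \<open>t \<rightarrow> \<infinity>\<close>, so \<open>tilt p z\<close> inherits the sublinearity of \<open>p\<close> and compatibility with suprema.\<close>

definition tilt :: "('v \<Rightarrow> real) \<Rightarrow> 'v \<Rightarrow> 'v \<Rightarrow> real" where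
  "tilt p z x = (INF t\<in>{0..}. p (x + sc t z) - t * p z)"

context
  fixes p :: "'v \<Rightarrow> real" and z :: 'v
  assumes p: "sublinear p" and z: "z \<in> X"
begin

lemma tilt_bdd: "x \<in> X \<Longrightarrow> bdd_below ((\<lambda>t. p (x + sc t z) - t * p z) ` {0..})"
proof (rule bdd_belowI2)
  fix t :: real assume x: "x \<in> X" and t: "t \<in> {0..}"
  have "p (sc t z) = t * p z"
    using t z sublinear_sc[OF p z, of t] sc_zero sublinear_zero[OF p] by (cases "t = 0") auto
  moreover have "p ((x + sc t z) + - x) \<le> p (x + sc t z) + p (- x)"
    using x z by (intro sublinear_add p add_in sc_in minus_in)
  ultimately show "- p (- x) \<le> p (x + sc t z) - t * p z" by simp
qed

lemma tilt_le: "x \<in> X \<Longrightarrow> 0 \<le> t \<Longrightarrow> tilt p z x \<le> p (x + sc t z) - t * p z"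
  unfolding tilt_def by (rule cINF_lower[OF tilt_bdd]) auto

text \<open>Monotonicity in the parameter turns the infimum into a limit, so that finitely many
  near-optimal parameters can be replaced by a common larger one.\<close>

lemma tilt_antimono:
  assumes "x \<in> X" "0 \<le> s" "s \<le> t"
  shows "p (x + sc t z) - t * p z \<le> p (x + sc s z) - s * p z"
proof (cases "s = t")
  case False
  then have d: "0 < t - s" using assms by simp
  have "sc t z = sc s z + sc (t - s) z" using sc_add_left[OF z, of s "t - s"] by simp
  then have "p (x + sc t z) \<le> p (x + sc s z) + p (sc (t - s) z)"
    using assms z sublinear_add[OF p, of "x + sc s z" "sc (t - s) z"]
    by (simp add: add_in sc_in add.assoc)
  then show ?thesis using sublinear_sc[OF p z d] by (simp add: algebra_simps)
qed simp

lemma tilt_less: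
  assumes "tilt p z x < c"
  obtains t where "0 \<le> t" "p (x + sc t z) - t * p z < c"
proof -
  have "\<exists>t\<in>{0..}. p (x + sc t z) - t * p z < c"
  proof (rule ccontr)
    assume "\<not> (\<exists>t\<in>{0..}. p (x + sc t z) - t * p z < c)"
    then have "c \<le> tilt p z x" unfolding tilt_def by (intro cINF_greatest) (auto simp: not_less)
    with assms show False by simp
  qed
  then show ?thesis using that by auto
qed

lemma tilt_le_self: "x \<in> X \<Longrightarrow> tilt p z x \<le> p x"
  using tilt_le[of x 0] z by (simp add: sc_zero)

lemma tilt_neg: "tilt p z (- z) \<le> - p z"
  using tilt_le[of "- z" 1] z by (simp add: sc_one minus_in sublinear_zero[OF p])

lemma tilt_sublinear: "sublinear (tilt p z)"
  unfolding sublinear_def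
proof (intro conjI ballI allI impI)
  fix x y assume xy: "x \<in> X" "y \<in> X"
  show "tilt p z (x + y) \<le> tilt p z x + tilt p z y"
  proof (rule field_le_epsilon)
    fix e :: real assume e: "0 < e"
    obtain t where t: "0 \<le> t" "p (x + sc t z) - t * p z < tilt p z x + e/2"
      using tilt_less[of x "tilt p z x + e/2"] e by auto
    obtain s where s: "0 \<le> s" "p (y + sc s z) - s * p z < tilt p z y + e/2"
      using tilt_less[of y "tilt p z y + e/2"] e by auto
    have "tilt p z (x + y) \<le> p (x + y + sc (t + s) z) - (t + s) * p z"
      using xy t s by (intro tilt_le add_in) auto
    also have "x + y + sc (t + s) z = (x + sc t z) + (y + sc s z)"
      using z by (simp add: sc_add_left algebra_simps)
    also have "p \<dots> \<le> p (x + sc t z) + p (y + sc s z)"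
      using xy z by (intro sublinear_add p add_in sc_in)
    finally show "tilt p z (x + y) \<le> tilt p z x + tilt p z y + e"
      using t s by (simp add: algebra_simps)
  qed
next
  fix r x assume r: "(0::real) < r" and x: "x \<in> X"
  show "tilt p z (sc r x) \<le> r * tilt p z x"
  proof (rule field_le_epsilon)
    fix e :: real assume e: "0 < e"
    obtain t where t: "0 \<le> t" "p (x + sc t z) - t * p z < tilt p z x + e / r"
      using tilt_less[of x "tilt p z x + e / r"] e r by auto
    have "tilt p z (sc r x) \<le> p (sc r x + sc (r * t) z) - r * t * p z"
      using x r t by (intro tilt_le sc_in) auto
    also have "sc r x + sc (r * t) z = sc r (x + sc t z)"
      using x z by (simp add: sc_add_right sc_sc sc_in)
    also have "p \<dots> = r * p (x + sc t z)"
      using x z r by (intro sublinear_sc p add_in sc_in)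
    also have "r * p (x + sc t z) - r * t * p z = r * (p (x + sc t z) - t * p z)"
      by (simp add: algebra_simps)
    also have "\<dots> \<le> r * (tilt p z x + e / r)"
      using t r by (intro mult_left_mono) auto
    finally show "tilt p z (sc r x) \<le> r * tilt p z x + e" using r by (simp add: algebra_simps)
  qed
qed

text \<open>Compatibility of \<open>J\<close> with translations carries the maximum through every
  shift by \<open>sc t z\<close>, and the limit over \<open>t\<close> keeps it.\<close>

lemma tilt_sup_preserving:
  assumes J: "\<And>x y. L \<Longrightarrow> x \<in> X \<Longrightarrow> y \<in> X \<Longrightarrow> J x y \<in> X"
    "\<And>x y w. L \<Longrightarrow> x \<in> X \<Longrightarrow> y \<in> X \<Longrightarrow> w \<in> X \<Longrightarrow> J x y + w = J (x + w) (y + w)"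
    and pJ: "sup_preserving L J p"
  shows "sup_preserving L J (tilt p z)"
  unfolding sup_preserving_def
proof (intro impI ballI antisym)
  fix x y assume L: L and xy: "x \<in> X" "y \<in> X"
  let ?f = "\<lambda>x t. p (x + sc t z) - t * p z"
  have f: "?f (J x y) t = max (?f x t) (?f y t)" for t
    using pJ L xy z J(2)[OF L xy sc_in[OF z]] unfolding sup_preserving_def
    by (simp add: add_in sc_in)
  show "tilt p z (J x y) \<le> max (tilt p z x) (tilt p z y)"
  proof (rule field_le_epsilon)
    fix e :: real assume e: "0 < e"
    obtain t where t: "0 \<le> t" "?f x t < tilt p z x + e"
      using tilt_less[of x "tilt p z x + e"] e by auto
    obtain s where s: "0 \<le> s" "?f y s < tilt p z y + e"
      using tilt_less[of y "tilt p z y + e"] e by auto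
    \<comment> \<open>Different parameters are nearly optimal for \<open>x\<close> and for
      \<open>y\<close>; by \<open>tilt_antimono\<close> the larger one is at least as good for
      both.\<close>
    have "tilt p z (J x y) \<le> ?f (J x y) (max t s)"
      using t s J(1)[OF L xy] by (intro tilt_le) auto
    also have "\<dots> \<le> max (?f x t) (?f y s)"
      unfolding f using tilt_antimono[OF xy(1) t(1), of "max t s"] tilt_antimono[OF xy(2) s(1), of "max t s"]
      by linarith
    also have "\<dots> \<le> max (tilt p z x) (tilt p z y) + e" using t s by linarith
    finally show "tilt p z (J x y) \<le> max (tilt p z x) (tilt p z y) + e" .
  qed
  have "tilt p z x \<le> tilt p z (J x y)" "tilt p z y \<le> tilt p z (J x y)"
    unfolding tilt_def[of p z "J x y"] using f tilt_le[OF xy(1)] tilt_le[OF xy(2)]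
    by (intro cINF_greatest; simp; smt (verit))+
  then show "max (tilt p z x) (tilt p z y) \<le> tilt p z (J x y)" by simp
qed

end

text \<open>Fixing the value 0 off the carrier makes the pointwise order of total functions agree
  with the pointwise order on \<open>X\<close>, so minimality in Zorn's lemma concerns
  \<open>X\<close> only.\<close>

definition sublinear_minorants where
  "sublinear_minorants L J p =
    {q. sublinear q \<and> sup_preserving L J q \<and> (\<forall>x\<in>X. q x \<le> p x) \<and> (\<forall>x. x \<notin> X \<longrightarrow> q x = 0)}"

text \<open>Members that are nearly minimal at two points are comparable, and the smaller one is
  nearly minimal at both (\<open>less2\<close>). Subadditivity and the maximum then pass from that
  member to the infimum.\<close>

lemma sublinear_chain_Inf:
  assumes J: "\<And>x y. L \<Longrightarrow> x \<in> X \<Longrightarrow> y \<in> X \<Longrightarrow> J x y \<in> X"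
    and C: "C \<subseteq> sublinear_minorants L J p" "C \<noteq> {}"
    and chain: "\<And>q r. q \<in> C \<Longrightarrow> r \<in> C \<Longrightarrow> q \<le> r \<or> r \<le> q"
  shows "(\<lambda>x. if x \<in> X then INF q\<in>C. q x else 0) \<in> sublinear_minorants L J p"
    (is "?u \<in> _")
proof -
  have C': "sublinear q" "sup_preserving L J q" "\<And>x. x \<in> X \<Longrightarrow> q x \<le> p x" if "q \<in> C" for q
    using C that by (auto simp: sublinear_minorants_def)
  have bdd: "bdd_below ((\<lambda>q. q x) ` C)" if x: "x \<in> X" for x
  proof (rule bdd_belowI2)
    fix q assume q: "q \<in> C"
    show "- p (- x) \<le> q x"
      using sublinear_neg_le[OF C'(1)[OF q] x] C'(3)[OF q minus_in[OF x]] by linarith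
  qed
  have le: "?u x \<le> q x" if "q \<in> C" "x \<in> X" for q x
    using that bdd by (auto intro: cINF_lower)
  have less: "\<exists>q\<in>C. q x < c" if "?u x < c" "x \<in> X" for x c
  proof (rule ccontr)
    assume "\<not> (\<exists>q\<in>C. q x < c)"
    then have "c \<le> (INF q\<in>C. q x)" using C(2) by (intro cINF_greatest) (auto simp: not_less)
    with that show False by simp
  qed
  have less2: "\<exists>q\<in>C. q x < ?u x + e \<and> q y < ?u y + e" if "x \<in> X" "y \<in> X" "0 < e" for x y e
  proof -
    obtain q where q: "q \<in> C" "q x < ?u x + e" using less[of x "?u x + e"] \<open>x \<in> X\<close> \<open>0 < e\<close> by auto
    obtain r where r: "r \<in> C" "r y < ?u y + e" using less[of y "?u y + e"] \<open>y \<in> X\<close> \<open>0 < e\<close> by auto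
    from chain[OF q(1) r(1)] show ?thesis
      using q r by (meson le_funD order_le_less_trans)
  qed
  have "sublinear ?u"
    unfolding sublinear_def
  proof (intro conjI ballI allI impI)
    fix x y assume xy: "x \<in> X" "y \<in> X"
    show "?u (x + y) \<le> ?u x + ?u y"
    proof (rule field_le_epsilon)
      fix e :: real assume "0 < e"
      then obtain q where q: "q \<in> C" "q x < ?u x + e/2" "q y < ?u y + e/2"
        using less2[OF xy, of "e/2"] by auto
      show "?u (x + y) \<le> ?u x + ?u y + e"
        using le[OF q(1) add_in[OF xy]] sublinear_add[OF C'(1)[OF q(1)] xy] q(2,3) by linarith
    qed
  next
    fix r x assume r: "(0::real) < r" and x: "x \<in> X"
    show "?u (sc r x) \<le> r * ?u x"
    proof (rule field_le_epsilon)
      fix e :: real assume e: "0 < e"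
      obtain q where q: "q \<in> C" "q x < ?u x + e / r" using less[of x "?u x + e / r"] x e r by auto
      have "?u (sc r x) \<le> r * q x"
        using le[OF q(1) sc_in[OF x, of r]] unfolding sublinear_sc[OF C'(1)[OF q(1)] x r] .
      also have "\<dots> \<le> r * (?u x + e / r)" using q r by (intro mult_left_mono) auto
      finally show "?u (sc r x) \<le> r * ?u x + e" using r by (simp only: algebra_simps) simp
    qed
  qed
  moreover have "sup_preserving L J ?u"
    unfolding sup_preserving_def
  proof (intro impI ballI antisym)
    fix x y assume L: L and xy: "x \<in> X" "y \<in> X"
    have qJ: "q (J x y) = max (q x) (q y)" if "q \<in> C" for q
      using C'(2)[OF that] L xy by (simp add: sup_preserving_def)
    show "?u (J x y) \<le> max (?u x) (?u y)"
    proof (rule field_le_epsilon)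
      fix e :: real assume "0 < e"
      then obtain q where q: "q \<in> C" "q x < ?u x + e" "q y < ?u y + e"
        using less2[OF xy, of e] by auto
      show "?u (J x y) \<le> max (?u x) (?u y) + e"
        using le[OF q(1) J[OF L xy]] q(2,3) qJ[OF q(1)] by linarith
    qed
    have "?u x \<le> (INF q\<in>C. q (J x y))" "?u y \<le> (INF q\<in>C. q (J x y))"
      using C(2) le[OF _ xy(1)] le[OF _ xy(2)] qJ by (intro cINF_greatest; simp; smt (verit))+
    then show "max (?u x) (?u y) \<le> ?u (J x y)" using J[OF L xy] by simp
  qed
  moreover have "\<forall>x\<in>X. ?u x \<le> p x"
  proof
    fix x assume x: "x \<in> X"
    obtain q where "q \<in> C" using C by auto
    with le[OF this x] C'(3)[OF this x] show "?u x \<le> p x" by linarith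
  qed
  ultimately show ?thesis by (simp add: sublinear_minorants_def)
qed

text \<open>A minimal functional is unchanged by tilting along any \<open>w\<close>, and tilting
  forces \<open>m (- w) \<le> - m w\<close>; by \<open>sublinear_imp_linear\<close> this is
  linearity.\<close>

theorem linear_minorant:
  assumes J: "\<And>x y. L \<Longrightarrow> x \<in> X \<Longrightarrow> y \<in> X \<Longrightarrow> J x y \<in> X"
    "\<And>x y w. L \<Longrightarrow> x \<in> X \<Longrightarrow> y \<in> X \<Longrightarrow> w \<in> X \<Longrightarrow> J x y + w = J (x + w) (y + w)"
    and p: "sublinear p" "sup_preserving L J p" and z: "z \<in> X"
  obtains h where "linear_on h" "sup_preserving L J h" "\<And>x. x \<in> X \<Longrightarrow> h x \<le> p x" "h z = p z"
proof -
  define cut where "cut q = (\<lambda>x. if x \<in> X then q x else 0)" for q :: "'v \<Rightarrow> real"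
  have cut_s: "sublinear (cut q)" if "sublinear q" for q
    using that by (auto simp: sublinear_def cut_def add_in sc_in)
  have cut_J: "sup_preserving L J (cut q)" if "sup_preserving L J q" for q
    using that J(1) by (auto simp: sup_preserving_def cut_def)
  \<comment> \<open>Minimality is sought below the tilt along \<open>z\<close> instead of below
    \<open>p\<close>: since \<open>p1 (- z) \<le> - p z\<close> and \<open>p1 \<le> p\<close>, every
    linear functional below \<open>p1\<close> has the value \<open>p z\<close> at
    \<open>z\<close>.\<close>
  define p1 where "p1 = tilt p z"
  have p1: "sublinear p1" "sup_preserving L J p1"
    unfolding p1_def by (rule tilt_sublinear[OF p(1) z] tilt_sup_preserving[OF p(1) z J p(2)]; simp)+
  define A where "A = sublinear_minorants L J p1"
  have cut_A: "cut q \<in> A" if "sublinear q" "sup_preserving L J q" "\<And>x. x \<in> X \<Longrightarrow> q x \<le> p1 x" for q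
    using that cut_s cut_J by (auto simp: A_def sublinear_minorants_def cut_def)
  have "\<exists>m\<in>A. \<forall>a\<in>A. a \<le> m \<longrightarrow> a = m"
  proof (rule predicate_Zorn)
    \<comment> \<open>Zorn's lemma produces maximal elements, so the order is reversed.\<close>
    show "partial_order_on A (relation_of (\<lambda>x y. y \<le> x) A)"
      by (rule partial_order_on_relation_ofI) auto
    fix C assume C: "C \<in> Chains (relation_of (\<lambda>x y. y \<le> x) A)"
    show "\<exists>u\<in>A. \<forall>a\<in>C. u \<le> a"
    proof (cases "C = {}")
      case True
      then show ?thesis using cut_A[OF p1] by auto
    next
      case False
      have CA: "C \<subseteq> A" using C by (auto simp: Chains_def relation_of_def)
      have ch: "\<And>q r. q \<in> C \<Longrightarrow> r \<in> C \<Longrightarrow> q \<le> r \<or> r \<le> q"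
        using C by (auto simp: Chains_def relation_of_def)
      let ?u = "\<lambda>x. if x \<in> X then INF q\<in>C. q x else 0"
      have "?u \<in> A" unfolding A_def by (rule sublinear_chain_Inf[OF J(1) _ False ch]) (use CA in \<open>auto simp: A_def\<close>)
      moreover have "?u \<le> q" if q: "q \<in> C" for q
      proof (rule le_funI)
        fix x
        show "?u x \<le> q x"
        proof (cases "x \<in> X")
          case True
          have "bdd_below ((\<lambda>q. q x) ` C)"
          proof (rule bdd_belowI2)
            fix q assume "q \<in> C"
            then have "sublinear q" "q (- x) \<le> p1 (- x)"
              using CA minus_in[OF True] by (auto simp: A_def sublinear_minorants_def)
            with sublinear_neg_le[OF this(1) True] show "- p1 (- x) \<le> q x" by linarith
          qed
          then show ?thesis using True q by (auto intro: cINF_lower)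
        next
          case False
          then show ?thesis using q CA by (auto simp: A_def sublinear_minorants_def)
        qed
      qed
      ultimately show ?thesis by blast
    qed
  qed
  then obtain m where m: "m \<in> A" "\<And>a. a \<in> A \<Longrightarrow> a \<le> m \<Longrightarrow> a = m" by blast
  have ms: "sublinear m" "sup_preserving L J m" "\<And>x. x \<in> X \<Longrightarrow> m x \<le> p1 x" "\<And>x. x \<notin> X \<Longrightarrow> m x = 0"
    using m(1) by (auto simp: A_def sublinear_minorants_def)
  have "m (- w) \<le> - m w" if w: "w \<in> X" for w
  proof -
    have "cut (tilt m w) \<in> A"
      using tilt_le_self[OF ms(1) w] ms(3)
      by (intro cut_A tilt_sublinear[OF ms(1) w] tilt_sup_preserving[OF ms(1) w J ms(2)]) (auto intro: order_trans)
    moreover have "cut (tilt m w) \<le> m"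
      using tilt_le_self[OF ms(1) w] ms(4) by (auto simp: cut_def le_fun_def)
    ultimately have "cut (tilt m w) = m" by (rule m(2))
    then have "cut (tilt m w) (- w) = m (- w)" by (rule fun_cong)
    then have "m (- w) = tilt m w (- w)" using minus_in[OF w] by (simp add: cut_def)
    then show ?thesis using tilt_neg[OF ms(1) w] by simp
  qed
  then have lin: "linear_on m" by (rule sublinear_imp_linear[OF ms(1)])
  have mp: "m x \<le> p x" if "x \<in> X" for x
    using ms(3)[OF that] tilt_le_self[OF p(1) z that] by (simp add: p1_def)
  have "m (- z) \<le> - p z"
    using ms(3)[OF minus_in[OF z]] tilt_neg[OF p(1) z] by (simp add: p1_def)
  then have "p z \<le> m z" using sublinear_neg_le[OF ms(1) z] by linarith
  then have "m z = p z" using mp[OF z] by linarith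
  then show ?thesis using that lin ms(2) mp by blast
qed

text \<open>A linear \<open>h\<close> below \<open>q\<close> is below \<open>p\<close> because
  \<open>(0, 0) \<in> G\<close>, and \<open>h (- g) \<le> p 0 - r\<close> gives
  \<open>r \<le> h g\<close>. The hypothesis \<open>r \<le> p g\<close> keeps the infimum that
  defines \<open>q\<close> finite.\<close>

lemma mazur_orlicz:
  assumes p: "sublinear p"
    and G0: "(0, 0) \<in> G" and GX: "\<And>g r. (g, r) \<in> G \<Longrightarrow> g \<in> X"
    and Gadd: "\<And>g h r s. (g, r) \<in> G \<Longrightarrow> (h, s) \<in> G \<Longrightarrow> (g + h, r + s) \<in> G"
    and Gsc: "\<And>g r t. 0 < t \<Longrightarrow> (g, r) \<in> G \<Longrightarrow> (sc t g, t * r) \<in> G"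
    and le: "\<And>g r. (g, r) \<in> G \<Longrightarrow> r \<le> p g"
  obtains h where "linear_on h" "\<And>x. x \<in> X \<Longrightarrow> h x \<le> p x" "\<And>g r. (g, r) \<in> G \<Longrightarrow> r \<le> h g"
proof -
  define q where "q y = (INF (g, r)\<in>G. p (y + g) - r)" for y
  have low: "- p (- y) \<le> p (y + g) - r" if "(g, r) \<in> G" "y \<in> X" for y g r
    using sublinear_add[OF p, of "y + g" "- y"] le[OF that(1)] that(2) GX[OF that(1)]
    by (simp add: add_in minus_in)
  have q_le: "q y \<le> p (y + g) - r" if "(g, r) \<in> G" "y \<in> X" for y g r
  proof -
    have "bdd_below ((\<lambda>(g, r). p (y + g) - r) ` G)"
      by (rule bdd_belowI2[of _ "- p (- y)"]) (use low that in auto)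
    from cINF_lower[OF this that(1)] show ?thesis by (simp add: q_def)
  qed
  have q_approx: "\<exists>g r. (g, r) \<in> G \<and> p (y + g) - r < q y + e" if "0 < e" for y e
  proof (rule ccontr)
    assume "\<not> ?thesis"
    then have "q y + e \<le> (INF (g, r)\<in>G. p (y + g) - r)"
      using G0 by (intro cINF_greatest) (auto simp: not_less)
    with that show False by (simp add: q_def)
  qed
  have q: "sublinear q"
    unfolding sublinear_def
  proof (intro conjI ballI allI impI)
    fix x y assume xy: "x \<in> X" "y \<in> X"
    show "q (x + y) \<le> q x + q y"
    proof (rule field_le_epsilon)
      fix e :: real assume "0 < e"
      then obtain g r h s where G: "(g, r) \<in> G" "p (x + g) - r < q x + e/2"
          "(h, s) \<in> G" "p (y + h) - s < q y + e/2"
        using q_approx[of "e/2" x] q_approx[of "e/2" y] by auto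
      have "q (x + y) \<le> p ((x + g) + (y + h)) - (r + s)"
        using q_le[OF Gadd[OF G(1,3)] add_in[OF xy]] by (simp add: algebra_simps)
      also have "\<dots> \<le> p (x + g) + p (y + h) - (r + s)"
        using sublinear_add[OF p, of "x + g" "y + h"] xy GX G by (simp add: add_in)
      finally show "q (x + y) \<le> q x + q y + e" using G by simp
    qed
  next
    fix t x assume t: "(0::real) < t" and x: "x \<in> X"
    show "q (sc t x) \<le> t * q x"
    proof (rule field_le_epsilon)
      fix e :: real assume "0 < e"
      then obtain g r where G: "(g, r) \<in> G" "p (x + g) - r < q x + e / t"
        using q_approx[of "e / t" x] t by auto
      have "q (sc t x) \<le> p (sc t (x + g)) - t * r"
        using q_le[OF Gsc[OF t G(1)] sc_in[OF x, of t]] x GX[OF G(1)] by (simp add: sc_add_right)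
      also have "\<dots> = t * (p (x + g) - r)"
        using sublinear_sc[OF p _ t, of "x + g"] x GX[OF G(1)] by (simp add: add_in right_diff_distrib)
      also have "\<dots> \<le> t * (q x + e / t)" using G t by (intro mult_left_mono) auto
      finally show "q (sc t x) \<le> t * q x + e" using t by (simp add: distrib_left)
    qed
  qed
  have "sup_preserving False (\<lambda>x y. x) q" by (simp add: sup_preserving_def)
  from linear_minorant[OF _ _ q this zero_in] obtain h where
    h: "linear_on h" "\<And>x. x \<in> X \<Longrightarrow> h x \<le> q x" by auto
  show ?thesis
  proof (rule that[OF h(1)])
    show "h x \<le> p x" if "x \<in> X" for x using h(2)[OF that] q_le[OF G0 that] by simp
    show "r \<le> h g" if g: "(g, r) \<in> G" for g r
    proof -
      have "h (- g) \<le> - r"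
        using h(2)[OF minus_in[OF GX[OF g]]] q_le[OF g minus_in[OF GX[OF g]]] sublinear_zero[OF p] by simp
      moreover have "h (- g) = - h g"
        using h(1) GX[OF g] sc_minus_one[OF GX[OF g]] unfolding linear_on_def by (metis mult_minus1)
      ultimately show ?thesis by simp
    qed
  qed
qed

end

lemma hahn_banach:
  fixes p :: "'b::real_vector \<Rightarrow> real"
  assumes "\<And>x y. p (x + y) \<le> p x + p y" "\<And>r x. 0 < r \<Longrightarrow> p (r *\<^sub>R x) \<le> r * p x"
  obtains h where "linear h" "\<And>x. h x \<le> p x" "h z = p z"
proof -
  interpret real_carrier "UNIV :: 'b set" scaleR
    by unfold_locales (auto simp: algebra_simps)
  have "sublinear p" "sup_preserving False (\<lambda>x y. x) p"
    using assms by (auto simp: sublinear_def sup_preserving_def)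
  from linear_minorant[OF _ _ this, of z] obtain h where
    h: "linear_on h" "\<And>x. h x \<le> p x" "h z = p z" by auto
  have "linear h" by (rule linearI) (use h(1) in \<open>auto simp: linear_on_def\<close>)
  with h show ?thesis using that by blast
qed


section \<open>Normed Riesz spaces and their characters\<close>

text \<open>The axioms of \<open>banach_lattice\<close> other than completeness. Centers and duals
  are made instances below, so that everything proved for this class applies to them again.\<close>

class normed_riesz = real_normed_vector + ordered_real_vector + lattice_ab_group_add_abs +
  assumes norm_le_of_abs_le: "\<bar>x\<bar> \<le> \<bar>y\<bar> \<Longrightarrow> norm x \<le> norm y"

instance banach_lattice \<subseteq> normed_riesz
  by standard (rule norm_mono_abs)

lemma abs_le_D:
  fixes x :: "'b::normed_riesz"
  assumes "\<bar>x\<bar> \<le> y" shows "x \<le> y" "- x \<le> y" "- y \<le> x"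
  using assms abs_ge_self[of x] abs_ge_minus_self[of x] by (auto intro: order_trans simp: minus_le_iff)

lemma scaleR_sup:
  fixes x y :: "'b::normed_riesz"
  assumes "0 \<le> t" shows "t *\<^sub>R sup x y = sup (t *\<^sub>R x) (t *\<^sub>R y)"
proof (cases "t = 0")
  case False
  then have t: "0 < t" using assms by simp
  show ?thesis
  proof (rule antisym)
    have "sup x y \<le> inverse t *\<^sub>R sup (t *\<^sub>R x) (t *\<^sub>R y)"
      using t by (intro sup_least) (simp_all add: pos_le_divideR_eq)
    then have "t *\<^sub>R sup x y \<le> t *\<^sub>R inverse t *\<^sub>R sup (t *\<^sub>R x) (t *\<^sub>R y)"
      using assms by (rule scaleR_left_mono)
    then show "t *\<^sub>R sup x y \<le> sup (t *\<^sub>R x) (t *\<^sub>R y)" using t by simp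
    show "sup (t *\<^sub>R x) (t *\<^sub>R y) \<le> t *\<^sub>R sup x y"
      using assms by (intro sup_least scaleR_left_mono) auto
  qed
qed simp

lemma abs_scaleR:
  fixes x :: "'b::normed_riesz"
  shows "\<bar>t *\<^sub>R x\<bar> = \<bar>t\<bar> *\<^sub>R \<bar>x\<bar>"
proof (cases "0 \<le> t")
  case True then show ?thesis using scaleR_sup[of t x "- x"] by (simp add: abs_lattice[of x] abs_lattice[of "t *\<^sub>R x"])
next
  case False
  then show ?thesis using scaleR_sup[of "- t" x "- x"]
    by (simp add: abs_lattice[of x] abs_lattice[of "t *\<^sub>R x"] sup_commute)
qed

lemma norm_abs_eq [simp]: "norm \<bar>x :: 'b::normed_riesz\<bar> = norm x"
  by (rule antisym; rule norm_le_of_abs_le) simp_all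

lemma norm_mono_nonneg: "0 \<le> x \<Longrightarrow> x \<le> y \<Longrightarrow> norm x \<le> norm (y :: 'b::normed_riesz)"
  by (rule norm_le_of_abs_le) (metis abs_of_nonneg order_trans)

lemma norm_le_of_abs_le': "\<bar>x\<bar> \<le> y \<Longrightarrow> norm x \<le> norm (y :: 'b::normed_riesz)"
  by (rule norm_le_of_abs_le) (metis abs_ge_self order_trans)

text \<open>Monotonicity of the norm bounds the norm of the positive part of \<open>x\<close> by
  every positive number. The summand 1 in the denominator of \<open>d\<close> covers the case
  \<open>u = 0\<close>.\<close>

lemma archimedean_le_zero:
  fixes x u :: "'b::normed_riesz"
  assumes "\<And>e. 0 < e \<Longrightarrow> x \<le> e *\<^sub>R u"
  shows "x \<le> 0"
proof -
  have "norm (pprt x) \<le> 0 + e" if "0 < e" for e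
  proof -
    define d where "d = e / (norm u + 1)"
    have n: "0 < norm u + 1" by (simp add: add_nonneg_pos)
    have d: "0 < d" using that n by (simp add: d_def)
    have "x \<le> d *\<^sub>R \<bar>u\<bar>"
      using assms[OF d] scaleR_left_mono[OF abs_ge_self[of u], of d] d by (meson less_imp_le order_trans)
    then have "pprt x \<le> d *\<^sub>R \<bar>u\<bar>" using d by (simp add: pprt_def scaleR_nonneg_nonneg)
    then have "norm (pprt x) \<le> norm (d *\<^sub>R \<bar>u\<bar>)" by (intro norm_mono_nonneg) auto
    also have "\<dots> \<le> d * (norm u + 1)" using d by simp
    also have "\<dots> = e" using n by (simp add: d_def)
    finally show ?thesis by simp
  qed
  then have "norm (pprt x) \<le> 0" by (rule field_le_epsilon)
  then show ?thesis by (simp add: le_zero_iff_zero_pprt)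
qed

lemma archimedean_le:
  fixes x y u :: "'b::normed_riesz"
  assumes "\<And>e. 0 < e \<Longrightarrow> x \<le> y + e *\<^sub>R u"
  shows "x \<le> y"
  using archimedean_le_zero[of "x - y" u] assms by (simp add: algebra_simps)

lemma pprt_diff_eq: "pprt x - pprt (- x) = (x :: 'b::normed_riesz)"
  using prts[of x] pprt_neg[of x] by simp

lemma abs_eq_pprt: "\<bar>x\<bar> = pprt x + pprt (- x :: 'b::normed_riesz)"
  by (simp add: abs_prts pprt_neg)

lemma riesz_decomposition:
  fixes x y z :: "'b::normed_riesz"
  assumes "0 \<le> x" "0 \<le> y" "0 \<le> z" "z \<le> x + y"
  shows "0 \<le> inf z x" "inf z x \<le> x" "0 \<le> z - inf z x" "z - inf z x \<le> y"
proof -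
  have "z - inf z x = sup 0 (z - x)" using add_sup_distrib_left[of z "- z" "- x"] by simp
  also have "\<dots> \<le> y" using assms by (simp add: algebra_simps)
  finally show "z - inf z x \<le> y" .
  show "0 \<le> z - inf z x" using inf_le1[of z x] by (simp only: diff_ge_0_iff_ge)
qed (use assms in auto)

text \<open>Suprema of central operators, least upper bounds of functionals and band projections are
  all given by formulas valid on the cone; this is their common linear extension.\<close>

definition cone_extension :: "('b::normed_riesz \<Rightarrow> 'c::real_vector) \<Rightarrow> 'b \<Rightarrow> 'c" where
  "cone_extension f x = f (pprt x) - f (pprt (- x))"

context
  fixes f :: "'b::normed_riesz \<Rightarrow> 'c::real_vector"
  assumes add: "\<And>x y. 0 \<le> x \<Longrightarrow> 0 \<le> y \<Longrightarrow> f (x + y) = f x + f y"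
    and scale: "\<And>r x. 0 < r \<Longrightarrow> 0 \<le> x \<Longrightarrow> f (r *\<^sub>R x) = r *\<^sub>R f x"
begin

lemma cone_extension_diff:
  assumes "0 \<le> a" "0 \<le> b"
  shows "cone_extension f (a - b) = f a - f b"
proof -
  have "pprt (a - b) + b = pprt (- (a - b)) + a"
    using pprt_diff_eq[of "a - b"] by (simp add: algebra_simps)
  then have "f (pprt (a - b)) + f b = f (pprt (- (a - b))) + f a"
    using assms by (metis add zero_le_pprt)
  then show ?thesis unfolding cone_extension_def by (simp add: algebra_simps)
qed

lemma cone_extension_nonneg: "0 \<le> x \<Longrightarrow> cone_extension f x = f x"
  using cone_extension_diff[of x 0] add[of 0 0] by simp

lemma linear_cone_extension: "linear (cone_extension f)"
proof (rule linearI)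
  fix x y :: 'b
  have "x + y = (pprt x + pprt y) - (pprt (- x) + pprt (- y))"
    using pprt_diff_eq[of x] pprt_diff_eq[of y] by (simp add: algebra_simps)
  then have "cone_extension f (x + y) = f (pprt x + pprt y) - f (pprt (- x) + pprt (- y))"
    using cone_extension_diff[of "pprt x + pprt y" "pprt (- x) + pprt (- y)"] by simp
  then show "cone_extension f (x + y) = cone_extension f x + cone_extension f y"
    by (simp add: add cone_extension_def)
next
  fix r x
  have pos: "cone_extension f (r *\<^sub>R x) = r *\<^sub>R cone_extension f x" if "0 < r" for r x
  proof -
    have "r *\<^sub>R x = r *\<^sub>R pprt x - r *\<^sub>R pprt (- x)"
      by (metis pprt_diff_eq scaleR_diff_right)
    then have "cone_extension f (r *\<^sub>R x) = f (r *\<^sub>R pprt x) - f (r *\<^sub>R pprt (- x))"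
      using cone_extension_diff[of "r *\<^sub>R pprt x" "r *\<^sub>R pprt (- x)"] that by (simp add: scaleR_nonneg_nonneg)
    then show ?thesis using that by (simp add: scale cone_extension_def scaleR_diff_right)
  qed
  have neg: "cone_extension f (- x) = - cone_extension f x" for x
    by (simp add: cone_extension_def)
  show "cone_extension f (r *\<^sub>R x) = r *\<^sub>R cone_extension f x"
  proof (cases r "0 :: real" rule: linorder_cases)
    case less
    then show ?thesis using pos[of "- r" x] neg[of "r *\<^sub>R x"] by simp
  next
    case equal
    then show ?thesis by (simp add: cone_extension_def)
  qed (use pos in simp)
qed

end

section \<open>Principal ideals and normalized lattice homomorphisms on them\<close>

definition principal_ideal :: "'b::normed_riesz \<Rightarrow> 'b set" where
  "principal_ideal u = {x. \<exists>t\<ge>0. \<bar>x\<bar> \<le> t *\<^sub>R u}"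

lemma principal_idealI: "\<bar>x\<bar> \<le> t *\<^sub>R u \<Longrightarrow> 0 \<le> u \<Longrightarrow> x \<in> principal_ideal u"
  unfolding principal_ideal_def
  by (rule CollectI, rule exI[of _ "\<bar>t\<bar>"]) (auto intro: order_trans[OF _ scaleR_right_mono[OF abs_ge_self]])

lemma principal_ideal_self: "0 \<le> u \<Longrightarrow> u \<in> principal_ideal u"
  by (rule principal_idealI[of _ 1]) auto

lemma principal_ideal_mono: "\<bar>x\<bar> \<le> \<bar>y\<bar> \<Longrightarrow> y \<in> principal_ideal u \<Longrightarrow> x \<in> principal_ideal u"
  unfolding principal_ideal_def by (blast intro: order_trans)

lemma principal_ideal_le: "0 \<le> x \<Longrightarrow> x \<le> u \<Longrightarrow> x \<in> principal_ideal u"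
  by (rule principal_idealI[of _ 1]) auto

lemma principal_ideal_add:
  assumes "x \<in> principal_ideal u" "y \<in> principal_ideal u"
  shows "x + y \<in> principal_ideal u"
proof -
  obtain s t where st: "0 \<le> s" "0 \<le> t" "\<bar>x\<bar> \<le> s *\<^sub>R u" "\<bar>y\<bar> \<le> t *\<^sub>R u"
    using assms by (auto simp: principal_ideal_def)
  have "\<bar>x + y\<bar> \<le> (s + t) *\<^sub>R u"
    using abs_triangle_ineq[of x y] add_mono[OF st(3,4)] by (simp add: scaleR_add_left)
  then show ?thesis using st unfolding principal_ideal_def by (intro CollectI exI[of _ "s + t"]) simp
qed

lemma principal_ideal_scaleR:
  assumes "x \<in> principal_ideal u" shows "r *\<^sub>R x \<in> principal_ideal u"
proof -
  obtain s where s: "0 \<le> s" "\<bar>x\<bar> \<le> s *\<^sub>R u" using assms by (auto simp: principal_ideal_def)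
  then have "\<bar>r *\<^sub>R x\<bar> \<le> (\<bar>r\<bar> * s) *\<^sub>R u"
    using scaleR_left_mono[OF s(2), of "\<bar>r\<bar>"] by (simp add: abs_scaleR)
  then show ?thesis using s unfolding principal_ideal_def by (intro CollectI exI[of _ "\<bar>r\<bar> * s"]) simp
qed

lemma principal_ideal_abs: "x \<in> principal_ideal u \<Longrightarrow> \<bar>x\<bar> \<in> principal_ideal u"
  by (rule principal_ideal_mono[of _ x]) simp_all

lemma principal_ideal_minus: "x \<in> principal_ideal u \<Longrightarrow> - x \<in> principal_ideal u"
  by (rule principal_ideal_mono[of _ x]) simp_all

lemma principal_ideal_diff: "x \<in> principal_ideal u \<Longrightarrow> y \<in> principal_ideal u \<Longrightarrow> x - y \<in> principal_ideal u"
  using principal_ideal_add[OF _ principal_ideal_minus, of x u y] by simp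

lemma principal_ideal_zero: "0 \<le> u \<Longrightarrow> 0 \<in> principal_ideal u"
  by (rule principal_idealI[of _ 0]) simp_all

lemma principal_ideal_sup:
  assumes "x \<in> principal_ideal u" "y \<in> principal_ideal u"
  shows "sup x y \<in> principal_ideal u"
proof (rule principal_ideal_mono)
  show "\<bar>x\<bar> + \<bar>y\<bar> \<in> principal_ideal u" using assms by (intro principal_ideal_add principal_ideal_abs)
  have "sup x y \<le> \<bar>x\<bar> + \<bar>y\<bar>"
    using abs_ge_self[of x] abs_ge_self[of y]
    by (intro sup_least) (auto intro: add_increasing add_increasing2)
  moreover have "- sup x y \<le> \<bar>x\<bar> + \<bar>y\<bar>"
    using abs_ge_minus_self[of x] by (auto intro: le_infI1 add_increasing2)
  ultimately show "\<bar>sup x y\<bar> \<le> \<bar>\<bar>x\<bar> + \<bar>y\<bar>\<bar>" by (simp add: abs_leI)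
qed

lemma principal_ideal_inf: "x \<in> principal_ideal u \<Longrightarrow> y \<in> principal_ideal u \<Longrightarrow> inf x y \<in> principal_ideal u"
  unfolding inf_eq_neg_sup by (intro principal_ideal_minus principal_ideal_sup)

lemmas principal_ideal_closed = principal_ideal_self principal_ideal_add principal_ideal_scaleR
  principal_ideal_abs principal_ideal_minus principal_ideal_diff principal_ideal_zero
  principal_ideal_sup principal_ideal_inf

text \<open>The points of the Kakutani representation space of the principal ideal.\<close>

definition characters :: "'b::normed_riesz \<Rightarrow> ('b \<Rightarrow> real) set" where
  "characters u = {h. (\<forall>x\<in>principal_ideal u. \<forall>y\<in>principal_ideal u. h (x + y) = h x + h y) \<and>
     (\<forall>r. \<forall>x\<in>principal_ideal u. h (r *\<^sub>R x) = r * h x) \<and>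
     (\<forall>x\<in>principal_ideal u. \<forall>y\<in>principal_ideal u. h (sup x y) = max (h x) (h y)) \<and> h u = 1}"

context
  fixes h :: "'b::normed_riesz \<Rightarrow> real" and u
  assumes h: "h \<in> characters u"
begin

lemma char_unit: "h u = 1"
  and char_add: "x \<in> principal_ideal u \<Longrightarrow> y \<in> principal_ideal u \<Longrightarrow> h (x + y) = h x + h y"
  and char_scaleR: "x \<in> principal_ideal u \<Longrightarrow> h (r *\<^sub>R x) = r * h x"
  and char_sup: "x \<in> principal_ideal u \<Longrightarrow> y \<in> principal_ideal u \<Longrightarrow> h (sup x y) = max (h x) (h y)"
  using h by (auto simp: characters_def)

lemma char_minus: "x \<in> principal_ideal u \<Longrightarrow> h (- x) = - h x"
  using char_scaleR[of x "- 1"] by simp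

lemma char_diff: "x \<in> principal_ideal u \<Longrightarrow> y \<in> principal_ideal u \<Longrightarrow> h (x - y) = h x - h y"
  using char_add[OF _ principal_ideal_minus, of x y] by (simp add: char_minus)

lemma char_zero: "x \<in> principal_ideal u \<Longrightarrow> h 0 = 0"
  using char_scaleR[of x 0] by simp

lemma char_abs: "x \<in> principal_ideal u \<Longrightarrow> h \<bar>x\<bar> = \<bar>h x\<bar>"
  by (simp add: abs_lattice[of x] char_sup char_minus principal_ideal_minus)

lemma char_mono: "x \<in> principal_ideal u \<Longrightarrow> y \<in> principal_ideal u \<Longrightarrow> x \<le> y \<Longrightarrow> h x \<le> h y"
  using char_sup[of x y] by (simp add: sup_absorb2)

end

text \<open>The one-sided gauge \<open>p\<close> of the unit \<open>u\<close> is sublinear and turns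
  suprema into maxima, so \<open>linear_minorant\<close> yields a lattice homomorphism that attains
  it at \<open>x\<close>. From \<open>p u \<le> 1\<close> and \<open>p (- u) \<le> - 1\<close> its
  value at \<open>u\<close> is 1.\<close>

theorem characters_separate:
  fixes u x :: "'b::normed_riesz"
  assumes u: "0 \<le> u" and x: "x \<in> principal_ideal u" and nle: "\<not> x \<le> 0"
  obtains h where "h \<in> characters u" "0 < h x"
proof -
  \<comment> \<open>The explicit carrier matters here: off the principal ideal there may be no
    multiple of \<open>u\<close> above the vector, and \<open>p\<close> would be an infimum over the
    empty set.\<close>
  interpret real_carrier "principal_ideal u" scaleR
    by unfold_locales (auto simp: algebra_simps intro: principal_ideal_zero[OF u] principal_ideal_add principal_ideal_scaleR)
  define p where "p x = Inf {t. x \<le> t *\<^sub>R u}" for x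
  have u0: "\<not> u \<le> 0"
  proof
    assume "u \<le> 0"
    with u have "u = 0" by simp
    with x nle show False by (auto simp: principal_ideal_def)
  qed
  have lower: "- s \<le> t" if "\<bar>x\<bar> \<le> s *\<^sub>R u" "x \<le> t *\<^sub>R u" for x s t
  proof (rule ccontr)
    assume "\<not> - s \<le> t"
    then have pos: "0 < - s - t" by simp
    have "(- s) *\<^sub>R u \<le> t *\<^sub>R u" using abs_le_D(3)[OF that(1)] that(2) by simp
    then have "(- s - t) *\<^sub>R u \<le> 0" by (simp add: scaleR_diff_left)
    then have "inverse (- s - t) *\<^sub>R ((- s - t) *\<^sub>R u) \<le> inverse (- s - t) *\<^sub>R 0"
      using pos by (intro scaleR_left_mono) auto
    then show False using u0 pos by simp
  qed
  have bdd: "bdd_below {t. x \<le> t *\<^sub>R u}" if x: "x \<in> principal_ideal u" for x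
  proof -
    obtain s where "\<bar>x\<bar> \<le> s *\<^sub>R u" using x by (auto simp: principal_ideal_def)
    from lower[OF this] show ?thesis by (intro bdd_belowI) auto
  qed
  have ne: "{t. x \<le> t *\<^sub>R u} \<noteq> {}" if "x \<in> principal_ideal u" for x
    using that abs_le_D(1) by (auto simp: principal_ideal_def)
  have p_le: "p x \<le> t" if "x \<in> principal_ideal u" "x \<le> t *\<^sub>R u" for x t
    unfolding p_def using that bdd by (intro cInf_lower) auto
  have p_approx: "x \<le> (p x + e) *\<^sub>R u" if x: "x \<in> principal_ideal u" and e: "0 < e" for x e
  proof -
    have "Inf {t. x \<le> t *\<^sub>R u} < p x + e" unfolding p_def using e by simp
    then obtain t where "x \<le> t *\<^sub>R u" "t < p x + e" using cInf_lessD[OF ne[OF x]] by auto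
    then show ?thesis using u by (meson less_imp_le order_trans scaleR_right_mono)
  qed
  \<comment> \<open>The Archimedean property makes the infimum a minimum; all later properties of
    \<open>p\<close> are read off from the order.\<close>
  have p_attained: "x \<le> p x *\<^sub>R u" if "x \<in> principal_ideal u" for x
    by (rule archimedean_le[of _ _ u]) (use p_approx[OF that] in \<open>simp add: scaleR_add_left\<close>)
  have sub: "sublinear p"
    unfolding sublinear_def
  proof (intro conjI ballI allI impI)
    fix x y assume xy: "x \<in> principal_ideal u" "y \<in> principal_ideal u"
    show "p (x + y) \<le> p x + p y"
      using add_mono[OF p_attained[OF xy(1)] p_attained[OF xy(2)]] xy
      by (intro p_le principal_ideal_add) (simp_all add: scaleR_add_left)
  next
    fix r x assume "(0::real) < r" "x \<in> principal_ideal u"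
    then show "p (r *\<^sub>R x) \<le> r * p x"
      using scaleR_left_mono[OF p_attained[of x], of r]
      by (intro p_le principal_ideal_scaleR) simp_all
  qed
  have pm: "p x \<le> p y" if "x \<le> y" "x \<in> principal_ideal u" "y \<in> principal_ideal u" for x y
    using p_le[OF that(2)] p_attained[OF that(3)] that(1) by (meson order_trans)
  have sup: "sup_preserving True sup p"
    unfolding sup_preserving_def
  proof (intro impI ballI antisym)
    fix x y assume xy: "x \<in> principal_ideal u" "y \<in> principal_ideal u"
    have "x \<le> max (p x) (p y) *\<^sub>R u" "y \<le> max (p x) (p y) *\<^sub>R u"
      using p_attained[OF xy(1)] p_attained[OF xy(2)] u
      by (meson max.cobounded1 max.cobounded2 order_trans scaleR_right_mono)+
    then show "p (sup x y) \<le> max (p x) (p y)"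
      using xy by (intro p_le principal_ideal_sup) auto
    show "max (p x) (p y) \<le> p (sup x y)"
      using xy by (auto intro: pm principal_ideal_sup)
  qed
  obtain h where h: "linear_on h" "sup_preserving True sup h"
      "\<And>x. x \<in> principal_ideal u \<Longrightarrow> h x \<le> p x" "h x = p x"
    by (rule linear_minorant[OF _ _ sub sup x])
       (auto simp: add_sup_distrib_right principal_ideal_sup)
  have hu: "h u = 1"
  proof (rule antisym)
    show "h u \<le> 1" using h(3)[OF principal_ideal_self[OF u]] p_le[OF principal_ideal_self[OF u], of 1] by simp
    have "h (- u) \<le> - 1"
      using h(3)[of "- u"] p_le[of "- u" "- 1"] principal_ideal_self[OF u] by (simp add: principal_ideal_minus)
    moreover have "h (- u) = - h u"
      using h(1) principal_ideal_self[OF u] unfolding linear_on_def by (metis mult_minus1 scaleR_minus1_left)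
    ultimately show "1 \<le> h u" by simp
  qed
  have "h \<in> characters u"
    using h hu by (auto simp: characters_def linear_on_def sup_preserving_def)
  moreover have "0 < p x"
  proof (rule ccontr)
    assume "\<not> 0 < p x"
    then have "p x *\<^sub>R u \<le> 0" using u by (simp add: scaleR_nonpos_nonneg)
    with p_attained[OF x] nle show False by (meson order_trans)
  qed
  ultimately show ?thesis using that h(4) by simp
qed

lemma le_by_characters:
  fixes u x y :: "'b::normed_riesz"
  assumes "0 \<le> u" "x \<in> principal_ideal u" "y \<in> principal_ideal u"
    and "\<And>h. h \<in> characters u \<Longrightarrow> h x \<le> h y"
  shows "x \<le> y"
proof (rule ccontr)
  assume "\<not> x \<le> y"
  then have "\<not> x - y \<le> 0" by simp
  then obtain h where "h \<in> characters u" "0 < h (x - y)"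
    using characters_separate[of u "x - y"] assms principal_ideal_diff by blast
  with assms show False by (fastforce simp: char_diff)
qed

lemma eq_by_characters:
  fixes u x y :: "'b::normed_riesz"
  assumes "0 \<le> u" "x \<in> principal_ideal u" "y \<in> principal_ideal u"
    and "\<And>h. h \<in> characters u \<Longrightarrow> h x = h y"
  shows "x = y"
proof (rule antisym)
  show "x \<le> y" by (rule le_by_characters[OF assms(1-3)]) (simp add: assms(4))
  show "y \<le> x" by (rule le_by_characters[OF assms(1,3,2)]) (simp add: assms(4))
qed


section \<open>The center of a normed Riesz space\<close>

definition central :: "('b::normed_riesz \<Rightarrow> 'b) \<Rightarrow> bool" where
  "central t \<longleftrightarrow> linear t \<and> (\<exists>M\<ge>0. \<forall>x. \<bar>t x\<bar> \<le> M *\<^sub>R \<bar>x\<bar>)"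

lemma linear_bound_from_cone:
  fixes t :: "'b::normed_riesz \<Rightarrow> 'b"
  assumes t: "linear t" and le: "\<And>x. 0 \<le> x \<Longrightarrow> \<bar>t x\<bar> \<le> M *\<^sub>R x"
  shows "\<bar>t x\<bar> \<le> M *\<^sub>R \<bar>x\<bar>"
proof -
  have "t x = t (pprt x) - t (pprt (- x))"
    using linear_diff[OF t, of "pprt x" "pprt (- x)"] by (simp add: pprt_diff_eq)
  then have "\<bar>t x\<bar> \<le> \<bar>t (pprt x)\<bar> + \<bar>t (pprt (- x))\<bar>" by (simp add: abs_triangle_ineq4)
  also have "\<dots> \<le> M *\<^sub>R pprt x + M *\<^sub>R pprt (- x)" by (intro add_mono le) auto
  finally show ?thesis by (simp add: abs_eq_pprt scaleR_add_right)
qed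

lemma centralI:
  assumes "linear t" "\<And>x. 0 \<le> x \<Longrightarrow> \<bar>t x\<bar> \<le> M *\<^sub>R x"
  shows "central t"
  unfolding central_def
proof (intro conjI assms exI allI)
  show "\<bar>t x\<bar> \<le> \<bar>M\<bar> *\<^sub>R \<bar>x\<bar>" for x
    by (rule linear_bound_from_cone[OF assms(1)]) (meson abs_ge_self assms(2) order_trans scaleR_right_mono)
qed simp

lemma central_ideal: "central t \<Longrightarrow> x \<in> principal_ideal u \<Longrightarrow> t x \<in> principal_ideal u"
proof -
  assume "central t" and x: "x \<in> principal_ideal u"
  then obtain M where M: "0 \<le> M" "\<bar>t x\<bar> \<le> M *\<^sub>R \<bar>x\<bar>" by (auto simp: central_def)
  show "t x \<in> principal_ideal u"
    by (rule principal_ideal_mono[of _ "M *\<^sub>R \<bar>x\<bar>"])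
       (use M x in \<open>simp_all add: abs_scaleR principal_ideal_scaleR principal_ideal_abs\<close>)
qed

text \<open>In the Kakutani representation a central operator is a multiplication operator.\<close>

lemma char_central:
  assumes t: "central t" and u: "0 \<le> u" and h: "h \<in> characters u" and x: "x \<in> principal_ideal u"
  shows "h (t x) = h (t u) * h x"
proof -
  obtain M where lin: "linear t" and M: "\<And>x. \<bar>t x\<bar> \<le> M *\<^sub>R \<bar>x\<bar>"
    using t by (auto simp: central_def)
  note [simp] = principal_ideal_self[OF u] x central_ideal[OF t] principal_ideal_diff
    principal_ideal_scaleR principal_ideal_abs
  have "\<bar>h (t (x - h x *\<^sub>R u))\<bar> \<le> h (M *\<^sub>R \<bar>x - h x *\<^sub>R u\<bar>)"
    using char_mono[OF h _ _ M[of "x - h x *\<^sub>R u"]] by (simp add: char_abs[OF h])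
  also have "\<dots> = 0"
    by (simp add: char_scaleR[OF h] char_abs[OF h] char_diff[OF h] char_unit[OF h])
  finally have "h (t x - h x *\<^sub>R t u) = 0"
    by (simp add: linear_diff[OF lin] linear_scale[OF lin])
  then show ?thesis by (simp add: char_diff[OF h] char_scaleR[OF h])
qed

lemma central_add: "central s \<Longrightarrow> central t \<Longrightarrow> central (\<lambda>x. s x + t x)"
proof -
  assume s: "central s" and t: "central t"
  obtain M N where "\<And>x. \<bar>s x\<bar> \<le> M *\<^sub>R \<bar>x\<bar>" "\<And>x. \<bar>t x\<bar> \<le> N *\<^sub>R \<bar>x\<bar>"
    using s t by (auto simp: central_def)
  from add_mono[OF this] have "\<bar>s x + t x\<bar> \<le> (M + N) *\<^sub>R \<bar>x\<bar>" for x
    by (metis abs_triangle_ineq order_trans scaleR_add_left)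
  then show ?thesis
    using s t by (intro centralI[where M = "M + N"]) (simp add: central_def linear_compose_add, metis abs_of_nonneg)
qed

lemma central_scaleR: "central s \<Longrightarrow> central (\<lambda>x. r *\<^sub>R s x)"
proof -
  assume s: "central s"
  obtain M where "\<And>x. \<bar>s x\<bar> \<le> M *\<^sub>R \<bar>x\<bar>" using s by (auto simp: central_def)
  from scaleR_left_mono[OF this, of "\<bar>r\<bar>"] have "\<bar>r *\<^sub>R s x\<bar> \<le> (\<bar>r\<bar> * M) *\<^sub>R \<bar>x\<bar>" for x
    by (simp add: abs_scaleR)
  then show ?thesis using s
    by (intro centralI[where M = "\<bar>r\<bar> * M"]) (simp add: central_def linear_compose_scale_right, metis abs_of_nonneg)
qed

lemma central_zero: "central (\<lambda>x. 0)"
  by (rule centralI[of _ 0]) (auto simp: linear_zero)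

lemma central_id: "central (\<lambda>x. x)"
  by (rule centralI[of _ 1]) (auto simp: linear_id[unfolded id_def])

lemma central_minus: "central s \<Longrightarrow> central (\<lambda>x. - s x)"
  using central_scaleR[of s "- 1"] by simp

lemma central_diff: "central s \<Longrightarrow> central t \<Longrightarrow> central (\<lambda>x. s x - t x)"
  using central_add[OF _ central_minus, of s t] by simp

lemma central_comp: "central s \<Longrightarrow> central t \<Longrightarrow> central (\<lambda>x. s (t x))"
proof -
  assume s: "central s" and t: "central t"
  obtain M N where MN: "0 \<le> M" "\<And>x. \<bar>s x\<bar> \<le> M *\<^sub>R \<bar>x\<bar>" "\<And>x. \<bar>t x\<bar> \<le> N *\<^sub>R \<bar>x\<bar>"
    using s t by (auto simp: central_def)
  have "\<bar>s (t x)\<bar> \<le> (M * N) *\<^sub>R \<bar>x\<bar>" for x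
    using MN(2)[of "t x"] scaleR_left_mono[OF MN(3)[of x] MN(1)]
    unfolding scaleR_scaleR by (rule order_trans)
  then show ?thesis
    using s t linear_compose[of t s, unfolded o_def]
    by (intro centralI[where M = "M * N"]) (simp add: central_def, metis abs_of_nonneg)
qed

text \<open>On the cone the supremum in the center is the pointwise one. At a character of
  \<open>x + y\<close> both operators multiply by constants \<open>a\<close> and \<open>b\<close>,
  so additivity reduces to \<open>max (a * c) (b * c) = max a b * c\<close> for
  \<open>c \<ge> 0\<close>.\<close>

lemma central_sup:
  assumes s: "central s" and t: "central t"
  defines "f \<equiv> cone_extension (\<lambda>x. sup (s x) (t x))"
  shows "central f" "0 \<le> x \<Longrightarrow> f x = sup (s x) (t x)"
proof -
  have lin: "linear s" "linear t" using s t by (auto simp: central_def)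
  have add: "sup (s (x + y)) (t (x + y)) = sup (s x) (t x) + sup (s y) (t y)"
    if "0 \<le> x" "0 \<le> y" for x y
  proof (rule eq_by_characters[of "x + y"])
    show u: "0 \<le> x + y" using that by simp
    have xy: "x \<in> principal_ideal (x + y)" "y \<in> principal_ideal (x + y)"
      using that by (auto intro: principal_ideal_le)
    note [simp] = central_ideal[OF s] central_ideal[OF t] xy principal_ideal_sup principal_ideal_add
    show "sup (s (x + y)) (t (x + y)) \<in> principal_ideal (x + y)"
      "sup (s x) (t x) + sup (s y) (t y) \<in> principal_ideal (x + y)" by simp_all
    fix h assume h: "h \<in> characters (x + y)"
    have nn: "0 \<le> h x" "0 \<le> h y"
      using char_mono[OF h principal_ideal_zero[OF u]] char_zero[OF h xy(1)] that xy by auto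
    note c = char_central[OF s u h] char_central[OF t u h]
    define a b where "a = h (s (x + y))" and "b = h (t (x + y))"
    have m: "max (a * c) (b * c) = max a b * c" if "0 \<le> c" for c
      using that by (simp add: max_mult_distrib_right)
    have "max (a * (h x + h y)) (b * (h x + h y)) = max a b * h x + max a b * h y"
      using nn by (subst m) (simp_all add: distrib_left)
    then have "max (a * (h x + h y)) (b * (h x + h y)) = max (a * h x) (b * h x) + max (a * h y) (b * h y)"
      using nn by (simp only: m)
    then show "h (sup (s (x + y)) (t (x + y))) = h (sup (s x) (t x) + sup (s y) (t y))"
      using c[of x] c[of y] char_add[OF h xy] char_unit[OF h]
      by (simp add: char_sup[OF h] char_add[OF h] a_def b_def)
  qed
  have scale: "sup (s (r *\<^sub>R x)) (t (r *\<^sub>R x)) = r *\<^sub>R sup (s x) (t x)" if "0 < r" for r x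
    using that by (simp add: scaleR_sup linear_scale[OF lin(1)] linear_scale[OF lin(2)])
  have f: "linear f" "\<And>x. 0 \<le> x \<Longrightarrow> f x = sup (s x) (t x)"
    unfolding f_def by (rule linear_cone_extension cone_extension_nonneg; use add scale in auto)+
  then show "0 \<le> x \<Longrightarrow> f x = sup (s x) (t x)" by simp
  obtain M N where MN: "0 \<le> M" "0 \<le> N" "\<And>x. \<bar>s x\<bar> \<le> M *\<^sub>R \<bar>x\<bar>" "\<And>x. \<bar>t x\<bar> \<le> N *\<^sub>R \<bar>x\<bar>"
    using s t by (auto simp: central_def)
  show "central f"
  proof (rule centralI[OF f(1)])
    fix x :: 'a assume x: "0 \<le> x"
    have b: "M *\<^sub>R x \<le> (M + N) *\<^sub>R x" "N *\<^sub>R x \<le> (M + N) *\<^sub>R x"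
      using x MN by (auto intro!: scaleR_right_mono)
    have "\<bar>s x\<bar> \<le> (M + N) *\<^sub>R x" "\<bar>t x\<bar> \<le> (M + N) *\<^sub>R x"
      using MN(3)[of x] MN(4)[of x] b x by (auto intro: order_trans)
    then have "sup (s x) (t x) \<le> (M + N) *\<^sub>R x" "- sup (s x) (t x) \<le> (M + N) *\<^sub>R x"
      by (auto dest: abs_le_D intro: le_infI1)
    then show "\<bar>f x\<bar> \<le> (M + N) *\<^sub>R x" using f(2)[OF x] by (simp add: abs_leI)
  qed
qed

text \<open>At each character both compositions multiply by the same two numbers.\<close>

lemma central_commute:
  assumes s: "central s" and t: "central t"
  shows "s (t x) = t (s x)"
proof -
  have lin: "linear s" "linear t" using s t by (auto simp: central_def)
  have pos: "s (t x) = t (s x)" if x: "0 \<le> x" for x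
  proof (rule eq_by_characters[OF x])
    note [simp] = central_ideal[OF s] central_ideal[OF t] principal_ideal_self[OF x]
    show "s (t x) \<in> principal_ideal x" "t (s x) \<in> principal_ideal x" by simp_all
    fix h assume h: "h \<in> characters x"
    show "h (s (t x)) = h (t (s x))"
      using char_central[OF s x h, of "t x"] char_central[OF t x h, of "s x"] by simp
  qed
  have "s (t (pprt x - pprt (- x))) = t (s (pprt x - pprt (- x)))"
    using lin by (simp add: linear_diff pos)
  then show ?thesis by (simp add: pprt_diff_eq)
qed

section \<open>The center as a commutative ordered algebra and a normed Riesz space\<close>

typedef (overloaded) 'b center_op = "{t :: 'b::normed_riesz \<Rightarrow> 'b. central t}"
  morphisms capp Abs_center_op
  by (rule exI[of _ "\<lambda>x. 0"]) (simp add: central_zero)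

setup_lifting type_definition_center_op

lemma central_capp [simp]: "central (capp t)"
  using capp[of t] by simp

lemma linear_capp [simp]: "linear (capp t)"
  using central_capp[of t] by (simp add: central_def)

lemmas capp_add_right = linear_add[OF linear_capp]
  and capp_diff_right = linear_diff[OF linear_capp]
  and capp_minus_right = linear_neg[OF linear_capp]
  and capp_scaleR_right = linear_scale[OF linear_capp]
  and capp_zero_right = linear_0[OF linear_capp]

lemma center_op_eqI: "(\<And>x. 0 \<le> x \<Longrightarrow> capp s x = capp t x) \<Longrightarrow> s = t"
proof -
  assume *: "\<And>x. 0 \<le> x \<Longrightarrow> capp s x = capp t x"
  have "capp s (pprt x - pprt (- x)) = capp t (pprt x - pprt (- x))" for x
    by (simp add: * capp_diff_right)
  then show ?thesis by (simp add: pprt_diff_eq capp_inject[symmetric] fun_eq_iff)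
qed

instantiation center_op :: (normed_riesz) "{real_vector, comm_ring, comm_monoid_mult, lattice_ab_group_add_abs}"
begin

lift_definition zero_center_op :: "'a center_op" is "\<lambda>x. 0" by (rule central_zero)
lift_definition one_center_op :: "'a center_op" is "\<lambda>x. x" by (rule central_id)
lift_definition plus_center_op :: "'a center_op \<Rightarrow> 'a center_op \<Rightarrow> 'a center_op"
  is "\<lambda>s t x. s x + t x" by (rule central_add)
lift_definition minus_center_op :: "'a center_op \<Rightarrow> 'a center_op \<Rightarrow> 'a center_op"
  is "\<lambda>s t x. s x - t x" by (rule central_diff)
lift_definition uminus_center_op :: "'a center_op \<Rightarrow> 'a center_op" is "\<lambda>s x. - s x"
  by (rule central_minus)
lift_definition scaleR_center_op :: "real \<Rightarrow> 'a center_op \<Rightarrow> 'a center_op"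
  is "\<lambda>r s x. r *\<^sub>R s x" by (rule central_scaleR)
lift_definition times_center_op :: "'a center_op \<Rightarrow> 'a center_op \<Rightarrow> 'a center_op"
  is "\<lambda>s t x. s (t x)" by (rule central_comp)
lift_definition sup_center_op :: "'a center_op \<Rightarrow> 'a center_op \<Rightarrow> 'a center_op"
  is "\<lambda>s t. cone_extension (\<lambda>x. sup (s x) (t x))" by (rule central_sup)
definition less_eq_center_op :: "'a center_op \<Rightarrow> 'a center_op \<Rightarrow> bool" where
  "less_eq_center_op s t \<longleftrightarrow> (\<forall>x\<ge>0. capp s x \<le> capp t x)"
definition less_center_op :: "'a center_op \<Rightarrow> 'a center_op \<Rightarrow> bool" where
  "less_center_op s t \<longleftrightarrow> s \<le> t \<and> \<not> t \<le> s"
definition inf_center_op :: "'a center_op \<Rightarrow> 'a center_op \<Rightarrow> 'a center_op" where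
  "inf_center_op s t = - sup (- s) (- t)"
definition abs_center_op :: "'a center_op \<Rightarrow> 'a center_op" where
  "abs_center_op s = sup s (- s)"

lemmas capp_simps = zero_center_op.rep_eq one_center_op.rep_eq plus_center_op.rep_eq
  minus_center_op.rep_eq uminus_center_op.rep_eq scaleR_center_op.rep_eq times_center_op.rep_eq

lemma capp_sup: "0 \<le> x \<Longrightarrow> capp (sup s t) x = sup (capp s x) (capp t x)"
  unfolding sup_center_op.rep_eq by (rule central_sup) auto

instance
proof
  fix a b c :: "'a center_op" and r s :: real
  show "a + b + c = a + (b + c)" "a + b = b + a" "0 + a = a" "- a + a = 0" "a - b = a + - b"
    "r *\<^sub>R (a + b) = r *\<^sub>R a + r *\<^sub>R b" "(r + s) *\<^sub>R a = r *\<^sub>R a + s *\<^sub>R a" "r *\<^sub>R s *\<^sub>R a = (r * s) *\<^sub>R a"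
    "1 *\<^sub>R a = a" "a * b * c = a * (b * c)" "1 * a = a" "(a + b) * c = a * c + b * c"
    by (rule center_op_eqI; simp add: capp_simps algebra_simps)+
  show "a * b = b * a"
    by (rule center_op_eqI) (simp add: capp_simps central_commute[OF central_capp central_capp])
  show "a \<le> a" "(a < b) = (a \<le> b \<and> \<not> b \<le> a)" by (auto simp: less_eq_center_op_def less_center_op_def)
  show "a \<le> b \<Longrightarrow> b \<le> c \<Longrightarrow> a \<le> c" by (auto simp: less_eq_center_op_def intro: order_trans)
  show "a \<le> b \<Longrightarrow> b \<le> a \<Longrightarrow> a = b"
    by (rule center_op_eqI) (auto simp: less_eq_center_op_def intro: antisym)
  show "a \<le> b \<Longrightarrow> c + a \<le> c + b" by (auto simp: less_eq_center_op_def capp_simps)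
  show "a \<le> sup a b" "b \<le> sup a b" by (auto simp: less_eq_center_op_def capp_sup)
  show "b \<le> a \<Longrightarrow> c \<le> a \<Longrightarrow> sup b c \<le> a" by (auto simp: less_eq_center_op_def capp_sup)
  show "inf a b \<le> a" "inf a b \<le> b" "a \<le> b \<Longrightarrow> a \<le> c \<Longrightarrow> a \<le> inf b c"
    by (auto simp: less_eq_center_op_def capp_sup capp_simps inf_center_op_def)
  show "\<bar>a\<bar> = sup a (- a)" by (rule abs_center_op_def)
qed

end

instance center_op :: (normed_riesz) ordered_real_vector
  by standard (auto simp: less_eq_center_op_def capp_simps intro: scaleR_left_mono scaleR_right_mono)

lemma capp_inf: "0 \<le> x \<Longrightarrow> capp (inf s t) x = inf (capp s x) (capp t x)"
  unfolding inf_center_op_def uminus_center_op.rep_eq by (simp add: capp_sup uminus_center_op.rep_eq)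

lemma capp_abs: "0 \<le> x \<Longrightarrow> capp \<bar>s\<bar> x = \<bar>capp s x\<bar>"
  by (simp add: abs_center_op_def capp_sup capp_simps abs_lattice)

instantiation center_op :: (normed_riesz) real_normed_vector
begin

text \<open>The order unit norm for the unit 1, chosen because its compatibility with the order is
  immediate. By \<open>norm_capp_le\<close> and \<open>central_contraction_le_one\<close> it equals
  the operator norm.\<close>

definition norm_center_op :: "'a center_op \<Rightarrow> real" where
  "norm_center_op t = Inf {M. 0 \<le> M \<and> (\<forall>x. \<bar>capp t x\<bar> \<le> M *\<^sub>R \<bar>x\<bar>)}"
definition dist_center_op :: "'a center_op \<Rightarrow> 'a center_op \<Rightarrow> real" where
  "dist_center_op s t = norm (s - t)"
definition sgn_center_op :: "'a center_op \<Rightarrow> 'a center_op" where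
  "sgn_center_op t = t /\<^sub>R norm t"
definition uniformity_center_op :: "('a center_op \<times> 'a center_op) filter" where
  "uniformity_center_op = (INF e\<in>{0 <..}. principal {(s, t). dist s t < e})"
definition open_center_op :: "'a center_op set \<Rightarrow> bool" where
  "open_center_op U \<longleftrightarrow> (\<forall>s\<in>U. eventually (\<lambda>(s', t). s' = s \<longrightarrow> t \<in> U) uniformity)"

lemma norm_center_op_le:
  assumes "0 \<le> M" "\<And>x. 0 \<le> x \<Longrightarrow> \<bar>capp t x\<bar> \<le> M *\<^sub>R x"
  shows "norm t \<le> M"
  unfolding norm_center_op_def
  by (rule cInf_lower) (auto intro!: assms linear_bound_from_cone bdd_belowI[of _ 0])

lemma abs_capp_le: "\<bar>capp t x\<bar> \<le> norm t *\<^sub>R \<bar>x\<bar>"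
proof (rule archimedean_le[of _ _ "\<bar>x\<bar>"])
  fix e :: real assume e: "0 < e"
  let ?S = "{M. 0 \<le> M \<and> (\<forall>x. \<bar>capp t x\<bar> \<le> M *\<^sub>R \<bar>x\<bar>)}"
  have S: "?S \<noteq> {}" using central_capp[of t] by (auto simp: central_def)
  have "Inf ?S < norm t + e" using e by (simp add: norm_center_op_def)
  from cInf_lessD[OF S this] obtain M where "M \<in> ?S" "M < norm t + e" by auto
  then have "\<bar>capp t x\<bar> \<le> M *\<^sub>R \<bar>x\<bar>" "M *\<^sub>R \<bar>x\<bar> \<le> (norm t + e) *\<^sub>R \<bar>x\<bar>"
    by (auto intro!: scaleR_right_mono)
  then show "\<bar>capp t x\<bar> \<le> norm t *\<^sub>R \<bar>x\<bar> + e *\<^sub>R \<bar>x\<bar>" unfolding scaleR_add_left by (rule order_trans)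
qed

lemma norm_center_op_nonneg: "0 \<le> norm (t :: 'a center_op)"
  unfolding norm_center_op_def using central_capp[of t]
  by (intro cInf_greatest) (auto simp: central_def)

instance
proof
  fix a b :: "'a center_op" and r :: real
  show "dist a b = norm (a - b)" by (rule dist_center_op_def)
  show "sgn a = a /\<^sub>R norm a" by (rule sgn_center_op_def)
  show "uniformity = (INF e\<in>{0 <..}. principal {(x :: 'a center_op, y). dist x y < e})"
    by (rule uniformity_center_op_def)
  show "open U = (\<forall>x\<in>U. eventually (\<lambda>(x', y). x' = x \<longrightarrow> y \<in> U) uniformity)" for U :: "'a center_op set"
    by (rule open_center_op_def)
  show "norm a = 0 \<longleftrightarrow> a = 0"
  proof
    assume "norm a = 0"
    then show "a = 0"
      using abs_capp_le[of a] by (intro center_op_eqI) (simp add: capp_simps)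
  next
    assume "a = 0"
    then have "norm a \<le> 0" by (intro norm_center_op_le) (auto simp: capp_simps)
    then show "norm a = 0" using norm_center_op_nonneg[of a] by simp
  qed
  show "norm (a + b) \<le> norm a + norm b"
  proof (rule norm_center_op_le)
    fix x :: 'a assume "0 \<le> x"
    then show "\<bar>capp (a + b) x\<bar> \<le> (norm a + norm b) *\<^sub>R x"
      using add_mono[OF abs_capp_le[of a x] abs_capp_le[of b x]] abs_triangle_ineq[of "capp a x" "capp b x"]
      by (simp add: capp_simps scaleR_add_left)
  qed (simp add: norm_center_op_nonneg)
  have le: "norm (r *\<^sub>R a) \<le> \<bar>r\<bar> * norm a" for r and a :: "'a center_op"
  proof (rule norm_center_op_le)
    fix x :: 'a assume "0 \<le> x"
    then show "\<bar>capp (r *\<^sub>R a) x\<bar> \<le> (\<bar>r\<bar> * norm a) *\<^sub>R x"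
      using scaleR_left_mono[OF abs_capp_le[of a x], of "\<bar>r\<bar>"] by (simp add: capp_simps abs_scaleR)
  qed (simp add: norm_center_op_nonneg)
  show "norm (r *\<^sub>R a) = \<bar>r\<bar> * norm a"
  proof (cases "r = 0")
    case True
    then show ?thesis using le[of 0 a] norm_center_op_nonneg[of "0 *\<^sub>R a"] by simp
  next
    case False
    then have "norm a \<le> \<bar>inverse r\<bar> * norm (r *\<^sub>R a)" using le[of "inverse r" "r *\<^sub>R a"] by simp
    then show ?thesis using le[of r a] False by (simp add: field_simps)
  qed
qed

end

lemma abs_capp_le': "0 \<le> x \<Longrightarrow> \<bar>capp t x\<bar> \<le> norm t *\<^sub>R x"
  using abs_capp_le[of t x] by simp

lemma norm_capp_le: "norm (capp t x) \<le> norm t * norm x"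
  using norm_le_of_abs_le'[OF abs_capp_le[of t x]] by simp

instance center_op :: (normed_riesz) normed_riesz
proof
  fix s t :: "'a center_op" assume le: "\<bar>s\<bar> \<le> \<bar>t\<bar>"
  show "norm s \<le> norm t"
  proof (rule norm_center_op_le)
    fix x :: 'a assume x: "0 \<le> x"
    have "capp \<bar>s\<bar> x \<le> capp \<bar>t\<bar> x" using le x by (simp add: less_eq_center_op_def)
    then have "\<bar>capp s x\<bar> \<le> \<bar>capp t x\<bar>" by (simp only: capp_abs[OF x])
    also have "\<dots> \<le> norm t *\<^sub>R x" using x by (rule abs_capp_le')
    finally show "\<bar>capp s x\<bar> \<le> norm t *\<^sub>R x" .
  qed simp
qed

lemma abs_le_norm_one: "\<bar>t\<bar> \<le> norm t *\<^sub>R (1 :: 'b::normed_riesz center_op)"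
  by (simp add: less_eq_center_op_def capp_abs abs_capp_le' capp_simps)

text \<open>Equality fails on the zero space, where the identity has norm 0.\<close>

lemma norm_one_center_op_le: "norm (1 :: 'b::normed_riesz center_op) \<le> 1"
  by (rule norm_center_op_le) (auto simp: capp_simps)

lemma one_center_op_nonneg [simp]: "0 \<le> (1 :: 'b::normed_riesz center_op)"
  by (simp add: less_eq_center_op_def capp_simps)

lemma capp_nonneg: "0 \<le> t \<Longrightarrow> 0 \<le> x \<Longrightarrow> 0 \<le> capp t x"
  by (simp add: less_eq_center_op_def capp_simps)

lemma times_center_op_nonneg: "0 \<le> s \<Longrightarrow> 0 \<le> t \<Longrightarrow> 0 \<le> s * (t :: 'b::normed_riesz center_op)"
  by (simp add: less_eq_center_op_def capp_simps)

lemma norm_times_center_op_le: "norm (s * t) \<le> norm s * norm (t :: 'b::normed_riesz center_op)"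
proof (rule norm_center_op_le)
  fix x :: 'b assume x: "0 \<le> x"
  have "\<bar>capp s (capp t x)\<bar> \<le> norm s *\<^sub>R norm t *\<^sub>R x"
    by (rule order_trans[OF abs_capp_le scaleR_left_mono[OF abs_capp_le'[OF x]]]) simp
  then show "\<bar>capp (s * t) x\<bar> \<le> (norm s * norm t) *\<^sub>R x" by (simp add: capp_simps)
qed simp

lemma scaleR_times_center_op [simp]:
  fixes s t :: "'b::normed_riesz center_op"
  shows "(r *\<^sub>R s) * t = r *\<^sub>R (s * t)" "s * (r *\<^sub>R t) = r *\<^sub>R (s * t)"
  by (rule center_op_eqI; simp add: capp_simps capp_scaleR_right)+

text \<open>
  If \<open>t y \<ge> c y\<close> with \<open>c > 1\<close> on the component \<open>y = (t x - c x)\<^sup>+\<close>, then \<open>t\<^sup>n y \<ge> c\<^sup>n y\<close>; so the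
  operator norm of a central operator is its order unit norm.
\<close>

theorem central_contraction_le_one:
  fixes t :: "'b::normed_riesz center_op"
  assumes contr: "\<And>x. norm (capp t x) \<le> norm x"
  shows "t \<le> 1"
  unfolding less_eq_center_op_def
proof (intro allI impI)
  fix x :: 'b assume x: "0 \<le> x"
  have le: "capp t x \<le> c *\<^sub>R x" if c: "1 < c" for c
  proof -
    define y where "y = pprt (capp t x - c *\<^sub>R x)"
    note [simp] = principal_ideal_self[OF x] principal_ideal_zero[OF x] principal_ideal_closed central_ideal[OF central_capp]
    have y: "y \<in> principal_ideal x" by (simp add: y_def pprt_def)
    have iter: "(capp t ^^ n) y \<in> principal_ideal x" for n by (induction n) (auto simp: y)
    have "c ^ n *\<^sub>R y \<le> (capp t ^^ n) y" for n
    proof (rule le_by_characters[OF x])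
      fix h assume h: "h \<in> characters x"
      have hy: "h y = max (h (capp t x) - c) 0"
        using char_zero[OF h principal_ideal_self[OF x]]
        by (simp add: y_def pprt_def char_sup[OF h] char_diff[OF h] char_scaleR[OF h] char_unit[OF h])
      have "h ((capp t ^^ n) y) = h (capp t x) ^ n * h y"
      proof (induction n)
        case (Suc n)
        then show ?case using char_central[OF central_capp x h iter[of n], of t] by simp
      qed simp
      \<comment> \<open>Where \<open>h (capp t x) \<le> c\<close> the value \<open>h y\<close> is 0;
        only characters with a larger multiplier contribute.\<close>
      moreover have "c ^ n * h y \<le> h (capp t x) ^ n * h y"
        using hy c by (cases "c < h (capp t x)") (auto intro!: mult_right_mono power_mono)
      ultimately show "h (c ^ n *\<^sub>R y) \<le> h ((capp t ^^ n) y)" by (simp add: char_scaleR[OF h] y)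
    qed (simp_all add: y iter)
    moreover have "0 \<le> c ^ n *\<^sub>R y" for n using c by (simp add: y_def scaleR_nonneg_nonneg)
    moreover have "norm ((capp t ^^ n) y) \<le> norm y" for n
    proof (induction n)
      case (Suc n)
      then show ?case using contr[of "(capp t ^^ n) y"] by simp
    qed simp
    ultimately have bound: "c ^ n * norm y \<le> norm y" for n
      using norm_mono_nonneg[of "c ^ n *\<^sub>R y" "(capp t ^^ n) y"] c by (fastforce intro: order_trans)
    have "norm y = 0"
    proof (rule ccontr)
      assume "norm y \<noteq> 0"
      moreover obtain n where "2 < c ^ n" using real_arch_pow[OF c] by blast
      ultimately show False using bound[of n] by (auto simp: mult_le_cancel_right1)
    qed
    then show ?thesis by (simp add: y_def flip: le_zero_iff_zero_pprt)
  qed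
  have "capp t x \<le> x"
  proof (rule archimedean_le[of _ _ x])
    fix e :: real assume "0 < e"
    then show "capp t x \<le> x + e *\<^sub>R x" using le[of "1 + e"] by (simp add: scaleR_add_left)
  qed
  then show "capp t x \<le> capp 1 x" by (simp add: capp_simps)
qed


section \<open>The dual of a normed Riesz space\<close>

typedef (overloaded) 'b rdual = "{f :: 'b::normed_riesz \<Rightarrow> real. bounded_linear f}"
  morphisms dapp Abs_rdual
  by (rule exI[of _ "\<lambda>x. 0"]) (simp add: bounded_linear_zero)

setup_lifting type_definition_rdual

lemma bounded_linear_dapp [simp]: "bounded_linear (dapp f)"
  using dapp[of f] by simp

lemmas linear_dapp = bounded_linear.linear[OF bounded_linear_dapp]
lemmas dapp_add_right = linear_add[OF linear_dapp]
  and dapp_diff_right = linear_diff[OF linear_dapp]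
  and dapp_minus_right = linear_neg[OF linear_dapp]
  and dapp_scaleR_right = linear_scale[OF linear_dapp, unfolded real_scaleR_def]
  and dapp_zero_right = linear_0[OF linear_dapp]

lemma rdual_eqI: "(\<And>x. 0 \<le> x \<Longrightarrow> dapp f x = dapp g x) \<Longrightarrow> f = g"
proof -
  assume *: "\<And>x. 0 \<le> x \<Longrightarrow> dapp f x = dapp g x"
  have "dapp f (pprt x - pprt (- x)) = dapp g (pprt x - pprt (- x))" for x
    by (simp add: * dapp_diff_right)
  then show ?thesis by (simp add: pprt_diff_eq dapp_inject[symmetric] fun_eq_iff)
qed

lemma norm_pprt_le: "norm (pprt x) \<le> norm (x :: 'b::normed_riesz)"
  by (rule norm_le_of_abs_le) (simp add: abs_eq_pprt)

lemma bounded_linear_from_cone: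
  fixes f :: "'b::normed_riesz \<Rightarrow> real"
  assumes f: "linear f" and le: "\<And>x. 0 \<le> x \<Longrightarrow> \<bar>f x\<bar> \<le> C * norm x"
  shows "bounded_linear f"
proof (rule bounded_linear_intro[of _ "2 * \<bar>C\<bar>"])
  show "f (x + y) = f x + f y" "f (r *\<^sub>R x) = r *\<^sub>R f x" for x y r
    using f by (simp_all add: linear_add linear_scale)
  fix x
  have "f x = f (pprt x) - f (pprt (- x))"
    using linear_diff[OF f, of "pprt x" "pprt (- x)"] by (simp add: pprt_diff_eq)
  then have "\<bar>f x\<bar> \<le> C * norm (pprt x) + C * norm (pprt (- x))"
    using le[of "pprt x"] le[of "pprt (- x)"] by simp
  also have "\<dots> \<le> \<bar>C\<bar> * norm x + \<bar>C\<bar> * norm x"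
    using norm_pprt_le[of x] norm_pprt_le[of "- x"] by (intro add_mono mult_mono) auto
  finally show "norm (f x) \<le> norm x * (2 * \<bar>C\<bar>)" by (simp add: algebra_simps)
qed

instantiation rdual :: (normed_riesz) "{real_vector, ordered_ab_group_add}"
begin

lift_definition zero_rdual :: "'a rdual" is "\<lambda>x. 0" by (rule bounded_linear_zero)
lift_definition plus_rdual :: "'a rdual \<Rightarrow> 'a rdual \<Rightarrow> 'a rdual"
  is "\<lambda>f g x. f x + g x" by (rule bounded_linear_add)
lift_definition minus_rdual :: "'a rdual \<Rightarrow> 'a rdual \<Rightarrow> 'a rdual"
  is "\<lambda>f g x. f x - g x" by (rule bounded_linear_sub)
lift_definition uminus_rdual :: "'a rdual \<Rightarrow> 'a rdual" is "\<lambda>f x. - f x"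
  by (rule bounded_linear_minus)
lift_definition scaleR_rdual :: "real \<Rightarrow> 'a rdual \<Rightarrow> 'a rdual"
  is "\<lambda>r f x. r * f x" by (rule bounded_linear_const_mult)
definition less_eq_rdual :: "'a rdual \<Rightarrow> 'a rdual \<Rightarrow> bool" where
  "less_eq_rdual f g \<longleftrightarrow> (\<forall>x\<ge>0. dapp f x \<le> dapp g x)"
definition less_rdual :: "'a rdual \<Rightarrow> 'a rdual \<Rightarrow> bool" where
  "less_rdual f g \<longleftrightarrow> f \<le> g \<and> \<not> g \<le> f"

lemmas dapp_simps = zero_rdual.rep_eq plus_rdual.rep_eq minus_rdual.rep_eq
  uminus_rdual.rep_eq scaleR_rdual.rep_eq

instance
proof
  fix a b c :: "'a rdual" and r s :: real
  show "a + b + c = a + (b + c)" "a + b = b + a" "0 + a = a" "- a + a = 0" "a - b = a + - b"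
    "r *\<^sub>R (a + b) = r *\<^sub>R a + r *\<^sub>R b" "(r + s) *\<^sub>R a = r *\<^sub>R a + s *\<^sub>R a" "r *\<^sub>R s *\<^sub>R a = (r * s) *\<^sub>R a"
    "1 *\<^sub>R a = a"
    by (rule rdual_eqI; simp add: dapp_simps algebra_simps)+
  show "a \<le> a" "(a < b) = (a \<le> b \<and> \<not> b \<le> a)" by (auto simp: less_eq_rdual_def less_rdual_def)
  show "a \<le> b \<Longrightarrow> b \<le> c \<Longrightarrow> a \<le> c" by (auto simp: less_eq_rdual_def intro: order_trans)
  show "a \<le> b \<Longrightarrow> b \<le> a \<Longrightarrow> a = b"
    by (rule rdual_eqI) (auto simp: less_eq_rdual_def intro: antisym)
  show "a \<le> b \<Longrightarrow> c + a \<le> c + b" by (auto simp: less_eq_rdual_def dapp_simps)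
qed

end

instance rdual :: (normed_riesz) ordered_real_vector
  by standard (auto simp: less_eq_rdual_def dapp_simps intro: mult_left_mono mult_right_mono)

lemma dapp_mono_left: "f \<le> g \<Longrightarrow> 0 \<le> x \<Longrightarrow> dapp f x \<le> dapp g x"
  by (simp add: less_eq_rdual_def)

lemma dapp_nonneg: "0 \<le> f \<Longrightarrow> 0 \<le> x \<Longrightarrow> 0 \<le> dapp f x"
  using dapp_mono_left[of 0 f x] by (simp add: dapp_simps)

lemma dapp_mono_right: "0 \<le> f \<Longrightarrow> x \<le> y \<Longrightarrow> dapp f x \<le> dapp f y"
  using dapp_nonneg[of f "y - x"] by (simp add: dapp_diff_right)

lemma abs_dapp_le: "0 \<le> f \<Longrightarrow> \<bar>dapp f x\<bar> \<le> dapp f \<bar>x\<bar>"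
  using dapp_mono_right[of f x "\<bar>x\<bar>"] dapp_mono_right[of f "- x" "\<bar>x\<bar>"]
  by (simp add: dapp_minus_right abs_le_iff abs_ge_self abs_ge_minus_self)

text \<open>
  \<open>split_sum F x r\<close>: \<open>r\<close> is a sum \<open>\<Sum> f\<^sub>i (x\<^sub>i)\<close> with \<open>f\<^sub>i \<in> F\<close>, \<open>x\<^sub>i \<ge> 0\<close> and \<open>\<Sum> x\<^sub>i = x\<close>. The
  supremum of all such \<open>r\<close> is the value at \<open>x\<close> of the least upper bound of \<open>F\<close>.
\<close>

inductive split_sum :: "'b::normed_riesz rdual set \<Rightarrow> 'b \<Rightarrow> real \<Rightarrow> bool" for F where
  single: "f \<in> F \<Longrightarrow> 0 \<le> x \<Longrightarrow> split_sum F x (dapp f x)"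
| add: "split_sum F x r \<Longrightarrow> split_sum F y s \<Longrightarrow> split_sum F (x + y) (r + s)"

lemma split_sum_nonneg: "split_sum F x r \<Longrightarrow> 0 \<le> x"
  by (induction rule: split_sum.induct) auto

lemma split_sum_scaleR: "split_sum F x r \<Longrightarrow> 0 < t \<Longrightarrow> split_sum F (t *\<^sub>R x) (t * r)"
proof (induction rule: split_sum.induct)
  case (single f x)
  then show ?case using split_sum.single[of f F "t *\<^sub>R x"] by (simp add: dapp_scaleR_right scaleR_nonneg_nonneg)
next
  case (add x r y s)
  then show ?case using split_sum.add by (simp add: scaleR_add_right distrib_left)
qed

text \<open>Riesz decomposition distributes every summand of \<open>z\<close> over \<open>x\<close>
  and \<open>y\<close>. This gives subadditivity of the supremum of split sums.\<close>

lemma split_sum_decompose: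
  "split_sum F z r \<Longrightarrow> 0 \<le> x \<Longrightarrow> 0 \<le> y \<Longrightarrow> z = x + y \<Longrightarrow>
    \<exists>r1 r2. split_sum F x r1 \<and> split_sum F y r2 \<and> r = r1 + r2"
proof (induction arbitrary: x y rule: split_sum.induct)
  case (single f z)
  then show ?case using split_sum.single by (metis dapp_add_right)
next
  case (add z1 r1 z2 r2)
  have z: "0 \<le> z1" "0 \<le> z2" using add.hyps split_sum_nonneg by auto
  have "x \<le> z1 + z2" using add.prems by simp
  note d = riesz_decomposition[OF z add.prems(1) this]
  \<comment> \<open>The share of \<open>x\<close> taken from \<open>z1\<close>; the remainder
    \<open>x - a\<close> fits into \<open>z2\<close>.\<close>
  define a where "a = inf x z1"
  note d = d[folded a_def]
  obtain p1 p2 where p: "split_sum F a p1" "split_sum F (z1 - a) p2" "r1 = p1 + p2"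
    using add.IH(1)[of a "z1 - a"] d by auto
  obtain q1 q2 where q: "split_sum F (x - a) q1" "split_sum F (z2 - (x - a)) q2" "r2 = q1 + q2"
    using add.IH(2)[of "x - a" "z2 - (x - a)"] d by auto
  have "split_sum F (a + (x - a)) (p1 + q1)" "split_sum F ((z1 - a) + (z2 - (x - a))) (p2 + q2)"
    using p q by (intro split_sum.add; simp)+
  moreover have "(z1 - a) + (z2 - (x - a)) = y" using add.prems by (simp add: algebra_simps)
  ultimately show ?case using p q by (intro exI[of _ "p1 + q1"] exI[of _ "p2 + q2"]) simp
qed

lemma split_sum_le:
  assumes "\<And>f. f \<in> F \<Longrightarrow> f \<le> g"
  shows "split_sum F x r \<Longrightarrow> r \<le> dapp g x"
  by (induction rule: split_sum.induct) (auto simp: dapp_add_right assms dapp_mono_left intro: add_mono)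

text \<open>The supremum of all split sums is superadditive by concatenation and subadditive by
  \<open>split_sum_decompose\<close>, hence additive on the cone. The norm bound is taken as
  hypothesis in order to cover both families with an upper bound and pairs of functionals, for which
  an upper bound is only obtained from this lemma.\<close>

lemma rdual_lub_exists_of_bound:
  fixes F :: "'b::normed_riesz rdual set"
  assumes ne: "F \<noteq> {}" and bound: "\<forall>x r. split_sum F x r \<longrightarrow> r \<le> D * norm x"
  shows "\<exists>s. (\<forall>w. s \<le> w \<longleftrightarrow> (\<forall>f\<in>F. f \<le> w)) \<and>
    (\<forall>x\<ge>0. \<forall>e>0. \<exists>r. split_sum F x r \<and> dapp s x < r + e)"
proof -
  obtain f0 where f0: "f0 \<in> F" using ne by auto
  define s where "s x = Sup {r. split_sum F x r}" for x
  have bdd: "bdd_above {r. split_sum F x r}" for x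
    by (rule bdd_aboveI[of _ "D * norm x"]) (use bound in auto)
  have le_s: "r \<le> s x" if "split_sum F x r" for r x
    unfolding s_def using that bdd by (intro cSup_upper) auto
  have s_least: "s x \<le> b" if "\<And>r. split_sum F x r \<Longrightarrow> r \<le> b" "0 \<le> x" for x b
    unfolding s_def using that split_sum.single[OF f0] by (intro cSup_least) auto
  have s_approx: "\<exists>r. split_sum F x r \<and> s x < r + e" if "0 \<le> x" "0 < e" for x e
  proof (rule ccontr)
    assume "\<not> ?thesis"
    then have "s x \<le> s x - e" using that by (intro s_least) (auto simp: not_less algebra_simps)
    with that show False by simp
  qed
  have add: "s (x + y) = s x + s y" if xy: "0 \<le> x" "0 \<le> y" for x y
  proof (rule antisym)
    show "s (x + y) \<le> s x + s y"
    proof (rule s_least)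
      fix r assume "split_sum F (x + y) r"
      then obtain r1 r2 where "split_sum F x r1" "split_sum F y r2" "r = r1 + r2"
        using split_sum_decompose[OF _ xy refl] by blast
      then show "r \<le> s x + s y" using le_s[of x r1] le_s[of y r2] by simp
    qed (use xy in simp)
    show "s x + s y \<le> s (x + y)"
    proof (rule field_le_epsilon)
      fix e :: real assume "0 < e"
      then obtain r1 r2 where r: "split_sum F x r1" "s x < r1 + e/2" "split_sum F y r2" "s y < r2 + e/2"
        using s_approx[OF xy(1), of "e/2"] s_approx[OF xy(2), of "e/2"] by auto
      show "s x + s y \<le> s (x + y) + e" using le_s[OF split_sum.add[OF r(1,3)]] r by simp
    qed
  qed
  have scale_le: "t * s x \<le> s (t *\<^sub>R x)" if "0 < t" "0 \<le> x" for t x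
  proof -
    have "s x \<le> s (t *\<^sub>R x) / t"
      using that le_s[OF split_sum_scaleR] by (intro s_least) (auto simp: field_simps)
    then show ?thesis using that by (simp add: field_simps)
  qed
  have scale: "s (t *\<^sub>R x) = t *\<^sub>R s x" if "0 < t" "0 \<le> x" for t x
    using scale_le[OF that] scale_le[of "inverse t" "t *\<^sub>R x"] that
    by (simp add: scaleR_nonneg_nonneg field_simps)
  let ?e = "cone_extension s"
  have lin: "linear ?e" by (rule linear_cone_extension[OF add scale])
  have ext: "?e x = s x" if "0 \<le> x" for x by (rule cone_extension_nonneg[OF add scale that])
  have s_le: "s x \<le> dapp w x" if "\<And>f. f \<in> F \<Longrightarrow> f \<le> w" "0 \<le> x" for w x
    using that by (intro s_least split_sum_le) auto
  obtain C where C: "\<And>x. norm (dapp f0 x) \<le> norm x * C"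
    using bounded_linear.bounded[OF bounded_linear_dapp] by blast
  have "bounded_linear ?e"
  proof (rule bounded_linear_from_cone[OF lin])
    fix x :: 'b assume x: "0 \<le> x"
    have nn: "0 \<le> \<bar>C\<bar> * norm x" "0 \<le> \<bar>D\<bar> * norm x" by simp_all
    have "s x \<le> D * norm x" using bound x by (intro s_least) auto
    then have "s x \<le> \<bar>D\<bar> * norm x" using mult_right_mono[OF abs_ge_self[of D], of "norm x"] by simp
    moreover have "- (\<bar>C\<bar> * norm x) \<le> dapp f0 x"
      using C[of x] mult_right_mono[OF abs_ge_self[of C], of "norm x"] by (simp add: abs_le_iff mult.commute)
    moreover have "dapp f0 x \<le> s x" by (rule le_s[OF split_sum.single[OF f0 x]])
    ultimately have "\<bar>s x\<bar> \<le> \<bar>C\<bar> * norm x + \<bar>D\<bar> * norm x" using nn by linarith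
    then show "\<bar>?e x\<bar> \<le> (\<bar>C\<bar> + \<bar>D\<bar>) * norm x" by (simp add: ext x distrib_right)
  qed
  then have rep: "dapp (Abs_rdual ?e) = ?e" by (simp add: Abs_rdual_inverse)
  show ?thesis
  proof (intro exI[of _ "Abs_rdual ?e"] conjI allI iffI ballI impI)
    fix w f assume le: "Abs_rdual ?e \<le> w" and f: "f \<in> F"
    show "f \<le> w"
      unfolding less_eq_rdual_def
    proof (intro allI impI)
      fix x :: 'b assume x: "0 \<le> x"
      have "dapp f x \<le> s x" using le_s[OF split_sum.single[OF f x]] .
      also have "\<dots> \<le> dapp w x" using dapp_mono_left[OF le x] by (simp add: rep ext x)
      finally show "dapp f x \<le> dapp w x" .
    qed
  next
    fix w assume "\<forall>f\<in>F. f \<le> w"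
    then show "Abs_rdual ?e \<le> w" using s_le by (auto simp: less_eq_rdual_def rep ext)
  next
    fix x :: 'b and e :: real assume "0 \<le> x" "0 < e"
    then show "\<exists>r. split_sum F x r \<and> dapp (Abs_rdual ?e) x < r + e" using s_approx by (simp add: rep ext)
  qed
qed

theorem rdual_lub_exists:
  fixes F :: "'b::normed_riesz rdual set"
  assumes "F \<noteq> {}" and ub: "\<And>f. f \<in> F \<Longrightarrow> f \<le> g"
  shows "\<exists>s. (\<forall>w. s \<le> w \<longleftrightarrow> (\<forall>f\<in>F. f \<le> w)) \<and>
    (\<forall>x\<ge>0. \<forall>e>0. \<exists>r. split_sum F x r \<and> dapp s x < r + e)"
proof -
  obtain D where D: "\<And>x. norm (dapp g x) \<le> norm x * D"
    using bounded_linear.bounded[OF bounded_linear_dapp] by blast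
  have "r \<le> D * norm x" if "split_sum F x r" for x r
    using split_sum_le[OF ub that] D[of x] by (simp add: mult.commute)
  then show ?thesis by (intro rdual_lub_exists_of_bound[OF assms(1)]) blast
qed

text \<open>The pieces at which \<open>f\<close> is evaluated add up to a single \<open>z\<close>,
  those of \<open>g\<close> to \<open>x - z\<close>, whatever the number of pieces.\<close>

lemma split_sum_pair_bound:
  assumes f: "\<And>x. \<bar>dapp f x\<bar> \<le> C * norm x" and g: "\<And>x. \<bar>dapp g x\<bar> \<le> D * norm x" and C: "0 \<le> C" "0 \<le> D"
    and r: "split_sum {f, g} x r"
  shows "r \<le> (C + D) * norm x"
proof -
  have "\<exists>z. 0 \<le> z \<and> z \<le> x \<and> r = dapp f z + dapp g (x - z)"
    using r
  proof (induction rule: split_sum.induct)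
    case (single h x)
    then show ?case by (auto simp: dapp_zero_right intro: exI[of _ 0] exI[of _ x])
  next
    case (add x r y s)
    then obtain z w where "0 \<le> z" "z \<le> x" "r = dapp f z + dapp g (x - z)"
      "0 \<le> w" "w \<le> y" "s = dapp f w + dapp g (y - w)" by auto
    then show ?case
      by (intro exI[of _ "z + w"]) (auto simp: dapp_add_right dapp_diff_right intro: add_mono)
  qed
  then obtain z where z: "0 \<le> z" "z \<le> x" "r = dapp f z + dapp g (x - z)" by blast
  have "C * norm z \<le> C * norm x" "D * norm (x - z) \<le> D * norm x"
    using z C by (auto intro!: mult_left_mono norm_mono_nonneg)
  then show ?thesis using f[of z] g[of "x - z"] z(3) by (simp add: distrib_right)
qed

instantiation rdual :: (normed_riesz) lattice_ab_group_add_abs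
begin

definition sup_rdual :: "'a rdual \<Rightarrow> 'a rdual \<Rightarrow> 'a rdual" where
  "sup_rdual f g = (SOME s. \<forall>w. s \<le> w \<longleftrightarrow> (\<forall>f\<in>{f, g}. f \<le> w))"
definition inf_rdual :: "'a rdual \<Rightarrow> 'a rdual \<Rightarrow> 'a rdual" where
  "inf_rdual f g = - sup (- f) (- g)"
definition abs_rdual :: "'a rdual \<Rightarrow> 'a rdual" where
  "abs_rdual f = sup f (- f)"

instance
proof
  fix a b c :: "'a rdual"
  have "\<exists>s. \<forall>w. s \<le> w \<longleftrightarrow> (\<forall>f\<in>{a, b}. f \<le> w)" for a b :: "'a rdual"
  proof -
    obtain C where C: "0 \<le> C" "\<And>x. norm (dapp a x) \<le> norm x * C"
      using bounded_linear.nonneg_bounded[OF bounded_linear_dapp, of a] by blast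
    obtain D where D: "0 \<le> D" "\<And>x. norm (dapp b x) \<le> norm x * D"
      using bounded_linear.nonneg_bounded[OF bounded_linear_dapp, of b] by blast
    have bound: "r \<le> (C + D) * norm x" if "split_sum {a, b} x r" for x r
    proof (rule split_sum_pair_bound[OF _ _ C(1) D(1) that])
      show "\<bar>dapp a y\<bar> \<le> C * norm y" for y using C(2)[of y] by (simp add: mult.commute)
      show "\<bar>dapp b y\<bar> \<le> D * norm y" for y using D(2)[of y] by (simp add: mult.commute)
    qed
    then have "\<forall>x r. split_sum {a, b} x r \<longrightarrow> r \<le> (C + D) * norm x" by blast
    from rdual_lub_exists_of_bound[OF insert_not_empty this] show ?thesis by (elim exE conjE) (rule exI)
  qed
  then have sup: "sup a b \<le> w \<longleftrightarrow> (\<forall>f\<in>{a, b}. f \<le> w)" for a b w :: "'a rdual"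
    unfolding sup_rdual_def by (rule someI2_ex) blast
  have ge: "a \<le> sup a b" "b \<le> sup a b" for a b :: "'a rdual"
    using sup[of a b "sup a b"] by auto
  show "a \<le> sup a b" "b \<le> sup a b" by (rule ge)+
  show "b \<le> a \<Longrightarrow> c \<le> a \<Longrightarrow> sup b c \<le> a" using sup by auto
  show "inf a b \<le> a" "inf a b \<le> b"
    using ge(1)[of "- a" "- b"] ge(2)[of "- b" "- a"] by (simp_all add: inf_rdual_def minus_le_iff)
  show "a \<le> b \<Longrightarrow> a \<le> c \<Longrightarrow> a \<le> inf b c"
    using sup[of "- b" "- c" "- a"] by (simp add: inf_rdual_def le_minus_iff)
  show "\<bar>a\<bar> = sup a (- a)" by (rule abs_rdual_def)
qed

end

text \<open>Least upper bounds are unique, so the approximation known for the constructed one holds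
  for every \<open>s\<close> with the defining property.\<close>

lemma rdual_lub_approx:
  fixes F :: "'b::normed_riesz rdual set"
  assumes "F \<noteq> {}" and s: "\<And>w. s \<le> w \<longleftrightarrow> (\<forall>f\<in>F. f \<le> w)" and "0 \<le> x" "0 < e"
  obtains r where "split_sum F x r" "dapp s x < r + e"
proof -
  have "\<And>f. f \<in> F \<Longrightarrow> f \<le> s" using s[of s] by simp
  from rdual_lub_exists[OF assms(1) this] obtain s' where
    s': "\<forall>w. s' \<le> w \<longleftrightarrow> (\<forall>f\<in>F. f \<le> w)"
    "\<forall>x\<ge>0. \<forall>e>0. \<exists>r. split_sum F x r \<and> dapp s' x < r + e" by blast
  have "s' = s" by (rule antisym) (use s s' in blast)+
  then show ?thesis using s' assms that by blast
qed

text \<open>The Riesz-Kantorovich formula for the positive part: in a split sum over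
  \<open>{f, 0}\<close> the pieces assigned to \<open>f\<close> combine into one
  \<open>z\<close>.\<close>

lemma pprt_dapp_approx:
  fixes f :: "'b::normed_riesz rdual"
  assumes "0 \<le> x" "0 < e"
  obtains z where "0 \<le> z" "z \<le> x" "dapp (pprt f) x < dapp f z + e"
proof -
  obtain r where r: "split_sum {f, 0} x r" "dapp (pprt f) x < r + e"
    by (rule rdual_lub_approx[of "{f, 0}" "pprt f" x e]) (use assms in \<open>auto simp: pprt_def\<close>)
  have "\<exists>z. 0 \<le> z \<and> z \<le> x \<and> r = dapp f z"
    using r(1)
  proof (induction rule: split_sum.induct)
    case (single g x)
    then show ?case
      by (auto simp: dapp_simps dapp_zero_right intro: exI[of _ 0])
  next
    case (add x r y s)
    then obtain z w where "0 \<le> z" "z \<le> x" "r = dapp f z" "0 \<le> w" "w \<le> y" "s = dapp f w" by auto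
    then show ?case by (intro exI[of _ "z + w"]) (auto simp: dapp_add_right intro: add_mono)
  qed
  then show ?thesis using r that by blast
qed

text \<open>In a split sum over \<open>{f, - f}\<close> the pieces assigned to \<open>- f\<close>
  are counted with a minus sign; the signed pieces combine into one \<open>z\<close> with modulus at
  most \<open>x\<close>.\<close>

lemma abs_dapp_approx:
  fixes f :: "'b::normed_riesz rdual"
  assumes "0 \<le> x" "0 < e"
  obtains z where "\<bar>z\<bar> \<le> x" "dapp \<bar>f\<bar> x < dapp f z + e"
proof -
  obtain r where r: "split_sum {f, - f} x r" "dapp \<bar>f\<bar> x < r + e"
    by (rule rdual_lub_approx[of "{f, - f}" "\<bar>f\<bar>" x e]) (use assms in \<open>auto simp: abs_lattice\<close>)
  have "\<exists>z. \<bar>z\<bar> \<le> x \<and> r = dapp f z"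
    using r(1)
  proof (induction rule: split_sum.induct)
    case (single g x)
    then show ?case
      by (auto simp: dapp_simps dapp_minus_right intro: exI[of _ "- x"] exI[of _ x])
  next
    case (add x r y s)
    then obtain z w where "\<bar>z\<bar> \<le> x" "r = dapp f z" "\<bar>w\<bar> \<le> y" "s = dapp f w" by auto
    then show ?case
      by (intro exI[of _ "z + w"]) (auto simp: dapp_add_right intro: order_trans[OF abs_triangle_ineq add_mono])
  qed
  then show ?thesis using r that by blast
qed

instantiation rdual :: (normed_riesz) real_normed_vector
begin

definition norm_rdual :: "'a rdual \<Rightarrow> real" where
  "norm_rdual f = onorm (dapp f)"
definition dist_rdual :: "'a rdual \<Rightarrow> 'a rdual \<Rightarrow> real" where
  "dist_rdual f g = norm (f - g)"
definition sgn_rdual :: "'a rdual \<Rightarrow> 'a rdual" where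
  "sgn_rdual f = f /\<^sub>R norm f"
definition uniformity_rdual :: "('a rdual \<times> 'a rdual) filter" where
  "uniformity_rdual = (INF e\<in>{0 <..}. principal {(f, g). dist f g < e})"
definition open_rdual :: "'a rdual set \<Rightarrow> bool" where
  "open_rdual U \<longleftrightarrow> (\<forall>f\<in>U. eventually (\<lambda>(f', g). f' = f \<longrightarrow> g \<in> U) uniformity)"

instance
proof
  fix a b :: "'a rdual" and r :: real
  show "dist a b = norm (a - b)" by (rule dist_rdual_def)
  show "sgn a = a /\<^sub>R norm a" by (rule sgn_rdual_def)
  show "uniformity = (INF e\<in>{0 <..}. principal {(x :: 'a rdual, y). dist x y < e})"
    by (rule uniformity_rdual_def)
  show "open U = (\<forall>x\<in>U. eventually (\<lambda>(x', y). x' = x \<longrightarrow> y \<in> U) uniformity)" for U :: "'a rdual set"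
    by (rule open_rdual_def)
  show "norm a = 0 \<longleftrightarrow> a = 0"
    unfolding norm_rdual_def onorm_eq_0[OF bounded_linear_dapp]
    by (auto simp: dapp_simps intro: rdual_eqI)
  show "norm (a + b) \<le> norm a + norm b"
    unfolding norm_rdual_def plus_rdual.rep_eq by (intro onorm_triangle bounded_linear_dapp)
  show "norm (r *\<^sub>R a) = \<bar>r\<bar> * norm a"
    unfolding norm_rdual_def scaleR_rdual.rep_eq
    using onorm_scaleR[OF bounded_linear_dapp, of r a] by simp
qed

end

lemma norm_dapp_le: "\<bar>dapp f x\<bar> \<le> norm f * norm x"
  using onorm[OF bounded_linear_dapp, of f x] by (simp add: norm_rdual_def)

lemma norm_rdual_le: "0 \<le> C \<Longrightarrow> (\<And>x. \<bar>dapp f x\<bar> \<le> C * norm x) \<Longrightarrow> norm f \<le> C"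
  unfolding norm_rdual_def by (rule onorm_bound) simp_all

lemma abs_dapp_le_abs: "\<bar>dapp f x\<bar> \<le> dapp \<bar>f\<bar> \<bar>x\<bar>"
proof -
  have "\<bar>dapp f x\<bar> \<le> dapp \<bar>f\<bar> (pprt x) + dapp \<bar>f\<bar> (pprt (- x))"
  proof -
    have *: "\<bar>dapp f y\<bar> \<le> dapp \<bar>f\<bar> y" if "0 \<le> y" for y
      using dapp_mono_left[OF abs_ge_self[of f] that] dapp_mono_left[OF abs_ge_minus_self[of f] that]
      by (simp add: dapp_simps abs_le_iff)
    have "dapp f x = dapp f (pprt x) - dapp f (pprt (- x))"
      by (simp add: pprt_diff_eq flip: dapp_diff_right)
    then show ?thesis using *[of "pprt x"] *[of "pprt (- x)"] by simp
  qed
  then show ?thesis by (simp add: abs_eq_pprt dapp_add_right)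
qed

instance rdual :: (normed_riesz) normed_riesz
proof
  fix f g :: "'a rdual" assume le: "\<bar>f\<bar> \<le> \<bar>g\<bar>"
  show "norm f \<le> norm g"
  proof (rule norm_rdual_le)
    fix x :: 'a
    have "\<bar>dapp f x\<bar> \<le> dapp \<bar>g\<bar> \<bar>x\<bar>"
      using abs_dapp_le_abs[of f x] dapp_mono_left[OF le, of "\<bar>x\<bar>"] by simp
    also have "\<dots> \<le> norm g * norm x"
    proof (rule field_le_epsilon)
      fix e :: real assume "0 < e"
      then obtain z where z: "\<bar>z\<bar> \<le> \<bar>x\<bar>" "dapp \<bar>g\<bar> \<bar>x\<bar> < dapp g z + e"
        using abs_dapp_approx[of "\<bar>x\<bar>" e g] by auto
      have "dapp g z \<le> norm g * norm z" using norm_dapp_le[of g z] by simp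
      also have "\<dots> \<le> norm g * norm x"
        using norm_le_of_abs_le[of z x] z by (intro mult_left_mono) auto
      finally show "dapp \<bar>g\<bar> \<bar>x\<bar> \<le> norm g * norm x + e" using z by simp
    qed
    finally show "\<bar>dapp f x\<bar> \<le> norm g * norm x" .
  qed simp
qed

lemma rdual_of_sublinear:
  fixes p :: "'b::normed_riesz \<Rightarrow> real"
  assumes "\<And>x y. p (x + y) \<le> p x + p y" "\<And>r x. 0 < r \<Longrightarrow> p (r *\<^sub>R x) \<le> r * p x"
    and bound: "\<And>x. p x \<le> C * norm x"
  obtains f where "\<And>x. dapp f x \<le> p x" "dapp f z = p z"
proof -
  obtain h where h: "linear h" "\<And>x. h x \<le> p x" "h z = p z"
    using hahn_banach[of p z] assms(1,2) by metis
  have "\<bar>h x\<bar> \<le> C * norm x" for x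
    using h(2)[of x] h(2)[of "- x"] bound[of x] bound[of "- x"] linear_neg[OF h(1), of x] by simp
  then have "bounded_linear h" by (rule bounded_linear_from_cone[OF h(1)])
  then have "dapp (Abs_rdual h) = h" by (simp add: Abs_rdual_inverse)
  with h show ?thesis using that by metis
qed


section \<open>The Arens extension of the center\<close>

lemma dapp_Abs_rdual:
  assumes "\<And>x y. f (x + y) = f x + f y" "\<And>r x. f (r *\<^sub>R x) = r * f x" "\<And>x. \<bar>f x\<bar> \<le> C * norm x"
  shows "dapp (Abs_rdual f) = f"
proof -
  have "bounded_linear f"
    by (rule bounded_linear_intro[of _ C]) (use assms in \<open>auto simp: mult.commute\<close>)
  then show ?thesis by (simp add: Abs_rdual_inverse)
qed

lemma pprt_subadd: "pprt (x + y) \<le> pprt x + pprt (y :: 'b::normed_riesz)"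
  unfolding pprt_def by (intro sup_least) (auto intro: add_mono)

lemma pprt_scaleR: "0 \<le> r \<Longrightarrow> pprt (r *\<^sub>R x) = r *\<^sub>R pprt (x :: 'b::normed_riesz)"
  by (simp add: pprt_def scaleR_sup)

lemma inf_pprt: "inf (pprt (- x)) (pprt x) = (0 :: 'b::normed_riesz)"
proof -
  have "sup (pprt (- x)) (pprt x) = \<bar>x\<bar>"
  proof (rule antisym)
    show "sup (pprt (- x)) (pprt x) \<le> \<bar>x\<bar>" by (simp add: abs_eq_pprt)
    have "x \<le> pprt x" "- x \<le> pprt (- x)" by (simp_all add: pprt_def)
    then show "\<bar>x\<bar> \<le> sup (pprt (- x)) (pprt x)" by (intro abs_leI) (auto intro: le_supI1 le_supI2)
  qed
  then show ?thesis
    using add_eq_inf_sup[of "pprt (- x)" "pprt x"] abs_eq_pprt[of x] by (simp add: add.commute)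
qed

lemma abs_sup_diff_le: "\<bar>sup z c - sup w c\<bar> \<le> \<bar>z - w :: 'b::normed_riesz\<bar>"
proof -
  have le: "sup z c - sup w c \<le> \<bar>z - w\<bar>" for z w :: 'b
  proof -
    have "z \<le> w + \<bar>z - w\<bar>" using abs_ge_self[of "z - w"] by (simp add: algebra_simps)
    also have "\<dots> \<le> sup w c + \<bar>z - w\<bar>" by simp
    finally have "sup z c \<le> sup w c + \<bar>z - w\<bar>" by (auto intro: add_increasing2)
    then show ?thesis by (simp only: diff_le_eq add.commute)
  qed
  show ?thesis
  proof (rule abs_leI)
    show "- (sup z c - sup w c) \<le> \<bar>z - w\<bar>"
      using le[of w z] by (simp only: minus_diff_eq abs_minus_commute[of w z])
  qed (rule le)
qed

lemma abs_inf_diff_le: "\<bar>inf z c - inf w c\<bar> \<le> \<bar>z - w :: 'b::normed_riesz\<bar>"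
  using abs_sup_diff_le[of "- w" "- c" "- z"] unfolding inf_eq_neg_sup
  by (simp only: diff_minus_eq_add uminus_add_conv_diff)

lemma rdual_mazur_orlicz:
  fixes p :: "'b::normed_riesz \<Rightarrow> real" and G :: "('b \<times> real) set"
  assumes sub: "\<And>x y. p (x + y) \<le> p x + p y" "\<And>r x. 0 < r \<Longrightarrow> p (r *\<^sub>R x) \<le> r * p x"
    and bound: "\<And>x. p x \<le> C * norm x"
    and G0: "(0, 0) \<in> G"
    and Gadd: "\<And>g h r s. (g, r) \<in> G \<Longrightarrow> (h, s) \<in> G \<Longrightarrow> (g + h, r + s) \<in> G"
    and Gscale: "\<And>g r t. 0 < t \<Longrightarrow> (g, r) \<in> G \<Longrightarrow> (t *\<^sub>R g, t * r) \<in> G"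
    and le: "\<And>g r. (g, r) \<in> G \<Longrightarrow> r \<le> p g"
  obtains f where "\<And>x. dapp f x \<le> p x" "\<And>g r. (g, r) \<in> G \<Longrightarrow> r \<le> dapp f g"
proof -
  interpret real_carrier "UNIV :: 'b set" scaleR
    by unfold_locales (auto simp: algebra_simps)
  have "sublinear p" using sub by (auto simp: sublinear_def)
  from mazur_orlicz[OF this G0 _ Gadd Gscale le] obtain h where
    h: "linear_on h" "\<And>x. h x \<le> p x" "\<And>g r. (g, r) \<in> G \<Longrightarrow> r \<le> h g" by auto
  have add: "h (x + y) = h x + h y" and scale: "h (r *\<^sub>R x) = r * h x" for x y r
    using h(1) by (simp_all add: linear_on_def)
  have "\<bar>h x\<bar> \<le> C * norm x" for x
    using h(2)[of x] h(2)[of "- x"] bound[of x] bound[of "- x"] scale[of "- 1" x] by simp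
  then have "dapp (Abs_rdual h) = h" by (intro dapp_Abs_rdual[OF add scale])
  with h show ?thesis using that by metis
qed

definition mu :: "'b::normed_riesz \<Rightarrow> 'b rdual \<Rightarrow> 'b center_op rdual" where
  "mu x f = Abs_rdual (\<lambda>t. dapp f (capp t x))"

lemma dapp_mu [simp]: "dapp (mu x f) t = dapp f (capp t x)"
proof -
  have "dapp (mu x f) = (\<lambda>t. dapp f (capp t x))"
    unfolding mu_def
  proof (rule dapp_Abs_rdual[where C = "norm f * norm x"])
    fix t :: "'a center_op"
    have "\<bar>dapp f (capp t x)\<bar> \<le> norm f * norm (capp t x)" by (rule norm_dapp_le)
    also have "\<dots> \<le> norm f * (norm t * norm x)" by (intro mult_left_mono norm_capp_le) auto
    finally show "\<bar>dapp f (capp t x)\<bar> \<le> norm f * norm x * norm t" by (simp add: algebra_simps)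
  qed (simp_all add: capp_simps dapp_add_right dapp_scaleR_right)
  then show ?thesis by simp
qed

lemma mu_linear:
  "mu (x + y) f = mu x f + mu y f" "mu (x - y) f = mu x f - mu y f" "mu (r *\<^sub>R x) f = r *\<^sub>R mu x f"
  "mu x (f + g) = mu x f + mu x g" "mu x (f - g) = mu x f - mu x g" "mu x (r *\<^sub>R f) = r *\<^sub>R mu x f"
  "mu x (- f) = - mu x f" "mu 0 f = 0" "mu x 0 = 0"
  by (rule rdual_eqI; simp add: dapp_simps capp_add_right capp_diff_right capp_scaleR_right
      dapp_add_right dapp_diff_right dapp_scaleR_right capp_zero_right dapp_zero_right)+

lemma mu_nonneg: "0 \<le> x \<Longrightarrow> 0 \<le> f \<Longrightarrow> 0 \<le> mu x f"
  unfolding less_eq_rdual_def[of 0] by (simp add: dapp_simps dapp_nonneg capp_nonneg)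

lemma norm_mu_le: "norm (mu x f) \<le> norm f * norm x"
proof (rule norm_rdual_le)
  fix t :: "'a center_op"
  have "\<bar>dapp f (capp t x)\<bar> \<le> norm f * norm (capp t x)" by (rule norm_dapp_le)
  also have "\<dots> \<le> norm f * (norm t * norm x)" by (intro mult_left_mono norm_capp_le) auto
  finally show "\<bar>dapp (mu x f) t\<bar> \<le> norm f * norm x * norm t" by (simp add: algebra_simps)
qed simp

text \<open>Sharper than the product of the norms: with this bound \<open>istar a\<close> maps
  \<open>f \<ge> 0\<close> to a functional of modulus at most \<open>norm a *\<^sub>R f\<close>,
  which is what makes it central.\<close>

lemma norm_mu_le_nonneg:
  assumes "0 \<le> x" "0 \<le> f" shows "norm (mu x f) \<le> dapp f x"
proof (rule norm_rdual_le)
  show "0 \<le> dapp f x" using assms by (simp add: dapp_nonneg)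
  fix t :: "'a center_op"
  have "\<bar>dapp f (capp t x)\<bar> \<le> dapp f \<bar>capp t x\<bar>" using assms by (intro abs_dapp_le)
  also have "\<dots> \<le> dapp f (norm t *\<^sub>R x)" using assms by (intro dapp_mono_right abs_capp_le')
  finally show "\<bar>dapp (mu x f) t\<bar> \<le> dapp f x * norm t" by (simp add: dapp_scaleR_right mult.commute)
qed

text \<open>By \<open>psi_le\<close> the value \<open>dapp \<psi> t\<close> depends only on
  \<open>capp t x\<close>, and as a functional on the orbit of \<open>x\<close> it is dominated by
  \<open>\<lambda>y. dapp f (pprt y)\<close>. Its extension to the whole space is
  \<open>g\<close>.\<close>

lemma mu_dominated:
  fixes x :: "'b::normed_riesz"
  assumes x: "0 \<le> x" and f: "0 \<le> f" and psi: "0 \<le> \<psi>" "\<psi> \<le> mu x f"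
  shows "\<exists>g. \<psi> = mu x g"
proof -
  have psi_le: "dapp \<psi> t \<le> dapp f (pprt (capp t x))" for t
  proof -
    have "dapp \<psi> t \<le> dapp \<psi> (pprt t)" using psi by (intro dapp_mono_right) (simp_all add: pprt_def)
    also have "\<dots> \<le> dapp (mu x f) (pprt t)" using psi by (intro dapp_mono_left) auto
    \<comment> \<open>Positive parts in the center are pointwise on the cone, which converts a bound
      in \<open>t\<close> into a bound in \<open>capp t x\<close>.\<close>
    also have "capp (pprt t) x = pprt (capp t x)" using x by (simp add: pprt_def capp_sup capp_simps)
    then have "dapp (mu x f) (pprt t) = dapp f (pprt (capp t x))" by simp
    finally show ?thesis .
  qed
  obtain g where g: "\<And>y. dapp g y \<le> dapp f (pprt y)"
      "\<And>z r. (z, r) \<in> range (\<lambda>t. (capp t x, dapp \<psi> t)) \<Longrightarrow> r \<le> dapp g z"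
  proof (rule rdual_mazur_orlicz[of "\<lambda>y. dapp f (pprt y)" "norm f" "range (\<lambda>t. (capp t x, dapp \<psi> t))"])
    show "dapp f (pprt (y + z)) \<le> dapp f (pprt y) + dapp f (pprt z)" for y z
      using dapp_mono_right[OF f pprt_subadd[of y z]] by (simp add: dapp_add_right)
    show "dapp f (pprt (r *\<^sub>R y)) \<le> r * dapp f (pprt y)" if "0 < r" for r y
      using that by (simp add: pprt_scaleR dapp_scaleR_right)
    show "dapp f (pprt y) \<le> norm f * norm y" for y
      using norm_dapp_le[of f "pprt y"] mult_left_mono[OF norm_pprt_le[of y], of "norm f"] by simp
    show "(0, 0) \<in> range (\<lambda>t. (capp t x, dapp \<psi> t))"
      by (rule range_eqI[of _ _ 0]) (simp add: capp_simps dapp_zero_right)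
    show "(y + z, r + s) \<in> range (\<lambda>t. (capp t x, dapp \<psi> t))"
      if ys: "(y, r) \<in> range (\<lambda>t. (capp t x, dapp \<psi> t))" "(z, s) \<in> range (\<lambda>t. (capp t x, dapp \<psi> t))" for y z r s
    proof -
      obtain t t' where "y = capp t x" "r = dapp \<psi> t" "z = capp t' x" "s = dapp \<psi> t'"
        using ys by auto
      then show ?thesis by (intro range_eqI[of _ _ "t + t'"]) (simp add: capp_simps dapp_add_right)
    qed
    show "(c *\<^sub>R y, c * r) \<in> range (\<lambda>t. (capp t x, dapp \<psi> t))"
      if y: "0 < c" "(y, r) \<in> range (\<lambda>t. (capp t x, dapp \<psi> t))" for c y r
    proof -
      obtain t where "y = capp t x" "r = dapp \<psi> t" using y by auto
      then show ?thesis by (intro range_eqI[of _ _ "c *\<^sub>R t"]) (simp add: capp_simps dapp_scaleR_right)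
    qed
  qed (use psi_le in auto)
  \<comment> \<open>Mazur-Orlicz gives one inequality, and its instance at \<open>- t\<close> the
    other.\<close>
  have "dapp \<psi> t = dapp g (capp t x)" for t
    using g(2)[OF rangeI, of t] g(2)[OF rangeI, of "- t"] by (simp add: capp_simps dapp_minus_right)
  then have "\<psi> = mu x g" by (intro rdual_eqI) simp
  then show ?thesis by blast
qed

text \<open>The Arens extension for real functionals. Over either field
  \<open>arens_extension\<close> acts by \<open>istar\<close> on real and imaginary parts, see
  \<open>arens_extension_c\<close>.\<close>

definition istar :: "'b::normed_riesz center_op rdual rdual \<Rightarrow> 'b rdual center_op" where
  "istar a = Abs_center_op (\<lambda>f. Abs_rdual (\<lambda>x. dapp a (mu x f)))"

lemma istar_app [simp]: "dapp (capp (istar a) f) x = dapp a (mu x f)"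
proof -
  have rep: "dapp (Abs_rdual (\<lambda>x. dapp a (mu x f))) = (\<lambda>x. dapp a (mu x f))" for f
  proof (rule dapp_Abs_rdual)
    fix x :: 'a
    have "\<bar>dapp a (mu x f)\<bar> \<le> norm a * norm (mu x f)" by (rule norm_dapp_le)
    also have "\<dots> \<le> norm a * (norm f * norm x)" by (intro mult_left_mono norm_mu_le) auto
    finally show "\<bar>dapp a (mu x f)\<bar> \<le> norm a * norm f * norm x" by (simp add: algebra_simps)
  qed (simp_all add: mu_linear dapp_add_right dapp_scaleR_right)
  have "central (\<lambda>f. Abs_rdual (\<lambda>x. dapp a (mu x f)))"
  proof (rule centralI)
    show "linear (\<lambda>f. Abs_rdual (\<lambda>x. dapp a (mu x f)))"
      by (rule linearI; rule rdual_eqI; unfold rep dapp_simps)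
         (simp_all add: mu_linear dapp_add_right dapp_scaleR_right)
    fix f :: "'a rdual" assume f: "0 \<le> f"
    have le: "\<bar>dapp a (mu x f)\<bar> \<le> norm a * dapp f x" if "0 \<le> x" for x
      using norm_dapp_le[of a "mu x f"] mult_left_mono[OF norm_mu_le_nonneg[OF that f], of "norm a"] by simp
    show "\<bar>Abs_rdual (\<lambda>x. dapp a (mu x f))\<bar> \<le> norm a *\<^sub>R f"
    proof (rule abs_leI)
      show "Abs_rdual (\<lambda>x. dapp a (mu x f)) \<le> norm a *\<^sub>R f" "- Abs_rdual (\<lambda>x. dapp a (mu x f)) \<le> norm a *\<^sub>R f"
        using abs_le_D1[OF le] abs_le_D2[OF le] by (auto simp: less_eq_rdual_def rep dapp_simps)
    qed
  qed
  then show ?thesis by (simp add: istar_def Abs_center_op_inverse rep)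
qed

lemma istar_eqI: "(\<And>f x. 0 \<le> f \<Longrightarrow> 0 \<le> x \<Longrightarrow> dapp (capp s f) x = dapp (capp t f) x) \<Longrightarrow> s = t"
  by (rule center_op_eqI, rule rdual_eqI)

lemma istar_linear:
  "istar (a + b) = istar a + istar b" "istar (a - b) = istar a - istar b"
  "istar (r *\<^sub>R a) = r *\<^sub>R istar a" "istar 0 = 0" "istar (- a) = - istar a"
  by (rule istar_eqI; simp add: dapp_simps capp_simps)+

lemma istar_nonneg: "0 \<le> a \<Longrightarrow> 0 \<le> istar a"
  by (simp add: less_eq_center_op_def less_eq_rdual_def[of "capp 0 f" for f] less_eq_rdual_def[of 0 "capp a f" for a f]
      capp_simps dapp_simps dapp_nonneg mu_nonneg)

lemma istar_zeroD: "istar a = 0 \<Longrightarrow> dapp a (mu x f) = 0"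
  using istar_app[of a f x] by (simp add: capp_simps dapp_simps)

lemma istar_zeroI:
  assumes "\<And>x f. 0 \<le> x \<Longrightarrow> 0 \<le> f \<Longrightarrow> dapp a (mu x f) = 0"
  shows "istar a = 0"
  by (rule istar_eqI) (simp add: assms capp_simps dapp_simps)

lemma istar_kernel_lub:
  fixes F :: "'b::normed_riesz center_op rdual rdual set"
  assumes "F \<noteq> {}" and F: "\<And>a. a \<in> F \<Longrightarrow> istar a = 0" and s: "\<And>w. s \<le> w \<longleftrightarrow> (\<forall>a\<in>F. a \<le> w)"
  shows "istar s = 0"
proof (rule istar_zeroI)
  fix x :: 'b and f :: "'b rdual" assume x: "0 \<le> x" and f: "0 \<le> f"
  \<comment> \<open>The supremum at \<open>mu x f\<close> is approximated by split sums. Each piece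
    of such a sum is dominated by \<open>mu x f\<close>, so the members of \<open>F\<close> are
    evaluated only where they vanish.\<close>
  have zero: "r = 0" if "split_sum F \<phi> r" "\<phi> \<le> mu x f" for \<phi> r
    using that
  proof (induction rule: split_sum.induct)
    case (single a \<phi>)
    then obtain g where "\<phi> = mu x g" using mu_dominated x f by blast
    then show ?case using istar_zeroD[OF F[OF single(1)]] by simp
  next
    case (add \<phi> r \<psi> t)
    then have "\<phi> \<le> mu x f" "\<psi> \<le> mu x f"
      using split_sum_nonneg[of F \<phi> r] split_sum_nonneg[of F \<psi> t]
      by (auto intro: order_trans[rotated] simp: add_increasing add_increasing2)
    then show ?case using add.IH by simp
  qed
  have "dapp s (mu x f) \<le> 0"
  proof (rule field_le_epsilon)
    fix e :: real assume e: "0 < e"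
    obtain r where "split_sum F (mu x f) r" "dapp s (mu x f) < r + e"
      using rdual_lub_approx[OF assms(1) s mu_nonneg[OF x f] e] by blast
    then show "dapp s (mu x f) \<le> 0 + e" using zero by fastforce
  qed
  moreover obtain a where a: "a \<in> F" using assms(1) by auto
  then have "a \<le> s" using s by blast
  then have "dapp a (mu x f) \<le> dapp s (mu x f)" using mu_nonneg[OF x f] by (intro dapp_mono_left)
  then have "0 \<le> dapp s (mu x f)" using istar_zeroD[OF F[OF a]] by simp
  ultimately show "dapp s (mu x f) = 0" by simp
qed


section \<open>The Arens product\<close>

text \<open>The Arens product is built in its three usual stages: the center acts on its dual by
  \<open>module_act\<close>, the bidual acts on the dual by \<open>bidual_act\<close>, and
  \<open>arens a b\<close> applies \<open>a\<close> after the action of \<open>b\<close>.\<close>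

definition module_act :: "'b::normed_riesz center_op rdual \<Rightarrow> 'b center_op \<Rightarrow> 'b center_op rdual" where
  "module_act \<phi> r = Abs_rdual (\<lambda>q. dapp \<phi> (r * q))"

lemma dapp_module_act [simp]: "dapp (module_act \<phi> r) q = dapp \<phi> (r * q)"
  and norm_module_act: "norm (module_act \<phi> r) \<le> norm \<phi> * norm r"
proof -
  have le: "\<bar>dapp \<phi> (r * q)\<bar> \<le> norm \<phi> * norm r * norm q" for q
  proof -
    have "\<bar>dapp \<phi> (r * q)\<bar> \<le> norm \<phi> * norm (r * q)" by (rule norm_dapp_le)
    also have "\<dots> \<le> norm \<phi> * (norm r * norm q)" by (intro mult_left_mono norm_times_center_op_le) auto
    finally show ?thesis by (simp add: algebra_simps)
  qed
  have rep: "dapp (module_act \<phi> r) = (\<lambda>q. dapp \<phi> (r * q))"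
    unfolding module_act_def by (rule dapp_Abs_rdual[OF _ _ le]) (simp_all add: distrib_left dapp_add_right dapp_scaleR_right)
  then show "dapp (module_act \<phi> r) q = dapp \<phi> (r * q)" by simp
  show "norm (module_act \<phi> r) \<le> norm \<phi> * norm r"
    by (rule norm_rdual_le) (use le rep in auto)
qed

lemma module_act_simps:
  "module_act (\<phi> + \<psi>) r = module_act \<phi> r + module_act \<psi> r" "module_act (c *\<^sub>R \<phi>) r = c *\<^sub>R module_act \<phi> r"
  "module_act \<phi> (r + s) = module_act \<phi> r + module_act \<phi> s" "module_act \<phi> (c *\<^sub>R r) = c *\<^sub>R module_act \<phi> r"
  "module_act \<phi> 1 = \<phi>" "module_act (module_act \<phi> r) s = module_act \<phi> (r * s)"
  "module_act (mu x f) r = mu (capp r x) f"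
        apply (rule rdual_eqI; simp add: dapp_simps distrib_right dapp_add_right dapp_scaleR_right mult.assoc; fail)+
  by (rule rdual_eqI) (simp add: mult.commute[of r] times_center_op.rep_eq)

lemma module_act_nonneg: "0 \<le> \<phi> \<Longrightarrow> 0 \<le> r \<Longrightarrow> 0 \<le> module_act \<phi> r"
  unfolding less_eq_rdual_def[of 0 "module_act \<phi> r"] by (simp add: dapp_simps dapp_nonneg times_center_op_nonneg)

definition bidual_act :: "'b::normed_riesz center_op rdual rdual \<Rightarrow> 'b center_op rdual \<Rightarrow> 'b center_op rdual" where
  "bidual_act b \<phi> = Abs_rdual (\<lambda>r. dapp b (module_act \<phi> r))"

lemma dapp_bidual_act [simp]: "dapp (bidual_act b \<phi>) r = dapp b (module_act \<phi> r)"
  and norm_bidual_act: "norm (bidual_act b \<phi>) \<le> norm b * norm \<phi>"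
proof -
  have le: "\<bar>dapp b (module_act \<phi> r)\<bar> \<le> norm b * norm \<phi> * norm r" for r
  proof -
    have "\<bar>dapp b (module_act \<phi> r)\<bar> \<le> norm b * norm (module_act \<phi> r)" by (rule norm_dapp_le)
    also have "\<dots> \<le> norm b * (norm \<phi> * norm r)" by (intro mult_left_mono norm_module_act) auto
    finally show ?thesis by (simp add: algebra_simps)
  qed
  have rep: "dapp (bidual_act b \<phi>) = (\<lambda>r. dapp b (module_act \<phi> r))"
    unfolding bidual_act_def
    by (rule dapp_Abs_rdual[OF _ _ le]) (simp_all add: module_act_simps dapp_add_right dapp_scaleR_right)
  then show "dapp (bidual_act b \<phi>) r = dapp b (module_act \<phi> r)" by simp
  show "norm (bidual_act b \<phi>) \<le> norm b * norm \<phi>"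
    by (rule norm_rdual_le) (use le rep in auto)
qed

text \<open>The last identity is the reason why \<open>istar\<close> is multiplicative: the action
  of \<open>a\<close> on \<open>mu x f\<close> changes only \<open>f\<close>, namely by
  \<open>istar a\<close>.\<close>

lemma bidual_act_simps:
  "bidual_act (a + b) \<phi> = bidual_act a \<phi> + bidual_act b \<phi>"
  "bidual_act (c *\<^sub>R a) \<phi> = c *\<^sub>R bidual_act a \<phi>"
  "bidual_act a (\<phi> + \<psi>) = bidual_act a \<phi> + bidual_act a \<psi>"
  "bidual_act a (c *\<^sub>R \<phi>) = c *\<^sub>R bidual_act a \<phi>"
  "module_act (bidual_act a \<phi>) r = bidual_act a (module_act \<phi> r)"
  "bidual_act a (mu x f) = mu x (capp (istar a) f)"
  by (rule rdual_eqI; simp add: dapp_simps module_act_simps dapp_add_right dapp_scaleR_right)+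

lemma bidual_act_nonneg: "0 \<le> a \<Longrightarrow> 0 \<le> \<phi> \<Longrightarrow> 0 \<le> bidual_act a \<phi>"
  unfolding less_eq_rdual_def[of 0 "bidual_act a \<phi>"] by (simp add: dapp_simps dapp_nonneg module_act_nonneg)

definition arens ::
    "'b::normed_riesz center_op rdual rdual \<Rightarrow> 'b center_op rdual rdual \<Rightarrow> 'b center_op rdual rdual" where
  "arens a b = Abs_rdual (\<lambda>\<phi>. dapp a (bidual_act b \<phi>))"

lemma dapp_arens [simp]: "dapp (arens a b) \<phi> = dapp a (bidual_act b \<phi>)"
proof -
  have "dapp (arens a b) = (\<lambda>\<phi>. dapp a (bidual_act b \<phi>))"
    unfolding arens_def
  proof (rule dapp_Abs_rdual)
    fix \<phi> :: "'a center_op rdual"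
    have "\<bar>dapp a (bidual_act b \<phi>)\<bar> \<le> norm a * norm (bidual_act b \<phi>)" by (rule norm_dapp_le)
    also have "\<dots> \<le> norm a * (norm b * norm \<phi>)" by (intro mult_left_mono norm_bidual_act) auto
    finally show "\<bar>dapp a (bidual_act b \<phi>)\<bar> \<le> norm a * norm b * norm \<phi>" by (simp add: algebra_simps)
  qed (simp_all add: bidual_act_simps dapp_add_right dapp_scaleR_right)
  then show ?thesis by simp
qed

lemma arens_linear:
  "arens (a + b) c = arens a c + arens b c" "arens (a - b) c = arens a c - arens b c"
  "arens (r *\<^sub>R a) c = r *\<^sub>R arens a c" "arens (- a) c = - arens a c"
  "arens a (b + c) = arens a b + arens a c" "arens a (r *\<^sub>R c) = r *\<^sub>R arens a c"
  by (rule rdual_eqI; simp add: dapp_simps bidual_act_simps dapp_add_right dapp_scaleR_right)+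

lemma arens_assoc: "arens (arens a b) c = arens a (arens b c)"
proof -
  have "bidual_act b (bidual_act c \<phi>) = bidual_act (arens b c) \<phi>" for \<phi>
    by (rule rdual_eqI) (simp add: bidual_act_simps)
  then show ?thesis by (intro rdual_eqI) simp
qed

lemma arens_nonneg: "0 \<le> a \<Longrightarrow> 0 \<le> b \<Longrightarrow> 0 \<le> arens a b"
  unfolding less_eq_rdual_def[of 0 "arens a b"] by (simp add: dapp_simps dapp_nonneg bidual_act_nonneg)

lemma istar_arens: "istar (arens a b) = istar a * istar b"
  by (rule istar_eqI) (simp add: times_center_op.rep_eq bidual_act_simps)

definition one_bidual :: "'b::normed_riesz center_op rdual rdual" where
  "one_bidual = Abs_rdual (\<lambda>\<phi>. dapp \<phi> 1)"

lemma norm_rdual_center_le: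
  assumes "0 \<le> \<phi>" shows "norm \<phi> \<le> dapp \<phi> (1 :: 'b::normed_riesz center_op)"
proof (rule norm_rdual_le)
  show "0 \<le> dapp \<phi> (1 :: 'b center_op)" using assms by (simp add: dapp_nonneg)
  fix t :: "'b center_op"
  have "\<bar>dapp \<phi> t\<bar> \<le> dapp \<phi> (norm t *\<^sub>R 1)"
    using abs_dapp_le[OF assms, of t] dapp_mono_right[OF assms abs_le_norm_one[of t]] by simp
  then show "\<bar>dapp \<phi> t\<bar> \<le> dapp \<phi> 1 * norm t" by (simp add: dapp_scaleR_right mult.commute)
qed

lemma dapp_one_bidual [simp]: "dapp one_bidual \<phi> = dapp \<phi> 1"
proof -
  have "dapp one_bidual = (\<lambda>\<phi>. dapp \<phi> (1 :: 'a center_op))"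
    unfolding one_bidual_def
  proof (rule dapp_Abs_rdual[of _ 1])
    show "\<bar>dapp \<phi> 1\<bar> \<le> 1 * norm \<phi>" for \<phi> :: "'a center_op rdual"
      using norm_dapp_le[of \<phi> 1] mult_left_mono[OF norm_one_center_op_le[where 'b = 'a] norm_ge_zero[of \<phi>]] by linarith
  qed (simp_all add: dapp_simps)
  then show ?thesis by simp
qed

lemma one_bidual_nonneg: "0 \<le> one_bidual"
  by (simp add: less_eq_rdual_def[of 0 one_bidual] dapp_simps dapp_nonneg)

lemma istar_one: "istar one_bidual = 1"
  by (rule istar_eqI) (simp add: one_center_op.rep_eq)

lemma arens_one_left: "arens one_bidual b = b"
  by (rule rdual_eqI) (simp add: module_act_simps)

lemma le_norm_one_bidual: "a \<le> norm a *\<^sub>R one_bidual"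
  unfolding less_eq_rdual_def[of a]
proof (intro allI impI)
  fix \<phi> :: "'a center_op rdual" assume "0 \<le> \<phi>"
  then have "\<bar>dapp a \<phi>\<bar> \<le> norm a * dapp \<phi> 1"
    using norm_dapp_le[of a \<phi>] mult_left_mono[OF norm_rdual_center_le, of \<phi> "norm a"] by simp
  then show "dapp a \<phi> \<le> dapp (norm a *\<^sub>R one_bidual) \<phi>" by (simp add: dapp_simps)
qed

text \<open>The largest element of \<open>[0, 1]\<close> in the kernel of \<open>istar\<close>, and its complementary idempotent.\<close>

definition kernel_unit :: "'b::normed_riesz center_op rdual rdual" where
  "kernel_unit = (SOME q. \<forall>w. q \<le> w \<longleftrightarrow> (\<forall>a\<in>{a. istar a = 0 \<and> 0 \<le> a \<and> a \<le> one_bidual}. a \<le> w))"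

definition support :: "'b::normed_riesz center_op rdual rdual" where
  "support = one_bidual - kernel_unit"

lemma kernel_unit_lub:
  "kernel_unit \<le> w \<longleftrightarrow> (\<forall>a\<in>{a. istar a = 0 \<and> 0 \<le> a \<and> a \<le> one_bidual}. a \<le> w)" for w
proof -
  have ne: "{a. istar a = 0 \<and> 0 \<le> a \<and> a \<le> one_bidual} \<noteq> ({} :: 'a center_op rdual rdual set)"
    using one_bidual_nonneg istar_linear(4) by blast
  show ?thesis
    unfolding kernel_unit_def
    by (rule someI2_ex) (use rdual_lub_exists[OF ne, of one_bidual] in \<open>blast+\<close>)
qed

lemma kernel_unit_props:
  fixes a :: "'a::normed_riesz center_op rdual rdual"
  defines "q \<equiv> kernel_unit :: 'a center_op rdual rdual"
  shows "istar q = 0" "0 \<le> q" "q \<le> one_bidual"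
  "istar a = 0 \<Longrightarrow> 0 \<le> a \<Longrightarrow> a \<le> one_bidual \<Longrightarrow> a \<le> q"
  unfolding q_def
proof -
  show le: "a \<le> kernel_unit" if "istar a = 0" "0 \<le> a" "a \<le> one_bidual" for a :: "'a center_op rdual rdual"
    using kernel_unit_lub[of kernel_unit] that by blast
  show "0 \<le> (kernel_unit :: 'a center_op rdual rdual)"
    using le[of 0] one_bidual_nonneg by (simp add: istar_linear)
  show "(kernel_unit :: 'a center_op rdual rdual) \<le> one_bidual" using kernel_unit_lub[of one_bidual] by blast
  show "istar (kernel_unit :: 'a center_op rdual rdual) = 0"
  proof (rule istar_kernel_lub[OF _ _ kernel_unit_lub])
    show "{a. istar a = 0 \<and> 0 \<le> a \<and> a \<le> one_bidual} \<noteq> ({} :: 'a center_op rdual rdual set)"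
      using one_bidual_nonneg istar_linear(4) by blast
  qed simp
qed

lemma support_props: "istar support = 1" "0 \<le> support" "support \<le> one_bidual"
  using kernel_unit_props(1-3) by (simp_all add: support_def istar_linear istar_one)

text \<open>If \<open>a\<close> lies in the kernel and in the unit interval, then so does
  \<open>kernel_unit + b\<close> for \<open>b = arens a support\<close>, because
  \<open>b \<le> support = one_bidual - kernel_unit\<close>. Maximality of
  \<open>kernel_unit\<close> gives \<open>b \<le> 0\<close>. Scaling and positive parts, which stay
  in the kernel by \<open>istar_kernel_lub\<close>, reduce to this case.\<close>

lemma kernel_arens_support: "istar a = 0 \<Longrightarrow> arens a support = 0"
proof -
  have unit: "arens a support = 0" if a: "istar a = 0" "0 \<le> a" "a \<le> one_bidual"
    for a :: "'a center_op rdual rdual"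
  proof -
    define b where "b = arens a support"
    have b0: "0 \<le> b" unfolding b_def by (rule arens_nonneg[OF a(2) support_props(2)])
    have "0 \<le> arens (one_bidual - a) support" using a by (intro arens_nonneg support_props) simp
    then have "b \<le> support" by (simp add: b_def arens_linear arens_one_left)
    then have "kernel_unit + b \<le> one_bidual" by (simp add: support_def algebra_simps)
    moreover have "istar (kernel_unit + b) = 0"
      by (simp add: istar_linear kernel_unit_props(1) b_def istar_arens a)
    moreover have "0 \<le> kernel_unit + b" using kernel_unit_props(2) b0 by (rule add_nonneg_nonneg)
    ultimately have "kernel_unit + b \<le> kernel_unit" by (intro kernel_unit_props(4))
    then have "b \<le> 0" by simp
    with b0 show ?thesis by (simp add: b_def)
  qed
  have pos: "arens a support = 0" if a: "istar a = 0" "0 \<le> a" for a :: "'a center_op rdual rdual"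
  proof -
    \<comment> \<open>Since \<open>a \<le> norm a *\<^sub>R one_bidual\<close>, this factor moves
      \<open>a\<close> into the unit interval; the summand 1 keeps the denominator positive.\<close>
    define c where "c = 1 / (norm a + 1)"
    have n: "0 < norm a + 1" by (simp add: add_nonneg_pos)
    have c: "0 < c" "c * norm a \<le> 1" using n by (auto simp: c_def field_simps)
    have "c *\<^sub>R a \<le> c *\<^sub>R norm a *\<^sub>R one_bidual"
      using c by (intro scaleR_left_mono le_norm_one_bidual) auto
    also have "\<dots> \<le> 1 *\<^sub>R one_bidual" using c one_bidual_nonneg unfolding scaleR_scaleR
      by (intro scaleR_right_mono) auto
    finally have "arens (c *\<^sub>R a) support = 0"
      using a c by (intro unit) (auto simp: istar_linear scaleR_nonneg_nonneg)
    then show ?thesis using c by (simp add: arens_linear)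
  qed
  assume a: "istar a = 0"
  have ker: "istar (pprt b) = 0" if "istar b = 0" for b :: "'a center_op rdual rdual"
    by (rule istar_kernel_lub[of "{b, 0}"]) (use that in \<open>auto simp: istar_linear pprt_def\<close>)
  have "arens (pprt a) support = 0" "arens (pprt (- a)) support = 0"
    using a by (auto intro!: pos ker simp: istar_linear)
  then have "arens (pprt a - pprt (- a)) support = 0" by (simp add: arens_linear)
  then show "arens a support = 0" by (simp add: pprt_diff_eq)
qed

text \<open>A complement of the kernel of \<open>istar\<close> in \<open>Z(E)''\<close>.\<close>

definition carrier_band :: "'b::normed_riesz center_op rdual rdual set" where
  "carrier_band = {b. arens b support = b}"

text \<open>This is idempotence of \<open>support\<close>: its complement \<open>kernel_unit\<close>
  lies in the kernel of \<open>istar\<close> and is annihilated by it.\<close>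

lemma arens_support_in_band: "arens a support \<in> carrier_band"
proof -
  have "arens support support = arens (one_bidual - kernel_unit) (support :: 'a center_op rdual rdual)"
    by (simp only: support_def)
  also have "\<dots> = support" unfolding arens_linear by (simp add: arens_one_left kernel_arens_support kernel_unit_props)
  finally show ?thesis by (simp add: carrier_band_def arens_assoc)
qed

lemma carrier_band_eqI:
  assumes "a \<in> carrier_band" "b \<in> carrier_band" "istar a = istar b"
  shows "a = b"
  using kernel_arens_support[of "a - b"] assms by (simp add: carrier_band_def arens_linear istar_linear)

lemma carrier_band_add: "a \<in> carrier_band \<Longrightarrow> b \<in> carrier_band \<Longrightarrow> a + b \<in> carrier_band"
  and carrier_band_diff: "a \<in> carrier_band \<Longrightarrow> b \<in> carrier_band \<Longrightarrow> a - b \<in> carrier_band"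
  and carrier_band_scaleR: "a \<in> carrier_band \<Longrightarrow> r *\<^sub>R a \<in> carrier_band"
  and carrier_band_arens: "b \<in> carrier_band \<Longrightarrow> arens a b \<in> carrier_band"
  and carrier_band_zero: "0 \<in> carrier_band"
  using arens_linear(3)[of 0 0 support] by (simp_all add: carrier_band_def arens_linear arens_assoc)

lemma arens_one_right: "arens a one_bidual = a"
proof (rule rdual_eqI)
  fix \<phi> :: "'a center_op rdual"
  have "bidual_act one_bidual \<phi> = \<phi>" by (rule rdual_eqI) simp
  then show "dapp (arens a one_bidual) \<phi> = dapp a \<phi>" by simp
qed

text \<open>The difference is the positive element \<open>arens a kernel_unit\<close>. So
  multiplication by \<open>support\<close> is a projection between 0 and the identity, that is, a
  band projection, and \<open>carrier_band\<close> is its range.\<close>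

lemma arens_support_le: "0 \<le> a \<Longrightarrow> arens a support \<le> a"
proof -
  assume "0 \<le> a"
  then have "0 \<le> arens a kernel_unit" by (intro arens_nonneg kernel_unit_props)
  moreover have "a = arens a (support + kernel_unit)" by (simp add: support_def arens_one_right)
  ultimately show ?thesis by (simp add: arens_linear) (metis le_add_same_cancel1)
qed

text \<open>Each \<open>a\<close> in \<open>F\<close> is fixed by the projection, so the projection
  of \<open>s\<close> is again an upper bound of \<open>F\<close>; conversely the projection
  decreases \<open>s - a\<close>.\<close>

lemma carrier_band_lub:
  assumes "F \<noteq> {}" "F \<subseteq> carrier_band"
    and ub: "\<And>a. a \<in> F \<Longrightarrow> a \<le> s" and least: "\<And>w. (\<And>a. a \<in> F \<Longrightarrow> a \<le> w) \<Longrightarrow> s \<le> w"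
  shows "s \<in> carrier_band"
proof -
  have mono: "a \<le> b \<Longrightarrow> arens a support \<le> arens b support" for a b :: "'a center_op rdual rdual"
    using arens_nonneg[OF _ support_props(2), of "b - a"] by (simp add: arens_linear)
  have F: "arens a support = a" if "a \<in> F" for a using assms that by (auto simp: carrier_band_def)
  have "s \<le> arens s support"
    by (rule least) (metis F mono ub)
  moreover obtain a where a: "a \<in> F" using assms by auto
  have "arens (s - a) support \<le> s - a" using ub[OF a] by (intro arens_support_le) simp
  then have "arens s support \<le> s" by (simp add: arens_linear F[OF a])
  ultimately show ?thesis by (simp add: carrier_band_def antisym)
qed

text \<open>The projection decreases both \<open>c - r\<close> and \<open>c + r\<close> and fixes
  \<open>c\<close>, which gives the two inequalities for \<open>r\<close>.\<close>

lemma carrier_band_ideal: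
  assumes c: "c \<in> carrier_band" and r: "r \<le> c" "- r \<le> c"
  shows "r \<in> carrier_band"
proof -
  have "arens (c - r) support \<le> c - r" "arens (c + r) support \<le> c + r"
    using r by (auto intro!: arens_support_le simp: minus_le_iff)  (metis add.commute diff_ge_0_iff_ge diff_minus_eq_add)
  then have "r \<le> arens r support" "arens r support \<le> r"
    using c by (simp_all add: arens_linear carrier_band_def)
  then show ?thesis by (simp add: carrier_band_def antisym)
qed


section \<open>Topologically full centers\<close>

text \<open>Topological fullness on the real lattice, in the form used for approximation: the order
  interval from \<open>- x\<close> to \<open>x\<close> lies in the closure of the orbit of
  \<open>x\<close>. \<open>topologically_full_iff\<close> shows that the closure is then an
  ideal.\<close>

definition top_full :: "'b::normed_riesz itself \<Rightarrow> bool" where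
  "top_full _ \<longleftrightarrow> (\<forall>x\<ge>0. \<forall>y::'b. \<bar>y\<bar> \<le> x \<longrightarrow> (\<forall>e>0. \<exists>t. norm (y - capp t x) < e))"

text \<open>The adjoint is central on the dual, so by \<open>central_commute\<close> it commutes
  with every element of \<open>Z(E')\<close>; this moves \<open>t\<close> past \<open>s\<close> in
  \<open>mu_span_approx\<close>.\<close>

definition adjoint_op :: "'b::normed_riesz center_op \<Rightarrow> 'b rdual center_op" where
  "adjoint_op t = Abs_center_op (\<lambda>f. Abs_rdual (\<lambda>x. dapp f (capp t x)))"

lemma adjoint_op_app [simp]: "dapp (capp (adjoint_op t) f) x = dapp f (capp t x)"
proof -
  have rep: "dapp (Abs_rdual (\<lambda>x. dapp f (capp t x))) = (\<lambda>x. dapp f (capp t x))" for f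
  proof (rule dapp_Abs_rdual)
    fix x :: 'a
    have "\<bar>dapp f (capp t x)\<bar> \<le> norm f * norm (capp t x)" by (rule norm_dapp_le)
    also have "\<dots> \<le> norm f * (norm t * norm x)" by (intro mult_left_mono norm_capp_le) auto
    finally show "\<bar>dapp f (capp t x)\<bar> \<le> norm f * norm t * norm x" by (simp add: algebra_simps)
  qed (simp_all add: capp_add_right capp_scaleR_right dapp_add_right dapp_scaleR_right)
  have "central (\<lambda>f. Abs_rdual (\<lambda>x. dapp f (capp t x)))"
  proof (rule centralI)
    show "linear (\<lambda>f. Abs_rdual (\<lambda>x. dapp f (capp t x)))"
      by (rule linearI; rule rdual_eqI; unfold rep; unfold dapp_simps; unfold rep) simp_all
    fix f :: "'a rdual" assume f: "0 \<le> f"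
    have le: "\<bar>dapp f (capp t x)\<bar> \<le> norm t * dapp f x" if x: "0 \<le> x" for x
      using abs_dapp_le[OF f, of "capp t x"] dapp_mono_right[OF f abs_capp_le'[OF x, of t]]
      by (simp add: dapp_scaleR_right)
    show "\<bar>Abs_rdual (\<lambda>x. dapp f (capp t x))\<bar> \<le> norm t *\<^sub>R f"
    proof (rule abs_leI)
      show "Abs_rdual (\<lambda>x. dapp f (capp t x)) \<le> norm t *\<^sub>R f" "- Abs_rdual (\<lambda>x. dapp f (capp t x)) \<le> norm t *\<^sub>R f"
        using abs_le_D1[OF le] abs_le_D2[OF le] by (auto simp: less_eq_rdual_def rep dapp_simps)
    qed
  qed
  then show ?thesis by (simp add: adjoint_op_def Abs_center_op_inverse rep)
qed

text \<open>A set of pairs and not a function, because different sums may represent the same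
  functional; that their prescribed values agree follows only from
  \<open>mu_span_le\<close>.\<close>

inductive_set mu_span :: "'b::normed_riesz rdual center_op \<Rightarrow> ('b center_op rdual \<times> real) set" for s where
  base: "0 \<le> x \<Longrightarrow> (mu x f, dapp (capp s f) x) \<in> mu_span s"
| add: "(\<phi>, r) \<in> mu_span s \<Longrightarrow> (\<psi>, q) \<in> mu_span s \<Longrightarrow> (\<phi> + \<psi>, r + q) \<in> mu_span s"

lemma mu_span_scaleR: "(\<phi>, r) \<in> mu_span s \<Longrightarrow> 0 < c \<Longrightarrow> (c *\<^sub>R \<phi>, c * r) \<in> mu_span s"
proof (induction rule: mu_span.induct)
  case (base x f)
  then show ?case using mu_span.base[of "c *\<^sub>R x" f s]
    by (simp add: mu_linear dapp_scaleR_right scaleR_nonneg_nonneg)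
next
  case (add \<phi> r \<psi> q)
  then show ?case using mu_span.add by (simp add: scaleR_add_right distrib_left)
qed

lemma mu_span_zero: "(0, 0) \<in> mu_span s"
  using mu_span.base[of 0 0 s] by (simp add: mu_linear dapp_zero_right)

text \<open>Topological fullness gives \<open>x \<approx> t u\<close>, and \<open>mu (t u) f = mu u (f \<circ> t)\<close> since the center is commutative.\<close>

lemma mu_span_approx:
  assumes tf: "top_full TYPE('b::normed_riesz)"
  shows "(\<phi>, r) \<in> mu_span s \<Longrightarrow> \<exists>v\<ge>0. \<forall>u::'b. v \<le> u \<longrightarrow> (\<forall>e>0. \<exists>g. norm (\<phi> - mu u g) \<le> e \<and> \<bar>r - dapp (capp s g) u\<bar> \<le> e)"
proof (induction rule: mu_span.induct)
  case (base x f)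
  show ?case
  proof (intro exI[of _ x] conjI allI impI base)
    fix u :: 'b and e :: real assume u: "x \<le> u" and e: "0 < e"
    \<comment> \<open>One tolerance for two estimates: the error \<open>x - capp t u\<close> is
      tested against \<open>f\<close> and against \<open>capp s f\<close>.\<close>
    define d where "d = e / (norm f + norm (capp s f) + 1)"
    have n: "0 < norm f + norm (capp s f) + 1" by (simp add: add_nonneg_pos)
    have d: "0 < d" using n e by (simp add: d_def)
    have "0 \<le> u" "\<bar>x\<bar> \<le> u" using base u by (auto intro: order_trans)
    then obtain t where t: "norm (x - capp t u) < d"
      using tf[unfolded top_full_def, rule_format, of u x d] d by blast
    define g where "g = capp (adjoint_op t) f"
    have b: "c * norm (x - capp t u) \<le> e" if "c \<le> norm f + norm (capp s f) + 1" "0 \<le> c" for c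
    proof -
      have "c * norm (x - capp t u) \<le> (norm f + norm (capp s f) + 1) * d"
        using that t by (intro mult_mono) auto
      also have "\<dots> = e" using n by (simp add: d_def)
      finally show ?thesis .
    qed
    have "mu x f - mu u g = mu (x - capp t u) f"
    proof (rule rdual_eqI)
      fix q :: "'b center_op"
      have "capp t (capp q u) = capp q (capp t u)" by (rule central_commute) simp_all
      then show "dapp (mu x f - mu u g) q = dapp (mu (x - capp t u) f) q"
        by (simp add: g_def dapp_simps capp_diff_right dapp_diff_right)
    qed
    then have "norm (mu x f - mu u g) \<le> e" using norm_mu_le[of "x - capp t u" f] b[of "norm f"] by simp
    moreover have "capp s g = capp (adjoint_op t) (capp s f)"
      unfolding g_def by (rule central_commute) simp_all
    then have "dapp (capp s f) x - dapp (capp s g) u = dapp (capp s f) (x - capp t u)"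
      by (simp add: dapp_diff_right)
    then have "\<bar>dapp (capp s f) x - dapp (capp s g) u\<bar> \<le> e"
      using norm_dapp_le[of "capp s f" "x - capp t u"] b[of "norm (capp s f)"] by simp
    ultimately show "\<exists>g. norm (mu x f - mu u g) \<le> e \<and> \<bar>dapp (capp s f) x - dapp (capp s g) u\<bar> \<le> e" by blast
  qed
next
  case (add \<phi> r \<psi> q)
  obtain v where v: "0 \<le> v" "\<And>u e. v \<le> u \<Longrightarrow> 0 < e \<Longrightarrow> \<exists>g. norm (\<phi> - mu u g) \<le> e \<and> \<bar>r - dapp (capp s g) u\<bar> \<le> e"
    using add.IH(1) by blast
  obtain w where w: "0 \<le> w" "\<And>u e. w \<le> u \<Longrightarrow> 0 < e \<Longrightarrow> \<exists>g. norm (\<psi> - mu u g) \<le> e \<and> \<bar>q - dapp (capp s g) u\<bar> \<le> e"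
    using add.IH(2) by blast
  \<comment> \<open>The statement is proved for every \<open>u\<close> above some \<open>v\<close>
    so that both summands can be approximated at one common \<open>u\<close>, here any
    \<open>u \<ge> v + w\<close>.\<close>
  show ?case
  proof (intro exI[of _ "v + w"] conjI allI impI)
    fix u :: 'b and e :: real assume u: "v + w \<le> u" and e: "0 < e"
    have "v \<le> u" "w \<le> u" using u v(1) w(1) by (auto intro: order_trans[rotated] simp: add_increasing add_increasing2)
    then obtain g h where gh: "norm (\<phi> - mu u g) \<le> e/2" "\<bar>r - dapp (capp s g) u\<bar> \<le> e/2"
        "norm (\<psi> - mu u h) \<le> e/2" "\<bar>q - dapp (capp s h) u\<bar> \<le> e/2"
      using v(2)[of u "e/2"] w(2)[of u "e/2"] e by auto
    have "norm (\<phi> + \<psi> - mu u (g + h)) \<le> e"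
      using norm_triangle_ineq[of "\<phi> - mu u g" "\<psi> - mu u h"] gh by (simp add: mu_linear algebra_simps)
    moreover have "\<bar>r + q - dapp (capp s (g + h)) u\<bar> \<le> e"
      using gh unfolding capp_add_right dapp_simps by linarith
    ultimately show "\<exists>g. norm (\<phi> + \<psi> - mu u g) \<le> e \<and> \<bar>r + q - dapp (capp s g) u\<bar> \<le> e" by blast
  qed (use v w in simp)
qed

text \<open>Chain of approximations: \<open>r\<close> is near \<open>dapp (capp s g) v\<close>,
  which is at most \<open>norm s\<close> times the value of \<open>pprt g\<close> at
  \<open>v\<close>. That value is nearly \<open>dapp g z\<close> with
  \<open>0 \<le> z \<le> v\<close>, and \<open>z\<close> is near \<open>capp t' v\<close> with
  \<open>0 \<le> t' \<le> 1\<close>. Finally \<open>dapp g (capp t' v)\<close> is near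
  \<open>dapp \<phi> t'\<close>, which is at most \<open>dapp (pprt \<phi>) 1\<close>.\<close>

lemma mu_span_le:
  assumes tf: "top_full TYPE('b::normed_riesz)" and s: "0 \<le> s" and mem: "(\<phi>, r) \<in> mu_span (s :: 'b rdual center_op)"
  shows "r \<le> norm s * dapp (pprt \<phi>) 1"
proof -
  \<comment> \<open>Four errors of size \<open>e\<close> enter: one in \<open>r\<close>, and three
    in the estimate of \<open>dapp (pprt g) v\<close>, each multiplied by
    \<open>norm s\<close>.\<close>
  define K where "K = 1 + 3 * norm s"
  have K: "0 < K" by (simp add: K_def add_pos_nonneg)
  have le: "r \<le> norm s * dapp (pprt \<phi>) 1 + e * K" if e: "0 < e" for e
  proof -
    obtain v where v: "0 \<le> v" "\<forall>u. v \<le> u \<longrightarrow> (\<forall>e>0. \<exists>g. norm (\<phi> - mu u g) \<le> e \<and> \<bar>r - dapp (capp s g) u\<bar> \<le> e)"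
      using mu_span_approx[OF tf mem] by blast
    then obtain g where g: "norm (\<phi> - mu v g) \<le> e" "\<bar>r - dapp (capp s g) v\<bar> \<le> e" using e by blast
    obtain z where z: "0 \<le> z" "z \<le> v" "dapp (pprt g) v < dapp g z + e"
      using pprt_dapp_approx[OF v(1) e] by blast
    define d where "d = e / (norm g + 1)"
    have n: "0 < norm g + 1" by (simp add: add_nonneg_pos)
    have d: "0 < d" "norm g * d \<le> e" using n e by (auto simp: d_def field_simps)
    obtain t where t: "norm (z - capp t v) < d" using tf v(1) z d unfolding top_full_def by (metis abs_of_nonneg)
    \<comment> \<open>Fullness gives no control of the order of \<open>t\<close>. Truncation to the
      interval from 0 to 1 does not increase distances and leaves \<open>z\<close> fixed since
      \<open>0 \<le> z \<le> v\<close>, so the approximation survives.\<close>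
    define t' where "t' = inf (sup t 0) 1"
    have t': "0 \<le> t'" "t' \<le> 1" by (simp_all add: t'_def)
    have "norm t' \<le> 1" using norm_mono_nonneg[OF t'] norm_one_center_op_le by (rule order_trans)
    have "capp t' v = inf (sup (capp t v) 0) v" using v(1) by (simp add: t'_def capp_inf capp_sup capp_simps)
    moreover have "z = inf (sup z 0) v" using z by (simp add: sup_absorb1 inf_absorb1)
    ultimately have "\<bar>z - capp t' v\<bar> \<le> \<bar>z - capp t v\<bar>"
      using abs_inf_diff_le[of "sup z 0" v "sup (capp t v) 0"] abs_sup_diff_le[of z 0 "capp t v"]
      by (metis order_trans)
    then have "norm (z - capp t' v) < d" using norm_le_of_abs_le t by (meson order_le_less_trans)
    then have "\<bar>dapp g (z - capp t' v)\<bar> \<le> e"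
      using norm_dapp_le[of g "z - capp t' v"] mult_left_mono[of "norm (z - capp t' v)" d "norm g"] d by simp
    then have "dapp g z \<le> dapp g (capp t' v) + e" by (simp add: dapp_diff_right)
    moreover have "\<bar>dapp (\<phi> - mu v g) t'\<bar> \<le> e"
      using norm_dapp_le[of "\<phi> - mu v g" t'] mult_mono[OF g(1) \<open>norm t' \<le> 1\<close>] e by simp
    then have "dapp g (capp t' v) \<le> dapp \<phi> t' + e" by (simp add: dapp_simps)
    moreover have "dapp \<phi> t' \<le> dapp (pprt \<phi>) t'" using t' by (intro dapp_mono_left) (simp_all add: pprt_def)
    moreover have "dapp (pprt \<phi>) t' \<le> dapp (pprt \<phi>) 1" using t' by (intro dapp_mono_right) simp_all
    ultimately have "dapp (pprt g) v \<le> dapp (pprt \<phi>) 1 + 3 * e" using z by simp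
    then have "norm s * dapp (pprt g) v \<le> norm s * (dapp (pprt \<phi>) 1 + 3 * e)" by (intro mult_left_mono) auto
    moreover have "dapp (capp s g) v \<le> norm s * dapp (pprt g) v"
    proof -
      have "capp s g \<le> capp s (pprt g)"
        using capp_nonneg[OF s, of "pprt g - g"] by (simp add: capp_diff_right pprt_def)
      also have "\<dots> \<le> norm s *\<^sub>R pprt g" using abs_capp_le'[of "pprt g" s] abs_le_D by auto
      finally show ?thesis using dapp_mono_left v(1) by (fastforce simp: dapp_simps)
    qed
    ultimately show ?thesis using g(2) by (simp add: K_def algebra_simps)
  qed
  show ?thesis
  proof (rule field_le_epsilon)
    fix e :: real assume "0 < e"
    then show "r \<le> norm s * dapp (pprt \<phi>) 1 + e" using le[of "e / K"] K by simp
  qed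
qed

text \<open>The majorant vanishes at negative functionals, so the functional from Mazur-Orlicz is
  positive; the pairs of \<open>mu_span\<close> for \<open>f\<close> and \<open>- f\<close> together
  prescribe its values exactly.\<close>

lemma top_full_lift_nonneg:
  assumes tf: "top_full TYPE('b::normed_riesz)" and s: "0 \<le> (s :: 'b rdual center_op)"
  obtains a where "0 \<le> a" "istar a = s"
proof -
  have norm1: "dapp (pprt \<phi>) 1 \<le> norm \<phi>" for \<phi> :: "'b center_op rdual"
  proof -
    have "norm (pprt \<phi>) * norm (1 :: 'b center_op) \<le> norm \<phi> * 1"
      by (intro mult_mono norm_pprt_le norm_one_center_op_le) auto
    then show ?thesis using norm_dapp_le[of "pprt \<phi>" 1] by linarith
  qed
  obtain a where a: "\<And>\<phi>. dapp a \<phi> \<le> norm s * dapp (pprt \<phi>) 1" "\<And>\<phi> r. (\<phi>, r) \<in> mu_span s \<Longrightarrow> r \<le> dapp a \<phi>"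
  proof (rule rdual_mazur_orlicz[of "\<lambda>\<phi>. norm s * dapp (pprt \<phi>) 1" "norm s" "mu_span s"])
    show "norm s * dapp (pprt (\<phi> + \<psi>)) 1 \<le> norm s * dapp (pprt \<phi>) 1 + norm s * dapp (pprt \<psi>) 1" for \<phi> \<psi> :: "'b center_op rdual"
      using mult_left_mono[OF dapp_mono_left[OF pprt_subadd[of \<phi> \<psi>] one_center_op_nonneg], of "norm s"]
      by (simp add: dapp_simps distrib_left)
    show "norm s * dapp (pprt (r *\<^sub>R \<phi>)) 1 \<le> r * (norm s * dapp (pprt \<phi>) 1)" if "0 < r" for r and \<phi> :: "'b center_op rdual"
      using that by (simp add: pprt_scaleR dapp_simps)
    show "norm s * dapp (pprt \<phi>) 1 \<le> norm s * norm \<phi>" for \<phi> :: "'b center_op rdual"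
      using norm1 by (intro mult_left_mono) auto
  qed (use mu_span_le[OF tf s] in \<open>auto intro: mu_span_zero mu_span.add mu_span_scaleR\<close>)
  have "0 \<le> a"
    unfolding less_eq_rdual_def[of 0 a]
  proof (intro allI impI)
    fix \<phi> :: "'b center_op rdual" assume "0 \<le> \<phi>"
    then have "dapp a (- \<phi>) \<le> 0" using a(1)[of "- \<phi>"] by (simp add: dapp_simps)
    then show "dapp 0 \<phi> \<le> dapp a \<phi>" by (simp add: dapp_simps dapp_minus_right)
  qed
  moreover have "istar a = s"
  proof (rule istar_eqI)
    fix f and x :: 'b assume x: "0 \<le> x"
    show "dapp (capp (istar a) f) x = dapp (capp s f) x"
      using a(2)[OF mu_span.base[OF x, of f]] a(2)[OF mu_span.base[OF x, of "- f"]]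
      by (simp add: mu_linear capp_minus_right dapp_minus_right dapp_simps)
  qed
  ultimately show ?thesis using that by blast
qed

lemma top_full_imp_surj:
  assumes "top_full TYPE('b::normed_riesz)"
  shows "surj (istar :: _ \<Rightarrow> 'b rdual center_op)"
proof (rule surjI)
  fix s :: "'b rdual center_op"
  obtain a b where "istar a = pprt s" "istar b = pprt (- s)"
    using top_full_lift_nonneg[OF assms] by (metis zero_le_pprt)
  then have "istar (a - b) = s" by (simp add: istar_linear pprt_diff_eq)
  then show "istar (SOME a. istar a = s) = s" by (rule someI)
qed

section \<open>Band projections in the dual and the converse implication\<close>

lemma band_projection_exists:
  fixes p :: "'b::normed_riesz rdual"
  assumes p: "0 \<le> p"
  obtains s where "capp s p = p" "\<And>g. 0 \<le> g \<Longrightarrow> inf g p = 0 \<Longrightarrow> capp s g = 0"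
proof -
  \<comment> \<open>For \<open>g \<ge> 0\<close> this is the component of \<open>g\<close> in the
    band generated by \<open>p\<close>, the supremum of the truncations of \<open>g\<close> at
    multiples of \<open>p\<close>.\<close>
  define P where "P g = (SOME s. \<forall>w. s \<le> w \<longleftrightarrow> (\<forall>n::nat. inf g (real n *\<^sub>R p) \<le> w))" for g
  have P: "P g \<le> w \<longleftrightarrow> (\<forall>n::nat. inf g (real n *\<^sub>R p) \<le> w)" for g w
  proof -
    have ne: "range (\<lambda>n::nat. inf g (real n *\<^sub>R p)) \<noteq> {}" by simp
    have ub: "f \<le> g" if "f \<in> range (\<lambda>n::nat. inf g (real n *\<^sub>R p))" for f using that by auto
    obtain s where "\<forall>w. s \<le> w \<longleftrightarrow> (\<forall>f\<in>range (\<lambda>n::nat. inf g (real n *\<^sub>R p)). f \<le> w)"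
      using rdual_lub_exists[OF ne ub] by blast
    then have "\<exists>s. \<forall>w. s \<le> w \<longleftrightarrow> (\<forall>n::nat. inf g (real n *\<^sub>R p) \<le> w)"
      by (intro exI[of _ s]) simp
    then show ?thesis unfolding P_def by (rule someI2_ex) blast
  qed
  have P_ge: "inf g (real n *\<^sub>R p) \<le> P g" for g n using P[of g "P g"] by blast
  have P_ge': "inf g (t *\<^sub>R p) \<le> P g" for g t
  proof -
    have "t *\<^sub>R p \<le> real (nat \<lceil>t\<rceil>) *\<^sub>R p" using p by (intro scaleR_right_mono) linarith+
    then have "inf g (t *\<^sub>R p) \<le> inf g (real (nat \<lceil>t\<rceil>) *\<^sub>R p)" by (rule inf_mono[OF order_refl])
    then show ?thesis using P_ge order_trans by blast
  qed
  have P_le: "P g \<le> g" for g by (simp add: P)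
  have P_nonneg: "0 \<le> P g" if "0 \<le> g" for g
    using P_ge[of g 0] that by (simp add: inf_absorb2)
  have add: "P (g + h) = P g + P h" if gh: "0 \<le> g" "0 \<le> h" for g h
  proof (rule antisym)
    have "inf (g + h) (real n *\<^sub>R p) \<le> P g + P h" for n
    proof -
      have np: "0 \<le> real n *\<^sub>R p" using p by (simp add: scaleR_nonneg_nonneg)
      define a where "a = inf (g + h) (real n *\<^sub>R p)"
      have a: "0 \<le> a" "a \<le> g + h" "a \<le> real n *\<^sub>R p" using gh np by (simp_all add: a_def)
      note d = riesz_decomposition[OF gh a(1,2)]
      have "inf a g \<le> P g" using a P_ge[of g n] by (meson inf_greatest inf_le1 inf_le2 order_trans)
      moreover have "a - inf a g \<le> P h"
      proof -
        have "a - inf a g \<le> real n *\<^sub>R p" using d(1) a(3) by (meson diff_le_eq le_add_same_cancel1 order_trans)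
        then show ?thesis using d(4) P_ge[of h n] by (meson inf_greatest order_trans)
      qed
      ultimately have "inf a g + (a - inf a g) \<le> P g + P h" by (rule add_mono)
      then show ?thesis by (simp only: add_diff_cancel_left' a_def[symmetric] add_diff_eq)
    qed
    then show "P (g + h) \<le> P g + P h" by (simp add: P)
    have sum: "inf g (real n *\<^sub>R p) + inf h (real m *\<^sub>R p) \<le> P (g + h)" for n m
    proof -
      have "inf g (real n *\<^sub>R p) + inf h (real m *\<^sub>R p) \<le> inf (g + h) ((real n + real m) *\<^sub>R p)"
        by (intro inf_greatest add_mono) (auto simp: scaleR_add_left intro: add_mono)
      then show ?thesis using P_ge' order_trans by blast
    qed
    \<comment> \<open>The two suprema are taken one after the other: over \<open>n\<close> with
      \<open>m\<close> fixed, and then over \<open>m\<close>.\<close>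
    have "inf h (real m *\<^sub>R p) \<le> P (g + h) - P g" for m
    proof -
      have "P g \<le> P (g + h) - inf h (real m *\<^sub>R p)" unfolding P using sum by (simp only: le_diff_eq) simp
      then show ?thesis by (simp only: le_diff_eq add.commute)
    qed
    then have "P h \<le> P (g + h) - P g" by (simp add: P)
    then show "P g + P h \<le> P (g + h)" by (simp add: algebra_simps)
  qed
  have inf_scale: "inf (t *\<^sub>R g) (t *\<^sub>R h) = t *\<^sub>R inf g h" if "0 < t" for t and g h :: "'b rdual"
    using scaleR_sup[of t "- g" "- h"] that unfolding inf_eq_neg_sup by (simp only: scaleR_minus_right)
  have scale_le: "t *\<^sub>R P g \<le> P (t *\<^sub>R g)" if t: "0 < t" for t g
  proof -
    have "P g \<le> inverse t *\<^sub>R P (t *\<^sub>R g)"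
      unfolding P
    proof
      fix n :: nat
      have "t *\<^sub>R inf g (real n *\<^sub>R p) \<le> P (t *\<^sub>R g)"
        using P_ge'[of "t *\<^sub>R g" "t * real n"] inf_scale[OF t, of g "real n *\<^sub>R p"] by simp
      then have "inverse t *\<^sub>R (t *\<^sub>R inf g (real n *\<^sub>R p)) \<le> inverse t *\<^sub>R P (t *\<^sub>R g)"
        using t by (intro scaleR_left_mono) auto
      then show "inf g (real n *\<^sub>R p) \<le> inverse t *\<^sub>R P (t *\<^sub>R g)" using t by simp
    qed
    then have "t *\<^sub>R P g \<le> t *\<^sub>R (inverse t *\<^sub>R P (t *\<^sub>R g))" using t by (intro scaleR_left_mono) auto
    then show ?thesis using t by simp
  qed
  have scale: "P (t *\<^sub>R g) = t *\<^sub>R P g" if t: "0 < t" "0 \<le> g" for t g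
  proof (rule antisym)
    have "t *\<^sub>R (inverse t *\<^sub>R P (t *\<^sub>R g)) \<le> t *\<^sub>R P (inverse t *\<^sub>R (t *\<^sub>R g))"
      using t by (intro scaleR_left_mono scale_le) auto
    then show "P (t *\<^sub>R g) \<le> t *\<^sub>R P g" using t by simp
  qed (rule scale_le[OF t(1)])
  define S where "S = cone_extension P"
  have S: "S g = P g" if "0 \<le> g" for g unfolding S_def by (rule cone_extension_nonneg[OF add scale that])
  have "central S"
  proof (rule centralI)
    show "linear S" unfolding S_def by (rule linear_cone_extension[OF add scale])
    fix g :: "'b rdual" assume g: "0 \<le> g"
    show "\<bar>S g\<bar> \<le> 1 *\<^sub>R g" using P_le[of g] P_nonneg[OF g] by (simp add: S g)
  qed
  then have rep: "capp (Abs_center_op S) = S" by (simp add: Abs_center_op_inverse)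
  show ?thesis
  proof (rule that[of "Abs_center_op S"])
    have "P p = p" using P_ge[of p 1] P_le[of p] by (simp add: antisym)
    then show "capp (Abs_center_op S) p = p" by (simp add: rep S p)
    fix g :: "'b rdual" assume g: "0 \<le> g" "inf g p = 0"
    have "inf g (real n *\<^sub>R p) \<le> 0" for n
    proof -
      \<comment> \<open>Enlarging both arguments to a common multiple reduces to
        \<open>inf g p = 0\<close>; the factor \<open>real n + 1\<close> is positive even for
        \<open>n = 0\<close>, as \<open>inf_scale\<close> requires.\<close>
      have "inf g (real n *\<^sub>R p) \<le> inf ((real n + 1) *\<^sub>R g) ((real n + 1) *\<^sub>R p)"
      proof (rule inf_mono)
        have "1 *\<^sub>R g \<le> (real n + 1) *\<^sub>R g" using g by (intro scaleR_right_mono) auto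
        then show "g \<le> (real n + 1) *\<^sub>R g" by simp
        show "real n *\<^sub>R p \<le> (real n + 1) *\<^sub>R p" using p by (intro scaleR_right_mono) auto
      qed
      also have "\<dots> = 0" using inf_scale[of "real n + 1" g p] g by simp
      finally show ?thesis .
    qed
    then have "P g \<le> 0" by (simp add: P)
    then show "capp (Abs_center_op S) g = 0" using P_nonneg[OF g(1)] by (simp add: rep S g)
  qed
qed

lemma surj_imp_top_full:
  assumes surj: "surj (istar :: _ \<Rightarrow> 'b::normed_riesz rdual center_op)"
  shows "top_full TYPE('b)"
  unfolding top_full_def
proof (intro allI impI, rule ccontr)
  fix x y :: 'b and e :: real
  assume x: "0 \<le> x" and y: "\<bar>y\<bar> \<le> x" and e: "0 < e" and no: "\<nexists>t. norm (y - capp t x) < e"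
  \<comment> \<open>The distance from the orbit of \<open>x\<close>. A functional below it vanishes
    on the orbit, and Hahn-Banach makes it attain the positive distance at \<open>y\<close>.\<close>
  define p where "p z = (INF t. norm (z - capp t x))" for z
  have p_le: "p z \<le> norm (z - capp t x)" for z t
    unfolding p_def by (rule cINF_lower) (auto intro: bdd_belowI[of _ 0])
  have p_approx: "\<exists>t. norm (z - capp t x) < p z + d" if "0 < d" for z d
  proof (rule ccontr)
    assume "\<not> ?thesis"
    then have "p z + d \<le> (INF t. norm (z - capp t x))" by (intro cINF_greatest) (auto simp: not_less)
    with that show False by (simp add: p_def)
  qed
  obtain f where f: "\<And>z. dapp f z \<le> p z" "dapp f y = p y"
  proof (rule rdual_of_sublinear[of p 1 y])
    show "p (w + z) \<le> p w + p z" for w z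
    proof (rule field_le_epsilon)
      fix d :: real assume "0 < d"
      then obtain t t' where t: "norm (w - capp t x) < p w + d/2" "norm (z - capp t' x) < p z + d/2"
        using p_approx[of "d/2" w] p_approx[of "d/2" z] by auto
      have "p (w + z) \<le> norm ((w - capp t x) + (z - capp t' x))"
        using p_le[of "w + z" "t + t'"] by (simp add: capp_simps algebra_simps)
      also have "\<dots> \<le> norm (w - capp t x) + norm (z - capp t' x)" by (rule norm_triangle_ineq)
      finally show "p (w + z) \<le> p w + p z + d" using t by simp
    qed
    show "p (r *\<^sub>R z) \<le> r * p z" if r: "0 < r" for r z
    proof (rule field_le_epsilon)
      fix d :: real assume "0 < d"
      then obtain t where t: "norm (z - capp t x) < p z + d / r" using p_approx[of "d / r" z] r by auto
      have "p (r *\<^sub>R z) \<le> norm (r *\<^sub>R (z - capp t x))"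
        using p_le[of "r *\<^sub>R z" "r *\<^sub>R t"] by (simp add: capp_simps scaleR_diff_right)
      also have "\<dots> \<le> r * (p z + d / r)" using r t by simp
      finally show "p (r *\<^sub>R z) \<le> r * p z + d" using r by (simp add: distrib_left)
    qed
    show "p z \<le> 1 * norm z" for z using p_le[of z 0] by (simp add: capp_simps)
  qed blast
  have fx: "dapp f (capp t x) = 0" for t
    using f(1)[of "capp t x"] f(1)[of "- capp t x"] p_le[of "capp t x" t] p_le[of "- capp t x" "- t"]
    by (simp add: capp_simps dapp_minus_right)
  have py: "0 < p y"
  proof -
    have "e \<le> p y" unfolding p_def by (intro cINF_greatest) (use no in \<open>auto simp: not_less\<close>)
    with e show ?thesis by simp
  qed
  have "mu x f = 0" by (rule rdual_eqI) (simp add: fx dapp_simps)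
  obtain s where s: "capp s (pprt f) = pprt f" "\<And>g. 0 \<le> g \<Longrightarrow> inf g (pprt f) = 0 \<Longrightarrow> capp s g = 0"
    using band_projection_exists[of "pprt f"] by auto
  have "inf (pprt (- f)) (pprt f) = 0" by (rule inf_pprt)
  then have "capp s f = pprt f"
    using s(1) s(2)[of "pprt (- f)"] capp_diff_right[of s "pprt f" "pprt (- f)"] by (simp add: pprt_diff_eq)
  moreover obtain a where "istar a = s" using surj by (metis surjD)
  ultimately have "dapp (pprt f) x = dapp a (mu x f)" using istar_app[of a f x] by simp
  then have "dapp (pprt f) x = 0" using \<open>mu x f = 0\<close> by (simp add: dapp_zero_right)
  moreover have "dapp f x = 0" using fx[of 1] by (simp add: capp_simps)
  ultimately have "dapp \<bar>f\<bar> x = 0"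
    using arg_cong[OF pprt_diff_eq[of f], of "\<lambda>g. dapp g x"] by (simp add: abs_eq_pprt dapp_simps)
  moreover have "\<bar>dapp f y\<bar> \<le> dapp \<bar>f\<bar> x"
    using abs_dapp_le_abs[of f y] dapp_mono_right[OF abs_ge_zero[of f] y] by simp
  ultimately show False using f(2) py by simp
qed

theorem top_full_iff_surj: "top_full TYPE('b::normed_riesz) \<longleftrightarrow> surj (istar :: _ \<Rightarrow> 'b rdual center_op)"
  using top_full_imp_surj surj_imp_top_full by blast

section \<open>A positive multiplicative right inverse of the Arens extension\<close>

definition arens_section :: "'b::normed_riesz rdual center_op \<Rightarrow> 'b center_op rdual rdual" where
  "arens_section s = arens (SOME a. istar a = s) support"

context
  assumes tf: "top_full TYPE('b::normed_riesz)"
begin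

lemma istar_arens_section: "istar (arens_section s) = (s :: 'b rdual center_op)"
proof -
  have "\<exists>a. istar a = s" using top_full_imp_surj[OF tf] by (metis surjD)
  from someI_ex[OF this] show ?thesis by (simp add: arens_section_def istar_arens support_props)
qed

lemma arens_section_in_band: "arens_section (s :: 'b rdual center_op) \<in> carrier_band"
  unfolding arens_section_def by (rule arens_support_in_band)

text \<open>\<open>istar\<close> is injective on the band, so the section does not depend on the
  chosen preimage. The algebraic rules below follow by comparing images under
  \<open>istar\<close>.\<close>

lemma arens_section_eqI:
  "b \<in> carrier_band \<Longrightarrow> istar b = s \<Longrightarrow> arens_section (s :: 'b rdual center_op) = b"
  by (rule carrier_band_eqI) (simp_all add: arens_section_in_band istar_arens_section)

lemma arens_section_add: "arens_section (s + t) = arens_section s + arens_section (t :: 'b rdual center_op)"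
  and arens_section_diff: "arens_section (s - t) = arens_section s - arens_section (t :: 'b rdual center_op)"
  and arens_section_scaleR: "arens_section (r *\<^sub>R s) = r *\<^sub>R arens_section (s :: 'b rdual center_op)"
  and arens_section_mult: "arens_section (s * t) = arens (arens_section s) (arens_section (t :: 'b rdual center_op))"
  by (rule arens_section_eqI; simp add: carrier_band_add carrier_band_diff carrier_band_scaleR carrier_band_arens
      arens_section_in_band istar_arens_section istar_linear istar_arens)+

lemma arens_section_zero: "arens_section (0 :: 'b rdual center_op) = 0"
  by (rule arens_section_eqI) (simp_all add: carrier_band_zero istar_linear)

text \<open>The preimage chosen in \<open>arens_section\<close> may fail to be positive, but a
  positive preimage exists and has the same product with \<open>support\<close>.\<close>

lemma arens_section_nonneg_iff: "0 \<le> arens_section s \<longleftrightarrow> 0 \<le> (s :: 'b rdual center_op)"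
proof
  assume "0 \<le> arens_section s"
  from istar_nonneg[OF this] show "0 \<le> s" by (simp add: istar_arens_section)
next
  assume "0 \<le> s"
  then obtain a where a: "0 \<le> a" "istar a = s" using top_full_lift_nonneg[OF tf] by blast
  have "arens_section s = arens a support"
    by (rule arens_section_eqI) (simp_all add: arens_support_in_band istar_arens a support_props)
  then show "0 \<le> arens_section s" using arens_nonneg[OF a(1) support_props(2)] by simp
qed

text \<open>The section maps the identity to \<open>support\<close>, which lies below the unit of
  the bidual. Through this order bound the norm of the section is controlled.\<close>

lemma arens_section_le_one: "s \<le> c *\<^sub>R 1 \<Longrightarrow> 0 \<le> c \<Longrightarrow> arens_section (s :: 'b rdual center_op) \<le> c *\<^sub>R one_bidual"
proof -
  assume s: "s \<le> c *\<^sub>R 1" and c: "0 \<le> c"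
  have one: "arens_section (1 :: 'b rdual center_op) = support"
    using arens_support_in_band[of "one_bidual :: 'b center_op rdual rdual"]
    by (intro arens_section_eqI) (simp_all add: support_props arens_one_left)
  have "0 \<le> arens_section (c *\<^sub>R 1 - s)" using s by (simp only: arens_section_nonneg_iff) simp
  then have "arens_section s \<le> c *\<^sub>R support" by (simp add: arens_section_diff arens_section_scaleR one)
  also have "\<dots> \<le> c *\<^sub>R one_bidual" using c by (intro scaleR_left_mono support_props)
  finally show ?thesis .
qed

end


section \<open>Decomposition of functionals along unit scalars\<close>

text \<open>The conclusion reads \<open>\<phi>1 + i \<phi>2 = \<Sum> u \<psi>\<^sub>u\<close>, and
  \<open>Re u *\<^sub>R t1 - Im u *\<^sub>R t2\<close> is the real part of
  \<open>u (t1 + i t2)\<close>. Hypothesis \<open>dom\<close> bounds the real part of the functional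
  by a sublinear functional of these finitely many coordinates. Mazur-Orlicz extends it from the
  coordinate families \<open>D t1 t2\<close> to all families, and the \<open>\<psi> u\<close> are
  the coordinates of the extension.\<close>

lemma finite_combination_decomposition:
  fixes U :: "complex set" and \<phi>1 \<phi>2 :: "'b::normed_riesz center_op rdual"
  assumes U: "finite U"
    and dom: "\<And>t1 t2 c. 0 \<le> c \<Longrightarrow> (\<And>u. u \<in> U \<Longrightarrow> Re u *\<^sub>R t1 - Im u *\<^sub>R t2 \<le> c *\<^sub>R 1) \<Longrightarrow>
      dapp \<phi>1 t1 - dapp \<phi>2 t2 \<le> c"
  obtains \<psi> :: "complex \<Rightarrow> 'b center_op rdual" where
    "\<And>u. u \<in> U \<Longrightarrow> 0 \<le> \<psi> u" "(\<Sum>u\<in>U. dapp (\<psi> u) 1) \<le> 1"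
    "\<phi>1 = (\<Sum>u\<in>U. Re u *\<^sub>R \<psi> u)" "\<phi>2 = (\<Sum>u\<in>U. Im u *\<^sub>R \<psi> u)"
proof -
  \<comment> \<open>The finite power of the center with index set \<open>U\<close>, realized by
    functions that vanish off \<open>U\<close>.\<close>
  define X where "X = {R :: complex \<Rightarrow> 'b center_op. \<forall>u. u \<notin> U \<longrightarrow> R u = 0}"
  interpret real_carrier X "\<lambda>r R u. r *\<^sub>R R u"
    by unfold_locales (auto simp: X_def fun_eq_iff algebra_simps)
  \<comment> \<open>The least nonnegative multiple of 1 above all coordinates. It is 0 on negative
    families, which makes the \<open>\<psi> u\<close> positive, and at most 1 on the constant family
    1, which bounds the sum of the values at 1.\<close>
  define p where "p R = Inf {c. 0 \<le> c \<and> (\<forall>u\<in>U. R u \<le> c *\<^sub>R 1)}" for R :: "complex \<Rightarrow> 'b center_op"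
  have p_le: "p R \<le> c" if "0 \<le> c" "\<And>u. u \<in> U \<Longrightarrow> R u \<le> c *\<^sub>R 1" for c R
    unfolding p_def using that by (intro cInf_lower bdd_belowI[of _ 0]) auto
  have p_approx: "\<exists>c\<ge>0. (\<forall>u\<in>U. R u \<le> c *\<^sub>R 1) \<and> c < p R + e" if "0 < e" for R e
  proof -
    let ?S = "{c. 0 \<le> c \<and> (\<forall>u\<in>U. R u \<le> c *\<^sub>R 1)}"
    have "R u \<le> (\<Sum>v\<in>U. norm (R v)) *\<^sub>R 1" if u: "u \<in> U" for u
    proof -
      have "norm (R u) *\<^sub>R (1 :: 'b center_op) \<le> (\<Sum>v\<in>U. norm (R v)) *\<^sub>R 1"
        using member_le_sum[OF u, of "\<lambda>v. norm (R v)"] U by (intro scaleR_right_mono) auto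
      then show ?thesis using abs_le_D(1)[OF abs_le_norm_one] order_trans by blast
    qed
    then have "(\<Sum>v\<in>U. norm (R v)) \<in> ?S" by (auto intro: sum_nonneg)
    then have ne: "?S \<noteq> {}" by blast
    have "Inf ?S < p R + e" using \<open>0 < e\<close> by (simp add: p_def)
    from cInf_lessD[OF ne this] show ?thesis by blast
  qed
  have sub: "sublinear p"
    unfolding sublinear_def
  proof (intro conjI ballI allI impI)
    fix R S :: "complex \<Rightarrow> 'b center_op"
    show "p (R + S) \<le> p R + p S"
    proof (rule field_le_epsilon)
      fix e :: real assume "0 < e"
      then obtain c d where cd: "0 \<le> c" "\<And>u. u \<in> U \<Longrightarrow> R u \<le> c *\<^sub>R 1" "c < p R + e/2"
          "0 \<le> d" "\<And>u. u \<in> U \<Longrightarrow> S u \<le> d *\<^sub>R 1" "d < p S + e/2"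
        using p_approx[of "e/2" R] p_approx[of "e/2" S] by auto
      have "p (R + S) \<le> c + d"
        using cd add_mono[OF cd(2,5)] by (intro p_le) (auto simp: scaleR_add_left)
      then show "p (R + S) \<le> p R + p S + e" using cd by simp
    qed
  next
    fix r :: real and R :: "complex \<Rightarrow> 'b center_op" assume r: "0 < r"
    show "p (\<lambda>u. r *\<^sub>R R u) \<le> r * p R"
    proof (rule field_le_epsilon)
      fix e :: real assume "0 < e"
      then obtain c where c: "0 \<le> c" "\<And>u. u \<in> U \<Longrightarrow> R u \<le> c *\<^sub>R 1" "c < p R + e/r"
        using p_approx[of "e/r" R] r by auto
      have "p (\<lambda>u. r *\<^sub>R R u) \<le> r * c"
        using c r scaleR_left_mono[OF c(2), of _ r] by (intro p_le) auto
      also have "\<dots> \<le> r * (p R + e/r)" using c r by (intro mult_left_mono) auto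
      finally show "p (\<lambda>u. r *\<^sub>R R u) \<le> r * p R + e" using r by (simp add: distrib_left)
    qed
  qed
  define D where "D t1 t2 = (\<lambda>u. if u \<in> U then Re u *\<^sub>R t1 - Im u *\<^sub>R t2 else 0)" for t1 t2 :: "'b center_op"
  have D_in: "D t1 t2 \<in> X" for t1 t2 by (simp add: D_def X_def)
  define G where "G = {(D t1 t2, dapp \<phi>1 t1 - dapp \<phi>2 t2) |t1 t2. True}"
  obtain h where h: "linear_on h" "\<And>R. R \<in> X \<Longrightarrow> h R \<le> p R" "\<And>g r. (g, r) \<in> G \<Longrightarrow> r \<le> h g"
  proof (rule mazur_orlicz[OF sub, of G])
    show "(0, 0) \<in> G"
      unfolding G_def by (intro CollectI exI[of _ 0]) (auto simp: D_def dapp_zero_right fun_eq_iff)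
    show "g \<in> X" if "(g, r) \<in> G" for g r using that D_in by (auto simp: G_def)
    show "(g + g', r + r') \<in> G" if gg: "(g, r) \<in> G" "(g', r') \<in> G" for g g' r r'
    proof -
      obtain t1 t2 t1' t2' where t: "g = D t1 t2" "r = dapp \<phi>1 t1 - dapp \<phi>2 t2"
          "g' = D t1' t2'" "r' = dapp \<phi>1 t1' - dapp \<phi>2 t2'"
        using gg by (auto simp: G_def)
      show ?thesis unfolding G_def t
        by (intro CollectI exI[of _ "t1 + t1'"] exI[of _ "t2 + t2'"])
           (auto simp: D_def dapp_add_right fun_eq_iff algebra_simps)
    qed
    show "(\<lambda>u. c *\<^sub>R g u, c * r) \<in> G" if g: "0 < c" "(g, r) \<in> G" for c g r
    proof -
      obtain t1 t2 where t: "g = D t1 t2" "r = dapp \<phi>1 t1 - dapp \<phi>2 t2" using g by (auto simp: G_def)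
      show ?thesis unfolding G_def t
        by (intro CollectI exI[of _ "c *\<^sub>R t1"] exI[of _ "c *\<^sub>R t2"])
           (auto simp: D_def dapp_scaleR_right fun_eq_iff algebra_simps)
    qed
    show "r \<le> p g" if g: "(g, r) \<in> G" for g r
    proof -
      obtain t1 t2 where t: "g = D t1 t2" "r = dapp \<phi>1 t1 - dapp \<phi>2 t2" using g by (auto simp: G_def)
      show ?thesis
      proof (rule field_le_epsilon)
        fix e :: real assume "0 < e"
        then obtain c where c: "0 \<le> c" "\<And>u. u \<in> U \<Longrightarrow> g u \<le> c *\<^sub>R 1" "c < p g + e"
          using p_approx[of e g] by auto
        have "Re u *\<^sub>R t1 - Im u *\<^sub>R t2 \<le> c *\<^sub>R 1" if "u \<in> U" for u
          using c(2)[OF that] that by (simp add: t D_def)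
        then have "r \<le> c" unfolding t by (rule dom[OF c(1)])
        then show "r \<le> p g + e" using c by simp
      qed
    qed
  qed blast
  define E where "E A R = (\<lambda>v. if v \<in> A then R v else 0)" for A and R :: "complex \<Rightarrow> 'b center_op"
  have E_in: "E A R \<in> X" if "A \<subseteq> U" for A R using that by (auto simp: E_def X_def)
  define \<psi> where "\<psi> u = Abs_rdual (\<lambda>t. h (E {u} (\<lambda>_. t)))" for u
  have h_add: "h (R + S) = h R + h S" if "R \<in> X" "S \<in> X" for R S using h(1) that by (simp add: linear_on_def)
  have h_scale: "h (\<lambda>u. r *\<^sub>R R u) = r * h R" if "R \<in> X" for r R using h(1) that by (simp add: linear_on_def)
  have psi: "dapp (\<psi> u) t = h (E {u} (\<lambda>_. t))" if u: "u \<in> U" for u t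
  proof -
    have X: "E {u} R \<in> X" for R using u by (intro E_in) simp
    have add: "h (E {u} (\<lambda>_. s + t)) = h (E {u} (\<lambda>_. s)) + h (E {u} (\<lambda>_. t))" for s t
    proof -
      have "E {u} (\<lambda>_. s + t) = E {u} (\<lambda>_. s) + E {u} (\<lambda>_. t)" by (auto simp: E_def fun_eq_iff)
      then show ?thesis using h_add[OF X X] by simp
    qed
    have scale: "h (E {u} (\<lambda>_. r *\<^sub>R t)) = r * h (E {u} (\<lambda>_. t))" for r t
    proof -
      have "E {u} (\<lambda>_. r *\<^sub>R t) = (\<lambda>v. r *\<^sub>R E {u} (\<lambda>_. t) v)" by (auto simp: E_def fun_eq_iff)
      then show ?thesis using h_scale[OF X] by simp
    qed
    have le: "h (E {u} (\<lambda>_. t)) \<le> norm t" for t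
    proof -
      have "E {u} (\<lambda>_. t) v \<le> norm t *\<^sub>R 1" for v
        using abs_le_D(1)[OF abs_le_norm_one[of t]] by (auto simp: E_def intro!: scaleR_nonneg_nonneg)
      then have "p (E {u} (\<lambda>_. t)) \<le> norm t" by (intro p_le) auto
      then show ?thesis using h(2)[OF X] by (rule order_trans[rotated])
    qed
    have "\<bar>h (E {u} (\<lambda>_. t))\<bar> \<le> 1 * norm t" for t
      using le[of t] le[of "- t"] scale[of "- 1" t] by (simp add: abs_le_iff)
    from dapp_Abs_rdual[OF add scale this] show ?thesis by (simp add: \<psi>_def)
  qed
  have h_sum: "h (E A R) = (\<Sum>u\<in>A. dapp (\<psi> u) (R u))" if "finite A" "A \<subseteq> U" for A R
    using that
  proof (induction A rule: finite_induct)
    case empty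
    have "E {} R = 0" by (auto simp: E_def fun_eq_iff)
    then show ?case using h_scale[OF zero_in, of 0] by (simp add: zero_fun_def)
  next
    case (insert u A)
    have "E (insert u A) R = E {u} (\<lambda>_. R u) + E A R"
      using insert.hyps by (auto simp: E_def fun_eq_iff)
    moreover have "h (E {u} (\<lambda>_. R u) + E A R) = h (E {u} (\<lambda>_. R u)) + h (E A R)"
      using insert.prems by (intro h_add E_in) auto
    ultimately have "h (E (insert u A) R) = dapp (\<psi> u) (R u) + h (E A R)"
      using insert.prems by (simp only: psi insert_subset)
    then show ?case using insert by simp
  qed
  have D_E: "D t1 t2 = E U (\<lambda>u. Re u *\<^sub>R t1 - Im u *\<^sub>R t2)" for t1 t2 by (auto simp: D_def E_def)
  have eq: "dapp \<phi>1 t1 - dapp \<phi>2 t2 = (\<Sum>u\<in>U. dapp (\<psi> u) (Re u *\<^sub>R t1 - Im u *\<^sub>R t2))" for t1 t2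
  proof -
    have le: "dapp \<phi>1 t1 - dapp \<phi>2 t2 \<le> (\<Sum>u\<in>U. dapp (\<psi> u) (Re u *\<^sub>R t1 - Im u *\<^sub>R t2))" for t1 t2
      using h(3)[of "D t1 t2" "dapp \<phi>1 t1 - dapp \<phi>2 t2"] h_sum[OF U order_refl]
      by (auto simp: G_def D_E)
    \<comment> \<open>Changing the sign of \<open>t1\<close> and \<open>t2\<close> turns the
      inequality into an equality.\<close>
    have "Re u *\<^sub>R - t1 - Im u *\<^sub>R - t2 = - (Re u *\<^sub>R t1 - Im u *\<^sub>R t2)" for u by simp
    then show ?thesis using le[of t1 t2] le[of "- t1" "- t2"]
      by (simp only: dapp_minus_right sum_negf)
  qed
  have app_sum: "dapp (\<Sum>u\<in>U. a u *\<^sub>R \<psi> u) t = (\<Sum>u\<in>U. a u * dapp (\<psi> u) t)" for a t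
    using U by (induction U rule: finite_induct) (auto simp: dapp_simps)
  show ?thesis
  proof (rule that)
    fix u assume u: "u \<in> U"
    show "0 \<le> \<psi> u"
      unfolding less_eq_rdual_def[of 0 "\<psi> u"]
    proof (intro allI impI)
      fix t :: "'b center_op" assume t: "0 \<le> t"
      have "p (E {u} (\<lambda>_. - t)) \<le> 0" using t by (intro p_le) (auto simp: E_def)
      moreover have "E {u} (\<lambda>_. - t) \<in> X" using u by (intro E_in) simp
      ultimately have "dapp (\<psi> u) (- t) \<le> 0" using h(2) psi[OF u] by (metis order_trans)
      then show "dapp 0 t \<le> dapp (\<psi> u) t" by (simp add: dapp_simps dapp_minus_right)
    qed
  next
    have "p (E U (\<lambda>_. 1)) \<le> 1" by (intro p_le) (auto simp: E_def)
    then have "h (E U (\<lambda>_. 1)) \<le> 1" using h(2)[OF E_in[OF order_refl]] by (rule order_trans[rotated])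
    then show "(\<Sum>u\<in>U. dapp (\<psi> u) 1) \<le> 1" using h_sum[OF U order_refl] by simp
  next
    show "\<phi>1 = (\<Sum>u\<in>U. Re u *\<^sub>R \<psi> u)"
      using eq[of _ 0] by (intro rdual_eqI) (simp add: app_sum dapp_zero_right dapp_scaleR_right)
    show "\<phi>2 = (\<Sum>u\<in>U. Im u *\<^sub>R \<psi> u)"
      using eq[of 0] by (intro rdual_eqI) (simp add: app_sum dapp_zero_right dapp_scaleR_right dapp_minus_right sum_negf)
  qed
qed

text \<open>The decomposition moves the estimate from \<open>\<phi>1\<close> and
  \<open>\<phi>2\<close> to positive functionals, where the order bounds on the rotations of
  \<open>a1\<close> and \<open>a2\<close> apply termwise. The factor \<open>d\<close> accounts for
  directions that are only a net and is removed by scaling.\<close>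

lemma bidual_le_of_finite_combination:
  fixes U :: "complex set" and \<phi>1 \<phi>2 :: "'b::normed_riesz center_op rdual"
  assumes U: "finite U"
    and dom: "\<And>t1 t2 c. 0 \<le> c \<Longrightarrow> (\<And>u. u \<in> U \<Longrightarrow> Re u *\<^sub>R t1 - Im u *\<^sub>R t2 \<le> c *\<^sub>R 1) \<Longrightarrow>
      dapp \<phi>1 t1 - dapp \<phi>2 t2 \<le> d * c"
    and d: "0 < d"
    and a: "\<And>u. u \<in> U \<Longrightarrow> Re u *\<^sub>R a1 - Im u *\<^sub>R a2 \<le> C *\<^sub>R one_bidual" and C: "0 \<le> C"
  shows "dapp a1 \<phi>1 - dapp a2 \<phi>2 \<le> d * C"
proof -
  obtain \<psi> :: "complex \<Rightarrow> 'b center_op rdual" where psi: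
    "\<And>u. u \<in> U \<Longrightarrow> 0 \<le> \<psi> u" "(\<Sum>u\<in>U. dapp (\<psi> u) 1) \<le> 1"
    "inverse d *\<^sub>R \<phi>1 = (\<Sum>u\<in>U. Re u *\<^sub>R \<psi> u)" "inverse d *\<^sub>R \<phi>2 = (\<Sum>u\<in>U. Im u *\<^sub>R \<psi> u)"
  proof (rule finite_combination_decomposition[OF U, of "inverse d *\<^sub>R \<phi>1" "inverse d *\<^sub>R \<phi>2"])
    fix t1 t2 :: "'b center_op" and c :: real
    assume "0 \<le> c" "\<And>u. u \<in> U \<Longrightarrow> Re u *\<^sub>R t1 - Im u *\<^sub>R t2 \<le> c *\<^sub>R 1"
    from dom[OF this] show "dapp (inverse d *\<^sub>R \<phi>1) t1 - dapp (inverse d *\<^sub>R \<phi>2) t2 \<le> c"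
      using d by (simp add: dapp_simps field_simps)
  qed blast
  have app: "dapp a (\<Sum>u\<in>U. r u *\<^sub>R \<psi> u) = (\<Sum>u\<in>U. r u * dapp a (\<psi> u))" for a r
    by (simp add: linear_sum[OF linear_dapp] dapp_scaleR_right)
  have "inverse d * (dapp a1 \<phi>1 - dapp a2 \<phi>2) = dapp a1 (inverse d *\<^sub>R \<phi>1) - dapp a2 (inverse d *\<^sub>R \<phi>2)"
    by (simp add: dapp_scaleR_right right_diff_distrib)
  also have "\<dots> = (\<Sum>u\<in>U. dapp (Re u *\<^sub>R a1 - Im u *\<^sub>R a2) (\<psi> u))"
    unfolding psi app by (simp add: dapp_simps sum_subtractf)
  also have "\<dots> \<le> (\<Sum>u\<in>U. C * dapp (\<psi> u) 1)"
    using dapp_mono_left[OF a psi(1)] by (intro sum_mono) (simp add: dapp_simps)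
  also have "\<dots> = C * (\<Sum>u\<in>U. dapp (\<psi> u) 1)" by (simp add: sum_distrib_left)
  also have "\<dots> \<le> C" using psi(2) C by (simp add: mult_left_le)
  finally show ?thesis using d by (simp add: field_simps)
qed


section \<open>Spaces over the real or complex field\<close>

text \<open>
  \<open>cx\<close> says whether the field is the complex one; \<open>ok y\<close> below says that \<open>y\<close> may occur as an
  imaginary part, that is, \<open>y = 0\<close> over the real field.
\<close>

locale scalar_field =
  fixes \<iota> :: "'k::real_normed_field \<Rightarrow> complex" and cx :: bool
  assumes i_add: "\<iota> (s + t) = \<iota> s + \<iota> t" and i_mult: "\<iota> (s * t) = \<iota> s * \<iota> t"
    and i_of_real: "\<iota> (of_real r) = of_real r" and i_norm: "cmod (\<iota> s) = norm s"
    and i_range: "range \<iota> = {z. cx \<or> Im z = 0}"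
begin

definition re :: "'k \<Rightarrow> real" where "re s = Re (\<iota> s)"
definition im :: "'k \<Rightarrow> real" where "im s = Im (\<iota> s)"

definition ok :: "'x::zero \<Rightarrow> bool" where "ok y \<longleftrightarrow> cx \<or> y = 0"

lemma ok_zero [simp]: "ok 0"
  by (simp add: ok_def)

lemma ok_cx: "cx \<Longrightarrow> ok y"
  unfolding ok_def by (rule disjI1)

lemma ok_not_cx: "\<not> cx \<Longrightarrow> ok y \<Longrightarrow> y = 0"
  unfolding ok_def by blast

lemma ok_add: "ok y \<Longrightarrow> ok y' \<Longrightarrow> ok (y + y' :: 'x::group_add)"
  and ok_diff: "ok y \<Longrightarrow> ok y' \<Longrightarrow> ok (y - y' :: 'x::group_add)"
  and ok_minus: "ok y \<Longrightarrow> ok (- y :: 'x::group_add)"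
  by (auto simp: ok_def)

lemma ok_scaleR: "ok y \<Longrightarrow> ok (r *\<^sub>R y)"
  and ok_dapp: "ok g \<Longrightarrow> ok (dapp g x)" and ok_dapp_right: "ok y \<Longrightarrow> ok (dapp g y)"
  and ok_capp: "ok t \<Longrightarrow> ok (capp t x)" and ok_capp_right: "ok y \<Longrightarrow> ok (capp t y)"
  by (auto simp: ok_def dapp_simps dapp_zero_right capp_simps capp_zero_right)

lemmas ok_intros = ok_add ok_diff ok_minus ok_scaleR ok_dapp ok_dapp_right ok_capp ok_capp_right

lemma i_zero [simp]: "\<iota> 0 = 0" and i_one [simp]: "\<iota> 1 = 1"
  using i_of_real[of 0] i_of_real[of 1] by simp_all

lemma i_minus: "\<iota> (- s) = - \<iota> s"
  using i_add[of s "- s"] by (simp add: eq_neg_iff_add_eq_0 add.commute)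

lemma i_diff: "\<iota> (s - t) = \<iota> s - \<iota> t"
  using i_add[of s "- t"] by (simp add: i_minus)

lemma i_eq_iff: "\<iota> s = \<iota> t \<longleftrightarrow> s = t"
proof
  assume "\<iota> s = \<iota> t"
  then have "norm (s - t) = 0" by (simp add: i_diff flip: i_norm)
  then show "s = t" by simp
qed simp

lemma im_zero: "\<not> cx \<Longrightarrow> im s = 0"
  using i_range by (auto simp: im_def)

lemma scalar_eqI: "re s = re t \<Longrightarrow> im s = im t \<Longrightarrow> s = t"
  by (simp add: re_def im_def complex_eq_iff flip: i_eq_iff)

lemma re_im_simps [simp]:
  "re (s + t) = re s + re t" "im (s + t) = im s + im t" "re (- s) = - re s" "im (- s) = - im s"
  "re (s - t) = re s - re t" "im (s - t) = im s - im t"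
  "re (s * t) = re s * re t - im s * im t" "im (s * t) = re s * im t + im s * re t"
  "re 0 = 0" "im 0 = 0" "re 1 = 1" "im 1 = 0" "re (of_real r) = r" "im (of_real r) = 0"
  by (simp_all add: re_def im_def i_add i_minus i_diff i_mult i_of_real)

lemma abs_re_le: "\<bar>re s\<bar> \<le> norm s" and abs_im_le: "\<bar>im s\<bar> \<le> norm s"
  using abs_Re_le_cmod[of "\<iota> s"] abs_Im_le_cmod[of "\<iota> s"] by (simp_all add: re_def im_def i_norm)

lemma norm_le_re_im: "norm s \<le> \<bar>re s\<bar> + \<bar>im s\<bar>"
  using cmod_le[of "\<iota> s"] by (simp add: re_def im_def i_norm)

definition mk :: "real \<Rightarrow> real \<Rightarrow> 'k" where "mk a b = inv \<iota> (Complex a b)"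

lemma re_mk [simp]: "ok b \<Longrightarrow> re (mk a b) = a" and im_mk [simp]: "ok b \<Longrightarrow> im (mk a b) = b"
proof -
  assume "ok b"
  then have "Complex a b \<in> range \<iota>" by (auto simp: i_range ok_def)
  then have "\<iota> (mk a b) = Complex a b" unfolding mk_def by (rule f_inv_into_f)
  then show "re (mk a b) = a" "im (mk a b) = b" by (simp_all add: re_def im_def)
qed

lemma nonneg_Reals_iff: "s \<in> \<real>\<^sub>\<ge>\<^sub>0 \<longleftrightarrow> im s = 0 \<and> 0 \<le> re s"
proof
  assume "s \<in> \<real>\<^sub>\<ge>\<^sub>0"
  then show "im s = 0 \<and> 0 \<le> re s" by (auto elim: nonneg_Reals_cases)
next
  assume "im s = 0 \<and> 0 \<le> re s"
  then have "s = of_real (re s)" "0 \<le> re s" by (auto intro: scalar_eqI)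
  then show "s \<in> \<real>\<^sub>\<ge>\<^sub>0" by (metis nonneg_Reals_of_real_iff)
qed

lemma square_nonpos_iff: "s\<^sup>2 \<in> \<real>\<^sub>\<le>\<^sub>0 \<longleftrightarrow> re s = 0"
proof -
  have "t \<in> \<real>\<^sub>\<le>\<^sub>0 \<longleftrightarrow> im t = 0 \<and> re t \<le> 0" for t
    using nonneg_Reals_iff[of "- t"] by (simp add: uminus_nonneg_Reals_iff)
  then show ?thesis
    by (auto simp: power2_eq_square) (smt (verit) zero_le_square mult_eq_0_iff)+
qed

lemma unit_rotation:
  fixes s :: 'k
  obtains u where "norm u = 1" "u * s = of_real (norm s)"
proof (cases "s = 0")
  case True
  show ?thesis by (rule that[of 1]) (simp_all add: True)
next
  case False
  then show ?thesis using that[of "of_real (norm s) / s"] by (simp add: norm_divide)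
qed

text \<open>The imaginary unit, or 0 over the real field; there imaginary parts are 0 as well, so
  \<open>c_split\<close> holds for both fields.\<close>

definition unit_i :: 'k where "unit_i = mk 0 (if cx then 1 else 0)"

lemma re_unit_i [simp]: "re unit_i = 0" and im_unit_i [simp]: "im unit_i = (if cx then 1 else 0)"
  by (simp_all add: unit_i_def ok_def)

text \<open>\<open>m\<close> is the modulus of \<open>x + i y\<close>.\<close>

definition is_modulus :: "'b::normed_riesz \<Rightarrow> 'b \<Rightarrow> 'b \<Rightarrow> bool" where
  "is_modulus x y m \<longleftrightarrow> (\<forall>w. m \<le> w \<longleftrightarrow> (\<forall>u. norm u = 1 \<longrightarrow> re u *\<^sub>R x - im u *\<^sub>R y \<le> w))"

lemma rotation_le_sum:
  fixes x y :: "'b::normed_riesz"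
  assumes "norm u = 1"
  shows "re u *\<^sub>R x - im u *\<^sub>R y \<le> \<bar>x\<bar> + \<bar>y\<bar>"
proof -
  have le: "r *\<^sub>R z \<le> \<bar>z\<bar>" if "\<bar>r\<bar> \<le> 1" for r and z :: 'b
  proof -
    have "r *\<^sub>R z \<le> \<bar>r\<bar> *\<^sub>R \<bar>z\<bar>" using abs_ge_self[of "r *\<^sub>R z"] by (simp add: abs_scaleR)
    also have "\<dots> \<le> 1 *\<^sub>R \<bar>z\<bar>" using that by (intro scaleR_right_mono) auto
    finally show ?thesis by simp
  qed
  have "re u *\<^sub>R x + (- im u) *\<^sub>R y \<le> \<bar>x\<bar> + \<bar>y\<bar>"
    using abs_re_le[of u] abs_im_le[of u] assms by (intro add_mono le) auto
  then show ?thesis by simp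
qed

text \<open>The rotations by 1 and -1 bound \<open>x\<close>, those by the two imaginary units bound
  \<open>y\<close>; over the real field \<open>y = 0\<close>.\<close>

lemma rotation_bound:
  fixes x y :: "'b::normed_riesz"
  assumes "\<And>u. norm u = 1 \<Longrightarrow> re u *\<^sub>R x - im u *\<^sub>R y \<le> w" and "ok y"
  shows "\<bar>x\<bar> \<le> w" "\<bar>y\<bar> \<le> w"
proof -
  have x: "x \<le> w" "- x \<le> w" using assms(1)[of 1] assms(1)[of "- 1"] by simp_all
  then show "\<bar>x\<bar> \<le> w" by (rule abs_leI)
  show "\<bar>y\<bar> \<le> w"
  proof (cases cx)
    case True
    have k: "ok b" for b :: real using True by (rule ok_cx)
    have n: "norm (mk 0 b) = \<bar>b\<bar>" for b
      using i_norm[of "mk 0 b"] re_mk[of b 0, unfolded ok_def] im_mk[of b 0, unfolded ok_def] True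
      by (simp add: re_def im_def cmod_def)
    have "y \<le> w" "- y \<le> w"
      using assms(1)[of "mk 0 (- 1)"] assms(1)[of "mk 0 1"] n k by simp_all
    then show ?thesis by (rule abs_leI)
  next
    case False
    then have "y = 0" using assms(2) by (rule ok_not_cx)
    moreover have "0 \<le> w" by (rule order_trans[OF abs_ge_zero abs_leI[OF x]])
    ultimately show ?thesis by simp
  qed
qed

lemma rdual_modulus_exists: "\<exists>m. is_modulus (f :: 'b::normed_riesz rdual) g m"
proof -
  let ?F = "{re u *\<^sub>R f - im u *\<^sub>R g |u. norm u = 1}"
  have "re 1 *\<^sub>R f - im 1 *\<^sub>R g \<in> ?F" by (intro CollectI exI[of _ 1]) simp
  then have ne: "?F \<noteq> {}" by blast
  have "h \<le> \<bar>f\<bar> + \<bar>g\<bar>" if "h \<in> ?F" for h using that rotation_le_sum by auto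
  from rdual_lub_exists[OF ne this] obtain m where "\<forall>w. m \<le> w \<longleftrightarrow> (\<forall>h\<in>?F. h \<le> w)" by blast
  then show ?thesis unfolding is_modulus_def by (intro exI[of _ m]) blast
qed

end


subsection \<open>Operator norms\<close>

definition homogeneous_norm :: "('k::real_normed_field, 'v::ab_group_add) ospace \<Rightarrow> bool" where
  "homogeneous_norm V \<longleftrightarrow> 0 \<in> vecs V \<and> (\<forall>s. \<forall>z\<in>vecs V. smul V s z \<in> vecs V \<and>
     vnorm V (smul V s z) = norm s * vnorm V z) \<and> (\<forall>z\<in>vecs V. 0 \<le> vnorm V z) \<and>
     (\<forall>z\<in>vecs V. vnorm V z = 0 \<longrightarrow> z = 0)"

context
  fixes V :: "('k::real_normed_field, 'v::ab_group_add) ospace"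
    and W :: "('k, 'w::ab_group_add) ospace"
  assumes V: "homogeneous_norm V" and W: "homogeneous_norm W"
begin

lemma zero_norm: "0 \<in> vecs V" "vnorm V 0 = 0"
proof -
  show z: "0 \<in> vecs V" using V by (simp add: homogeneous_norm_def)
  have "vnorm V (smul V 0 0) = 0" using V z by (simp add: homogeneous_norm_def)
  moreover have "smul V 0 0 = 0"
    using V z calculation unfolding homogeneous_norm_def by blast
  ultimately show "vnorm V 0 = 0" by simp
qed

lemma bounded_mapsD:
  assumes "T \<in> bounded_maps V W"
  shows "z \<in> vecs V \<Longrightarrow> T z \<in> vecs W" "z \<in> vecs V \<Longrightarrow> T (smul V s z) = smul W s (T z)"
    "\<exists>C\<ge>0. \<forall>z\<in>vecs V. vnorm W (T z) \<le> C * vnorm V z"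
proof -
  show "z \<in> vecs V \<Longrightarrow> T z \<in> vecs W" "z \<in> vecs V \<Longrightarrow> T (smul V s z) = smul W s (T z)"
    using assms by (auto simp: bounded_maps_def linear_map_def)
  obtain C where C: "\<forall>z\<in>vecs V. vnorm W (T z) \<le> C * vnorm V z" using assms by (auto simp: bounded_maps_def)
  have "vnorm W (T z) \<le> \<bar>C\<bar> * vnorm V z" if "z \<in> vecs V" for z
    using C that V unfolding homogeneous_norm_def by (meson abs_ge_self mult_right_mono order_trans)
  then show "\<exists>C\<ge>0. \<forall>z\<in>vecs V. vnorm W (T z) \<le> C * vnorm V z" by (intro exI[of _ "\<bar>C\<bar>"]) simp
qed

lemma operator_norm_le:
  assumes "\<And>z. z \<in> vecs V \<Longrightarrow> vnorm V z \<le> 1 \<Longrightarrow> vnorm W (T z) \<le> C"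
  shows "vnorm (operators V W) T \<le> C"
proof -
  have "0 \<in> vecs V \<and> vnorm V 0 \<le> 1" using zero_norm by simp
  then have "{vnorm W (T x) |x. x \<in> vecs V \<and> vnorm V x \<le> 1} \<noteq> {}" by blast
  then show ?thesis unfolding operators_def using assms by (auto intro!: cSup_least)
qed

lemma operator_norm_bound:
  assumes T: "T \<in> bounded_maps V W" and z: "z \<in> vecs V"
  shows "vnorm W (T z) \<le> vnorm (operators V W) T * vnorm V z"
proof -
  obtain C where C: "0 \<le> C" "\<And>z. z \<in> vecs V \<Longrightarrow> vnorm W (T z) \<le> C * vnorm V z"
    using bounded_mapsD(3)[OF T] by blast
  have bdd: "bdd_above {vnorm W (T x) |x. x \<in> vecs V \<and> vnorm V x \<le> 1}"
  proof (rule bdd_aboveI, clarify)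
    fix x assume "x \<in> vecs V" "vnorm V x \<le> 1"
    then show "vnorm W (T x) \<le> C" using C(2)[of x] mult_left_mono[of "vnorm V x" 1 C] C(1) by simp
  qed
  have unit: "vnorm W (T x) \<le> vnorm (operators V W) T" if "x \<in> vecs V" "vnorm V x \<le> 1" for x
    unfolding operators_def using that by (auto intro!: cSup_upper bdd)
  show ?thesis
  proof (cases "vnorm V z = 0")
    case True
    then show ?thesis using C(2)[OF z] by simp
  next
    case False
    then have pos: "0 < vnorm V z" using V z by (auto simp: homogeneous_norm_def less_le)
    define s :: 'k where "s = of_real (inverse (vnorm V z))"
    have "norm s = inverse (vnorm V z)" using pos unfolding s_def norm_of_real by simp
    moreover have "vnorm W (T (smul V s z)) = norm s * vnorm W (T z)"
      using W bounded_mapsD(1,2)[OF T z] by (simp add: homogeneous_norm_def)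
    moreover have "vnorm W (T (smul V s z)) \<le> vnorm (operators V W) T"
      using V z pos \<open>norm s = _\<close> by (intro unit) (auto simp: homogeneous_norm_def)
    ultimately have "inverse (vnorm V z) * vnorm W (T z) \<le> vnorm (operators V W) T" by simp
    then show ?thesis using pos by (simp add: field_simps)
  qed
qed

lemma operator_norm_nonneg:
  assumes T: "T \<in> bounded_maps V W" shows "0 \<le> vnorm (operators V W) T"
proof (cases "\<exists>z\<in>vecs V. vnorm V z \<noteq> 0")
  case True
  then obtain z where z: "z \<in> vecs V" "0 < vnorm V z" using V by (auto simp: homogeneous_norm_def less_le)
  have "0 \<le> vnorm (operators V W) T * vnorm V z"
    using operator_norm_bound[OF T z(1)] W bounded_mapsD(1)[OF T z(1)] by (auto simp: homogeneous_norm_def intro: order_trans)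
  then show ?thesis using z by (simp add: zero_le_mult_iff)
next
  case False
  have zero: "vnorm W (T z) = 0" if z: "z \<in> vecs V" for z
  proof -
    have "vnorm W (T z) \<le> 0" using operator_norm_bound[OF T z] False z by simp
    moreover have "0 \<le> vnorm W (T z)" using W bounded_mapsD(1)[OF T z] by (simp add: homogeneous_norm_def)
    ultimately show ?thesis by simp
  qed
  have "{vnorm W (T x) |x. x \<in> vecs V \<and> vnorm V x \<le> 1} = {0}"
    using zero zero_norm by (auto intro!: exI[of _ 0])
  then show ?thesis by (simp add: operators_def)
qed

lemma operator_norm_smul:
  assumes T: "T \<in> bounded_maps V W" and sT: "(\<lambda>z. smul W s (T z)) \<in> bounded_maps V W"
  shows "vnorm (operators V W) (\<lambda>z. smul W s (T z)) = norm s * vnorm (operators V W) T"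
proof -
  have eq: "vnorm W (smul W s (T z)) = norm s * vnorm W (T z)" if "z \<in> vecs V" for z
    using W bounded_mapsD(1)[OF T that] by (simp add: homogeneous_norm_def)
  have unit: "vnorm W (R z) \<le> vnorm (operators V W) R" if R: "R \<in> bounded_maps V W" and z: "z \<in> vecs V" "vnorm V z \<le> 1" for R z
    using operator_norm_bound[OF R z(1)] mult_left_mono[OF z(2) operator_norm_nonneg[OF R]] by simp
  show ?thesis
  proof (rule antisym)
    show "vnorm (operators V W) (\<lambda>z. smul W s (T z)) \<le> norm s * vnorm (operators V W) T"
      by (rule operator_norm_le) (simp add: eq unit[OF T] mult_left_mono)
    show "norm s * vnorm (operators V W) T \<le> vnorm (operators V W) (\<lambda>z. smul W s (T z))"
    proof (cases "s = 0")
      case True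
      then show ?thesis using operator_norm_nonneg[OF sT] by simp
    next
      case False
      have "vnorm (operators V W) T \<le> vnorm (operators V W) (\<lambda>z. smul W s (T z)) / norm s"
      proof (rule operator_norm_le)
        fix z assume "z \<in> vecs V" "vnorm V z \<le> 1"
        then show "vnorm W (T z) \<le> vnorm (operators V W) (\<lambda>z. smul W s (T z)) / norm s"
          using unit[OF sT, of z] eq[of z] False by (simp add: field_simps)
      qed
      then show ?thesis using False by (simp add: field_simps)
    qed
  qed
qed

end

lemma homogeneous_norm_scalars: "homogeneous_norm (scalars :: ('k::real_normed_field, 'k) ospace)"
  by (simp add: homogeneous_norm_def scalars_def norm_mult)

lemma scalars_simps [simp]: "vecs scalars = UNIV" "smul scalars = (*)" "vnorm scalars = norm" "cone scalars = \<real>\<^sub>\<ge>\<^sub>0"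
  by (simp_all add: scalars_def)


subsection \<open>Complexifications\<close>

text \<open>
  The space \<open>V\<close> consists of the vectors \<open>c x y\<close>, to be read as \<open>x + i y\<close>, where \<open>y = 0\<close> in the real case.
\<close>

locale kspace = scalar_field \<iota> cx for \<iota> :: "'k::real_normed_field \<Rightarrow> complex" and cx +
  fixes V :: "('k, 'v::ab_group_add) ospace" and c :: "'b::normed_riesz \<Rightarrow> 'b \<Rightarrow> 'v"
  assumes vecs_eq: "vecs V = {c x y |x y. ok y}"
    and c_inj: "ok y \<Longrightarrow> ok y' \<Longrightarrow> c x y = c x' y' \<Longrightarrow> x = x' \<and> y = y'"
    and c_add: "ok y \<Longrightarrow> ok y' \<Longrightarrow> c x y + c x' y' = c (x + x') (y + y')"
    and c_smul: "ok y \<Longrightarrow> smul V s (c x y) = c (re s *\<^sub>R x - im s *\<^sub>R y) (im s *\<^sub>R x + re s *\<^sub>R y)"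
    and cone_eq: "cone V = {c x 0 |x. 0 \<le> x}"
    and norm_smul: "ok y \<Longrightarrow> vnorm V (smul V s (c x y)) = norm s * vnorm V (c x y)"
    and norm_bounds: "\<exists>K>0. \<forall>x y. ok y \<longrightarrow> norm x \<le> K * vnorm V (c x y) \<and> norm y \<le> K * vnorm V (c x y) \<and>
      vnorm V (c x y) \<le> K * (norm x + norm y)"
begin

lemma ok_smul: "ok y \<Longrightarrow> ok (im s *\<^sub>R x + re s *\<^sub>R (y :: 'x::real_vector))"
  unfolding ok_def by (metis add.left_neutral im_zero scaleR_zero_left scaleR_zero_right)

lemma c_in [simp]: "ok y \<Longrightarrow> c x y \<in> vecs V"
  by (auto simp: vecs_eq)

lemma c_zero: "c 0 0 = 0"
  using c_add[of 0 0 0 0] by simp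

lemma c_minus: "ok y \<Longrightarrow> - c x y = c (- x) (- y)"
  using c_add[of y "- y" x "- x"] by (simp add: c_zero ok_minus minus_unique)

lemma c_diff: "ok y \<Longrightarrow> ok y' \<Longrightarrow> c x y - c x' y' = c (x - x') (y - y')"
  using c_add[of y "- y'" x "- x'"] c_minus[of y' x'] by (simp only: diff_conv_add_uminus ok_minus)

definition px :: "'v \<Rightarrow> 'b" where "px z = fst (SOME p. ok (snd p) \<and> z = c (fst p) (snd p))"
definition py :: "'v \<Rightarrow> 'b" where "py z = snd (SOME p. ok (snd p) \<and> z = c (fst p) (snd p))"

lemma px_c [simp]: "ok y \<Longrightarrow> px (c x y) = x" and py_c [simp]: "ok y \<Longrightarrow> py (c x y) = y"
proof -
  assume y: "ok y"
  let ?P = "\<lambda>p. ok (snd p) \<and> c x y = c (fst p) (snd p)"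
  have "?P (SOME p. ?P p)" using y by (intro someI[of ?P "(x, y)"]) simp
  then have "x = fst (SOME p. ?P p) \<and> y = snd (SOME p. ?P p)" by (intro c_inj[OF y]) auto
  then show "px (c x y) = x" "py (c x y) = y" by (simp_all add: px_def py_def)
qed

lemma vecs_cases: assumes "z \<in> vecs V" obtains x y where "ok y" "z = c x y"
  using assms by (auto simp: vecs_eq)

lemma real_vecs_eq: "real_vecs V = {c x 0 |x. True}"
proof (intro set_eqI iffI)
  fix z assume "z \<in> real_vecs V"
  then obtain x y where "z = c x 0 - c y 0" by (auto simp: real_vecs_def cone_eq)
  then show "z \<in> {c x 0 |x. True}" by (auto simp: c_diff)
next
  fix z assume "z \<in> {c x 0 |x. True}"
  then obtain x where "z = c x 0" by auto
  then have "z = c (pprt x) 0 - c (pprt (- x)) 0" by (simp add: c_diff pprt_diff_eq)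
  then show "z \<in> real_vecs V" unfolding real_vecs_def cone_eq
    by (intro CollectI exI[of _ "c (pprt x) 0"] exI[of _ "c (pprt (- x)) 0"]) auto
qed

lemma le_c: "ok y \<Longrightarrow> ok y' \<Longrightarrow> le V (c x y) (c x' y') \<longleftrightarrow> y = y' \<and> x \<le> x'"
proof -
  assume y: "ok y" "ok y'"
  have "le V (c x y) (c x' y') \<longleftrightarrow> (\<exists>w. c (x' - x) (y' - y) = c w 0 \<and> 0 \<le> w)"
    using y by (simp add: le_def cone_eq c_diff)
  also have "\<dots> \<longleftrightarrow> y = y' \<and> x \<le> x'"
    using c_inj[OF ok_diff[OF y(2,1)] ok_zero, of "x' - x"] by (fastforce intro: exI[of _ "x' - x"])
  finally show ?thesis .
qed

lemma c_split: "ok y \<Longrightarrow> c x y = c x 0 + smul V unit_i (c y 0)"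
  by (auto simp: c_smul c_add c_zero ok_def)

lemma is_Re_c: "ok y \<Longrightarrow> is_Re V (c x y) z \<longleftrightarrow> z = c x 0"
proof
  assume y: "ok y" and "is_Re V (c x y) z"
  then obtain s a b where s: "re s = 0" "c x y = z + smul V s (c b 0)" "z = c a 0"
    unfolding is_Re_def real_vecs_eq by (auto simp: square_nonpos_iff)
  have k: "ok (im s *\<^sub>R b)" using im_zero[of s] by (auto simp: ok_def)
  have "c x y = c a (im s *\<^sub>R b)" using s k by (simp add: c_smul c_add)
  then show "z = c x 0" using c_inj[OF y k] s by auto
next
  assume y: "ok y" and z: "z = c x 0"
  show "is_Re V (c x y) z"
    unfolding is_Re_def real_vecs_eq z
    using c_split[OF y, of x] by (auto simp: square_nonpos_iff intro!: exI[of _ unit_i])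
qed

text \<open>The set of rotated real parts is nonempty, so each of its upper bounds in
  \<open>V\<close> has imaginary part 0. Hence the supremum in \<open>V\<close> is the one in the
  real lattice.\<close>

lemma modulus_c:
  assumes y: "ok y" and m: "is_modulus x y m"
  shows "modulus V (c x y) = c m 0"
proof -
  define S where "S = {c (re u *\<^sub>R x - im u *\<^sub>R y) 0 |u. norm u = 1}"
  have S: "{z. \<exists>u. norm u = 1 \<and> is_Re V (smul V u (c x y)) z} = S"
    unfolding S_def c_smul[OF y] is_Re_c[OF ok_smul[OF y]] by blast
  have ub: "(\<forall>a\<in>S. le V a (c w v)) \<longleftrightarrow> v = 0 \<and> m \<le> w" if v: "ok v" for w v
  proof -
    have "(\<forall>a\<in>S. le V a (c w v)) \<longleftrightarrow> (\<forall>u. norm u = 1 \<longrightarrow> 0 = v \<and> re u *\<^sub>R x - im u *\<^sub>R y \<le> w)"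
      unfolding S_def le_c[OF ok_zero v, symmetric] by blast
    also have "\<dots> \<longleftrightarrow> v = 0 \<and> m \<le> w"
      using m norm_one[where 'a = 'k] unfolding is_modulus_def by metis
    finally show ?thesis .
  qed
  show ?thesis
    unfolding modulus_def S
  proof (rule the_equality)
    show "is_lub V S (c m 0)"
      unfolding is_lub_def
    proof (intro conjI ballI impI)
      show "le V a (c m 0)" if "a \<in> S" for a using ub[OF ok_zero, of m] that by simp
      fix z assume "z \<in> vecs V" and z: "\<forall>a\<in>S. le V a z"
      obtain w v where "ok v" "z = c w v" using \<open>z \<in> vecs V\<close> by (rule vecs_cases)
      then show "le V (c m 0) z" using z ub[of v w] by (simp add: le_c)
    qed simp
    fix z assume L: "is_lub V S z"
    then have "z \<in> vecs V" by (simp add: is_lub_def)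
    then obtain w v where z: "ok v" "z = c w v" by (rule vecs_cases)
    have "v = 0" "m \<le> w" using L ub[OF z(1), of w] z by (auto simp: is_lub_def)
    moreover have "le V z (c m 0)" using L ub[OF ok_zero, of m] by (simp add: is_lub_def)
    ultimately show "z = c m 0" using z by (simp add: le_c antisym)
  qed
qed

lemma vnorm_nonneg: "ok y \<Longrightarrow> 0 \<le> vnorm V (c x y)"
proof -
  assume y: "ok y"
  obtain K where "0 < K" "norm x \<le> K * vnorm V (c x y)" using norm_bounds y by blast
  then have "0 \<le> K * vnorm V (c x y)" using norm_ge_zero order_trans by blast
  then show ?thesis using \<open>0 < K\<close> by (simp add: zero_le_mult_iff)
qed

lemma homogeneous: "homogeneous_norm V"
  unfolding homogeneous_norm_def
proof (intro conjI allI ballI impI)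
  show "0 \<in> vecs V" using c_in[of 0 0] by (simp add: c_zero)
  fix z assume "z \<in> vecs V"
  then obtain x y where z: "ok y" "z = c x y" by (rule vecs_cases)
  show "smul V s z \<in> vecs V" for s unfolding z c_smul[OF z(1)] by (rule c_in[OF ok_smul[OF z(1)]])
  show "vnorm V (smul V s z) = norm s * vnorm V z" for s using z by (simp add: norm_smul)
  show "0 \<le> vnorm V z" using z by (simp add: vnorm_nonneg)
  assume "vnorm V z = 0"
  moreover obtain K where "norm x \<le> K * vnorm V z" "norm y \<le> K * vnorm V z" using norm_bounds z by blast
  ultimately show "z = 0" using z by (simp add: c_zero)
qed

text \<open>The functional \<open>f + i g\<close>.\<close>

definition dc :: "'b rdual \<Rightarrow> 'b rdual \<Rightarrow> 'v \<Rightarrow> 'k" where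
  "dc f g = restrict0 (vecs V) (\<lambda>z. mk (dapp f (px z) - dapp g (py z)) (dapp g (px z) + dapp f (py z)))"

lemma re_dc [simp]: "ok y \<Longrightarrow> ok g \<Longrightarrow> re (dc f g (c x y)) = dapp f x - dapp g y"
  and im_dc [simp]: "ok y \<Longrightarrow> ok g \<Longrightarrow> im (dc f g (c x y)) = dapp g x + dapp f y"
proof -
  assume "ok y" "ok g"
  then have "ok (dapp g x + dapp f y)" by (intro ok_intros)
  then show "re (dc f g (c x y)) = dapp f x - dapp g y" "im (dc f g (c x y)) = dapp g x + dapp f y"
    using \<open>ok y\<close> by (simp_all add: dc_def restrict0_def)
qed

lemma dc_eqI:
  assumes "ok g" "\<And>z. z \<notin> vecs V \<Longrightarrow> F z = 0"
    "\<And>x y. ok y \<Longrightarrow> re (F (c x y)) = dapp f x - dapp g y"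
    "\<And>x y. ok y \<Longrightarrow> im (F (c x y)) = dapp g x + dapp f y"
  shows "F = dc f g"
proof
  fix z
  show "F z = dc f g z"
  proof (cases "z \<in> vecs V")
    case True
    then obtain x y where "ok y" "z = c x y" by (rule vecs_cases)
    then show ?thesis using assms by (auto intro!: scalar_eqI)
  qed (use assms in \<open>simp add: dc_def restrict0_def\<close>)
qed

lemma dc_bounded: assumes g: "ok g" shows "dc f g \<in> bounded_maps V scalars"
  unfolding bounded_maps_def linear_map_def
proof (intro CollectI conjI allI ballI impI)
  show "dc f g x \<in> vecs scalars" for x by simp
  show "dc f g z = 0" if "z \<notin> vecs V" for z using that by (simp add: dc_def restrict0_def)
  fix z assume "z \<in> vecs V"
  then obtain x y where z: "ok y" "z = c x y" by (rule vecs_cases)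
  show "dc f g (smul V s z) = smul scalars s (dc f g z)" for s
    unfolding z c_smul[OF z(1)]
    by (rule scalar_eqI)
       (simp_all add: re_dc[OF ok_smul[OF z(1)] g] im_dc[OF ok_smul[OF z(1)] g] re_dc[OF z(1) g] im_dc[OF z(1) g]
         dapp_add_right dapp_diff_right dapp_scaleR_right algebra_simps del: re_dc im_dc)
  fix w assume "w \<in> vecs V"
  then obtain x' y' where w: "ok y'" "w = c x' y'" by (rule vecs_cases)
  have "ok (y + y')" using z w by (intro ok_intros)
  then show "dc f g (z + w) = dc f g z + dc f g w"
    using z w g by (auto intro!: scalar_eqI simp: c_add dapp_add_right)
next
  obtain K where K: "0 < K" "\<And>x y. ok y \<Longrightarrow> norm x \<le> K * vnorm V (c x y)" "\<And>x y. ok y \<Longrightarrow> norm y \<le> K * vnorm V (c x y)"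
    using norm_bounds by blast
  show "\<exists>C. \<forall>z\<in>vecs V. vnorm scalars (dc f g z) \<le> C * vnorm V z"
  proof (intro exI ballI)
    fix z assume "z \<in> vecs V"
    then obtain x y where z: "ok y" "z = c x y" by (rule vecs_cases)
    have b: "\<bar>dapp h w\<bar> \<le> norm h * (K * vnorm V z)" if "norm w \<le> K * vnorm V z" for h w
      using norm_dapp_le[of h w] mult_left_mono[OF that, of "norm h"] by simp
    have xy: "norm x \<le> K * vnorm V z" "norm y \<le> K * vnorm V z" using K(2,3)[OF z(1), of x] z by auto
    have "norm (dc f g z) \<le> \<bar>dapp f x - dapp g y\<bar> + \<bar>dapp g x + dapp f y\<bar>"
      using norm_le_re_im[of "dc f g z"] z g by simp
    also have "\<dots> \<le> 2 * (norm f + norm g) * K * vnorm V z"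
      using b[OF xy(1), of f] b[OF xy(2), of f] b[OF xy(1), of g] b[OF xy(2), of g] by (simp add: algebra_simps)
    finally show "vnorm scalars (dc f g z) \<le> 2 * (norm f + norm g) * K * vnorm V z" by simp
  qed
qed

lemma dual_cases:
  assumes F: "F \<in> bounded_maps V scalars"
  obtains f g where "ok g" "F = dc f g"
proof -
  have F_add: "F (z + w) = F z + F w" if "z \<in> vecs V" "w \<in> vecs V" for z w
    using F that by (auto simp: bounded_maps_def linear_map_def)
  have F_smul: "F (smul V s z) = s * F z" if "z \<in> vecs V" for s z
    using F that by (auto simp: bounded_maps_def linear_map_def)
  obtain C where C: "0 \<le> C" "\<And>z. z \<in> vecs V \<Longrightarrow> norm (F z) \<le> C * vnorm V z"
    using bounded_mapsD(3)[OF homogeneous homogeneous_norm_scalars F] by auto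
  obtain K where K: "0 < K" "\<And>x y. ok y \<Longrightarrow> vnorm V (c x y) \<le> K * (norm x + norm y)" using norm_bounds by blast
  have bound: "norm (F (c x 0)) \<le> C * K * norm x" for x
    using C(2)[of "c x 0"] mult_left_mono[OF K(2)[of 0 x] C(1)] by simp
  have add: "F (c (x + y) 0) = F (c x 0) + F (c y 0)" for x y
    using F_add[of "c x 0" "c y 0"] by (simp add: c_add)
  have scale: "F (c (r *\<^sub>R x) 0) = of_real r * F (c x 0)" for r x
    using F_smul[of "c x 0" "of_real r"] by (simp add: c_smul)
  have f: "dapp (Abs_rdual (\<lambda>x. re (F (c x 0)))) = (\<lambda>x. re (F (c x 0)))"
    by (rule dapp_Abs_rdual[of _ "C * K"]) (use bound abs_re_le in \<open>auto simp: add scale intro: order_trans\<close>)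
  have g: "dapp (Abs_rdual (\<lambda>x. im (F (c x 0)))) = (\<lambda>x. im (F (c x 0)))"
    by (rule dapp_Abs_rdual[of _ "C * K"]) (use bound abs_im_le in \<open>auto simp: add scale intro: order_trans\<close>)
  show ?thesis
  proof (rule that)
    show ok: "ok (Abs_rdual (\<lambda>x. im (F (c x 0))))"
    proof (cases cx)
      case False
      then have "Abs_rdual (\<lambda>x. im (F (c x 0))) = 0"
        using im_zero by (intro rdual_eqI) (simp add: g[unfolded im_zero[OF False]] im_zero dapp_simps)
      then show ?thesis by (simp add: ok_def)
    next
      case True
      then show ?thesis by (rule ok_cx)
    qed
    show "F = dc (Abs_rdual (\<lambda>x. re (F (c x 0)))) (Abs_rdual (\<lambda>x. im (F (c x 0))))"
    proof (rule dc_eqI[OF ok])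
      show "F z = 0" if "z \<notin> vecs V" for z using F that by (auto simp: bounded_maps_def)
      fix x y :: 'b assume y: "ok y"
      have "smul V unit_i (c y 0) \<in> vecs V" using homogeneous by (simp add: homogeneous_norm_def)
      then have "F (c x y) = F (c x 0) + unit_i * F (c y 0)"
        using F_add[of "c x 0" "smul V unit_i (c y 0)"] F_smul[of "c y 0" unit_i] c_split[OF y, of x] by simp
      moreover have "F (c y 0) = 0" if "\<not> cx"
        using ok_not_cx[OF that y] scale[of 0 0] by simp
      ultimately show "re (F (c x y)) = dapp (Abs_rdual (\<lambda>x. re (F (c x 0)))) x - dapp (Abs_rdual (\<lambda>x. im (F (c x 0)))) y"
        "im (F (c x y)) = dapp (Abs_rdual (\<lambda>x. im (F (c x 0)))) x + dapp (Abs_rdual (\<lambda>x. re (F (c x 0)))) y"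
        using im_zero by (auto simp: f g)
    qed
  qed
qed

lemma dual_simps: "vecs (dual V) = bounded_maps V scalars" "smul (dual V) s F = (\<lambda>z. s * F z)"
  "cone (dual V) = {T \<in> bounded_maps V scalars. \<forall>z\<in>cone V. T z \<in> \<real>\<^sub>\<ge>\<^sub>0}"
  by (simp_all add: dual_def operators_def)

lemma vecs_dual: "vecs (dual V) = {dc f g |f g. ok g}"
  unfolding dual_simps by (blast intro: dc_bounded elim: dual_cases)

lemma dc_smul: assumes g: "ok g"
  shows "(\<lambda>z. s * dc f g z) = dc (re s *\<^sub>R f - im s *\<^sub>R g) (im s *\<^sub>R f + re s *\<^sub>R g)"
proof (rule dc_eqI[OF ok_smul[OF g]])
  show "s * dc f g z = 0" if "z \<notin> vecs V" for z using that by (simp add: dc_def restrict0_def)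
qed (use g in \<open>simp_all add: dapp_simps algebra_simps\<close>)

lemma dual_norm_bound:
  "F \<in> vecs (dual V) \<Longrightarrow> z \<in> vecs V \<Longrightarrow> norm (F z) \<le> vnorm (dual V) F * vnorm V z"
  using operator_norm_bound[OF homogeneous homogeneous_norm_scalars, of F z] by (simp add: dual_def[symmetric] dual_simps)

lemma dual_norm_le:
  "(\<And>z. z \<in> vecs V \<Longrightarrow> vnorm V z \<le> 1 \<Longrightarrow> norm (F z) \<le> C) \<Longrightarrow> vnorm (dual V) F \<le> C"
  using operator_norm_le[OF homogeneous homogeneous_norm_scalars, of F C] by (simp add: dual_def[symmetric])

lemma dual_norm_nonneg: "F \<in> vecs (dual V) \<Longrightarrow> 0 \<le> vnorm (dual V) F"
  using operator_norm_nonneg[OF homogeneous homogeneous_norm_scalars, of F] by (simp add: dual_def[symmetric] dual_simps)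

lemma kspace_dual: "kspace \<iota> cx (dual V) dc"
proof (unfold_locales)
  show "vecs (dual V) = {dc f g |f g. ok g}" by (rule vecs_dual)
  fix f g f' g' :: "'b rdual" assume g: "ok g"
  show "smul (dual V) s (dc f g) = dc (re s *\<^sub>R f - im s *\<^sub>R g) (im s *\<^sub>R f + re s *\<^sub>R g)" for s
    by (simp add: dual_simps dc_smul[OF g])
  have d: "dc f g \<in> vecs (dual V)" using g by (auto simp: vecs_dual)
  show "vnorm (dual V) (smul (dual V) s (dc f g)) = norm s * vnorm (dual V) (dc f g)" for s
    using operator_norm_smul[OF homogeneous homogeneous_norm_scalars dc_bounded[OF g], of s f]
      dc_bounded[OF ok_smul[OF g]]
    by (simp add: dual_simps dc_smul[OF g]) (simp add: dual_def)
  assume g': "ok g'"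
  show "dc f g + dc f' g' = dc (f + f') (g + g')"
  proof (rule dc_eqI)
    show "ok (g + g')" using g g' by (intro ok_intros)
    show "(dc f g + dc f' g') z = 0" if "z \<notin> vecs V" for z using that by (simp add: dc_def restrict0_def)
  qed (use g g' in \<open>simp_all add: dapp_simps\<close>)
  assume "dc f g = dc f' g'"
  then have "re (dc f g (c x 0)) = re (dc f' g' (c x 0))" "im (dc f g (c x 0)) = im (dc f' g' (c x 0))" for x by simp_all
  then show "f = f' \<and> g = g'" using g g' by (auto intro!: rdual_eqI simp: dapp_zero_right)
next
  show "cone (dual V) = {dc f 0 |f. 0 \<le> f}"
  proof (intro set_eqI iffI)
    fix F assume F: "F \<in> cone (dual V)"
    then obtain f g where fg: "ok g" "F = dc f g" using vecs_dual by (auto simp: dual_simps elim: dual_cases)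
    have "F (c x 0) \<in> \<real>\<^sub>\<ge>\<^sub>0" if "0 \<le> x" for x using F that by (auto simp: dual_simps cone_eq)
    then have "dapp g x = 0" "0 \<le> dapp f x" if "0 \<le> x" for x
      using fg that by (fastforce simp: nonneg_Reals_iff dapp_zero_right)+
    then have "g = 0" "0 \<le> f" by (auto intro!: rdual_eqI simp: dapp_simps less_eq_rdual_def)
    with fg show "F \<in> {dc f 0 |f. 0 \<le> f}" by auto
  next
    fix F assume "F \<in> {dc f 0 |f. 0 \<le> f}"
    then obtain f where "F = dc f 0" "0 \<le> f" by auto
    then show "F \<in> cone (dual V)"
      by (auto simp: dual_simps dc_bounded cone_eq nonneg_Reals_iff dapp_nonneg dapp_zero_right dapp_simps)
  qed
next
  obtain K where K: "0 < K" "\<And>x y. ok y \<Longrightarrow> norm x \<le> K * vnorm V (c x y)"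
    "\<And>x y. ok y \<Longrightarrow> norm y \<le> K * vnorm V (c x y)" "\<And>x y. ok y \<Longrightarrow> vnorm V (c x y) \<le> K * (norm x + norm y)"
    using norm_bounds by blast
  show "\<exists>K>0. \<forall>f g. ok g \<longrightarrow> norm f \<le> K * vnorm (dual V) (dc f g) \<and> norm g \<le> K * vnorm (dual V) (dc f g) \<and>
      vnorm (dual V) (dc f g) \<le> K * (norm f + norm g)"
  proof (intro exI[of _ "2 * K"] conjI allI impI)
    fix f g :: "'b rdual" assume g: "ok g"
    have d: "dc f g \<in> vecs (dual V)" using g by (auto simp: vecs_dual)
    note nn = dual_norm_nonneg[OF d]
    have b: "norm (dc f g (c x 0)) \<le> 2 * K * vnorm (dual V) (dc f g) * norm x" for x
    proof -
      have "norm (dc f g (c x 0)) \<le> vnorm (dual V) (dc f g) * vnorm V (c x 0)" using d by (intro dual_norm_bound) auto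
      also have "\<dots> \<le> vnorm (dual V) (dc f g) * (K * norm x)"
        using K(4)[of 0 x] nn by (intro mult_left_mono) auto
      also have "\<dots> \<le> 2 * K * vnorm (dual V) (dc f g) * norm x"
        using nn K(1) by (simp add: algebra_simps)
      finally show ?thesis .
    qed
    show "norm f \<le> 2 * K * vnorm (dual V) (dc f g)" "norm g \<le> 2 * K * vnorm (dual V) (dc f g)"
      using b abs_re_le[of "dc f g (c x 0)" for x] abs_im_le[of "dc f g (c x 0)" for x] nn K(1) g
      by (auto intro!: norm_rdual_le simp: dapp_zero_right intro: order_trans)
    show "vnorm (dual V) (dc f g) \<le> 2 * K * (norm f + norm g)"
    proof (rule dual_norm_le)
      fix z assume zV: "z \<in> vecs V" and z1: "vnorm V z \<le> 1"
      obtain x y where z: "ok y" "z = c x y" using zV by (rule vecs_cases)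
      have "norm x \<le> K" "norm y \<le> K"
        using K(2,3)[OF z(1), of x] mult_left_mono[OF z1, of K] K(1) unfolding z(2)[symmetric] by linarith+
      then have b: "\<bar>dapp h x\<bar> \<le> norm h * K" "\<bar>dapp h y\<bar> \<le> norm h * K" for h
        using norm_dapp_le[of h x] norm_dapp_le[of h y] mult_left_mono[of _ K "norm h"] by (auto intro: order_trans)
      have "norm (dc f g z) \<le> \<bar>dapp f x - dapp g y\<bar> + \<bar>dapp g x + dapp f y\<bar>"
        using norm_le_re_im[of "dc f g z"] z g by simp
      also have "\<dots> \<le> 2 * K * (norm f + norm g)" using b[of f] b[of g] by (simp add: algebra_simps)
      finally show "norm (dc f g z) \<le> 2 * K * (norm f + norm g)" .
    qed
  qed (use K in simp)
qed

text \<open>\<open>norm_bounds\<close> fixes the norm of \<open>V\<close> only up to equivalence.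
  The isometry needs the constant 1 in comparing with the real lattice, which this condition
  supplies.\<close>

definition exact :: bool where
  "exact \<longleftrightarrow> (\<forall>x y. ok y \<longrightarrow> norm x \<le> vnorm V (c x y)) \<and> (\<forall>x. vnorm V (c x 0) = norm x)"

lemma dual_exact: assumes exact shows "kspace.exact cx (dual V) dc"
proof -
  interpret D: kspace \<iota> cx "dual V" dc by (rule kspace_dual)
  have ex: "\<And>x y. ok y \<Longrightarrow> norm x \<le> vnorm V (c x y)" "\<And>x. vnorm V (c x 0) = norm x"
    using assms by (auto simp: exact_def)
  have le: "norm f \<le> vnorm (dual V) (dc f g)" if g: "ok g" for f g
  proof -
    have d: "dc f g \<in> vecs (dual V)" using g by (auto simp: vecs_dual)
    show ?thesis
    proof (rule norm_rdual_le[OF dual_norm_nonneg[OF d]])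
      fix x
      have "\<bar>dapp f x\<bar> \<le> norm (dc f g (c x 0))" using abs_re_le[of "dc f g (c x 0)"] g by (simp add: dapp_zero_right)
      also have "\<dots> \<le> vnorm (dual V) (dc f g) * norm x" using dual_norm_bound[OF d, of "c x 0"] ex by simp
      finally show "\<bar>dapp f x\<bar> \<le> vnorm (dual V) (dc f g) * norm x" .
    qed
  qed
  moreover have "vnorm (dual V) (dc f 0) \<le> norm f" for f
  proof (rule dual_norm_le)
    fix z assume zV: "z \<in> vecs V" and z1: "vnorm V z \<le> 1"
    obtain x y where z: "ok y" "z = c x y" using zV by (rule vecs_cases)
    \<comment> \<open>After rotation of \<open>z\<close> the value of the real functional is a
      nonnegative number, hence equal to \<open>f\<close> at the real part of the rotated vector,
      whose norm is controlled by exactness.\<close>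
    obtain u where u: "norm u = 1" "u * dc f 0 z = of_real (norm (dc f 0 z))" by (rule unit_rotation)
    have "re (dc f 0 (smul V u z)) = dapp f (re u *\<^sub>R x - im u *\<^sub>R y)"
      unfolding z c_smul[OF z(1)] by (subst re_dc[OF ok_smul[OF z(1)]]) (simp_all add: dapp_simps)
    moreover have "dc f 0 (smul V u z) = u * dc f 0 z"
      using bounded_mapsD(2)[OF homogeneous homogeneous_norm_scalars dc_bounded[of 0 f], of z u] z by simp
    ultimately have "norm (dc f 0 z) = dapp f (re u *\<^sub>R x - im u *\<^sub>R y)" using u by simp
    also have "\<dots> \<le> norm f * norm (re u *\<^sub>R x - im u *\<^sub>R y)" using norm_dapp_le[of f] by (meson abs_le_D1)
    also have "\<dots> \<le> norm f * vnorm V (smul V u z)"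
      unfolding z c_smul[OF z(1)] by (intro mult_left_mono ex(1) ok_smul z) simp
    also have "\<dots> \<le> norm f" using norm_smul[OF z(1), of u x] u z z1 by (simp add: mult_left_le)
    finally show "norm (dc f 0 z) \<le> norm f" .
  qed
  ultimately show ?thesis unfolding D.exact_def by (auto intro: antisym)
qed

text \<open>The operator \<open>s + i t\<close>.\<close>

definition cc :: "'b center_op \<Rightarrow> 'b center_op \<Rightarrow> 'v \<Rightarrow> 'v" where
  "cc s t = restrict0 (vecs V) (\<lambda>z. c (capp s (px z) - capp t (py z)) (capp t (px z) + capp s (py z)))"

lemma ok_cc: "ok y \<Longrightarrow> ok t \<Longrightarrow> ok (capp t x + capp s y)"
  by (intro ok_intros)

lemma cc_app [simp]: "ok y \<Longrightarrow> cc s t (c x y) = c (capp s x - capp t y) (capp t x + capp s y)"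
  by (simp add: cc_def restrict0_def)

lemma cc_outside: "z \<notin> vecs V \<Longrightarrow> cc s t z = 0"
  by (simp add: cc_def restrict0_def)

lemma cc_eqI:
  assumes "\<And>z. z \<notin> vecs V \<Longrightarrow> T z = 0"
    "\<And>x y. ok y \<Longrightarrow> T (c x y) = c (capp s x - capp t y) (capp t x + capp s y)"
  shows "T = cc s t"
proof
  fix z
  show "T z = cc s t z"
  proof (cases "z \<in> vecs V")
    case True
    then obtain x y where "ok y" "z = c x y" by (rule vecs_cases)
    then show ?thesis using assms by simp
  qed (simp add: assms cc_outside)
qed

lemma cc_bounded: assumes t: "ok t" shows "cc s t \<in> bounded_maps V V"
  unfolding bounded_maps_def linear_map_def
proof (intro CollectI conjI allI ballI impI)
  show "cc s t z = 0" if "z \<notin> vecs V" for z using that by (rule cc_outside)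
  fix z assume "z \<in> vecs V"
  then obtain x y where z: "ok y" "z = c x y" by (rule vecs_cases)
  note k = ok_cc[OF z(1) t, of x s]
  show "cc s t z \<in> vecs V" using z c_in[OF k] by simp
  show "cc s t (smul V a z) = smul V a (cc s t z)" for a
    unfolding z c_smul[OF z(1)] cc_app[OF z(1)] cc_app[OF ok_smul[OF z(1)]] c_smul[OF k]
    by (simp add: capp_add_right capp_diff_right capp_scaleR_right algebra_simps)
  fix w assume "w \<in> vecs V"
  then obtain x' y' where w: "ok y'" "w = c x' y'" by (rule vecs_cases)
  have yy: "ok (y + y')" using z w by (intro ok_intros)
  show "cc s t (z + w) = cc s t z + cc s t w"
    unfolding z w c_add[OF z(1) w(1)] cc_app[OF yy] cc_app[OF z(1)] cc_app[OF w(1)]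
      c_add[OF ok_cc[OF z(1) t] ok_cc[OF w(1) t]]
    by (simp add: capp_add_right algebra_simps)
next
  obtain K where K: "0 < K" "\<And>x y. ok y \<Longrightarrow> norm x \<le> K * vnorm V (c x y)"
    "\<And>x y. ok y \<Longrightarrow> norm y \<le> K * vnorm V (c x y)" "\<And>x y. ok y \<Longrightarrow> vnorm V (c x y) \<le> K * (norm x + norm y)"
    using norm_bounds by blast
  show "\<exists>C. \<forall>z\<in>vecs V. vnorm V (cc s t z) \<le> C * vnorm V z"
  proof (intro exI ballI)
    fix z assume "z \<in> vecs V"
    then obtain x y where z: "ok y" "z = c x y" by (rule vecs_cases)
    have b: "norm (capp r w) \<le> norm r * (K * vnorm V z)" if "norm w \<le> K * vnorm V z" for r w
      using norm_capp_le[of r w] mult_left_mono[OF that, of "norm r"] by simp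
    have xy: "norm x \<le> K * vnorm V z" "norm y \<le> K * vnorm V z" using K(2,3)[OF z(1), of x] z by auto
    have "vnorm V (cc s t z) \<le> K * (norm (capp s x - capp t y) + norm (capp t x + capp s y))"
      using K(4)[OF ok_cc[OF z(1) t]] z by simp
    also have "\<dots> \<le> K * (2 * (norm s + norm t) * K * vnorm V z)"
      using b[OF xy(1), of s] b[OF xy(2), of s] b[OF xy(1), of t] b[OF xy(2), of t] K(1)
        norm_triangle_ineq4[of "capp s x" "capp t y"] norm_triangle_ineq[of "capp t x" "capp s y"]
      by (intro mult_left_mono) (simp_all add: algebra_simps)
    finally show "vnorm V (cc s t z) \<le> K * (2 * (norm s + norm t) * K) * vnorm V z" by (simp add: mult.assoc)
  qed
qed

lemma cc_comp: "ok t' \<Longrightarrow> cc s t \<circ> cc s' t' = cc (s * s' - t * t') (t * s' + s * t')"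
proof (rule cc_eqI)
  show "(cc s t \<circ> cc s' t') z = 0" if "z \<notin> vecs V" for z
    using cc_app[OF ok_zero, of s t 0] that by (simp add: cc_outside c_zero capp_zero_right)
  fix x y :: 'b assume "ok t'" and y: "ok y"
  then show "(cc s t \<circ> cc s' t') (c x y) = c (capp (s * s' - t * t') x - capp (t * s' + s * t') y)
      (capp (t * s' + s * t') x + capp (s * s' - t * t') y)"
    unfolding o_def cc_app[OF y] 
    by (subst cc_app[OF ok_cc]; simp add: capp_simps capp_add_right capp_diff_right; simp add: algebra_simps)
qed

lemma center_simps: "vecs (center V) = {T \<in> bounded_maps V V. \<exists>M>0. \<forall>x\<in>cone V. le V (modulus V (T x)) (smul V (of_real M) x)}"
  "smul (center V) s T = (\<lambda>z. smul V s (T z))"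
  "cone (center V) = {T \<in> vecs (center V). \<forall>z\<in>cone V. T z \<in> cone V}"
  "vnorm (center V) = vnorm (operators V V)"
  unfolding center_def operators_def Let_def by auto

end

locale kspace_modulus = kspace \<iota> cx V c
  for \<iota> :: "'k::real_normed_field \<Rightarrow> complex" and cx and V :: "('k, 'v::ab_group_add) ospace"
    and c :: "'b::normed_riesz \<Rightarrow> 'b \<Rightarrow> 'v" +
  assumes modulus_exists: "ok (y :: 'b) \<Longrightarrow> \<exists>m. is_modulus x y m"
    and exact: exact
begin

lemma exact_le: "ok y \<Longrightarrow> norm x \<le> vnorm V (c x y)" and exact_eq: "vnorm V (c x 0) = norm x"
  using exact by (auto simp: exact_def)

lemma modulus_le_iff:
  assumes "ok y" shows "le V (modulus V (c x y)) (c w 0) \<longleftrightarrow> (\<forall>u. norm u = 1 \<longrightarrow> re u *\<^sub>R x - im u *\<^sub>R y \<le> w)"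
proof -
  obtain m where m: "is_modulus x y m" using modulus_exists assms by blast
  then show ?thesis by (auto simp: modulus_c[OF assms m] le_c is_modulus_def)
qed

lemma cc_in_center: assumes t: "ok t" shows "cc s t \<in> vecs (center V)"
  unfolding center_simps
proof (intro CollectI conjI cc_bounded[OF t] exI[of _ "norm s + norm t + 1"] ballI)
  show "0 < norm s + norm t + 1" by (simp add: add_nonneg_pos)
  fix z assume "z \<in> cone V"
  then obtain x where x: "0 \<le> x" "z = c x 0" by (auto simp: cone_eq)
  have k: "ok (capp t x)" using t by (intro ok_intros)
  have "re u *\<^sub>R capp s x - im u *\<^sub>R capp t x \<le> (norm s + norm t + 1) *\<^sub>R x" if u: "norm u = 1" for u
  proof -
    have "re u *\<^sub>R capp s x - im u *\<^sub>R capp t x \<le> norm s *\<^sub>R x + norm t *\<^sub>R x"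
      using rotation_le_sum[OF u, of "capp s x" "capp t x"] add_mono[OF abs_capp_le'[OF x(1), of s] abs_capp_le'[OF x(1), of t]]
      by (rule order_trans)
    also have "\<dots> \<le> (norm s + norm t + 1) *\<^sub>R x" using x by (simp add: scaleR_add_left)
    finally show ?thesis .
  qed
  then show "le V (modulus V (cc s t z)) (smul V (of_real (norm s + norm t + 1)) z)"
    using x k by (simp add: capp_zero_right c_smul modulus_le_iff)
qed

text \<open>The modulus bound on the cone dominates all rotations, hence both coordinates of
  \<open>T (c x 0)\<close>; so the coordinate maps \<open>f\<close> and \<open>g\<close> are central
  operators of the real lattice.\<close>

lemma center_cases:
  assumes T: "T \<in> vecs (center V)"
  obtains s t where "ok t" "T = cc s t"
proof -
  have bT: "T \<in> bounded_maps V V" using T by (simp add: center_simps)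
  note D = bounded_mapsD[OF homogeneous homogeneous bT]
  have T_add: "T (z + w) = T z + T w" if "z \<in> vecs V" "w \<in> vecs V" for z w
    using bT that by (auto simp: bounded_maps_def linear_map_def)
  define f g where "f x = px (T (c x 0))" and "g x = py (T (c x 0))" for x
  have fg: "T (c x 0) = c (f x) (g x)" "ok (g x)" for x
  proof -
    obtain a b where "ok b" "T (c x 0) = c a b" using D(1)[of "c x 0"] by (auto elim: vecs_cases)
    then show "T (c x 0) = c (f x) (g x)" "ok (g x)" by (simp_all add: f_def g_def)
  qed
  obtain M where M: "\<And>x. 0 \<le> x \<Longrightarrow> le V (modulus V (T (c x 0))) (smul V (of_real M) (c x 0))"
    using T by (auto simp: center_simps cone_eq)
  have bound: "\<bar>f x\<bar> \<le> M *\<^sub>R x" "\<bar>g x\<bar> \<le> M *\<^sub>R x" if x: "0 \<le> x" for x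
  proof -
    have "le V (modulus V (c (f x) (g x))) (c (M *\<^sub>R x) 0)" using M[OF x] fg by (simp add: c_smul)
    then have "\<And>u. norm u = 1 \<Longrightarrow> re u *\<^sub>R f x - im u *\<^sub>R g x \<le> M *\<^sub>R x" using modulus_le_iff[OF fg(2)] by blast
    from rotation_bound[OF this fg(2)] show "\<bar>f x\<bar> \<le> M *\<^sub>R x" "\<bar>g x\<bar> \<le> M *\<^sub>R x" by blast+
  qed
  have add: "f (x + y) = f x + f y \<and> g (x + y) = g x + g y" for x y
  proof -
    have k: "ok (g x + g y)" by (intro ok_intros fg)
    have "c (f (x + y)) (g (x + y)) = c (f x + f y) (g x + g y)"
      using T_add[of "c x 0" "c y 0"] fg c_add[OF fg(2)[of x] fg(2)[of y]] by (simp add: c_add)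
    then show ?thesis by (rule c_inj[OF fg(2) k])
  qed
  have scale: "f (r *\<^sub>R x) = r *\<^sub>R f x \<and> g (r *\<^sub>R x) = r *\<^sub>R g x" for r x
  proof -
    have k: "ok (r *\<^sub>R g x)" by (intro ok_intros fg)
    have "c (f (r *\<^sub>R x)) (g (r *\<^sub>R x)) = c (r *\<^sub>R f x) (r *\<^sub>R g x)"
      using D(2)[of "c x 0" "of_real r"] fg c_smul[OF fg(2)[of x], of "of_real r"] by (simp add: c_smul)
    then show ?thesis by (rule c_inj[OF fg(2) k])
  qed
  have "central f" by (rule centralI[of _ M]) (auto intro!: linearI simp: add scale bound)
  then have f: "capp (Abs_center_op f) = f" by (simp add: Abs_center_op_inverse)
  have "central g" by (rule centralI[of _ M]) (auto intro!: linearI simp: add scale bound)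
  then have g: "capp (Abs_center_op g) = g" by (simp add: Abs_center_op_inverse)
  show ?thesis
  proof (rule that)
    show "ok (Abs_center_op g)"
    proof (cases cx)
      case False
      then have "Abs_center_op g = 0" using fg(2)[unfolded ok_def] by (intro center_op_eqI) (simp add: g capp_simps)
      then show ?thesis by simp
    next
      case True
      then show ?thesis by (rule ok_cx)
    qed
    show "T = cc (Abs_center_op f) (Abs_center_op g)"
    proof (rule cc_eqI)
      show "T z = 0" if "z \<notin> vecs V" for z using bT that by (auto simp: bounded_maps_def)
      fix x y :: 'b assume y: "ok y"
      have "smul V unit_i (c y 0) \<in> vecs V" using homogeneous by (simp add: homogeneous_norm_def)
      then have e: "T (c x y) = c (f x) (g x) + smul V unit_i (c (f y) (g y))"
        using T_add[of "c x 0" "smul V unit_i (c y 0)"] D(2)[of "c y 0" unit_i] fg c_split[OF y, of x] by simp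
      show "T (c x y) = c (capp (Abs_center_op f) x - capp (Abs_center_op g) y) (capp (Abs_center_op g) x + capp (Abs_center_op f) y)"
      proof (cases cx)
        case True
        have "im unit_i = 1" unfolding im_unit_i by (rule if_P[OF True])
        then show ?thesis unfolding e c_smul[OF fg(2)]
          using c_add[OF fg(2)[of x] ok_cx[OF True], of "f x" "- g y" "f y"] by (simp add: f g)
      next
        case False
        then have "y = 0" using y by (rule ok_not_cx)
        moreover have "f 0 = 0" "g 0 = 0" using scale[of 0 0] by auto
        ultimately show ?thesis using fg by (simp add: f g)
      qed
    qed
  qed
qed

lemma vecs_center: "vecs (center V) = {cc s t |s t. ok t}"
  by (blast intro: cc_in_center elim: center_cases)

lemma center_subset_bounded: "T \<in> vecs (center V) \<Longrightarrow> T \<in> bounded_maps V V"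
  by (simp add: center_simps)

lemma center_norm_bound:
  "T \<in> vecs (center V) \<Longrightarrow> z \<in> vecs V \<Longrightarrow> vnorm V (T z) \<le> vnorm (center V) T * vnorm V z"
  unfolding center_simps(4) by (rule operator_norm_bound[OF homogeneous homogeneous center_subset_bounded])

lemma center_norm_nonneg: "T \<in> vecs (center V) \<Longrightarrow> 0 \<le> vnorm (center V) T"
  unfolding center_simps(4) by (rule operator_norm_nonneg[OF homogeneous homogeneous center_subset_bounded])

lemma center_norm_le:
  "(\<And>z. z \<in> vecs V \<Longrightarrow> vnorm V z \<le> 1 \<Longrightarrow> vnorm V (T z) \<le> C) \<Longrightarrow> vnorm (center V) T \<le> C"
  unfolding center_simps(4) by (rule operator_norm_le[OF homogeneous homogeneous])

text \<open>By exactness the real part \<open>r\<close> of the rotated operator has operator norm at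
  most \<open>N\<close> on the real lattice; \<open>central_contraction_le_one\<close>, applied to
  \<open>r\<close> divided by \<open>N\<close>, turns this into an order bound.\<close>

lemma rotation_le_center_norm:
  assumes t: "ok t" and u: "norm u = 1"
  shows "re u *\<^sub>R s - im u *\<^sub>R t \<le> vnorm (center V) (cc s t) *\<^sub>R 1"
proof -
  define N where "N = vnorm (center V) (cc s t)"
  have T: "cc s t \<in> vecs (center V)" using t by (auto simp: vecs_center)
  have N: "0 \<le> N" unfolding N_def by (rule center_norm_nonneg[OF T])
  define r where "r = re u *\<^sub>R s - im u *\<^sub>R t"
  have le: "norm (capp r x) \<le> N * norm x" for x
  proof -
    have k: "ok (capp t x)" using t by (intro ok_intros)
    have "norm (capp r x) \<le> vnorm V (smul V u (c (capp s x) (capp t x)))"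
      unfolding c_smul[OF k] using exact_le[OF ok_smul[OF k]] by (simp add: r_def capp_simps)
    also have "\<dots> = vnorm V (cc s t (c x 0))" using norm_smul[OF k, of u] u by (simp add: capp_zero_right)
    also have "\<dots> \<le> N * norm x" using center_norm_bound[OF T, of "c x 0"] by (simp add: N_def exact_eq)
    finally show ?thesis .
  qed
  have "r \<le> N *\<^sub>R 1"
  proof (cases "N = 0")
    case True
    then have "r = 0" using le by (intro center_op_eqI) (simp add: capp_simps)
    then show ?thesis using True by simp
  next
    case False
    then have pos: "0 < N" using N by simp
    have "inverse N *\<^sub>R r \<le> 1"
      by (rule central_contraction_le_one) (use le pos in \<open>simp add: capp_simps field_simps\<close>)
    then have "N *\<^sub>R inverse N *\<^sub>R r \<le> N *\<^sub>R 1" using N by (rule scaleR_left_mono)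
    then show ?thesis using pos by simp
  qed
  then show ?thesis by (simp add: r_def N_def)
qed

lemma kspace_center: "kspace \<iota> cx (center V) cc"
proof (unfold_locales)
  show "vecs (center V) = {cc s t |s t. ok t}" by (rule vecs_center)
  fix s t s' t' :: "'b center_op" assume t: "ok t"
  have smul: "smul (center V) a (cc s t) = cc (re a *\<^sub>R s - im a *\<^sub>R t) (im a *\<^sub>R s + re a *\<^sub>R t)" for a
    unfolding center_simps
  proof (rule cc_eqI)
    show "smul V a (cc s t z) = 0" if "z \<notin> vecs V" for z
      using c_smul[of 0 a 0] by (simp add: cc_outside[OF that] c_zero)
    fix x y :: 'b assume y: "ok y"
    show "smul V a (cc s t (c x y)) = c (capp (re a *\<^sub>R s - im a *\<^sub>R t) x - capp (im a *\<^sub>R s + re a *\<^sub>R t) y)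
        (capp (im a *\<^sub>R s + re a *\<^sub>R t) x + capp (re a *\<^sub>R s - im a *\<^sub>R t) y)"
      unfolding cc_app[OF y] c_smul[OF ok_cc[OF y t]] by (simp add: capp_simps algebra_simps)
  qed
  then show "smul (center V) a (cc s t) = cc (re a *\<^sub>R s - im a *\<^sub>R t) (im a *\<^sub>R s + re a *\<^sub>R t)" for a .
  have "(\<lambda>z. smul V a (cc s t z)) \<in> bounded_maps V V" for a
    using smul[of a] cc_bounded[OF ok_smul[OF t]] by (simp add: center_simps)
  then show "vnorm (center V) (smul (center V) a (cc s t)) = norm a * vnorm (center V) (cc s t)" for a
    using operator_norm_smul[OF homogeneous homogeneous cc_bounded[OF t]] by (simp add: center_simps)
  assume t': "ok t'"
  show "cc s t + cc s' t' = cc (s + s') (t + t')"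
  proof (rule cc_eqI)
    show "(cc s t + cc s' t') z = 0" if "z \<notin> vecs V" for z using that by (simp add: cc_outside)
    fix x y :: 'b assume y: "ok y"
    show "(cc s t + cc s' t') (c x y) = c (capp (s + s') x - capp (t + t') y) (capp (t + t') x + capp (s + s') y)"
      unfolding plus_fun_apply cc_app[OF y] c_add[OF ok_cc[OF y t] ok_cc[OF y t']]
      by (simp add: capp_simps algebra_simps)
  qed
  assume eq: "cc s t = cc s' t'"
  have "capp s x = capp s' x \<and> capp t x = capp t' x" for x
  proof -
    have "c (capp s x) (capp t x) = c (capp s' x) (capp t' x)"
      using fun_cong[OF eq, of "c x 0"] by (simp add: capp_zero_right)
    then show ?thesis by (rule c_inj[rotated 2]) (rule ok_capp[OF t] ok_capp[OF t'])+
  qed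
  then show "s = s' \<and> t = t'" by (auto intro: center_op_eqI)
next
  show "cone (center V) = {cc s 0 |s. 0 \<le> s}"
  proof (intro set_eqI iffI)
    fix T assume T: "T \<in> cone (center V)"
    then have "T \<in> vecs (center V)" by (simp add: center_simps(3))
    then obtain s t where st: "ok t" "T = cc s t" by (rule center_cases)
    have pos: "capp t x = 0 \<and> 0 \<le> capp s x" if x: "0 \<le> x" for x
    proof -
      have "T (c x 0) \<in> cone V" using T x by (auto simp: center_simps(3) cone_eq)
      then obtain w where "0 \<le> w" "c (capp s x) (capp t x) = c w 0" using st by (auto simp: cone_eq capp_zero_right)
      then show ?thesis using c_inj[OF ok_capp[OF st(1), of x] ok_zero, of "capp s x" w] by simp
    qed
    have "t = 0" by (rule center_op_eqI) (simp add: pos capp_simps)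
    moreover have "0 \<le> s" unfolding less_eq_center_op_def by (simp add: pos capp_simps)
    ultimately show "T \<in> {cc s 0 |s. 0 \<le> s}" using st by auto
  next
    fix T assume "T \<in> {cc s 0 |s. 0 \<le> s}"
    then obtain s where "T = cc s 0" "0 \<le> s" by auto
    then show "T \<in> cone (center V)"
      by (auto simp: center_simps(3) cc_in_center cone_eq capp_simps capp_zero_right capp_nonneg)
  qed
next
  obtain K where K: "0 < K" "\<And>x y. ok y \<Longrightarrow> norm x \<le> K * vnorm V (c x y)"
    "\<And>x y. ok y \<Longrightarrow> norm y \<le> K * vnorm V (c x y)" "\<And>x y. ok y \<Longrightarrow> vnorm V (c x y) \<le> K * (norm x + norm y)"
    using norm_bounds by blast
  \<comment> \<open>The bounds on \<open>s\<close> and \<open>t\<close> hold with constant 1, the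
    reverse bound with \<open>2 * K * K\<close>; \<open>L\<close> exceeds both.\<close>
  define L where "L = 2 * K * K + 1"
  have L: "0 < L" "1 \<le> L" "2 * K * K \<le> L" using K(1) by (auto simp: L_def add_pos_pos)
  show "\<exists>K>0. \<forall>s t. ok t \<longrightarrow> norm s \<le> K * vnorm (center V) (cc s t) \<and> norm t \<le> K * vnorm (center V) (cc s t) \<and>
      vnorm (center V) (cc s t) \<le> K * (norm s + norm t)"
  proof (intro exI[of _ L] conjI allI impI)
    fix s t :: "'b center_op" assume t: "ok t"
    define N where "N = vnorm (center V) (cc s t)"
    have N: "0 \<le> N" unfolding N_def by (rule center_norm_nonneg[OF cc_in_center[OF t]])
    note b = rotation_bound[OF rotation_le_center_norm[OF t] t, folded N_def]
    have le: "norm r \<le> L * N" if "\<bar>r\<bar> \<le> N *\<^sub>R (1 :: 'b center_op)" for r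
    proof -
      have "norm r \<le> norm (N *\<^sub>R (1 :: 'b center_op))" by (rule norm_le_of_abs_le'[OF that])
      also have "\<dots> = N * norm (1 :: 'b center_op)" using N by simp
      also have "\<dots> \<le> N * 1" by (rule mult_left_mono[OF norm_one_center_op_le N])
      also have "\<dots> \<le> L * N" using mult_right_mono[OF L(2) N] by simp
      finally show ?thesis .
    qed
    show "norm s \<le> L * vnorm (center V) (cc s t)" "norm t \<le> L * vnorm (center V) (cc s t)"
      using le b by (auto simp: N_def)
    show "vnorm (center V) (cc s t) \<le> L * (norm s + norm t)"
    proof (rule center_norm_le)
      fix z assume zV: "z \<in> vecs V" and z1: "vnorm V z \<le> 1"
      obtain x y where z: "ok y" "z = c x y" using zV by (rule vecs_cases)
      have xy: "norm x \<le> K" "norm y \<le> K"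
        using K(2,3)[OF z(1), of x] mult_left_mono[OF z1, of K] K(1) unfolding z(2)[symmetric] by linarith+
      have b: "norm (capp r w) \<le> norm r * K" if "norm w \<le> K" for r w
        using norm_capp_le[of r w] mult_left_mono[OF that, of "norm r"] by simp
      have "vnorm V (cc s t z) \<le> K * (norm (capp s x - capp t y) + norm (capp t x + capp s y))"
        using K(4)[OF ok_cc[OF z(1) t]] z by simp
      also have "\<dots> \<le> K * (2 * (norm s + norm t) * K)"
        using b[OF xy(1), of s] b[OF xy(2), of s] b[OF xy(1), of t] b[OF xy(2), of t] K(1)
          norm_triangle_ineq4[of "capp s x" "capp t y"] norm_triangle_ineq[of "capp t x" "capp s y"]
        by (intro mult_left_mono) (simp_all add: algebra_simps)
      also have "\<dots> = (2 * K * K) * (norm s + norm t)" by (simp add: algebra_simps)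
      also have "\<dots> \<le> L * (norm s + norm t)" using L by (intro mult_right_mono) auto
      finally show "vnorm V (cc s t z) \<le> L * (norm s + norm t)" .
    qed
  qed (rule L)
qed

lemma kspace_modulus_dual: "kspace_modulus \<iota> cx (dual V) dc"
proof -
  interpret D: kspace \<iota> cx "dual V" dc by (rule kspace_dual)
  show ?thesis by unfold_locales (auto simp: rdual_modulus_exists dual_exact[OF exact])
qed

end


section \<open>The Arens extension over the scalar field\<close>

text \<open>The additional assumption bounds the norm of a central operator by order bounds on
  finitely many rotations, up to a factor \<open>1 + e\<close>. This is the form in which
  \<open>bidual_le_of_finite_combination\<close> can be applied to functionals on the
  center.\<close>

locale lattice_kspace = kspace_modulus \<iota> cx V c
  for \<iota> :: "'k::real_normed_field \<Rightarrow> complex" and cx and V :: "('k, 'v::ab_group_add) ospace"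
    and c :: "'b::normed_riesz \<Rightarrow> 'b \<Rightarrow> 'v" +
  assumes operator_norm_net: "0 < e \<Longrightarrow> \<exists>U. finite U \<and> (\<forall>u\<in>U. norm u = 1) \<and>
    (\<forall>s t M. ok t \<longrightarrow> 0 \<le> M \<longrightarrow> (\<forall>u\<in>U. re u *\<^sub>R s - im u *\<^sub>R t \<le> M *\<^sub>R 1) \<longrightarrow>
      (\<forall>z\<in>vecs V. vnorm V (cc s t z) \<le> (1 + e) * M * vnorm V z))"
begin

sublocale A: kspace \<iota> cx "center V" cc
  by (rule kspace_center)

sublocale A1: kspace \<iota> cx "dual (center V)" A.dc
  by (rule A.kspace_dual)

sublocale A2: kspace \<iota> cx "center_bidual V" A1.dc
  by (rule A1.kspace_dual)

sublocale D: kspace_modulus \<iota> cx "dual V" dc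
  by (rule kspace_modulus_dual)

sublocale Z: kspace \<iota> cx "center (dual V)" D.cc
  by (rule D.kspace_center)


subsection \<open>Topological fullness\<close>

definition orbit_closure :: "'b \<Rightarrow> 'b set" where
  "orbit_closure x = {y. \<forall>e>0. \<exists>t. norm (y - capp t x) < e}"

text \<open>The real and imaginary parts of a central operator can be chosen independently, so the
  two coordinates are approximated separately; over the real field the second one is 0 and is
  matched by 0.\<close>

lemma norm_closure_orbit:
  assumes y: "ok y2"
  shows "c y1 y2 \<in> norm_closure V {T (c x 0) |T. T \<in> vecs (center V)} \<longleftrightarrow>
    y1 \<in> orbit_closure x \<and> y2 \<in> orbit_closure x"
proof -
  obtain K where K: "0 < K" "\<And>x y. ok y \<Longrightarrow> norm x \<le> K * vnorm V (c x y)"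
    "\<And>x y. ok y \<Longrightarrow> norm y \<le> K * vnorm V (c x y)" "\<And>x y. ok y \<Longrightarrow> vnorm V (c x y) \<le> K * (norm x + norm y)"
    using norm_bounds by blast
  have diff: "c y1 y2 - cc s t (c x 0) = c (y1 - capp s x) (y2 - capp t x)" if "ok t" for s t
    using c_diff[OF y ok_capp[OF that], of y1 "capp s x" x] by (simp add: capp_zero_right)
  have k: "ok (y2 - capp t x)" if "ok t" for t by (intro ok_intros y that)
  show ?thesis
  proof
    assume L: "c y1 y2 \<in> norm_closure V {T (c x 0) |T. T \<in> vecs (center V)}"
    have "\<exists>s t. norm (y1 - capp s x) < e \<and> norm (y2 - capp t x) < e" if e: "0 < e" for e
    proof -
      have "0 < e / K" using e K(1) by simp
      then obtain T where T: "T \<in> vecs (center V)" "vnorm V (c y1 y2 - T (c x 0)) < e / K"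
        using L unfolding norm_closure_def by blast
      obtain s t where st: "ok t" "T = cc s t" using T(1) by (rule center_cases)
      have "vnorm V (c (y1 - capp s x) (y2 - capp t x)) < e / K" using T(2) st diff by simp
      then have "K * vnorm V (c (y1 - capp s x) (y2 - capp t x)) < e" using K(1) by (simp add: field_simps)
      then show ?thesis using K(2,3)[OF k[OF st(1)], of "y1 - capp s x"] by (blast intro: le_less_trans)
    qed
    then show "y1 \<in> orbit_closure x \<and> y2 \<in> orbit_closure x" unfolding orbit_closure_def by blast
  next
    assume R: "y1 \<in> orbit_closure x \<and> y2 \<in> orbit_closure x"
    have "\<exists>T\<in>vecs (center V). vnorm V (c y1 y2 - T (c x 0)) < e" if e: "0 < e" for e
    proof -
      have e': "0 < e / (2 * K)" using e K(1) by simp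
      obtain s where s: "norm (y1 - capp s x) < e / (2 * K)" using R e' by (auto simp: orbit_closure_def)
      have "\<exists>t. ok t \<and> norm (y2 - capp t x) < e / (2 * K)"
      proof (cases cx)
        case True
        obtain t where "norm (y2 - capp t x) < e / (2 * K)" using R e' by (auto simp: orbit_closure_def)
        with ok_cx[OF True] show ?thesis by blast
      next
        case False
        then have "y2 = 0" using y by (rule ok_not_cx)
        then show ?thesis using e' by (intro exI[of _ 0]) (simp add: capp_simps)
      qed
      then obtain t where t: "ok t" "norm (y2 - capp t x) < e / (2 * K)" by blast
      have "vnorm V (c y1 y2 - cc s t (c x 0)) \<le> K * (norm (y1 - capp s x) + norm (y2 - capp t x))"
        unfolding diff[OF t(1)] by (rule K(4)[OF k[OF t(1)]])
      also have "\<dots> < K * (e / (2 * K) + e / (2 * K))" using s t K(1) by (intro mult_strict_left_mono add_strict_mono)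
      also have "\<dots> = e" using K(1) by (simp add: field_simps)
      finally show ?thesis using cc_in_center[OF t(1)] by blast
    qed
    then show "c y1 y2 \<in> norm_closure V {T (c x 0) |T. T \<in> vecs (center V)}"
      unfolding norm_closure_def using c_in[OF y] by blast
  qed
qed

lemma orbit_closure_lincomb:
  assumes y: "y \<in> orbit_closure x" and w: "w \<in> orbit_closure x"
  shows "r *\<^sub>R y + q *\<^sub>R w \<in> orbit_closure x"
  unfolding orbit_closure_def
proof (intro CollectI allI impI)
  fix e :: real assume e: "0 < e"
  define d where "d = e / (\<bar>r\<bar> + \<bar>q\<bar> + 1)"
  have n: "0 < \<bar>r\<bar> + \<bar>q\<bar> + 1" by linarith
  have d: "0 < d" using e n by (simp add: d_def)
  obtain s t where st: "norm (y - capp s x) < d" "norm (w - capp t x) < d"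
    using y w d unfolding orbit_closure_def by blast
  have "norm (r *\<^sub>R y + q *\<^sub>R w - capp (r *\<^sub>R s + q *\<^sub>R t) x) = norm (r *\<^sub>R (y - capp s x) + q *\<^sub>R (w - capp t x))"
    by (simp add: capp_simps algebra_simps)
  also have "\<dots> \<le> \<bar>r\<bar> * norm (y - capp s x) + \<bar>q\<bar> * norm (w - capp t x)"
    by (rule norm_triangle_le) simp
  also have "\<dots> \<le> \<bar>r\<bar> * d + \<bar>q\<bar> * d" using st by (intro add_mono mult_left_mono) auto
  also have "\<dots> < (\<bar>r\<bar> + \<bar>q\<bar> + 1) * d" using d by (simp add: algebra_simps)
  also have "\<dots> = e" using n by (simp add: d_def)
  finally show "\<exists>t. norm (r *\<^sub>R y + q *\<^sub>R w - capp t x) < e" by blast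
qed

text \<open>\<open>top_full\<close> concerns elements dominated by a multiple of \<open>x\<close>,
  whereas \<open>y1\<close> and \<open>y2\<close> only lie in the closure of the orbit. Replace them
  by \<open>capp s x\<close> and \<open>capp t x\<close>, and truncate \<open>w\<close> to
  \<open>v\<close> between \<open>- m\<close> and \<open>m\<close>. Then \<open>v\<close> is
  dominated by \<open>N *\<^sub>R x\<close>, and the truncation costs at most \<open>d\<close>,
  whose norm is small.\<close>

lemma orbit_closure_ideal:
  assumes tf: "top_full TYPE('b)" and x: "0 \<le> x"
    and y: "y1 \<in> orbit_closure x" "y2 \<in> orbit_closure x" and w: "\<bar>w\<bar> \<le> \<bar>y1\<bar> + \<bar>y2\<bar>"
  shows "w \<in> orbit_closure x"
  unfolding orbit_closure_def
proof (intro CollectI allI impI)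
  fix e :: real assume e: "0 < e"
  then have "0 < e / 4" by simp
  then obtain s t where st: "norm (y1 - capp s x) < e / 4" "norm (y2 - capp t x) < e / 4"
    using y unfolding orbit_closure_def by blast
  define m d N where "m = \<bar>capp s x\<bar> + \<bar>capp t x\<bar>" and "d = \<bar>y1 - capp s x\<bar> + \<bar>y2 - capp t x\<bar>"
    and "N = norm s + norm t + 1"
  have d0: "0 \<le> d" and m0: "0 \<le> m" and N: "0 < N" by (simp_all add: d_def m_def N_def add_nonneg_pos)
  have "\<bar>y1\<bar> \<le> \<bar>capp s x\<bar> + \<bar>y1 - capp s x\<bar>" "\<bar>y2\<bar> \<le> \<bar>capp t x\<bar> + \<bar>y2 - capp t x\<bar>"
    using abs_triangle_ineq[of "capp s x" "y1 - capp s x"] abs_triangle_ineq[of "capp t x" "y2 - capp t x"] by simp_all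
  from add_mono[OF this] have "\<bar>y1\<bar> + \<bar>y2\<bar> \<le> m + d" by (simp add: m_def d_def algebra_simps)
  with w have "\<bar>w\<bar> \<le> m + d" by (rule order_trans)
  note wm = abs_le_D(1,3)[OF this]
  define v where "v = inf (sup w (- m)) m"
  have mm: "- m \<le> m" using m0 by (meson neg_le_0_iff_le order_trans)
  have v: "\<bar>v\<bar> \<le> m"
  proof (rule abs_leI)
    have "- m \<le> v" unfolding v_def using mm by (intro inf_greatest) auto
    then show "- v \<le> m" by (simp only: minus_le_iff)
  qed (simp add: v_def)
  have "v \<le> w + d"
  proof -
    have "v \<le> sup w (- m)" by (simp add: v_def)
    also have "\<dots> \<le> w + d"
    proof (rule sup_least)
      show "w \<le> w + d" using d0 by simp
      have "- (m + d) + d \<le> w + d" using wm(2) by (rule add_right_mono)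
      then show "- m \<le> w + d" by simp
    qed
    finally show ?thesis .
  qed
  moreover have "w \<le> v + d"
  proof -
    have "w - d \<le> v" unfolding v_def
    proof (rule inf_greatest)
      have "w - d \<le> w" using d0 by simp
      then show "w - d \<le> sup w (- m)" by (rule le_supI1)
      show "w - d \<le> m" using wm(1) by (simp only: diff_le_eq)
    qed
    then show ?thesis by (simp only: diff_le_eq)
  qed
  ultimately have "\<bar>w - v\<bar> \<le> d" by (intro abs_leI) (simp_all add: algebra_simps)
  then have "norm (w - v) \<le> norm d" by (rule norm_le_of_abs_le')
  also have "\<dots> \<le> norm (y1 - capp s x) + norm (y2 - capp t x)"
    unfolding d_def using norm_triangle_ineq[of "\<bar>y1 - capp s x\<bar>" "\<bar>y2 - capp t x\<bar>"] by simp
  finally have wv: "norm (w - v) < e / 2" using st by simp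
  have "m \<le> norm s *\<^sub>R x + norm t *\<^sub>R x" unfolding m_def by (intro add_mono abs_capp_le' x)
  also have "\<dots> \<le> N *\<^sub>R x" using x by (simp add: N_def scaleR_add_left)
  finally have "\<bar>v\<bar> \<le> N *\<^sub>R x" using v by (rule order_trans[rotated])
  then have "inverse N *\<^sub>R \<bar>v\<bar> \<le> inverse N *\<^sub>R N *\<^sub>R x" using N by (intro scaleR_left_mono) auto
  then have "\<bar>inverse N *\<^sub>R v\<bar> \<le> x" using N by (simp add: abs_scaleR)
  moreover have "0 < e / (2 * N)" using e N by simp
  ultimately obtain r where r: "norm (inverse N *\<^sub>R v - capp r x) < e / (2 * N)"
    using tf x unfolding top_full_def by blast
  have "v - capp (N *\<^sub>R r) x = N *\<^sub>R (inverse N *\<^sub>R v - capp r x)"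
    using N by (simp add: capp_simps scaleR_diff_right)
  then have "norm (v - capp (N *\<^sub>R r) x) = N * norm (inverse N *\<^sub>R v - capp r x)" using N by simp
  also have "\<dots> < N * (e / (2 * N))" using r N by (rule mult_strict_left_mono)
  also have "\<dots> = e / 2" using N by simp
  finally have "norm (w - capp (N *\<^sub>R r) x) < e"
    using norm_triangle_ineq[of "w - v" "v - capp (N *\<^sub>R r) x"] wv by simp
  then show "\<exists>t. norm (w - capp t x) < e" by blast
qed

text \<open>The modulus of \<open>c y1 y2\<close> dominates the modulus of each coordinate and is at
  most their sum; this is why \<open>orbit_closure_ideal\<close> admits a sum of two moduli as
  bound.\<close>

theorem topologically_full_iff: "topologically_full_center V \<longleftrightarrow> top_full TYPE('b)"
proof
  assume tf: "topologically_full_center V"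
  show "top_full TYPE('b)"
    unfolding top_full_def
  proof (intro allI impI)
    fix x y :: 'b and e :: real assume x: "0 \<le> x" and y: "\<bar>y\<bar> \<le> x" and e: "0 < e"
    let ?J = "norm_closure V {T (c x 0) |T. T \<in> vecs (center V)}"
    have J: "order_ideal V ?J" using tf x by (auto simp: topologically_full_center_def cone_eq)
    have "x \<in> orbit_closure x" "0 \<in> orbit_closure x"
      unfolding orbit_closure_def by (auto intro: exI[of _ 1] exI[of _ 0] simp: capp_simps)
    then have "c x 0 \<in> ?J" by (simp add: norm_closure_orbit)
    moreover have "le V (modulus V (c y 0)) (modulus V (c x 0))"
    proof -
      obtain m where m: "is_modulus x 0 m" using modulus_exists[OF ok_zero] by blast
      have "re 1 *\<^sub>R x - im 1 *\<^sub>R 0 \<le> m" using m norm_one unfolding is_modulus_def by blast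
      then have "x \<le> m" by simp
      then have "re u *\<^sub>R y - im u *\<^sub>R 0 \<le> m" if "norm u = 1" for u
        using rotation_le_sum[OF that, of y 0] y by (auto intro: order_trans)
      then show ?thesis unfolding modulus_c[OF ok_zero m] modulus_le_iff[OF ok_zero] by blast
    qed
    ultimately have "c y 0 \<in> ?J" using J c_in[OF ok_zero, of y] unfolding order_ideal_def by blast
    then have "y \<in> orbit_closure x" by (simp add: norm_closure_orbit)
    then show "\<exists>t. norm (y - capp t x) < e" using e by (simp add: orbit_closure_def)
  qed
next
  assume tf: "top_full TYPE('b)"
  show "topologically_full_center V"
    unfolding topologically_full_center_def cone_eq
  proof clarify
    fix x :: 'b assume x: "0 \<le> x"
    let ?J = "norm_closure V {T (c x 0) |T. T \<in> vecs (center V)}"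
    have J_cases: thesis if z: "z \<in> ?J" and h: "\<And>y1 y2. z = c y1 y2 \<Longrightarrow> ok y2 \<Longrightarrow> y1 \<in> orbit_closure x \<Longrightarrow> y2 \<in> orbit_closure x \<Longrightarrow> thesis"
      for z thesis
    proof -
      have "z \<in> vecs V" using z by (simp add: norm_closure_def)
      then obtain y1 y2 where y: "ok y2" "z = c y1 y2" by (rule vecs_cases)
      show thesis by (rule h[OF y(2,1)]) (use z y norm_closure_orbit in auto)
    qed
    show "order_ideal V ?J"
      unfolding order_ideal_def is_subspace_def
    proof (intro conjI ballI allI impI subsetI)
      show "z \<in> vecs V" if "z \<in> ?J" for z using that by (simp add: norm_closure_def)
      have "0 \<in> orbit_closure x" unfolding orbit_closure_def by (auto intro: exI[of _ 0] simp: capp_simps)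
      then have "c 0 0 \<in> ?J" by (simp add: norm_closure_orbit)
      then show "0 \<in> ?J" by (simp add: c_zero)
      fix z assume z: "z \<in> ?J"
      obtain y1 y2 where y: "z = c y1 y2" "ok y2" "y1 \<in> orbit_closure x" "y2 \<in> orbit_closure x" using J_cases[OF z] by blast
      show "smul V s z \<in> ?J" for s
      proof -
        have "re s *\<^sub>R y1 - im s *\<^sub>R y2 \<in> orbit_closure x"
          using orbit_closure_lincomb[OF y(3,4), of "re s" "- im s"] by simp
        then show ?thesis
          unfolding y(1) c_smul[OF y(2)] norm_closure_orbit[OF ok_smul[OF y(2)]]
          using orbit_closure_lincomb[OF y(3,4)] by blast
      qed
      show "z + w \<in> ?J" if w: "w \<in> ?J" for w
      proof -
        obtain w1 w2 where w: "w = c w1 w2" "ok w2" "w1 \<in> orbit_closure x" "w2 \<in> orbit_closure x" using J_cases[OF w] by blast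
        show ?thesis
          unfolding y(1) w(1) c_add[OF y(2) w(2)] norm_closure_orbit[OF ok_add[OF y(2) w(2)]]
          using orbit_closure_lincomb[OF y(3) w(3), of 1 1] orbit_closure_lincomb[OF y(4) w(4), of 1 1] by simp
      qed
      fix w assume wV: "w \<in> vecs V" and le: "le V (modulus V w) (modulus V z)"
      obtain w1 w2 where w: "ok w2" "w = c w1 w2" using wV by (rule vecs_cases)
      obtain m where m: "is_modulus y1 y2 m" using modulus_exists[OF y(2)] by blast
      have mle: "m \<le> \<bar>y1\<bar> + \<bar>y2\<bar>" using m rotation_le_sum unfolding is_modulus_def by blast
      have "\<And>u. norm u = 1 \<Longrightarrow> re u *\<^sub>R w1 - im u *\<^sub>R w2 \<le> m"
        using le unfolding y(1) w(2) modulus_c[OF y(2) m] modulus_le_iff[OF w(1)] by blast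
      from rotation_bound[OF this w(1)] have "\<bar>w1\<bar> \<le> \<bar>y1\<bar> + \<bar>y2\<bar>" "\<bar>w2\<bar> \<le> \<bar>y1\<bar> + \<bar>y2\<bar>"
        using mle by (blast intro: order_trans)+
      then show "w \<in> ?J"
        unfolding w(2) norm_closure_orbit[OF w(1)] using orbit_closure_ideal[OF tf x y(3,4)] by blast
    qed
  qed
qed


subsection \<open>The Arens extension and the Arens product in coordinates\<close>

lemma ok_mu: "ok y \<Longrightarrow> ok (mu y f)" and ok_mu_right: "ok g \<Longrightarrow> ok (mu x g)"
  unfolding ok_def by (auto simp: mu_linear)

lemma ok_module_act: "ok \<phi> \<Longrightarrow> ok (module_act \<phi> r)" and ok_module_act_right: "ok r \<Longrightarrow> ok (module_act \<phi> r)"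
  unfolding ok_def using module_act_simps(2)[of 0 \<phi> r] module_act_simps(4)[of \<phi> 0 r] by auto

lemma ok_bidual_act: "ok a \<Longrightarrow> ok (bidual_act a \<phi>)" and ok_bidual_act_right: "ok \<phi> \<Longrightarrow> ok (bidual_act a \<phi>)"
  unfolding ok_def using bidual_act_simps(2)[of 0 a \<phi>] bidual_act_simps(4)[of a 0 \<phi>] by auto

lemma ok_arens: "ok a \<Longrightarrow> ok (arens a b)" and ok_arens_right: "ok b \<Longrightarrow> ok (arens a b)"
  unfolding ok_def using arens_linear(3)[of 0 a b] arens_linear(6)[of a 0 b] by auto

lemma ok_istar: "ok a \<Longrightarrow> ok (istar a)"
  unfolding ok_def by (auto simp: istar_linear)

lemma mu_functional_c:
  assumes y: "ok y" and g: "ok g"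
  shows "mu_functional V (c x y) (dc f g) = A.dc (mu x f - mu y g) (mu x g + mu y f)"
proof (rule A.dc_eqI)
  show "ok (mu x g + mu y f)" by (intro ok_intros ok_mu ok_mu_right y g)
  show "mu_functional V (c x y) (dc f g) T = 0" if "T \<notin> vecs (center V)" for T
    using that by (simp add: mu_functional_def restrict0_def)
  fix s t :: "'b center_op" assume t: "ok t"
  have app: "mu_functional V (c x y) (dc f g) (cc s t) = dc f g (c (capp s x - capp t y) (capp t x + capp s y))"
    using cc_in_center[OF t] cc_app[OF y] by (simp add: mu_functional_def restrict0_def)
  note k = ok_cc[OF y t]
  show "re (mu_functional V (c x y) (dc f g) (cc s t)) = dapp (mu x f - mu y g) s - dapp (mu x g + mu y f) t"
    "im (mu_functional V (c x y) (dc f g) (cc s t)) = dapp (mu x g + mu y f) s + dapp (mu x f - mu y g) t"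
    unfolding app re_dc[OF k g] im_dc[OF k g] by (simp_all add: dapp_simps dapp_add_right dapp_diff_right)
qed

lemma arens_extension_c:
  assumes b: "ok b"
  shows "arens_extension V (A1.dc a b) = D.cc (istar a) (istar b)"
proof (rule D.cc_eqI)
  show "arens_extension V (A1.dc a b) F = 0" if "F \<notin> vecs (dual V)" for F
    using that by (auto simp: arens_extension_def restrict0_def)
  fix f g :: "'b rdual" assume g: "ok g"
  have F: "dc f g \<in> vecs (dual V)" using g by (auto simp: vecs_dual)
  show "arens_extension V (A1.dc a b) (dc f g) =
      dc (capp (istar a) f - capp (istar b) g) (capp (istar b) f + capp (istar a) g)"
  proof (rule dc_eqI)
    show "ok (capp (istar b) f + capp (istar a) g)" by (intro ok_intros ok_istar b g)
    show "arens_extension V (A1.dc a b) (dc f g) z = 0" if "z \<notin> vecs V" for z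
      using that F by (simp add: arens_extension_def restrict0_def)
    fix x y :: 'b assume y: "ok y"
    have app: "arens_extension V (A1.dc a b) (dc f g) (c x y) = A1.dc a b (A.dc (mu x f - mu y g) (mu x g + mu y f))"
      using F y g by (simp add: arens_extension_def restrict0_def mu_functional_c)
    have k: "ok (mu x g + mu y f)" by (intro ok_intros ok_mu ok_mu_right y g)
    show "re (arens_extension V (A1.dc a b) (dc f g) (c x y)) =
        dapp (capp (istar a) f - capp (istar b) g) x - dapp (capp (istar b) f + capp (istar a) g) y"
      "im (arens_extension V (A1.dc a b) (dc f g) (c x y)) =
        dapp (capp (istar b) f + capp (istar a) g) x + dapp (capp (istar a) f - capp (istar b) g) y"
      unfolding app A1.re_dc[OF k b] A1.im_dc[OF k b] by (simp_all add: dapp_simps dapp_add_right dapp_diff_right)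
  qed
qed

lemma surj_iff: "arens_extension V ` vecs (center_bidual V) = vecs (center (dual V)) \<longleftrightarrow>
    surj (istar :: _ \<Rightarrow> 'b rdual center_op)"
proof
  assume eq: "arens_extension V ` vecs (center_bidual V) = vecs (center (dual V))"
  show "surj (istar :: _ \<Rightarrow> 'b rdual center_op)"
    unfolding surj_def
  proof
    fix s :: "'b rdual center_op"
    have "D.cc s 0 \<in> arens_extension V ` vecs (center_bidual V)" using D.cc_in_center[OF ok_zero] eq by blast
    then obtain a b where b: "ok b" "D.cc s 0 = D.cc (istar a) (istar b)"
      using A1.vecs_dual arens_extension_c by auto
    from Z.c_inj[OF ok_zero ok_istar[OF b(1)] b(2)] show "\<exists>a. s = istar a" by blast
  qed
next
  assume surj: "surj (istar :: _ \<Rightarrow> 'b rdual center_op)"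
  show "arens_extension V ` vecs (center_bidual V) = vecs (center (dual V))"
  proof (intro set_eqI iffI)
    fix S assume "S \<in> arens_extension V ` vecs (center_bidual V)"
    then obtain a b where "ok b" "S = D.cc (istar a) (istar b)" using A1.vecs_dual arens_extension_c by auto
    then show "S \<in> vecs (center (dual V))" using D.cc_in_center ok_istar by blast
  next
    fix S assume "S \<in> vecs (center (dual V))"
    then obtain s t where st: "ok t" "S = D.cc s t" by (rule D.center_cases)
    obtain a where a: "istar a = s" using surj by (metis surjD)
    have "\<exists>b. ok b \<and> istar b = t"
    proof (cases cx)
      case True
      obtain b where "istar b = t" using surj by (metis surjD)
      with ok_cx[OF True] show ?thesis by blast
    next
      case False
      then have "t = 0" using st(1) by (rule ok_not_cx)
      then show ?thesis by (intro exI[of _ 0]) (simp add: istar_linear)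
    qed
    then obtain b where b: "ok b" "istar b = t" by blast
    then have "S = arens_extension V (A1.dc a b)" using st a arens_extension_c by simp
    then show "S \<in> arens_extension V ` vecs (center_bidual V)" using A1.vecs_dual b by blast
  qed
qed

text \<open>The product is evaluated from the inside: \<open>inner\<close> is the module action of
  an operator on a functional and \<open>middle\<close> the action of the second factor, each
  expanded like a product of complex numbers.\<close>

lemma arens_product_c:
  assumes a: "ok a2" and b: "ok b2"
  shows "arens_product (center V) (A1.dc a1 a2) (A1.dc b1 b2) =
    A1.dc (arens a1 b1 - arens a2 b2) (arens a1 b2 + arens a2 b1)"
proof (rule A1.dc_eqI)
  show "ok (arens a1 b2 + arens a2 b1)" by (intro ok_intros ok_arens ok_arens_right a b)
  show "arens_product (center V) (A1.dc a1 a2) (A1.dc b1 b2) \<Phi> = 0" if "\<Phi> \<notin> vecs (dual (center V))" for \<Phi>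
    using that by (simp add: arens_product_def restrict0_def)
  fix \<phi>1 \<phi>2 :: "'b center_op rdual" assume p: "ok \<phi>2"
  have P: "A.dc \<phi>1 \<phi>2 \<in> vecs (dual (center V))" using p by (auto simp: A.vecs_dual)
  have inner: "restrict0 (vecs (center V)) (\<lambda>T. A.dc \<phi>1 \<phi>2 (cc s1 s2 \<circ> T)) =
      A.dc (module_act \<phi>1 s1 - module_act \<phi>2 s2) (module_act \<phi>2 s1 + module_act \<phi>1 s2)" if s: "ok s2" for s1 s2
  proof (rule A.dc_eqI)
    show "ok (module_act \<phi>2 s1 + module_act \<phi>1 s2)" by (rule ok_add[OF ok_module_act[OF p] ok_module_act_right[OF s]])
    show "restrict0 (vecs (center V)) (\<lambda>T. A.dc \<phi>1 \<phi>2 (cc s1 s2 \<circ> T)) T = 0" if "T \<notin> vecs (center V)" for T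
      using that by (simp add: restrict0_def)
    fix t1 t2 :: "'b center_op" assume t: "ok t2"
    have k: "ok (s2 * t1 + s1 * t2)" using s t unfolding ok_def by auto
    have app: "restrict0 (vecs (center V)) (\<lambda>T. A.dc \<phi>1 \<phi>2 (cc s1 s2 \<circ> T)) (cc t1 t2) =
        A.dc \<phi>1 \<phi>2 (cc (s1 * t1 - s2 * t2) (s2 * t1 + s1 * t2))"
      using cc_in_center[OF t] cc_comp[OF t] by (simp add: restrict0_def)
    show "re (restrict0 (vecs (center V)) (\<lambda>T. A.dc \<phi>1 \<phi>2 (cc s1 s2 \<circ> T)) (cc t1 t2)) =
        dapp (module_act \<phi>1 s1 - module_act \<phi>2 s2) t1 - dapp (module_act \<phi>2 s1 + module_act \<phi>1 s2) t2"
      "im (restrict0 (vecs (center V)) (\<lambda>T. A.dc \<phi>1 \<phi>2 (cc s1 s2 \<circ> T)) (cc t1 t2)) =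
        dapp (module_act \<phi>2 s1 + module_act \<phi>1 s2) t1 + dapp (module_act \<phi>1 s1 - module_act \<phi>2 s2) t2"
      unfolding app A.re_dc[OF k p] A.im_dc[OF k p] by (simp_all add: dapp_simps dapp_add_right dapp_diff_right)
  qed
  have middle: "restrict0 (vecs (center V)) (\<lambda>S. A1.dc b1 b2 (restrict0 (vecs (center V)) (\<lambda>T. A.dc \<phi>1 \<phi>2 (S \<circ> T)))) =
      A.dc (bidual_act b1 \<phi>1 - bidual_act b2 \<phi>2) (bidual_act b1 \<phi>2 + bidual_act b2 \<phi>1)" (is "?M = _")
  proof (rule A.dc_eqI)
    show "ok (bidual_act b1 \<phi>2 + bidual_act b2 \<phi>1)"
      by (rule ok_add[OF ok_bidual_act_right[OF p] ok_bidual_act[OF b]])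
    show "?M S = 0" if "S \<notin> vecs (center V)" for S using that by (simp add: restrict0_def)
    fix s1 s2 :: "'b center_op" assume s: "ok s2"
    have k: "ok (module_act \<phi>2 s1 + module_act \<phi>1 s2)"
      by (rule ok_add[OF ok_module_act[OF p] ok_module_act_right[OF s]])
    have app: "?M (cc s1 s2) = A1.dc b1 b2 (A.dc (module_act \<phi>1 s1 - module_act \<phi>2 s2) (module_act \<phi>2 s1 + module_act \<phi>1 s2))"
      using cc_in_center[OF s] inner[OF s] by (simp add: restrict0_def[where A = "vecs (center V)" and f = "\<lambda>S. A1.dc b1 b2 (g S)" for g])
    show "re (?M (cc s1 s2)) = dapp (bidual_act b1 \<phi>1 - bidual_act b2 \<phi>2) s1 - dapp (bidual_act b1 \<phi>2 + bidual_act b2 \<phi>1) s2"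
      "im (?M (cc s1 s2)) = dapp (bidual_act b1 \<phi>2 + bidual_act b2 \<phi>1) s1 + dapp (bidual_act b1 \<phi>1 - bidual_act b2 \<phi>2) s2"
      unfolding app A1.re_dc[OF k b] A1.im_dc[OF k b] by (simp_all add: dapp_simps dapp_add_right dapp_diff_right)
  qed
  have k: "ok (bidual_act b1 \<phi>2 + bidual_act b2 \<phi>1)"
    by (rule ok_add[OF ok_bidual_act_right[OF p] ok_bidual_act[OF b]])
  have app: "arens_product (center V) (A1.dc a1 a2) (A1.dc b1 b2) (A.dc \<phi>1 \<phi>2) =
      A1.dc a1 a2 (A.dc (bidual_act b1 \<phi>1 - bidual_act b2 \<phi>2) (bidual_act b1 \<phi>2 + bidual_act b2 \<phi>1))"
    unfolding arens_product_def restrict0_def[of "vecs (dual (center V))"] if_P[OF P] middle ..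
  show "re (arens_product (center V) (A1.dc a1 a2) (A1.dc b1 b2) (A.dc \<phi>1 \<phi>2)) =
      dapp (arens a1 b1 - arens a2 b2) \<phi>1 - dapp (arens a1 b2 + arens a2 b1) \<phi>2"
    "im (arens_product (center V) (A1.dc a1 a2) (A1.dc b1 b2) (A.dc \<phi>1 \<phi>2)) =
      dapp (arens a1 b2 + arens a2 b1) \<phi>1 + dapp (arens a1 b1 - arens a2 b2) \<phi>2"
    unfolding app A1.re_dc[OF k a] A1.im_dc[OF k a] by (simp_all add: dapp_simps dapp_add_right dapp_diff_right)
qed


subsection \<open>Norms\<close>

text \<open>After rotation of \<open>\<Phi>\<close> its value is the real number
  \<open>dapp a1 \<phi>1 - dapp a2 \<phi>2\<close>. That \<open>\<Psi>\<close> has norm at most 1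
  gives, through the net, the domination required by \<open>bidual_le_of_finite_combination\<close>
  with factor \<open>1 + e\<close>; then \<open>e\<close> tends to 0.\<close>

lemma bidual_norm_le:
  assumes a: "ok a2" and C: "0 \<le> C"
    and le: "\<And>u. norm u = 1 \<Longrightarrow> re u *\<^sub>R a1 - im u *\<^sub>R a2 \<le> C *\<^sub>R one_bidual"
  shows "vnorm (center_bidual V) (A1.dc a1 a2) \<le> C"
proof (rule A1.dual_norm_le)
  fix \<Phi> assume P: "\<Phi> \<in> vecs (dual (center V))" and P1: "vnorm (dual (center V)) \<Phi> \<le> 1"
  obtain w where w: "norm w = 1" "w * A1.dc a1 a2 \<Phi> = of_real (norm (A1.dc a1 a2 \<Phi>))" by (rule unit_rotation)
  have hom: "homogeneous_norm (dual (center V))" by (rule A1.homogeneous)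
  define \<Psi> where "\<Psi> = smul (dual (center V)) w \<Phi>"
  have Psi: "\<Psi> \<in> vecs (dual (center V))" "vnorm (dual (center V)) \<Psi> \<le> 1"
    using hom P P1 w(1) by (simp_all add: \<Psi>_def homogeneous_norm_def)
  obtain \<phi>1 \<phi>2 where p: "ok \<phi>2" "\<Psi> = A.dc \<phi>1 \<phi>2" using Psi(1) by (auto simp: A.vecs_dual)
  have "A1.dc a1 a2 \<Psi> = w * A1.dc a1 a2 \<Phi>"
    using bounded_mapsD(2)[OF hom homogeneous_norm_scalars A1.dc_bounded[OF a, of a1] P, of w] by (simp add: \<Psi>_def)
  then have eq: "norm (A1.dc a1 a2 \<Phi>) = dapp a1 \<phi>1 - dapp a2 \<phi>2"
    using w(2) A1.re_dc[OF p(1) a, of a1 \<phi>1] p(2) by simp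
  have approx: "dapp a1 \<phi>1 - dapp a2 \<phi>2 \<le> (1 + e) * C" if e: "0 < e" for e
  proof -
    obtain U where U: "finite U" "\<forall>u\<in>U. norm u = 1"
      and net: "\<forall>s t M. ok t \<longrightarrow> 0 \<le> M \<longrightarrow> (\<forall>u\<in>U. re u *\<^sub>R s - im u *\<^sub>R t \<le> M *\<^sub>R 1) \<longrightarrow>
        (\<forall>z\<in>vecs V. vnorm V (cc s t z) \<le> (1 + e) * M * vnorm V z)"
      using operator_norm_net[OF e] by (elim exE conjE)
    have ok_le: "dapp \<phi>1 s - dapp \<phi>2 t \<le> (1 + e) * M"
      if t: "ok t" and M: "0 \<le> M" and st: "\<forall>u\<in>U. re u *\<^sub>R s - im u *\<^sub>R t \<le> M *\<^sub>R 1" for s t M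
    proof -
      have T: "cc s t \<in> vecs (center V)" by (rule cc_in_center[OF t])
      have "vnorm (center V) (cc s t) \<le> (1 + e) * M"
      proof (rule center_norm_le)
        fix z assume z: "z \<in> vecs V" "vnorm V z \<le> 1"
        have "(1 + e) * M * vnorm V z \<le> (1 + e) * M * 1" using z e M by (intro mult_left_mono) auto
        then show "vnorm V (cc s t z) \<le> (1 + e) * M" using net[rule_format, OF t M st[rule_format] z(1)] by simp
      qed
      moreover have "dapp \<phi>1 s - dapp \<phi>2 t \<le> norm (\<Psi> (cc s t))"
        using abs_re_le[of "\<Psi> (cc s t)"] A.re_dc[OF t p(1), of \<phi>1 s] p(2) by simp
      moreover have "norm (\<Psi> (cc s t)) \<le> vnorm (dual (center V)) \<Psi> * vnorm (center V) (cc s t)"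
        by (rule A.dual_norm_bound[OF Psi(1) T])
      moreover have "vnorm (dual (center V)) \<Psi> * vnorm (center V) (cc s t) \<le> 1 * vnorm (center V) (cc s t)"
        using Psi(2) center_norm_nonneg[OF T] by (rule mult_right_mono)
      ultimately show ?thesis by linarith
    qed
    show ?thesis
    proof (rule bidual_le_of_finite_combination[of "\<iota> ` U"])
      show "finite (\<iota> ` U)" using U(1) by simp
      show "0 < 1 + e" using e by simp
      show "Re u *\<^sub>R a1 - Im u *\<^sub>R a2 \<le> C *\<^sub>R one_bidual" if "u \<in> \<iota> ` U" for u
        using that le U(2) by (auto simp: re_def im_def)
      fix s t :: "'b center_op" and M :: real
      assume M: "0 \<le> M" and "\<And>u. u \<in> \<iota> ` U \<Longrightarrow> Re u *\<^sub>R s - Im u *\<^sub>R t \<le> M *\<^sub>R 1"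
      then have st: "\<forall>u\<in>U. re u *\<^sub>R s - im u *\<^sub>R t \<le> M *\<^sub>R 1" by (auto simp: re_def im_def)
      show "dapp \<phi>1 s - dapp \<phi>2 t \<le> (1 + e) * M"
      \<comment> \<open>The combination lemma quantifies over arbitrary \<open>t\<close>, the net
        only over \<open>ok t\<close>. Over the real field \<open>\<phi>2 = 0\<close> and
        \<open>im u = 0\<close>, so \<open>t\<close> may be replaced by 0.\<close>
      proof (cases cx)
        case True
        show ?thesis by (rule ok_le[OF ok_cx[OF True] M st])
      next
        case False
        have "\<phi>2 = 0" using False p(1) by (rule ok_not_cx)
        moreover have "\<forall>u\<in>U. re u *\<^sub>R s - im u *\<^sub>R 0 \<le> M *\<^sub>R 1" using st im_zero[OF False] by simp
        from ok_le[OF ok_zero M this] have "dapp \<phi>1 s \<le> (1 + e) * M" by (simp add: dapp_zero_right)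
        ultimately show ?thesis by (simp add: dapp_simps)
      qed
    qed (rule C)
  qed
  have lim: "dapp a1 \<phi>1 - dapp a2 \<phi>2 \<le> C + e * C" if "0 < e" for e
    using approx[OF that] by (simp only: distrib_right mult_1_left)
  have "dapp a1 \<phi>1 - dapp a2 \<phi>2 \<le> C"
  proof (rule field_le_epsilon)
    fix e :: real assume e: "0 < e"
    have n: "0 < C + 1" using C by simp
    \<comment> \<open>The parameter of the net is chosen so that multiplication by \<open>C\<close>
      leaves an error of at most \<open>e\<close>, including the case \<open>C = 0\<close>.\<close>
    have "e / (C + 1) * C \<le> e" using e C n by (simp add: field_simps)
    moreover have "0 < e / (C + 1)" using e n by simp
    ultimately show "dapp a1 \<phi>1 - dapp a2 \<phi>2 \<le> C + e" using lim[of "e / (C + 1)"] by linarith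
  qed
  then show "norm (A1.dc a1 a2 \<Phi>) \<le> C" by (simp add: eq)
qed

text \<open>For \<open>z\<close> and \<open>F\<close> in the unit balls,
  \<open>mu_functional V z F\<close> lies in the unit ball of the dual of the center.\<close>

lemma arens_extension_norm_le:
  assumes a: "a \<in> vecs (center_bidual V)"
  shows "vnorm (center (dual V)) (arens_extension V a) \<le> vnorm (center_bidual V) a"
proof (rule D.center_norm_le)
  fix F assume F: "F \<in> vecs (dual V)" "vnorm (dual V) F \<le> 1"
  show "vnorm (dual V) (arens_extension V a F) \<le> vnorm (center_bidual V) a"
  proof (rule dual_norm_le)
    fix z assume z: "z \<in> vecs V" "vnorm V z \<le> 1"
    obtain x y where xy: "ok y" "z = c x y" using z(1) by (rule vecs_cases)
    obtain f g where fg: "ok g" "F = dc f g" using F(1) by (auto simp: vecs_dual)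
    have z0: "0 \<le> vnorm V z" using xy vnorm_nonneg by simp
    define m where "m = mu_functional V z F"
    have m: "m \<in> vecs (dual (center V))"
      unfolding m_def xy(2) fg(2) mu_functional_c[OF xy(1) fg(1)]
      using ok_add[OF ok_mu_right[OF fg(1)] ok_mu[OF xy(1)]] by (auto simp: A.vecs_dual)
    have "vnorm (dual (center V)) m \<le> 1"
    proof (rule A.dual_norm_le)
      fix T assume T: "T \<in> vecs (center V)" "vnorm (center V) T \<le> 1"
      have Tz: "T z \<in> vecs V" using bounded_mapsD(1)[OF homogeneous homogeneous center_subset_bounded[OF T(1)] z(1)] .
      have "vnorm V (T z) \<le> vnorm (center V) T * vnorm V z" by (rule center_norm_bound[OF T(1) z(1)])
      also have "\<dots> \<le> 1 * 1" using T z z0 by (intro mult_mono) auto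
      finally have Tz1: "vnorm V (T z) \<le> 1" by simp
      have Tz0: "0 \<le> vnorm V (T z)" using homogeneous Tz by (simp add: homogeneous_norm_def)
      have "norm (F (T z)) \<le> vnorm (dual V) F * vnorm V (T z)" by (rule dual_norm_bound[OF F(1) Tz])
      also have "\<dots> \<le> 1 * 1" using F Tz1 Tz0 by (intro mult_mono) auto
      finally show "norm (m T) \<le> 1" using T by (simp add: m_def mu_functional_def restrict0_def)
    qed
    moreover have "norm (a m) \<le> vnorm (center_bidual V) a * vnorm (dual (center V)) m"
      by (rule A1.dual_norm_bound[OF a m])
    moreover have "vnorm (center_bidual V) a * vnorm (dual (center V)) m \<le> vnorm (center_bidual V) a * 1"
      using calculation(1) A1.dual_norm_nonneg[OF a] by (intro mult_left_mono) auto
    ultimately show "norm (arens_extension V a F z) \<le> vnorm (center_bidual V) a"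
      using F(1) z(1) by (simp add: arens_extension_def restrict0_def m_def)
  qed
qed


subsection \<open>The band\<close>

definition bidual_band :: "((('v \<Rightarrow> 'v) \<Rightarrow> 'k) \<Rightarrow> 'k) set" where
  "bidual_band = {A1.dc a b |a b. ok b \<and> a \<in> carrier_band \<and> b \<in> carrier_band}"

lemma bidual_band_c: "ok b \<Longrightarrow> A1.dc a b \<in> bidual_band \<longleftrightarrow> a \<in> carrier_band \<and> b \<in> carrier_band"
  unfolding bidual_band_def using A2.c_inj by blast

text \<open>The modulus of an element is the supremum of real combinations of its coordinates, so it
  stays in \<open>carrier_band\<close> by \<open>carrier_band_lub\<close>; coordinates of dominated
  elements are then caught by \<open>carrier_band_ideal\<close>.\<close>

lemma band_bidual_band: "band (center_bidual V) bidual_band"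
  unfolding band_def order_ideal_def is_subspace_def
proof (intro conjI ballI allI impI subsetI)
  show "a \<in> vecs (center_bidual V)" if "a \<in> bidual_band" for a
    using that by (auto simp: bidual_band_def A1.vecs_dual)
  have "A1.dc 0 0 \<in> bidual_band" by (simp add: bidual_band_c carrier_band_zero)
  then show "0 \<in> bidual_band" by (simp add: A2.c_zero)
  fix a assume "a \<in> bidual_band"
  then obtain a1 a2 where a: "ok a2" "a = A1.dc a1 a2" "a1 \<in> carrier_band" "a2 \<in> carrier_band"
    by (auto simp: bidual_band_def)
  show "smul (center_bidual V) s a \<in> bidual_band" for s
    unfolding a(2) A2.c_smul[OF a(1)] bidual_band_c[OF ok_smul[OF a(1)]]
    using a by (intro conjI carrier_band_add carrier_band_diff carrier_band_scaleR)
  show "a + b \<in> bidual_band" if b: "b \<in> bidual_band" for b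
  proof -
    obtain b1 b2 where b: "ok b2" "b = A1.dc b1 b2" "b1 \<in> carrier_band" "b2 \<in> carrier_band"
      using b by (auto simp: bidual_band_def)
    show ?thesis
      unfolding a(2) b(2) A2.c_add[OF a(1) b(1)] bidual_band_c[OF ok_add[OF a(1) b(1)]]
      using a b by (intro conjI carrier_band_add)
  qed
  fix b assume bV: "b \<in> vecs (center_bidual V)" and le: "le (center_bidual V) (modulus (center_bidual V) b) (modulus (center_bidual V) a)"
  obtain b1 b2 where b: "ok b2" "b = A1.dc b1 b2" using bV by (auto simp: A1.vecs_dual)
  obtain m where m: "is_modulus a1 a2 m" using rdual_modulus_exists by blast
  obtain n where n: "is_modulus b1 b2 n" using rdual_modulus_exists by blast
  have nm: "n \<le> m"
    using le unfolding a(2) b(2) A2.modulus_c[OF a(1) m] A2.modulus_c[OF b(1) n] by (simp add: A2.le_c)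
  have "m \<in> carrier_band"
  proof (rule carrier_band_lub[of "{re u *\<^sub>R a1 - im u *\<^sub>R a2 |u. norm u = 1}"])
    have "re 1 *\<^sub>R a1 - im 1 *\<^sub>R a2 \<in> {re u *\<^sub>R a1 - im u *\<^sub>R a2 |u. norm u = 1}"
      using norm_one by blast
    then show "{re u *\<^sub>R a1 - im u *\<^sub>R a2 |u. norm u = 1} \<noteq> {}" by blast
    show "{re u *\<^sub>R a1 - im u *\<^sub>R a2 |u. norm u = 1} \<subseteq> carrier_band"
      using a by (auto intro: carrier_band_diff carrier_band_scaleR)
  qed (use m in \<open>unfold is_modulus_def, blast+\<close>)
  moreover have "\<And>u. norm u = 1 \<Longrightarrow> re u *\<^sub>R b1 - im u *\<^sub>R b2 \<le> m"
    using n nm unfolding is_modulus_def by blast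
  note bm = rotation_bound[OF this b(1)]
  ultimately show "b \<in> bidual_band"
    unfolding b(2) bidual_band_c[OF b(1)] using abs_le_D(1,2)[OF bm(1)] abs_le_D(1,2)[OF bm(2)]
    by (blast intro: carrier_band_ideal)
next
  fix S s assume S: "S \<subseteq> bidual_band \<inter> real_vecs (center_bidual V)" and lub: "is_lub (center_bidual V) S s"
  then have "s \<in> vecs (center_bidual V)" by (simp add: is_lub_def)
  then obtain s1 s2 where s: "ok s2" "s = A1.dc s1 s2" by (auto simp: A1.vecs_dual)
  define F where "F = {a. A1.dc a 0 \<in> S}"
  have S_F: "S = (\<lambda>a. A1.dc a 0) ` F" using S by (auto simp: F_def A2.real_vecs_eq)
  have FB: "F \<subseteq> carrier_band" using S by (auto simp: F_def bidual_band_c)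
  have ub: "s2 = 0 \<and> a \<le> s1" if "a \<in> F" for a
    using lub that by (auto simp: is_lub_def S_F s A2.le_c)
  have least: "s2 = 0 \<and> s1 \<le> w" if "\<And>a. a \<in> F \<Longrightarrow> a \<le> w" for w
  proof -
    have "le (center_bidual V) s (A1.dc w 0)"
      using lub that unfolding is_lub_def S_F by (auto simp: A2.le_c)
    then show ?thesis by (simp add: s A2.le_c)
  qed
  show "s \<in> bidual_band"
  proof (cases "F = {}")
    case True
    \<comment> \<open>\<open>is_lub\<close> admits the empty set, for which \<open>s\<close> lies
      below every real vector; comparison with 0 and with \<open>s1 + s1\<close> forces
      \<open>s = 0\<close>.\<close>
    then have "s2 = 0" "s1 \<le> 0" "s1 \<le> s1 + s1" using least[of 0] least[of "s1 + s1"] by simp_all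
    then have "s1 = 0" "s2 = 0" by simp_all
    then show ?thesis by (simp add: s bidual_band_c carrier_band_zero)
  next
    case False
    have "s1 \<in> carrier_band" by (rule carrier_band_lub[OF False FB]) (use ub least in blast)+
    moreover have "s2 = 0" using ub False by blast
    ultimately show ?thesis by (simp add: s bidual_band_c carrier_band_zero)
  qed
qed

context
  assumes tf: "top_full TYPE('b)"
begin

definition center_dual_embedding :: "(('v \<Rightarrow> 'k) \<Rightarrow> 'v \<Rightarrow> 'k) \<Rightarrow> (('v \<Rightarrow> 'v) \<Rightarrow> 'k) \<Rightarrow> 'k" where
  "center_dual_embedding T = A1.dc (arens_section (Z.px T)) (arens_section (Z.py T))"

lemma center_dual_embedding_c:
  "ok t \<Longrightarrow> center_dual_embedding (D.cc s t) = A1.dc (arens_section s) (arens_section t)"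
  by (simp add: center_dual_embedding_def)

lemma ok_arens_section: "ok t \<Longrightarrow> ok (arens_section (t :: 'b rdual center_op))"
  unfolding ok_def using arens_section_zero[OF tf] by auto

lemma arens_section_le_iff: "arens_section s \<le> arens_section t \<longleftrightarrow> s \<le> (t :: 'b rdual center_op)"
  using arens_section_nonneg_iff[OF tf, of "t - s"] by (simp add: arens_section_diff[OF tf])

lemma arens_section_inject: "arens_section s = arens_section t \<longleftrightarrow> s = (t :: 'b rdual center_op)"
  using istar_arens_section[OF tf] by metis

text \<open>For the norm, order bounds on all rotations of \<open>S\<close> pass through the section
  to the bidual, where \<open>bidual_norm_le\<close> applies. Conversely the Arens extension is
  contractive and maps the image of \<open>S\<close> back to \<open>S\<close>.\<close>

lemma center_dual_embedding_iso:
  "banach_lattice_algebra_iso (center (dual V)) (center_bidual V) bidual_band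
    (\<circ>) (arens_product (center V)) center_dual_embedding"
  unfolding banach_lattice_algebra_iso_def linear_map_def
proof (intro conjI ballI allI)
  note Phi = center_dual_embedding_c and okP = ok_arens_section
  show "bij_betw center_dual_embedding (vecs (center (dual V))) bidual_band"
    unfolding bij_betw_def
  proof
    show "inj_on center_dual_embedding (vecs (center (dual V)))"
    proof (rule inj_onI)
      fix S T assume ST: "S \<in> vecs (center (dual V))" "T \<in> vecs (center (dual V))"
        and eq: "center_dual_embedding S = center_dual_embedding T"
      obtain s1 s2 where s: "ok s2" "S = D.cc s1 s2" using ST(1) by (rule D.center_cases)
      obtain t1 t2 where t: "ok t2" "T = D.cc t1 t2" using ST(2) by (rule D.center_cases)
      have "A1.dc (arens_section s1) (arens_section s2) = A1.dc (arens_section t1) (arens_section t2)"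
        using eq s t by (simp add: Phi)
      from A2.c_inj[OF okP[OF s(1)] okP[OF t(1)] this] show "S = T" using s t by (simp add: arens_section_inject)
    qed
    show "center_dual_embedding ` vecs (center (dual V)) = bidual_band"
    proof (intro set_eqI iffI)
      fix a assume "a \<in> center_dual_embedding ` vecs (center (dual V))"
      then obtain s t where "ok t" "a = A1.dc (arens_section s) (arens_section t)"
        using D.vecs_center Phi by auto
      then show "a \<in> bidual_band" using okP bidual_band_c arens_section_in_band[OF tf] by simp
    next
      fix a assume "a \<in> bidual_band"
      then obtain a1 a2 where a: "ok a2" "a = A1.dc a1 a2" "a1 \<in> carrier_band" "a2 \<in> carrier_band"
        by (auto simp: bidual_band_def)
      have "a = center_dual_embedding (D.cc (istar a1) (istar a2))"
        unfolding Phi[OF ok_istar[OF a(1)]] using a arens_section_eqI[OF tf] by simp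
      then show "a \<in> center_dual_embedding ` vecs (center (dual V))"
        using D.cc_in_center[OF ok_istar[OF a(1)]] by blast
    qed
  qed
  fix S assume S: "S \<in> vecs (center (dual V))"
  obtain s1 s2 where s: "ok s2" "S = D.cc s1 s2" using S by (rule D.center_cases)
  have PhiS: "center_dual_embedding S = A1.dc (arens_section s1) (arens_section s2)" using s Phi by simp
  show PS: "center_dual_embedding S \<in> vecs (center_bidual V)"
    unfolding PhiS using okP[OF s(1)] by (auto simp: A1.vecs_dual)
  show "center_dual_embedding (smul (center (dual V)) a S) = smul (center_bidual V) a (center_dual_embedding S)" for a
    unfolding PhiS unfolding s(2) Z.c_smul[OF s(1)] Phi[OF ok_smul[OF s(1)]] A2.c_smul[OF okP[OF s(1)]]
    by (simp add: arens_section_add[OF tf] arens_section_diff[OF tf] arens_section_scaleR[OF tf])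
  show "vnorm (center_bidual V) (center_dual_embedding S) = vnorm (center (dual V)) S"
  proof (rule antisym)
    show "vnorm (center_bidual V) (center_dual_embedding S) \<le> vnorm (center (dual V)) S"
      unfolding PhiS
    proof (rule bidual_norm_le[OF okP[OF s(1)] D.center_norm_nonneg[OF S]])
      fix u :: 'k assume u: "norm u = 1"
      have "re u *\<^sub>R s1 - im u *\<^sub>R s2 \<le> vnorm (center (dual V)) S *\<^sub>R 1"
        unfolding s(2) by (rule D.rotation_le_center_norm[OF s(1) u])
      from arens_section_le_one[OF tf this D.center_norm_nonneg[OF S]]
      show "re u *\<^sub>R arens_section s1 - im u *\<^sub>R arens_section s2 \<le> vnorm (center (dual V)) S *\<^sub>R one_bidual"
        by (simp add: arens_section_diff[OF tf] arens_section_scaleR[OF tf])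
    qed
    have "arens_extension V (center_dual_embedding S) = S"
      unfolding PhiS arens_extension_c[OF okP[OF s(1)]] istar_arens_section[OF tf] by (rule s(2)[symmetric])
    with arens_extension_norm_le[OF PS]
    show "vnorm (center (dual V)) S \<le> vnorm (center_bidual V) (center_dual_embedding S)" by simp
  qed
  fix T assume T: "T \<in> vecs (center (dual V))"
  obtain t1 t2 where t: "ok t2" "T = D.cc t1 t2" using T by (rule D.center_cases)
  have PhiT: "center_dual_embedding T = A1.dc (arens_section t1) (arens_section t2)" using t Phi by simp
  show "center_dual_embedding (S + T) = center_dual_embedding S + center_dual_embedding T"
    unfolding PhiS PhiT unfolding s(2) t(2) Z.c_add[OF s(1) t(1)] Phi[OF ok_add[OF s(1) t(1)]]
      A2.c_add[OF okP[OF s(1)] okP[OF t(1)]] by (simp add: arens_section_add[OF tf])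
  have k: "ok (s2 * t1 + s1 * t2)" using s(1) t(1) unfolding ok_def by auto
  show "center_dual_embedding (S \<circ> T) = arens_product (center V) (center_dual_embedding S) (center_dual_embedding T)"
    unfolding PhiS PhiT unfolding s(2) t(2) D.cc_comp[OF t(1)] Phi[OF k] arens_product_c[OF okP[OF s(1)] okP[OF t(1)]]
    by (simp add: arens_section_add[OF tf] arens_section_diff[OF tf] arens_section_mult[OF tf] add.commute)
  show "le (center_bidual V) (center_dual_embedding S) (center_dual_embedding T) \<longleftrightarrow> le (center (dual V)) S T"
    unfolding PhiS PhiT unfolding s(2) t(2) Z.le_c[OF s(1) t(1)] A2.le_c[OF okP[OF s(1)] okP[OF t(1)]]
    by (simp add: arens_section_le_iff arens_section_inject)
qed

end

theorem arens_extension_main: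
  "(topologically_full_center V \<longleftrightarrow> arens_extension V ` vecs (center_bidual V) = vecs (center (dual V))) \<and>
   (topologically_full_center V \<longrightarrow> (\<exists>B \<Phi>. band (center_bidual V) B \<and>
      banach_lattice_algebra_iso (center (dual V)) (center_bidual V) B (\<circ>) (arens_product (center V)) \<Phi>))"
  unfolding surj_iff topologically_full_iff
  using top_full_iff_surj band_bidual_band center_dual_embedding_iso by blast

end


section \<open>Real and complex Banach lattices\<close>

lemma real_lattice_kspace:
  "lattice_kspace (of_real :: real \<Rightarrow> complex) False (real_lattice :: (real, 'a::banach_lattice) ospace) (\<lambda>x y. x)"
proof -
  interpret S: scalar_field "of_real :: real \<Rightarrow> complex" False
    by unfold_locales (auto simp: complex_is_Real_iff[symmetric] elim: Reals_cases)
  have re: "S.re u = u" "S.im u = 0" for u by (simp_all add: S.re_def S.im_def)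
  interpret V: kspace "of_real :: real \<Rightarrow> complex" False "real_lattice :: (real, 'a) ospace" "\<lambda>x y. x"
    by unfold_locales (auto simp: S.ok_def re intro!: exI[of _ 1])
  interpret M: kspace_modulus "of_real :: real \<Rightarrow> complex" False "real_lattice :: (real, 'a) ospace" "\<lambda>x y. x"
  proof unfold_locales
    fix x y :: 'a
    have "\<bar>x\<bar> \<le> w \<longleftrightarrow> (\<forall>u. norm u = 1 \<longrightarrow> S.re u *\<^sub>R x - S.im u *\<^sub>R y \<le> w)" for w
    proof
      assume "\<bar>x\<bar> \<le> w"
      then show "\<forall>u. norm u = 1 \<longrightarrow> S.re u *\<^sub>R x - S.im u *\<^sub>R y \<le> w"
        using abs_le_D[of x w] by (auto simp: re abs_if split: if_splits)
    next
      assume "\<forall>u. norm u = 1 \<longrightarrow> S.re u *\<^sub>R x - S.im u *\<^sub>R y \<le> w"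
      from this[rule_format, of 1] this[rule_format, of "- 1"] show "\<bar>x\<bar> \<le> w"
        by (intro abs_leI) (simp_all add: re)
    qed
    then show "\<exists>m. S.is_modulus x y m" unfolding S.is_modulus_def by blast
  qed (simp add: V.exact_def)
  show ?thesis
  proof unfold_locales
    fix e :: real assume e: "0 < e"
    show "\<exists>U. finite U \<and> (\<forall>u\<in>U. norm u = 1) \<and>
      (\<forall>s t M. S.ok t \<longrightarrow> 0 \<le> M \<longrightarrow> (\<forall>u\<in>U. S.re u *\<^sub>R s - S.im u *\<^sub>R t \<le> M *\<^sub>R 1) \<longrightarrow>
        (\<forall>z\<in>vecs real_lattice. vnorm real_lattice (V.cc s t z) \<le> (1 + e) * M * vnorm real_lattice (z :: 'a)))"
    \<comment> \<open>The two signs already give \<open>\<bar>s\<bar> \<le> M *\<^sub>R 1\<close>,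
      so over the real field the net loses nothing.\<close>
    proof (intro exI[of _ "{1, - 1}"] conjI allI impI ballI)
      fix s t :: "'a center_op" and M :: real and z :: 'a
      assume t: "S.ok t" and M: "0 \<le> M" and st: "\<forall>u\<in>{1, - 1}. S.re u *\<^sub>R s - S.im u *\<^sub>R t \<le> M *\<^sub>R 1"
      have "\<bar>s\<bar> \<le> M *\<^sub>R 1" using st by (intro abs_leI) (simp_all add: re)
      then have "norm s \<le> norm (M *\<^sub>R (1 :: 'a center_op))" by (rule norm_le_of_abs_le')
      also have "\<dots> \<le> M" using M mult_left_mono[OF norm_one_center_op_le[where 'b = 'a] M] by simp
      also have "M \<le> (1 + e) * M" using e M by (simp add: distrib_right)
      finally have "norm s * norm z \<le> (1 + e) * M * norm z" by (intro mult_right_mono) auto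
      moreover have "V.cc s t z = capp s z"
        using V.cc_app[OF S.ok_zero, of s t z] t by (simp add: capp_zero_right)
      ultimately show "vnorm real_lattice (V.cc s t z) \<le> (1 + e) * M * vnorm real_lattice z"
        using norm_capp_le[of s z] by simp
    qed auto
  qed
qed

section \<open>The complexification of a real Banach lattice\<close>

lemma pair_modulus_upper: "cos t *\<^sub>R x + sin t *\<^sub>R y \<le> pair_modulus x (y :: 'a::banach_lattice)"
  using le_pair_modulus_iff[of x y "pair_modulus x y"] by simp

lemma pair_modulus_abs_le: "\<bar>x\<bar> \<le> pair_modulus x y" "\<bar>y\<bar> \<le> pair_modulus x (y :: 'a::banach_lattice)"
  using pair_modulus_upper[of 0 x y] pair_modulus_upper[of pi x y]
    pair_modulus_upper[of "pi / 2" x y] pair_modulus_upper[of "- (pi / 2)" x y]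
  by (auto intro: abs_leI)

lemma pair_modulus_le_sum: "pair_modulus x y \<le> \<bar>x\<bar> + \<bar>y :: 'a::banach_lattice\<bar>"
proof -
  have le: "r *\<^sub>R z \<le> \<bar>z\<bar>" if "\<bar>r\<bar> \<le> 1" for r and z :: 'a
  proof -
    have "r *\<^sub>R z \<le> \<bar>r\<bar> *\<^sub>R \<bar>z\<bar>" using abs_ge_self[of "r *\<^sub>R z"] by (simp add: abs_scaleR)
    also have "\<dots> \<le> 1 *\<^sub>R \<bar>z\<bar>" using that by (intro scaleR_right_mono) auto
    finally show ?thesis by simp
  qed
  show ?thesis unfolding le_pair_modulus_iff by (intro allI add_mono le) auto
qed

text \<open>In polar form, multiplication by \<open>s\<close> shifts the angle by \<open>p\<close>
  and scales by \<open>r\<close>, so both moduli are suprema over the same circle of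
  directions.\<close>

lemma pair_modulus_scale:
  fixes x y :: "'a::banach_lattice"
  shows "pair_modulus (Re s *\<^sub>R x - Im s *\<^sub>R y) (Im s *\<^sub>R x + Re s *\<^sub>R y) = cmod s *\<^sub>R pair_modulus x y"
proof (cases "s = 0")
  case True
  have "pair_modulus (0 :: 'a) 0 = 0"
  proof (rule antisym)
    show "pair_modulus (0 :: 'a) 0 \<le> 0" using pair_modulus_le_sum[of "0 :: 'a" 0] by simp
    show "0 \<le> pair_modulus (0 :: 'a) 0" using pair_modulus_abs_le(1)[of "0 :: 'a" 0] by simp
  qed
  then show ?thesis by (simp add: True)
next
  case False
  define r where "r = cmod s"
  have r: "0 < r" using False by (simp add: r_def)
  obtain p where p: "Re s = r * cos p" "Im s = r * sin p"
    using rcis_cmod_Arg[of s] by (metis Re_rcis Im_rcis r_def)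
  have rot: "cos t *\<^sub>R (Re s *\<^sub>R x - Im s *\<^sub>R y) + sin t *\<^sub>R (Im s *\<^sub>R x + Re s *\<^sub>R y) =
      r *\<^sub>R (cos (t - p) *\<^sub>R x + sin (t - p) *\<^sub>R y)" for t
    by (simp add: p cos_diff sin_diff algebra_simps)
  have "pair_modulus (Re s *\<^sub>R x - Im s *\<^sub>R y) (Im s *\<^sub>R x + Re s *\<^sub>R y) \<le> r *\<^sub>R pair_modulus x y"
    unfolding le_pair_modulus_iff rot using r by (intro allI scaleR_left_mono pair_modulus_upper) auto
  moreover have "pair_modulus x y \<le> inverse r *\<^sub>R pair_modulus (Re s *\<^sub>R x - Im s *\<^sub>R y) (Im s *\<^sub>R x + Re s *\<^sub>R y)"
    unfolding le_pair_modulus_iff[of x y]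
  proof
    fix t
    have "inverse r *\<^sub>R (r *\<^sub>R (cos t *\<^sub>R x + sin t *\<^sub>R y)) \<le>
        inverse r *\<^sub>R pair_modulus (Re s *\<^sub>R x - Im s *\<^sub>R y) (Im s *\<^sub>R x + Re s *\<^sub>R y)"
      using pair_modulus_upper[of "t + p" "Re s *\<^sub>R x - Im s *\<^sub>R y" "Im s *\<^sub>R x + Re s *\<^sub>R y"] rot[of "t + p"] r
      by (intro scaleR_left_mono) simp_all
    then show "cos t *\<^sub>R x + sin t *\<^sub>R y \<le> inverse r *\<^sub>R pair_modulus (Re s *\<^sub>R x - Im s *\<^sub>R y) (Im s *\<^sub>R x + Re s *\<^sub>R y)"
      using r by simp
  qed
  then have "r *\<^sub>R pair_modulus x y \<le> r *\<^sub>R inverse r *\<^sub>R pair_modulus (Re s *\<^sub>R x - Im s *\<^sub>R y) (Im s *\<^sub>R x + Re s *\<^sub>R y)"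
    using r by (intro scaleR_left_mono) auto
  then have "r *\<^sub>R pair_modulus x y \<le> pair_modulus (Re s *\<^sub>R x - Im s *\<^sub>R y) (Im s *\<^sub>R x + Re s *\<^sub>R y)" using r by simp
  ultimately show ?thesis unfolding r_def by (rule antisym)
qed

text \<open>Replacing the optimal direction by one at distance less than \<open>d\<close> costs at
  most \<open>d * cmod w\<close>. The value \<open>d = e / (1 + e)\<close> is the solution of
  \<open>(1 + e) * (1 - d) = 1\<close>.\<close>

lemma unit_net:
  assumes e: "0 < e"
  obtains U where "finite U" "\<And>u. u \<in> U \<Longrightarrow> cmod u = 1"
    "\<And>w M. (\<And>u. u \<in> U \<Longrightarrow> Re (u * w) \<le> M) \<Longrightarrow> cmod w \<le> (1 + e) * M"
proof -
  define d where "d = e / (1 + e)"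
  have d: "0 < d" "(1 + e) * (1 - d) = 1" using e by (auto simp: d_def field_simps)
  have "compact (sphere (0 :: complex) 1)" by simp
  then obtain U :: "complex set" where U: "U \<subseteq> sphere 0 1" "finite U" "sphere 0 1 \<subseteq> (\<Union>u\<in>U. ball u d)"
  proof (rule compactE_image[of _ "sphere 0 1" "\<lambda>u. ball u d"])
    show "sphere (0 :: complex) 1 \<subseteq> (\<Union>u\<in>sphere 0 1. ball u d)" using d(1) by auto
    show "open (ball u d)" for u :: complex by simp
  qed blast
  show ?thesis
  proof (rule that[OF U(2)])
    show "cmod u = 1" if "u \<in> U" for u using that U(1) by auto
    fix w M assume M: "\<And>u. u \<in> U \<Longrightarrow> Re (u * w) \<le> M"
    define v where "v = (if w = 0 then 1 else of_real (cmod w) / w)"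
    have v: "cmod v = 1" "v * w = of_real (cmod w)" by (auto simp: v_def norm_divide)
    then obtain u where u: "u \<in> U" "dist u v < d" using U(3) by auto
    have "cmod w = Re (u * w) + Re ((v - u) * w)" using v by (simp add: left_diff_distrib)
    also have "Re ((v - u) * w) \<le> cmod (v - u) * cmod w" using complex_Re_le_cmod[of "(v - u) * w"] by (simp add: norm_mult)
    also have "\<dots> \<le> d * cmod w" using u by (intro mult_right_mono) (auto simp: dist_norm norm_minus_commute)
    finally have "cmod w * (1 - d) \<le> M" using M[OF u(1)] by (simp add: algebra_simps)
    then have "(1 + e) * (cmod w * (1 - d)) \<le> (1 + e) * M" using e by (intro mult_left_mono) auto
    then show "cmod w \<le> (1 + e) * M" using d(2) by (simp add: mult.left_commute)
  qed
qed

text \<open>At a character of \<open>w\<close> the operator \<open>s + i t\<close> is multiplication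
  by a complex number \<open>\<sigma>\<close> and \<open>x + i y\<close> becomes a complex number
  \<open>z\<close>. The claim is then that the real part of a rotation of
  \<open>\<sigma> * z\<close> is at most \<open>cmod \<sigma> * cmod z\<close>.\<close>

lemma central_pair_modulus_le:
  fixes s t :: "'a::banach_lattice center_op"
  assumes net: "\<And>w. (\<And>u. u \<in> U \<Longrightarrow> Re (u * w) \<le> M) \<Longrightarrow> cmod w \<le> C"
    and le: "\<And>u. u \<in> U \<Longrightarrow> Re u *\<^sub>R s - Im u *\<^sub>R t \<le> M *\<^sub>R 1" and C: "0 \<le> C"
  shows "pair_modulus (capp s x - capp t y) (capp t x + capp s y) \<le> C *\<^sub>R pair_modulus x y"
  unfolding le_pair_modulus_iff
proof
  fix \<theta> :: real
  define w where "w = \<bar>x\<bar> + \<bar>y\<bar>"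
  have w: "0 \<le> w" by (simp add: w_def)
  have xy: "x \<in> principal_ideal w" "y \<in> principal_ideal w"
    using w by (auto intro!: principal_idealI[of _ 1] simp: w_def)
  have pm: "pair_modulus x y \<in> principal_ideal w"
  proof (rule principal_idealI[of _ 1])
    have "0 \<le> pair_modulus x y" using pair_modulus_abs_le(1)[of x y] abs_ge_zero order_trans by blast
    then show "\<bar>pair_modulus x y\<bar> \<le> 1 *\<^sub>R w" using pair_modulus_le_sum[of x y] by (simp add: w_def)
  qed (rule w)
  note [simp] = xy pm principal_ideal_self[OF w] principal_ideal_closed central_ideal[OF central_capp]
  show "cos \<theta> *\<^sub>R (capp s x - capp t y) + sin \<theta> *\<^sub>R (capp t x + capp s y) \<le> C *\<^sub>R pair_modulus x y"
  proof (rule le_by_characters[OF w])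
    fix h assume h: "h \<in> characters w"
    note [simp] = char_add[OF h] char_diff[OF h] char_scaleR[OF h]
    define \<sigma> where "\<sigma> = Complex (h (capp s w)) (h (capp t w))"
    define z where "z = Complex (h x) (h y)"
    have sC: "cmod \<sigma> \<le> C"
    proof (rule net)
      fix u assume u: "u \<in> U"
      have "Re u *\<^sub>R capp s w - Im u *\<^sub>R capp t w \<le> M *\<^sub>R w"
        using le[OF u] w by (simp add: less_eq_center_op_def capp_simps)
      from char_mono[OF h _ _ this] show "Re (u * \<sigma>) \<le> M" by (simp add: \<sigma>_def char_unit[OF h])
    qed
    \<comment> \<open>At the angle \<open>Arg z\<close> the rotated real part of
      \<open>x + i y\<close> takes the value \<open>cmod z\<close>, and it lies below the
      modulus.\<close>
    have zh: "cmod z \<le> h (pair_modulus x y)"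
    proof -
      have "h (cos (Arg z) *\<^sub>R x + sin (Arg z) *\<^sub>R y) \<le> h (pair_modulus x y)"
        by (rule char_mono[OF h _ _ pair_modulus_upper]) simp_all
      moreover have "h x = cmod z * cos (Arg z)" "h y = cmod z * sin (Arg z)"
        using rcis_cmod_Arg[of z] by (metis Re_rcis Im_rcis z_def complex.sel)+
      then have "cos (Arg z) * h x + sin (Arg z) * h y = cmod z"
        using sin_cos_squared_add[of "Arg z"]
        by (metis (no_types, opaque_lifting) add.commute distrib_left mult.commute mult.left_commute mult.right_neutral power2_eq_square)
      ultimately show ?thesis by simp
    qed
    have "h (cos \<theta> *\<^sub>R (capp s x - capp t y) + sin \<theta> *\<^sub>R (capp t x + capp s y)) = Re (cis (- \<theta>) * (\<sigma> * z))"
      using char_central[OF central_capp w h xy(1)] char_central[OF central_capp w h xy(2)]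
      by (simp add: \<sigma>_def z_def algebra_simps)
    also have "\<dots> \<le> cmod \<sigma> * cmod z"
      using complex_Re_le_cmod[of "cis (- \<theta>) * (\<sigma> * z)"] by (simp add: norm_mult)
    also have "\<dots> \<le> C * h (pair_modulus x y)" by (intro mult_mono sC zh C) simp
    finally show "h (cos \<theta> *\<^sub>R (capp s x - capp t y) + sin \<theta> *\<^sub>R (capp t x + capp s y)) \<le> h (C *\<^sub>R pair_modulus x y)"
      by simp
  qed simp_all
qed

lemma complex_lattice_kspace:
  "lattice_kspace (\<lambda>z. z) True (complex_lattice :: (complex, 'a::banach_lattice \<times> 'a) ospace) Pair"
proof -
  interpret S: scalar_field "\<lambda>z::complex. z" True by unfold_locales auto
  have re: "S.re u = Re u" "S.im u = Im u" for u by (simp_all add: S.re_def S.im_def)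
  have ok: "S.ok y" for y by (simp add: S.ok_def)
  have pm: "norm x \<le> norm (pair_modulus x y)" "norm y \<le> norm (pair_modulus x y)"
    "norm (pair_modulus x y) \<le> norm x + norm y" for x y :: 'a
  proof -
    show "norm x \<le> norm (pair_modulus x y)" "norm y \<le> norm (pair_modulus x y)"
      by (rule norm_le_of_abs_le'[OF pair_modulus_abs_le(1)] norm_le_of_abs_le'[OF pair_modulus_abs_le(2)])+
    have "0 \<le> pair_modulus x y" using pair_modulus_abs_le(1)[of x y] abs_ge_zero order_trans by blast
    then have "norm (pair_modulus x y) \<le> norm (\<bar>x\<bar> + \<bar>y\<bar>)" by (rule norm_mono_nonneg[OF _ pair_modulus_le_sum])
    also have "\<dots> \<le> norm x + norm y" using norm_triangle_ineq[of "\<bar>x\<bar>" "\<bar>y\<bar>"] by simp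
    finally show "norm (pair_modulus x y) \<le> norm x + norm y" .
  qed
  interpret V: kspace "\<lambda>z::complex. z" True "complex_lattice :: (complex, 'a \<times> 'a) ospace" Pair
    by unfold_locales
       (auto simp: ok re complex_lattice_simps pair_modulus_scale pm intro!: exI[of _ 1])
  interpret M: kspace_modulus "\<lambda>z::complex. z" True "complex_lattice :: (complex, 'a \<times> 'a) ospace" Pair
  proof unfold_locales
    fix x y :: 'a
    have "(\<forall>t::real. cos t *\<^sub>R x + sin t *\<^sub>R y \<le> w) \<longleftrightarrow> (\<forall>u. cmod u = 1 \<longrightarrow> Re u *\<^sub>R x - Im u *\<^sub>R y \<le> w)" for w
    proof (intro iffI allI impI)
      fix u :: complex assume t: "\<forall>t::real. cos t *\<^sub>R x + sin t *\<^sub>R y \<le> w" and u: "cmod u = 1"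
      have "(Re u)\<^sup>2 + (Im u)\<^sup>2 = 1" using u by (simp add: cmod_def)
      then obtain p where "Re u = cos p" "Im u = sin p" using sincos_total_2pi by metis
      then show "Re u *\<^sub>R x - Im u *\<^sub>R y \<le> w" using t[rule_format, of "- p"] by simp
    next
      fix t :: real assume "\<forall>u. cmod u = 1 \<longrightarrow> Re u *\<^sub>R x - Im u *\<^sub>R y \<le> w"
      from this[rule_format, of "cis (- t)"] show "cos t *\<^sub>R x + sin t *\<^sub>R y \<le> w" by simp
    qed
    then show "\<exists>m. S.is_modulus x y m"
      unfolding S.is_modulus_def re le_pair_modulus_iff[symmetric] by blast
  next
    have "norm (pair_modulus x 0) = norm x" for x :: 'a
      using pm(1,3)[of x 0] by (intro antisym) simp_all
    then show "V.exact" by (simp add: V.exact_def complex_lattice_simps pm)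
  qed
  show ?thesis
  proof unfold_locales
    fix e :: real assume e: "0 < e"
    obtain U where U: "finite U" "\<And>u. u \<in> U \<Longrightarrow> cmod u = 1"
      "\<And>w M. (\<And>u. u \<in> U \<Longrightarrow> Re (u * w) \<le> M) \<Longrightarrow> cmod w \<le> (1 + e) * M"
      using unit_net[OF e] by blast
    show "\<exists>U. finite U \<and> (\<forall>u\<in>U. norm u = 1) \<and>
      (\<forall>s t M. S.ok t \<longrightarrow> 0 \<le> M \<longrightarrow> (\<forall>u\<in>U. S.re u *\<^sub>R s - S.im u *\<^sub>R t \<le> M *\<^sub>R 1) \<longrightarrow>
        (\<forall>z\<in>vecs complex_lattice. vnorm complex_lattice (V.cc s t z) \<le> (1 + e) * M * vnorm complex_lattice (z :: 'a \<times> 'a)))"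
    proof (intro exI[of _ U] conjI allI impI ballI)
      fix s t :: "'a center_op" and M :: real and z :: "'a \<times> 'a"
      assume M: "0 \<le> M" and st: "\<forall>u\<in>U. S.re u *\<^sub>R s - S.im u *\<^sub>R t \<le> M *\<^sub>R 1"
      obtain x y where z: "z = (x, y)" by force
      have C: "0 \<le> (1 + e) * M" using e M by simp
      have le: "pair_modulus (capp s x - capp t y) (capp t x + capp s y) \<le> ((1 + e) * M) *\<^sub>R pair_modulus x y"
        by (rule central_pair_modulus_le[OF U(3) _ C]) (use st in \<open>auto simp: re\<close>)
      have "0 \<le> pair_modulus a b" for a b :: 'a
        using pair_modulus_abs_le(1)[of a b] abs_ge_zero order_trans by blast
      from norm_mono_nonneg[OF this le]
      have "norm (pair_modulus (capp s x - capp t y) (capp t x + capp s y)) \<le> (1 + e) * M * norm (pair_modulus x y)"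
        using C by simp
      then show "vnorm complex_lattice (V.cc s t z) \<le> (1 + e) * M * vnorm complex_lattice z"
        by (simp add: z V.cc_app[OF ok] complex_lattice_simps)
    qed (use U in auto)
  qed
qed

theorem corollary2:
  fixes E :: "(real, 'a::banach_lattice) ospace"
    and EC :: "(complex, 'a \<times> 'a) ospace"
  assumes "E = real_lattice" and "EC = complex_lattice"
  shows
    "(topologically_full_center E \<longleftrightarrow>
        arens_extension E ` vecs (center_bidual E) = vecs (center (dual E))) \<and>
     (topologically_full_center E \<longrightarrow>
        (\<exists>B \<Phi>. band (center_bidual E) B \<and>
          banach_lattice_algebra_iso (center (dual E)) (center_bidual E) B
            (\<circ>) (arens_product (center E)) \<Phi>)) \<and>
     (topologically_full_center EC \<longleftrightarrow>
        arens_extension EC ` vecs (center_bidual EC) = vecs (center (dual EC))) \<and>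
     (topologically_full_center EC \<longrightarrow>
        (\<exists>B \<Phi>. band (center_bidual EC) B \<and>
          banach_lattice_algebra_iso (center (dual EC)) (center_bidual EC) B
            (\<circ>) (arens_product (center EC)) \<Phi>))"
  unfolding assms
  using lattice_kspace.arens_extension_main[OF real_lattice_kspace]
    lattice_kspace.arens_extension_main[OF complex_lattice_kspace] by blast

end
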